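(* Let $\digamma(n)$ be a multiplicative function with $\digamma(1)=1$ and $\digamma(p^k)=\epsilon_k\in\{-1,1\}$ for every prime $p$ and every $k\geq1$, where $\epsilon_k$ does not depend on $p$, and let $\digamma$'s summatory function be $F(x)=\sum_{n=1}^{\lfloor x\rfloor}\digamma(n)$. Then: (i) If $\epsilon_1=1$, or if $\epsilon_1=\epsilon_2=-1$, then $F(x)$ has no persistent or apparent bias. (ii) If $\epsilon_1=-1$ and $\epsilon_2=1$, then $F(x)$ has apparent bias $b\in[A_1,B_1]$, where \[ A_1=\frac{1}{\zeta(1/2)}\prod_p\left(1+\frac{2}{p(\sqrt p-1)}\right)=-10.29174\ldots,\qquad B_1=\frac{1}{\zeta(1/2)}\prod_p\left(1-\frac{2}{p^{3/2}(\sqrt p-1)}\right)=0.16918\ldots, \] and both extreme values $A_1$ and $B_1$ are achieved by functions in this family. (iii) There exist uncountably many such functions $\digamma$ with $\epsilon_1=-1$ and $\epsilon_2=1$ for which $F(x)$ has no persistent or apparent bias, and these functions may be characterized precisely.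
   Context: Let $T(s)=\sum_{n\geq1}\digamma(n)n^{-s}$ for $\operatorname{Re}(s)>1$; in all cases considered, $T(s)$ extends meromorphically to a neighbourhood of the half-plane $\operatorname{Re}(s)\ge 1/2$ (it equals a product of powers of $\zeta(s),\zeta(2s),\ldots$ times an Euler product converging absolutely for $\operatorname{Re}(s)>1/3$). Let $a=\lim_{x\to\infty}F(x)/x$ (the residue of $T$ at $s=1$, or $0$). The bias of $F$ (at the scale $\sqrt x$) is the constant term $b$ of the normalized function $(F(x)-ax)/\sqrt x$ arising in Perron's formula, namely $b=2\operatorname{Res}_{s=1/2}T(s)$ when $T$ has a simple pole at $s=1/2$, and $b=0$ when $T$ is analytic at $s=1/2$. If $b\neq0$ and $(F(x)-ax)/\sqrt x\to b$, $F$ is said to have persistent bias $b$; if instead $(F(x)-ax)/\sqrt x$ is expected to oscillate about $b$ (due to zeros of $\zeta$ on the critical line), $b$ is called the apparent bias. "No persistent or apparent bias" means $b=0$, i.e. $T(s)$ is analytic at $s=1/2$. Products $\prod_p$ run over all primes.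
   Formalization: The printed decimal -10.29174... for A_1 is wrong for its closed form; the closed form is kept and the decimal corrected: A_1 is within 10^-5 of -10.29438. *)

theory Defs
  imports
    "HOL-Complex_Analysis.Complex_Analysis"
    "HOL-Computational_Algebra.Primes"
    "HOL-Library.Extended_Real"
    "HOL-Library.Liminf_Limsup"
    "HOL-Library.Countable_Set"
begin

(* The value at 0 is pinned so that arithmetic functions which agree on the positive integers
   are equal; otherwise counting such functions would count junk values at 0. *)
definition multiplicative :: "(nat \<Rightarrow> int) \<Rightarrow> bool" where
  "multiplicative f \<longleftrightarrow>
     f 0 = 0 \<and> f 1 = 1 \<and> (\<forall>m n. coprime m n \<longrightarrow> f (m * n) = f m * f n)"

(* The value \<epsilon> 0 is irrelevant and left unconstrained. *)
definition sign_multiplicative :: "(nat \<Rightarrow> int) \<Rightarrow> (nat \<Rightarrow> int) \<Rightarrow> bool" where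
  "sign_multiplicative \<epsilon> f \<longleftrightarrow>
     multiplicative f \<and> (\<forall>k\<ge>1. \<epsilon> k \<in> {-1, 1}) \<and>
     (\<forall>p k. prime p \<longrightarrow> 1 \<le> k \<longrightarrow> f (p ^ k) = \<epsilon> k)"

definition summatory :: "(nat \<Rightarrow> int) \<Rightarrow> real \<Rightarrow> real" where
  "summatory f x = (\<Sum>n = 1..nat \<lfloor>x\<rfloor>. real_of_int (f n))"

definition dirichlet_series :: "(nat \<Rightarrow> int) \<Rightarrow> complex \<Rightarrow> complex" where
  "dirichlet_series f s = (\<Sum>n. of_int (f (Suc n)) / of_nat (Suc n) powr s)"

(* Being meromorphic on the closed half-plane means having a Laurent expansion in a punctured
   neighbourhood of each of its points, hence being meromorphic on an open neighbourhood of it.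
   The "nicely" variant fixes the values at removable singularities, so that T is uniquely
   determined on the half-plane. *)
definition continues_series :: "(nat \<Rightarrow> int) \<Rightarrow> (complex \<Rightarrow> complex) \<Rightarrow> bool" where
  "continues_series f T \<longleftrightarrow>
     T nicely_meromorphic_on {s. Re s \<ge> 1/2} \<and>
     (\<forall>s. Re s > 1 \<longrightarrow> T s = dirichlet_series f s)"

(* The coefficient a of the linear main term of the summatory function; the residue is 0
   if the continuation is analytic at 1. *)
definition linear_coeff :: "(nat \<Rightarrow> int) \<Rightarrow> real \<Rightarrow> bool" where
  "linear_coeff f a \<longleftrightarrow>
     (\<exists>T. continues_series f T \<and> complex_of_real a = residue T 1)"

(* The relation determines b uniquely. It holds for no b if the series has no continuation,
   or if the continuation has a pole of higher order at 1/2. *)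
definition bias :: "(nat \<Rightarrow> int) \<Rightarrow> real \<Rightarrow> bool" where
  "bias f b \<longleftrightarrow>
     (\<exists>T. continues_series f T \<and>
        (is_pole T (1/2) \<and> zorder T (1/2) = -1 \<and> complex_of_real b = 2 * residue T (1/2)
         \<or> T analytic_on {1/2} \<and> b = 0))"

(* A simple pole has nonzero residue, so this says that the continuation is analytic at 1/2. *)
definition no_bias :: "(nat \<Rightarrow> int) \<Rightarrow> bool" where
  "no_bias f \<longleftrightarrow> bias f 0"

definition normalized_summatory :: "(nat \<Rightarrow> int) \<Rightarrow> real \<Rightarrow> real \<Rightarrow> real" where
  "normalized_summatory f a x = (summatory f x - a * x) / sqrt x"

definition oscillates_about :: "(real \<Rightarrow> real) \<Rightarrow> real \<Rightarrow> bool" where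
  "oscillates_about g b \<longleftrightarrow>
     Liminf at_top (\<lambda>x. ereal (g x)) < ereal b \<and> ereal b < Limsup at_top (\<lambda>x. ereal (g x))"

(* The bias is apparent, as opposed to persistent, if the normalized summatory function does not
   converge to b but keeps oscillating about it. The value b = 0 is not excluded. *)
definition apparent_bias :: "(nat \<Rightarrow> int) \<Rightarrow> real \<Rightarrow> bool" where
  "apparent_bias f b \<longleftrightarrow>
     bias f b \<and> (\<exists>a. linear_coeff f a \<and> oscillates_about (normalized_summatory f a) b)"

(* The analytic continuation of the series to Re s > 0; unspecified at 1 and elsewhere. *)
definition zeta :: "complex \<Rightarrow> complex" where
  "zeta = (SOME Z. Z holomorphic_on {s. Re s > 0} - {1} \<and>
                   (\<forall>s. Re s > 1 \<longrightarrow> Z s = (\<Sum>n. 1 / of_nat (Suc n) powr s)))"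

definition prime_prod :: "(nat \<Rightarrow> real) \<Rightarrow> real" where
  "prime_prod g = (\<Prod>n. if prime n then g n else 1)"

(* zeta (1/2) is real, so taking the real part only converts the type. *)
definition A1 :: real where
  "A1 = 1 / Re (zeta (1/2)) * prime_prod (\<lambda>p. 1 + 2 / (real p * (sqrt (real p) - 1)))"

definition B1 :: real where
  "B1 = 1 / Re (zeta (1/2)) *
        prime_prod (\<lambda>p. 1 - 2 / (real p powr (3/2) * (sqrt (real p) - 1)))"

end

theory Submission
  imports Defs
begin

text \<open>Comparing Euler factors, the Dirichlet series of $f$ is a product of integral powers of $\zeta(s)$ and
  $\zeta(2s)$ with an Euler product $U(s)$ that converges beyond the line $\mathrm{Re}\, s = 1/2$. Only for
  $\epsilon_1 = -1$, $\epsilon_2 = 1$ does $\zeta(2s)$ occur with a positive exponent; the series is then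
  $U(s)\zeta(2s)/\zeta(s)$, the bias is $U(1/2)/\zeta(1/2)$, and it vanishes exactly when the factor of $U$ at 2 does.

  Suppose the normalized summatory function did not exceed $b$ in the limit. By Landau's theorem the series would be
  analytic to the right of the line $\mathrm{Re}\, s = 1/2$, with at most simple poles on the line, and of moderate
  growth. Dividing by $\zeta(2s)$ and by the Euler factors at the odd primes shows that $P(2^{-s})/\zeta(s)$, with a
  polynomial $P \neq 0$, is analytic for $\mathrm{Re}\, s \geq 1/2$. By the functional equation and the
  Phragmen-Lindeloef principle this is impossible.

  The extreme values come from comparing Euler factors prime by prime; only a negative factor at 2 needs care. The
  numerical bounds use Euler products accelerated by values of $\zeta$ at half-integers.\<close>


text \<open>A zero of zeta in Re s >= 1/2 would settle the oscillation, were it not that the Euler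
  factor at 2 can vanish there as well and cancel it. So no single zero is used; the contradiction
  is global. Multiplied by P(2^(s-1)) and the reciprocal Gamma factor, P(2^(-s))/zeta(s) becomes
  invariant under s -> 1-s and hence entire. Since 1/Gamma decays faster than every exponential as
  Re s grows, the result is bounded by a multiple of exp(t|Im s| - t|Re s|), which forces it to be
  0. A polynomial has to replace the factor at 2: that factor is a power series in 2^(-s) with
  radius of convergence 1, and the reflection leads out of its disc.

  The one-sided bound holds only with a slack d > 0, as F(N) <= (b+d) sqrt N for large N. It makes
  the coefficients ((b+d) sqrt n - F(n))/n nonnegative from some point on. Their Dirichlet series
  has residue d at 1/2, and by positivity this controls all vertical lines nearby; as d is
  arbitrary, even simple poles on the line disappear, except at 1/2. The opposite bound is the same
  statement for -f.\<close>

section \<open>The continuation of (s - 1) zeta(s) to Re s > -1 by the trapezoidal rule\<close>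

lemma holomorphic_on_suminf_M_test:
	fixes f :: "nat => complex => complex"
	assumes "open A" and "!!n. f n holomorphic_on A"
		and "!!z. z \<in> A ==> \<exists>d M. d > 0 \<and> cball z d \<subseteq> A \<and> summable M \<and>
					 (\<forall>n. \<forall>w\<in>cball z d. norm (f n w)<=M n)"
	shows "(%z. \<Sum>n. f n z) holomorphic_on A"
proof (rule holomorphic_uniform_sequence[OF \<open>open A\<close>])
	show "(%z. \<Sum>n<N. f n z) holomorphic_on A" for N by (intro holomorphic_intros assms)
next
	fix z assume "z \<in> A"
	then obtain d M where "d > 0" "cball z d \<subseteq> A" "summable M"
		and b: "!!n w. w \<in> cball z d ==> norm (f n w)<=M n" using assms(3) by metis
	have "uniform_limit (cball z d) (%n x. \<Sum>i<n. f i x) (%x. \<Sum>i. f i x) sequentially"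
		by (rule Weierstrass_m_test[OF _ \<open>summable M\<close>]) (use b in auto)
	thus "\<exists>d>0. cball z d \<subseteq> A \<and>
			uniform_limit (cball z d) (%n x. \<Sum>i<n. f i x) (%z. \<Sum>n. f n z) sequentially"
		using \<open>d > 0\<close> \<open>cball z d \<subseteq> A\<close> by blast
qed

text \<open>For the function x^(-s) on [n, n+1], this is s - 1 times (trapezoidal rule minus
  integral). The factor s - 1 turns the integral into a difference of powers, which also makes sense
  at s = 1.\<close>

definition em_term :: "nat => complex => complex" where
	"em_term n s = (s-1)*(of_nat n powr (-s) + of_nat (Suc n) powr (-s))/2
		 + of_nat (Suc n) powr (1-s)-of_nat n powr (1-s)"

text \<open>The function (s - 1) zeta(s). The trapezoids miss half of the first term, hence (s -
  1)/2; the summand 1 is s - 1 times the integral of x^(-s) over [1, infinity).\<close>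

definition zeta_reg :: "complex => complex" where
	"zeta_reg s = 1+(s-1)/2+(\<Sum>n. em_term (Suc n) s)"

lemma norm_of_real_powr: "x > 0 ==> norm (of_real x powr s :: complex) = x powr Re s" by (simp add: norm_powr_real_powr)

lemma norm_of_nat_powr: "n > 0 ==> norm (of_nat n powr s :: complex) = real n powr Re s" using norm_of_real_powr[of "real n" s] by simp

text \<open>The error \<phi>(u) of the rule on [n, n+u] satisfies \<phi>' = (s-1)/2 \<psi> and
  \<psi>' = s (s+1) u (n+u)^(-s-2), and both functions vanish at 0, so the mean value inequality is
  applied twice. The two extra powers of n are what carries the continuation as far as Re s >
  -1.\<close>

lemma norm_em_term_le:
	assumes n: "n > 0" and s: "Re s>=-2"
	shows "norm (em_term n s)<=norm (s-1) * norm s * norm (s+1)/2 * real n powr (- Re s-2)"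
proof -
	define x where "x = real n"
	have x: "x > 0" using n by (simp add: x_def)
	define \<psi> where "\<psi> = (%u::real. of_real x powr (-s)-of_real (x+u) powr (-s)
		 - s * of_real u * of_real (x+u) powr (-s-1))"
	define \<phi> where "\<phi> = (%u::real. (s-1)*(of_real x powr (-s) + of_real (x+u) powr (-s)) * of_real u/2
		 + of_real (x+u) powr (1-s)-of_real x powr (1-s))"
	define B where "B = norm s * norm (s+1) * x powr (- Re s-2)"
	have d\<psi>: "(\<psi> has_vector_derivative s*(s+1) * of_real u * of_real (x+u) powr (-s-2)) (at u within {0..1})"
		if "u \<in> {0..1}" for u
	proof -
		have pos: "complex_of_real (x+u) \<notin> \<real>\<^sub>\<le>\<^sub>0" using x that
			by (metis Re_complex_of_real atLeastAtMost_iff complex_nonpos_Reals_iff linorder_not_le add_pos_nonneg)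
		define q where "q = complex_of_real (x+u)"
		have q0: "q~=0" "q \<notin> \<real>\<^sub>\<le>\<^sub>0" using pos by (auto simp: q_def)
		have qe: "of_real x + of_real u = q" by (simp add: q_def)
		have "((%w. of_real x powr (-s)-(of_real x+w) powr (-s)-s * w*(of_real x+w) powr (-s-1))
			 has_field_derivative (0-(-s * q powr (-s-1))-(s * of_real u*((-s-1) * q powr (-s-1-1))+s * q powr (-s-1)))) (at (of_real u))"
			using q0 by (auto intro!: derivative_eq_intros simp: qe)
		also have "-s-1-1 = -s-2" by simp
		also have "(0-(-s * q powr (-s-1))-(s * of_real u*((-s-1) * q powr (-s-2))+s * q powr (-s-1)))
			 = s*(s+1) * of_real u * of_real (x+u) powr (-s-2)" unfolding q_def[symmetric] by (simp add: algebra_simps)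
		finally have "((%w. of_real x powr (-s)-(of_real x+w) powr (-s)-s * w*(of_real x+w) powr (-s-1))
			 has_field_derivative s*(s+1) * of_real u * of_real (x+u) powr (-s-2)) (at (of_real u))" .
		from has_vector_derivative_real_field[OF this] show ?thesis by (simp add: \<psi>_def o_def)
	qed
	have b\<psi>: "norm (\<psi> u)<=B" if u: "u \<in> {0..1}" for u
	proof -
		have "norm (\<psi> u - \<psi> 0)<=B * norm (u-0)"
		proof (rule differentiable_bound[of "{0..1}" \<psi> "%u h. h *\<^sub>R (s*(s+1) * of_real u * of_real (x+u) powr (-s-2))"])
			fix v :: real assume v: "v \<in> {0..1}"
			show "(\<psi> has_derivative (%h. h *\<^sub>R (s*(s+1) * of_real v * of_real (x+v) powr (- s-2)))) (at v within {0..1})"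
				using d\<psi>[OF v] by (simp add: has_vector_derivative_def)
			have "norm (s*(s+1) * of_real v * of_real (x+v) powr (-s-2)) = norm s * norm (s+1) * v * (x+v) powr (-Re s-2)"
				using v x by (simp add: norm_mult norm_powr_real_powr del: of_real_add)
			also have "...<=norm s * norm (s+1)*1 * x powr (-Re s-2)" using v x s by (intro mult_mono powr_mono2') auto
			finally have "norm (s*(s+1) * of_real v * of_real (x+v) powr (-s-2))<=B" by (simp add: B_def)
			thus "onorm (%h. h *\<^sub>R (s*(s+1) * of_real v * of_real (x+v) powr (- s-2)))<=B"
				by (intro onorm_bound) (auto simp: B_def mult.commute mult_left_mono intro!: mult_left_mono)
		qed (use u in auto)
		also have "...<=B*1" using u by (intro mult_left_mono) (auto simp: B_def)
		finally show ?thesis by (simp add: \<psi>_def)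
	qed
	have d\<phi>: "(\<phi> has_vector_derivative (s-1)/2 * \<psi> u) (at u within {0..1})"
		if "u \<in> {0..1}" for u
	proof -
		have pos: "complex_of_real (x+u) \<notin> \<real>\<^sub>\<le>\<^sub>0" using x that
			by (metis Re_complex_of_real atLeastAtMost_iff complex_nonpos_Reals_iff linorder_not_le add_pos_nonneg)
		define q where "q = complex_of_real (x+u)"
		have q0: "q \<notin> \<real>\<^sub>\<le>\<^sub>0" using pos by (auto simp: q_def)
		have qe: "of_real x + of_real u = q" by (simp add: q_def)
		have "((%w. (s-1)*(of_real x powr (-s)+(of_real x+w) powr (-s)) * w/2
		 + (of_real x+w) powr (1-s)-of_real x powr (1-s))
			 has_field_derivative (((s-1)*(of_real x powr (-s)+q powr (-s))+(s-1)*(-s * q powr (-s-1)) * of_real u)/2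
				 + (1-s) * q powr (1-s-1))) (at (of_real u))" using q0 by (auto intro!: derivative_eq_intros simp: qe)
		also have "1-s-1 = -s" by simp
		also have "(((s-1)*(of_real x powr (-s)+q powr (-s))+(s-1)*(-s * q powr (-s-1)) * of_real u)/2
				 + (1-s) * q powr (-s)) = (s-1)/2 * \<psi> u" unfolding \<psi>_def q_def[symmetric] by (simp add: field_simps)
		finally have "((%w. (s-1)*(of_real x powr (-s)+(of_real x+w) powr (-s)) * w/2
		 + (of_real x+w) powr (1-s)-of_real x powr (1-s))
			 has_field_derivative (s-1)/2 * \<psi> u) (at (of_real u))" .
		from has_vector_derivative_real_field[OF this] show ?thesis by (simp add: \<phi>_def o_def)
	qed
	have "norm (\<phi> 1 - \<phi> 0)<=(norm (s-1)/2 * B) * norm (1-0 :: real)"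
	proof (rule differentiable_bound[of "{0..1}" \<phi> "%u h. h *\<^sub>R ((s-1)/2 * \<psi> u)"])
		fix v :: real assume v: "v \<in> {0..1}"
		show "(\<phi> has_derivative (%h. h *\<^sub>R ((s-1)/2 * \<psi> v))) (at v within {0..1})"
			using d\<phi>[OF v] by (simp add: has_vector_derivative_def)
		have "norm ((s-1)/2 * \<psi> v)<=norm (s-1)/2 * B" using b\<psi>[OF v] by (auto simp: norm_mult norm_divide intro!: mult_left_mono)
		thus "onorm (%h. h *\<^sub>R ((s-1)/2 * \<psi> v))<=norm (s-1)/2 * B"
			by (intro onorm_bound) (auto simp: B_def mult.commute intro!: mult_left_mono)
	qed auto
	moreover have "\<phi> 0 = 0" by (simp add: \<phi>_def)
	moreover have "\<phi> 1 = em_term n s" by (simp add: \<phi>_def em_term_def x_def add.commute)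
	ultimately show ?thesis by (simp add: B_def x_def)
qed

lemma holomorphic_em_term: "n > 0 ==> em_term n holomorphic_on A" unfolding em_term_def by (intro holomorphic_intros) auto

lemma open_Re_gt: "open {s. Re s > a}" by (simp add: open_halfspace_Re_gt)

lemma summable_Suc_powr: "a > 1 ==> summable (%n. real (Suc n) powr (-a))"
	using summable_real_powr_iff[of "-a"] summable_Suc_iff[of "%n. real n powr (-a)"] by simp

lemma summable_em_term: "Re s > -1 ==> summable (%n. em_term (Suc n) s)"
proof (rule summable_comparison_test)
	assume s: "Re s > -1"
	show "\<exists>N. \<forall>n\<ge>N. norm (em_term (Suc n) s)
			<= norm (s-1) * norm s * norm (s+1)/2 * real (Suc n) powr (- (Re s+2))"
		using norm_em_term_le[of "Suc n" s for n] s by (intro exI[of _ 0]) auto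
	show "summable (%n. norm (s-1) * norm s * norm (s+1)/2 * real (Suc n) powr (- (Re s+2)))"
		using s by (intro summable_mult summable_Suc_powr) auto
qed

lemma holomorphic_zeta_reg: "zeta_reg holomorphic_on {s. Re s > -1}"
proof -
	have "(%s. \<Sum>n. em_term (Suc n) s) holomorphic_on {s. Re s > -1}"
	proof (rule holomorphic_on_suminf_M_test)
		fix z assume "z \<in> {s. Re s > -1}"
		hence z: "Re z > -1" by simp
		define d where "d = (Re z+1)/2"
		define R where "R = norm z+d+1"
		have d: "d > 0" using z by (simp add: d_def)
		have w: "Re w>=d-1" "norm w<=R" "norm (w-1)<=R" "norm (w+1)<=R" if "w \<in> cball z d" for w
		proof -
			have *: "norm (z-w)<=d" using that by (simp add: dist_norm)
			have "Re (z-w)<=d" using complex_Re_le_cmod[of "z-w"] * by linarith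
			thus "Re w>=d-1" by (simp add: d_def field_simps)
			have **: "norm w<=norm z+d" using * norm_triangle_sub[of w z] by (simp add: norm_minus_commute)
			thus "norm w<=R" "norm (w-1)<=R" "norm (w+1)<=R" using norm_triangle_ineq4[of w 1] norm_triangle_ineq[of w 1] by (auto simp: R_def)
		qed
		have "norm (em_term (Suc n) w)<=R * R * R/2 * real (Suc n) powr (-(d+1))" if "w \<in> cball z d" for w n
		proof -
			have "norm (em_term (Suc n) w)<=norm (w-1) * norm w * norm (w+1)/2 * real (Suc n) powr (- Re w-2)"
				using w(1)[OF that] d by (intro norm_em_term_le) auto
			also have "...<=R * R * R/2 * real (Suc n) powr (-(d+1))"
				using w[OF that] d by (intro mult_mono divide_right_mono powr_mono) (auto simp: R_def)
			finally show ?thesis .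
		qed
		moreover have "summable (%n. R * R * R/2 * real (Suc n) powr (-(d+1)))" using d by (intro summable_mult summable_Suc_powr) auto
		moreover have "cball z d \<subseteq> {s. Re s > -1}" using w(1) d by force
		ultimately show "\<exists>d M. d > 0 \<and> cball z d \<subseteq> {s. Re s > -1} \<and> summable M \<and>
					 (\<forall>n. \<forall>w\<in>cball z d. norm (em_term (Suc n) w)<=M n)"
			using d by (intro exI[of _ d] exI[of _ "%n. R * R * R/2 * real (Suc n) powr (-(d+1))"]) auto
	qed (auto intro!: holomorphic_em_term open_Re_gt)
	thus ?thesis unfolding zeta_reg_def by (intro holomorphic_intros) auto
qed

lemma zeta_reg_1 [simp]: "zeta_reg 1 = 1"
proof -
	have "of_nat (Suc n)~=(0::complex)" for n by (rule of_nat_neq_0)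
	hence "em_term (Suc n) 1 = 0" for n by (simp add: em_term_def del: of_nat_Suc)
	thus ?thesis by (simp add: zeta_reg_def)
qed

text \<open>The terms telescope. In contrast to the Dirichlet series this limit formula is available
  at 1/2 and on (-1, 0), the points at which real values of zeta are needed below.\<close>

lemma zeta_reg_LIMSEQ:
	assumes s: "Re s > -1"
	shows "(%N. (s-1)*((\<Sum>n=1..N. of_nat n powr (-s))-of_nat N powr (-s)/2) + of_nat N powr (1-s))
					 \<longlonglongrightarrow> zeta_reg s"
proof -
	define P where "P = (%N. (s-1)*((\<Sum>n=1..N. of_nat n powr (-s))-of_nat N powr (-s)/2) + of_nat N powr (1-s))"
	have P: "P (Suc N) = 1+(s-1)/2+(\<Sum>n<N. em_term (Suc n) s)" for N
	proof (induction N)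
		case 0
		show ?case by (simp add: P_def field_simps)
	next
		case (Suc N)
		have "P (Suc (Suc N)) = P (Suc N)+em_term (Suc N) s" by (simp add: P_def em_term_def field_simps)
		thus ?case using Suc by simp
	qed
	have "(%N. P (Suc N)) \<longlonglongrightarrow> zeta_reg s" unfolding P zeta_reg_def by (intro tendsto_intros summable_LIMSEQ summable_em_term s)
	thus ?thesis by (subst (asm) filterlim_sequentially_Suc) (simp add: P_def)
qed

lemma of_nat_powr_tendsto_0:
	assumes "Re s < 0"
	shows "(%N. of_nat N powr s :: complex) \<longlonglongrightarrow> 0"
proof (rule tendsto_norm_zero_cancel, rule Lim_transform_eventually)
	show "(%N. real N powr Re s) \<longlonglongrightarrow> 0" using assms by (intro tendsto_neg_powr filterlim_real_sequentially)
	show "\<forall>\<^sub>F x in sequentially. real x powr Re s = norm (of_nat x powr s :: complex)"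
		using eventually_gt_at_top[of 0] by eventually_elim (simp add: norm_of_nat_powr)
qed

lemma summable_dirichlet_zeta:
	assumes "Re s > 1"
	shows "summable (%n. norm (of_nat (Suc n) powr (-s) :: complex))"
proof -
	have eq: "norm (of_nat (Suc n) powr (-s) :: complex) = real (Suc n) powr (- Re s)" for n
		by (metis norm_of_nat_powr uminus_complex.sel(1) zero_less_Suc)
	from summable_Suc_powr[OF assms] show ?thesis unfolding eq .
qed

lemma zeta_reg_eq_series:
	assumes s: "Re s > 1"
	shows "zeta_reg s = (s-1)*(\<Sum>n. of_nat (Suc n) powr (-s))"
proof (rule LIMSEQ_unique[OF zeta_reg_LIMSEQ])
	have "(%N. \<Sum>n<N. of_nat (Suc n) powr (-s)) \<longlonglongrightarrow> (\<Sum>n. of_nat (Suc n) powr (-s) :: complex)"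
		using summable_norm_cancel[OF summable_dirichlet_zeta[OF s]] by (rule summable_LIMSEQ)
	moreover have "(\<Sum>n<N. of_nat (Suc n) powr (-s)) = (\<Sum>n=1..N. of_nat n powr (-s) :: complex)" for N
		by (rule sum.reindex_bij_witness[of _ "%n. n-1" Suc]) auto
	ultimately have "(%N. \<Sum>n=1..N. of_nat n powr (-s)) \<longlonglongrightarrow> (\<Sum>n. of_nat (Suc n) powr (-s) :: complex)" by simp
	hence "(%N. (s-1)*((\<Sum>n=1..N. of_nat n powr (-s))-of_nat N powr (-s)/2) + of_nat N powr (1-s))
		 \<longlonglongrightarrow> (s-1)*((\<Sum>n. of_nat (Suc n) powr (-s))-0/2)+0" using s by (intro tendsto_intros of_nat_powr_tendsto_0) auto
	thus "(%N. (s-1)*((\<Sum>n=1..N. of_nat n powr (-s))-of_nat N powr (-s)/2) + of_nat N powr (1-s))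
		 \<longlonglongrightarrow> (s-1)*(\<Sum>n. of_nat (Suc n) powr (-s))" by simp
qed (use s in auto)

lemma connected_Re_gt_0_minus_1: "connected ({s. Re s > 0}-{1::complex})"
	by (intro connected_open_diff_countable convex_connected convex_halfspace_Re_gt open_Re_gt) auto

text \<open>\<open>zeta\<close> is an arbitrary continuation chosen by \<open>SOME\<close>. A
  half-plane without one point is still connected, so the continuation is unique there.\<close>

lemma zeta_eq:
	assumes "Re s > 0" "s~=1"
	shows "zeta s = zeta_reg s/(s-1)"
proof -
	define A where "A = {s. Re s > 0}-{1::complex}"
	have "\<exists>Z. Z holomorphic_on A \<and> (\<forall>s. Re s > 1 \<longrightarrow> Z s = (\<Sum>n. 1/of_nat (Suc n) powr s))"
	proof (intro exI conjI allI impI)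
		show "(%s. zeta_reg s/(s-1)) holomorphic_on A" by (intro holomorphic_intros holomorphic_on_subset[OF holomorphic_zeta_reg]) (auto simp: A_def)
		fix s :: complex assume "Re s > 1"
		moreover from this have "s~=1" by auto
		ultimately show "zeta_reg s/(s-1) = (\<Sum>n. 1/of_nat (Suc n) powr s)" by (auto simp: zeta_reg_eq_series powr_minus divide_inverse)
	qed
	from someI_ex[OF this] have Z: "zeta holomorphic_on A"
		 "!!s. Re s > 1 ==> zeta s = (\<Sum>n. 1/of_nat (Suc n) powr s)" unfolding zeta_def A_def by blast+
	show ?thesis
	proof (rule analytic_continuation_open[of "{s. Re s > 1}" A zeta "%s. zeta_reg s/(s-1)"])
		show "{s. Re s > 1}~={}" by (auto intro!: exI[of _ 2])
		show "(%s. zeta_reg s/(s-1)) holomorphic_on A" by (intro holomorphic_intros holomorphic_on_subset[OF holomorphic_zeta_reg]) (auto simp: A_def)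
		show "zeta z = zeta_reg z/(z-1)" if "z \<in> {s. Re s > 1}" for z
		proof -
			have "z~=1" using that by auto
			thus ?thesis using that Z(2)[of z] by (auto simp: zeta_reg_eq_series powr_minus divide_inverse)
		qed
		show "connected A" unfolding A_def by (rule connected_Re_gt_0_minus_1)
		show "open A" by (simp add: A_def open_Re_gt open_delete)
		show "{s. Re s > 1} \<subseteq> A" by (auto simp: A_def)
		show "s \<in> A" using assms by (simp add: A_def)
	qed (use Z open_Re_gt in auto)
qed

section \<open>Integrals of nonnegative functions over (0, infinity)\<close>

text \<open>Values in \<open>ennreal\<close>: the integrands below are nonnegative, so Tonelli and
  monotone convergence apply without any proof of integrability, and finiteness comes out of the
  computed values.\<close>

definition pint :: "(real => real) => ennreal" where
	"pint g = (\<integral>\<^sup>+x. ennreal (indicator {0<..} x * g x) \<partial>lborel)"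

lemma pint_cong: "(!!x. x > 0 ==> g x = h x) ==> pint g = pint h" unfolding pint_def by (intro nn_integral_cong) (auto simp: indicator_def)

lemma pint_cmult:
	assumes [measurable]: "g \<in> borel_measurable borel" and "c>=0"
	shows "pint (%x. c * g x) = ennreal c * pint g"
proof -
	have "ennreal (indicator {0<..} x*(c * g x)) = ennreal c * ennreal (indicator {0<..} x * g x)" for x
		using assms(2) by (simp add: ennreal_mult' mult_ac flip: ennreal_mult')
	thus ?thesis unfolding pint_def by (simp add: nn_integral_cmult)
qed

lemma pint_add:
	assumes [measurable]: "g \<in> borel_measurable borel" "h \<in> borel_measurable borel"
		and "!!x. x > 0 ==> g x>=0" "!!x. x > 0 ==> h x>=0"
	shows "pint (%x. g x+h x) = pint g+pint h"
proof -
	have "ennreal (indicator {0<..} x*(g x+h x)) =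
			ennreal (indicator {0<..} x * g x)+ennreal (indicator {0<..} x * h x)" for x using assms(3,4) by (auto simp: indicator_def ennreal_plus)
	thus ?thesis unfolding pint_def by (simp add: nn_integral_add)
qed

lemma pint_sum:
	assumes "!!i. i \<in> A ==> g i \<in> borel_measurable borel" "!!i x. i \<in> A ==> x > 0 ==> g i x>=0"
	shows "pint (%x. \<Sum>i\<in>A. g i x) = (\<Sum>i\<in>A. pint (g i))" using assms
proof (induction A rule: infinite_finite_induct)
	case (insert i A)
	have "pint (%x. \<Sum>i\<in>insert i A. g i x) = pint (%x. g i x+(\<Sum>i\<in>A. g i x))" using insert by simp
	also have "... = pint (g i)+pint (%x. \<Sum>i\<in>A. g i x)" using insert by (intro pint_add borel_measurable_sum sum_nonneg) auto
	finally show ?case using insert by simp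
qed (simp_all add: pint_def)

lemma pint_scale:
	assumes [measurable]: "g \<in> borel_measurable borel" and c: "c > 0"
	shows "pint g = ennreal c * pint (%x. g (c * x))"
proof -
	have "pint g = ennreal \<bar>c\<bar>*(\<integral>\<^sup>+x. ennreal (indicator {0<..} (0+c * x) * g (0+c * x)) \<partial>lborel)"
		unfolding pint_def using c by (intro nn_integral_real_affine) auto
	also have "(%x. indicator {0<..} (0+c * x) * g (0+c * x)) = (%x. indicator {0<..} x * g (c * x))"
		using c by (auto simp: indicator_def zero_less_mult_iff fun_eq_iff)
	finally show ?thesis using c by (simp add: pint_def)
qed

lemma nn_integral_has_integral_on:
	fixes g :: "real => real"
	assumes [measurable]: "g \<in> borel_measurable borel" "U \<in> sets borel"
		and "!!u. u \<in> U ==> g u>=0" "(g has_integral I) U"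
	shows "(\<integral>\<^sup>+u. ennreal (indicator U u * g u) \<partial>lborel) = ennreal I"
proof (rule nn_integral_has_integral_lborel)
	have "((%u. if u \<in> U then g u else 0) has_integral I) UNIV" using assms(4) by (simp add: has_integral_restrict_UNIV)
	thus "((%u. indicator U u * g u) has_integral I) UNIV" by (rule has_integral_eq[rotated]) (auto simp: indicator_def)
qed (use assms(3) in \<open>auto simp: indicator_def\<close>)

text \<open>\<open>g\<close> and \<open>h\<close> are the two inner integrals of \<open>f\<close>;
  the outer integrals are then equal.\<close>

lemma pint_tonelli:
	fixes f :: "real => real => real"
	assumes m: "case_prod f \<in> borel_measurable (borel \<Otimes>\<^sub>M borel)" and U: "U \<in> sets borel"
		and g: "!!x. x > 0 ==> (\<integral>\<^sup>+u. ennreal (indicator U u * f x u) \<partial>lborel) = ennreal (g x)"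
		and h: "!!u. u \<in> U ==> pint (%x. f x u) = ennreal (h u)"
	shows "pint g = (\<integral>\<^sup>+u. ennreal (indicator U u * h u) \<partial>lborel)"
proof -
	note [measurable] = U
	have [measurable]: "(%x. f (fst x) (snd x)) \<in> borel_measurable (borel \<Otimes>\<^sub>M borel)" using m by (simp add: case_prod_unfold)
	define F where "F = (%x u. ennreal (indicator {0<..} x * indicator U u * f x u))"
	have "(%z. ennreal (indicator {0<..} (fst z) * indicator U (snd z) * f (fst z) (snd z))) \<in> borel_measurable (borel \<Otimes>\<^sub>M borel)"
		by measurable
	hence F: "case_prod F \<in> borel_measurable (lborel \<Otimes>\<^sub>M lborel)"
		by (simp add: F_def case_prod_unfold measurable_lborel1 cong: measurable_cong_sets)
	have "pint g = (\<integral>\<^sup>+x. (\<integral>\<^sup>+u. F x u \<partial>lborel) \<partial>lborel)"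
		unfolding pint_def F_def by (intro nn_integral_cong) (auto simp: indicator_def g[symmetric])
	also have "... = (\<integral>\<^sup>+u. (\<integral>\<^sup>+x. F x u \<partial>lborel) \<partial>lborel)"
		by (rule lborel_pair.Fubini'[OF F, symmetric])
	also have "... = (\<integral>\<^sup>+u. ennreal (indicator U u * h u) \<partial>lborel)"
	proof (intro nn_integral_cong)
		fix u show "(\<integral>\<^sup>+x. F x u \<partial>lborel) = ennreal (indicator U u * h u)"
			using h[of u] by (cases "u \<in> U") (auto simp: F_def pint_def)
	qed
	finally show ?thesis .
qed

lemma has_integral_lborel_halfopen:
	assumes "(g has_integral I) {0..v::real}"
	shows "((g :: real => real) has_integral I) {0<..v}"
proof (rule iffD1[OF has_integral_spike_set_eq assms])
	show "negligible {x \<in> {0..v}-{0<..v}. g x~=0}" by (rule negligible_subset[of "{0}"]) auto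
	show "negligible {x \<in> {0<..v}-{0..v}. g x~=0}" by (rule negligible_subset[of "{}"]) auto
qed

lemma pint_Gamma:
	assumes a: "a > 0" and v: "v > 0"
	shows "pint (%x. x powr (a-1) * exp (- (v * x))) = ennreal (Gamma a * v powr (-a))"
proof -
	have "ennreal (Gamma a) = pint (%x. x powr (a-1) * exp (- x))" unfolding Gamma_conv_nn_integral_real[OF a] pint_def
		by (intro nn_integral_cong) (auto simp: indicator_def exp_minus field_simps)
	also have "... = ennreal v * pint (%x. (v * x) powr (a-1) * exp (- (v * x)))" using v by (intro pint_scale) auto
	also have "pint (%x. (v * x) powr (a-1) * exp (- (v * x))) =
			pint (%x. v powr (a-1)*(x powr (a-1) * exp (- (v * x))))" using v by (intro pint_cong) (auto simp: powr_mult)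
	also have "... = ennreal (v powr (a-1)) * pint (%x. x powr (a-1) * exp (- (v * x)))" by (intro pint_cmult) auto
	finally have "ennreal (Gamma a) = ennreal (v * v powr (a-1)) * pint (%x. x powr (a-1) * exp (- (v * x)))"
		using v by (simp add: ennreal_mult' mult.assoc)
	also have "v * v powr (a-1) = v powr a" using v by (simp add: powr_diff)
	finally have "ennreal (v powr (-a)) * ennreal (Gamma a) =
			ennreal (v powr (-a)) * ennreal (v powr a) * pint (%x. x powr (a-1) * exp (- (v * x)))" by (simp add: mult.assoc)
	also have "ennreal (v powr (-a)) * ennreal (v powr a) = 1" using v by (simp add: powr_minus flip: ennreal_mult')
	finally show ?thesis using Gamma_real_nonneg[OF a] by (simp add: mult.commute ennreal_mult')
qed

section \<open>The Mellin transform of 1/(exp x - 1) - 1/x + 1/2 on -1 < s < 0\<close>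

text \<open>After clearing denominators the claim is x (exp x + 1) >= 2 (exp x - 1). The difference
  vanishes at 0, and so does its derivative \<open>f'\<close>, which is itself
  nondecreasing.\<close>

lemma exp_ge_quadratic_aux:
	fixes x :: real assumes "x > 0"
	shows "1/(exp x-1)-1/x+1/2>=0"
proof -
	define f where "f = (%x::real. x*(exp x+1)-2*(exp x-1))"
	define f' where "f' = (%x::real. x * exp x-exp x+1)"
	have f'0: "f' y>=0" if "y>=0" for y
	proof -
		have "f' 0<=f' y" by (rule DERIV_nonneg_imp_nondecreasing[OF that])
				 (auto simp: f'_def intro!: exI derivative_eq_intros)
		thus ?thesis by (simp add: f'_def)
	qed
	have "f 0<=f x"
	proof (rule DERIV_nonneg_imp_nondecreasing[where f = f])
		fix y :: real assume "0<=y"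
		show "\<exists>z. (f has_real_derivative z) (at y) \<and> 0<=z" using f'0[OF \<open>0 <= y\<close>]
			by (intro exI[of _ "f' y"]) (auto simp: f_def f'_def algebra_simps intro!: derivative_eq_intros)
	qed (use assms in auto)
	hence "x*(exp x+1)-2*(exp x-1)>=0" by (simp add: f_def)
	moreover have "exp x > 1" using assms by simp
	ultimately show ?thesis using assms by (simp add: field_simps)
qed

text \<open>The generating function of the Bernoulli numbers, divided by x and without its first two
  terms. It is O(x) at 0 and bounded at infinity, so its Mellin integral converges for -1 < s < 0.
  Evaluating that integral in two ways gives the functional equation.\<close>

definition bern :: "real => real" where
	"bern x = 1/(exp x-1)-1/x+1/2"

lemma bern_nonneg: "x > 0 ==> bern x>=0" unfolding bern_def by (rule exp_ge_quadratic_aux)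

lemma bern_measurable [measurable]: "bern \<in> borel_measurable borel" unfolding bern_def by measurable

text \<open>The constant \<open>c\<close> is -Gamma(s), written through Gamma(s+1) so that its
  positivity is visible.\<close>

context
	fixes s c :: real
	assumes s: "s > -1" "s < 0"
	defines "c \<equiv> Gamma (s+1)/(-s)"
begin

lemma c_pos: "c > 0" using s by (simp add: c_def Gamma_real_pos divide_pos_neg)

text \<open>(1 - exp(-v x)) x^(s-1) is the integral of x^s exp(-u x) over u in (0, v]; after the
  exchange the inner integral is a Gamma integral.\<close>

lemma pint_one_minus_exp:
	assumes v: "v > 0"
	shows "pint (%x. (1-exp (- (v * x))) * x powr (s-1)) = ennreal (c * v powr (-s))"
proof -
	have "pint (%x. (1-exp (- (v * x))) * x powr (s-1)) =
		 (\<integral>\<^sup>+u. ennreal (indicator {0<..v} u*(Gamma (s+1) * u powr (-s-1))) \<partial>lborel)"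
	proof (rule pint_tonelli[where f = "%x u. x powr s * exp (- (u * x))"])
		fix x :: real assume x: "x > 0"
		have "((%u. x powr s * exp (- (u * x))) has_integral
				(- (x powr (s-1)) * exp (- (v * x))-(- (x powr (s-1)) * exp (- (0 * x))))) {0..v}" using v x by (intro fundamental_theorem_of_calculus)
				(auto intro!: derivative_eq_intros simp: powr_diff simp flip: has_real_derivative_iff_has_vector_derivative)
		hence "((%u. x powr s * exp (- (u * x))) has_integral ((1-exp (- (v * x))) * x powr (s-1))) {0<..v}"
			by (intro has_integral_lborel_halfopen) (simp add: algebra_simps)
		thus "(\<integral>\<^sup>+u. ennreal (indicator {0<..v} u*(x powr s * exp (- (u * x)))) \<partial>lborel)
				= ennreal ((1-exp (- (v * x))) * x powr (s-1))" by (intro nn_integral_has_integral_on) auto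
	next
		fix u assume "u \<in> {0<..v}"
		hence "pint (%x. x powr (s+1-1) * exp (- (u * x))) = ennreal (Gamma (s+1) * u powr (-(s+1)))" using s by (intro pint_Gamma) auto
		also have "s+1-1 = s" by simp
		also have "-(s+1) = -s-1" by simp
		finally show "pint (%x. x powr s * exp (- (u * x))) = ennreal (Gamma (s+1) * u powr (-s-1))" .
	qed (auto simp: case_prod_unfold)
	also have "((%u. Gamma (s+1) * u powr (-s-1)) has_integral (Gamma (s+1)*(v powr (-s-1+1)/(-s-1+1)))) {0<..v}"
		using s v by (intro has_integral_lborel_halfopen has_integral_mult_right has_integral_powr_from_0) auto
	hence "(\<integral>\<^sup>+u. ennreal (indicator {0<..v} u*(Gamma (s+1) * u powr (-s-1))) \<partial>lborel)
			= ennreal (Gamma (s+1)*(v powr (-s-1+1)/(-s-1+1)))" using s by (intro nn_integral_has_integral_on) (auto intro!: Gamma_real_nonneg)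
	also have "Gamma (s+1)*(v powr (-s-1+1)/(-s-1+1)) = c * v powr (-s)" by (simp add: c_def)
	finally show ?thesis .
qed

text \<open>One more integration in v of the preceding formula.\<close>

lemma pint_one_minus_exp_integral:
	assumes v: "v > 0"
	shows "pint (%x. (v-(1-exp (- (v * x)))/x) * x powr (s-1)) = ennreal (c * v powr (1-s)/(1-s))"
proof -
	have "pint (%x. (v-(1-exp (- (v * x)))/x) * x powr (s-1)) =
		 (\<integral>\<^sup>+u. ennreal (indicator {0<..v} u*(c * u powr (-s))) \<partial>lborel)"
	proof (rule pint_tonelli[where f = "%x u. (1-exp (- (u * x))) * x powr (s-1)"])
		fix x :: real assume x: "x > 0"
		have "((%u. (1-exp (- (u * x))) * x powr (s-1)) has_integral
				((v+exp (- (v * x))/x) * x powr (s-1)  - (0+exp (- (0 * x))/x) * x powr (s-1))) {0..v}"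
			using v x by (intro fundamental_theorem_of_calculus)
				(auto intro!: derivative_eq_intros simp flip: has_real_derivative_iff_has_vector_derivative)
		also have "((v+exp (- (v * x))/x) * x powr (s-1)  - (0+exp (- (0 * x))/x) * x powr (s-1))
			 = (v-(1-exp (- (v * x)))/x) * x powr (s-1)" using x by (simp add: field_simps)
		finally have "((%u. (1-exp (- (u * x))) * x powr (s-1)) has_integral
			 ((v-(1-exp (- (v * x)))/x) * x powr (s-1))) {0<..v}" by (rule has_integral_lborel_halfopen)
		thus "(\<integral>\<^sup>+u. ennreal (indicator {0<..v} u*((1-exp (- (u * x))) * x powr (s-1))) \<partial>lborel)
				= ennreal ((v-(1-exp (- (v * x)))/x) * x powr (s-1))" using x by (intro nn_integral_has_integral_on) auto
	next
		fix u assume "u \<in> {0<..v}"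
		thus "pint (%x. (1-exp (- (u * x))) * x powr (s-1)) = ennreal (c * u powr (-s))" using pint_one_minus_exp[of u] by simp
	qed (auto simp: case_prod_unfold)
	also have "((%u. c * u powr (-s)) has_integral (c*(v powr (-s+1)/(-s+1)))) {0<..v}"
		using s v by (intro has_integral_lborel_halfopen has_integral_mult_right has_integral_powr_from_0) auto
	hence "(\<integral>\<^sup>+u. ennreal (indicator {0<..v} u*(c * u powr (-s))) \<partial>lborel)
			= ennreal (c*(v powr (-s+1)/(-s+1)))" using s c_pos by (intro nn_integral_has_integral_on) auto
	finally show ?thesis by simp
qed

text \<open>The factor 1 - exp(-N x) makes the geometric series for 1/(exp x - 1) finite. In
  \<open>key\<close> all terms have been moved to the side on which they are nonnegative, so that
  both sides can be integrated term by term; the subtraction is done afterwards, between finite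
  numbers.\<close>

lemma pint_bern_truncated:
	assumes N: "N > 0"
	shows "pint (%x. bern x*(1-exp (- (real N * x))) * x powr (s-1)) =
		ennreal (c*(real N powr (1-s)/(1-s)+real N powr (-s)/2-(\<Sum>n=1..N. real n powr (-s))))"
		and "real N powr (1-s)/(1-s)+real N powr (-s)/2-(\<Sum>n=1..N. real n powr (-s))>=0"
proof -
	have key: "bern x*(1-exp (- (real N * x))) * x powr (s-1)
		 + (\<Sum>n=1..N. (1-exp (- (real n * x))) * x powr (s-1)) =
		 (real N-(1-exp (- (real N * x)))/x) * x powr (s-1)+1/2*((1-exp (- (real N * x))) * x powr (s-1))"
		if x: "x > 0" for x :: real
	proof -
		define q where "q = exp (-x)"
		have q: "q < 1" "q > 0" using x by (auto simp: q_def)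
		have e: "exp (- (real n * x)) = q^n" for n by (simp add: q_def flip: exp_of_nat_mult)
		have ex: "exp x = 1/q" by (simp add: q_def exp_minus field_simps)
		have g: "(\<Sum>n=1..N. q^n) = q/(1-q)*(1-q^N)"
		proof -
			have "(1-q)*(\<Sum>n=1..M. q^n) = q*(1-q^M)" for M
			proof (induction M)
				case (Suc M)
				have "(1-q)*(\<Sum>n=1..Suc M. q^n) = (1-q)*(\<Sum>n=1..M. q^n)+(1-q) * q^Suc M" by (simp add: distrib_left)
				also have "... = q*(1-q^M)+(1-q) * q^Suc M" by (simp only: Suc)
				also have "... = q*(1-q^Suc M)" by (simp add: algebra_simps)
				finally show ?case .
			qed simp
			from this[of N] show ?thesis using q by (simp add: field_simps)
		qed
		have b: "1/(exp x-1) = q/(1-q)" using q unfolding ex by (simp add: field_simps)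
		have "bern x*(1-q^N)+(\<Sum>n=1..N. 1-q^n) = (real N-(1-q^N)/x)+1/2*(1-q^N)"
		proof -
			have "(\<Sum>n=1..N. 1-q^n) = real N-q/(1-q)*(1-q^N)" unfolding sum_subtractf g by simp
			thus ?thesis unfolding bern_def b by (simp add: algebra_simps diff_divide_distrib)
		qed
		from arg_cong[OF this, of "%t. t * x powr (s-1)"] show ?thesis unfolding e by (simp add: ring_distribs sum_distrib_right)
	qed
	have A: "pint (%x. bern x*(1-exp (- (real N * x))) * x powr (s-1))+ennreal (c*(\<Sum>n=1..N. real n powr (-s)))
			= ennreal (c * real N powr (1-s)/(1-s)+c * real N powr (-s)/2)" (is "?J+_ = _")
	proof -
		have "pint (%x. \<Sum>n=1..N. (1-exp (- (real n * x))) * x powr (s-1)) = ennreal (c*(\<Sum>n=1..N. real n powr (-s)))"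
		proof -
			have "pint (%x. \<Sum>n=1..N. (1-exp (- (real n * x))) * x powr (s-1))
				 = (\<Sum>n=1..N. pint (%x. (1-exp (- (real n * x))) * x powr (s-1)))" by (intro pint_sum) auto
			also have "... = (\<Sum>n=1..N. ennreal (c * real n powr (-s)))" by (intro sum.cong refl pint_one_minus_exp) auto
			also have "... = ennreal (c*(\<Sum>n=1..N. real n powr (-s)))" using c_pos by (subst sum_ennreal) (auto simp: sum_distrib_left)
			finally show ?thesis .
		qed
		hence "?J+ennreal (c*(\<Sum>n=1..N. real n powr (-s))) =
			 ?J+pint (%x. \<Sum>n=1..N. (1-exp (- (real n * x))) * x powr (s-1))" by simp
		also have "... = pint (%x. bern x*(1-exp (- (real N * x))) * x powr (s-1)
				 + (\<Sum>n=1..N. (1-exp (- (real n * x))) * x powr (s-1)))"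
			by (intro pint_add[symmetric]) (auto intro!: mult_nonneg_nonneg sum_nonneg bern_nonneg)
		also have "... = pint (%x. (real N-(1-exp (- (real N * x)))/x) * x powr (s-1)
			 + 1/2*((1-exp (- (real N * x))) * x powr (s-1)))" by (intro pint_cong key)
		also have "... = pint (%x. (real N-(1-exp (- (real N * x)))/x) * x powr (s-1))
			 + pint (%x. 1/2*((1-exp (- (real N * x))) * x powr (s-1)))"
		proof (rule pint_add)
			fix x :: real assume x: "x > 0"
			have "1-exp (- (real N * x))<=real N * x" using exp_ge_add_one_self[of "- (real N * x)"] by simp
			thus "(real N-(1-exp (- (real N * x)))/x) * x powr (s-1)>=0" using x by (intro mult_nonneg_nonneg) (auto simp: field_simps)
			show "1/2*((1-exp (- (real N * x))) * x powr (s-1))>=0" using x by simp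
		qed auto
		also have "... = ennreal (c * real N powr (1-s)/(1-s))+ennreal (1/2) * ennreal (c * real N powr (-s))"
			using N by (subst pint_cmult) (auto simp: pint_one_minus_exp pint_one_minus_exp_integral)
		also have "... = ennreal (c * real N powr (1-s)/(1-s)+c * real N powr (-s)/2)"
		proof -
			have "ennreal (1/2) * ennreal (c * real N powr (-s)) = ennreal (1/2*(c * real N powr (-s)))" by (rule ennreal_mult'[symmetric]) simp
			thus ?thesis using c_pos s by (simp flip: ennreal_plus)
		qed
		finally show ?thesis .
	qed
	have le: "c*(\<Sum>n=1..N. real n powr (-s))<=c * real N powr (1-s)/(1-s)+c * real N powr (-s)/2"
	proof -
		have "ennreal (c*(\<Sum>n=1..N. real n powr (-s)))<=ennreal (c * real N powr (1-s)/(1-s)+c * real N powr (-s)/2)"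
			unfolding A[symmetric] by simp
		thus ?thesis using c_pos s by (subst (asm) ennreal_le_iff) auto
	qed
	hence "c*(real N powr (1-s)/(1-s)+real N powr (-s)/2-(\<Sum>n=1..N. real n powr (-s)))>=0" by (simp add: algebra_simps)
	thus "real N powr (1-s)/(1-s)+real N powr (-s)/2-(\<Sum>n=1..N. real n powr (-s))>=0" using c_pos by (simp add: zero_le_mult_iff)
	have "?J = ennreal (c * real N powr (1-s)/(1-s)+c * real N powr (-s)/2)-ennreal (c*(\<Sum>n=1..N. real n powr (-s)))"
		unfolding A[symmetric] by (simp add: ennreal_add_diff_cancel_right)
	also have "... = ennreal (c * real N powr (1-s)/(1-s)+c * real N powr (-s)/2-c*(\<Sum>n=1..N. real n powr (-s)))"
		using c_pos by (intro ennreal_minus) (auto intro!: sum_nonneg mult_nonneg_nonneg)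
	finally show "?J = ennreal (c*(real N powr (1-s)/(1-s)+real N powr (-s)/2-(\<Sum>n=1..N. real n powr (-s))))" by (simp add: algebra_simps)
qed

text \<open>Monotone convergence as N grows; the truncated values converge by
  \<open>zeta_reg_LIMSEQ\<close>. The result is Gamma(s) zeta(s), a product of two numbers that are
  not positive for -1 < s < 0.\<close>

lemma pint_bern_conv_zeta_reg:
	"pint (%x. bern x * x powr (s-1)) = ennreal (c * Re (zeta_reg (of_real s))/(1-s))"
	"Im (zeta_reg (of_real s)) = 0" "Re (zeta_reg (of_real s))>=0"
proof -
	define S where "S = (%N. real N powr (1-s)/(1-s)+real N powr (-s)/2-(\<Sum>n=1..N. real n powr (-s)))"
	have "(%N. (of_real s-1)*((\<Sum>n=1..N. of_nat n powr (-of_real s))-of_nat N powr (-of_real s)/2) + of_nat N powr (1-of_real s))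
					 \<longlonglongrightarrow> zeta_reg (of_real s)" using s by (intro zeta_reg_LIMSEQ) auto
	also have "(%N. (of_real s-1)*((\<Sum>n=1..N. of_nat n powr (-of_real s))-of_nat N powr (-of_real s)/2) + of_nat N powr (1-of_real s))
		= (%N. complex_of_real ((1-s) * S N))"
	proof
		fix N
		have p: "complex_of_real (real n powr r) = of_nat n powr (of_real r)" for n r using powr_of_real[of "real n" r] by simp
		have e: "(1-s) * S N = (s-1)*((\<Sum>n=1..N. real n powr (-s))-real N powr (-s)/2)+real N powr (1-s)"
			unfolding S_def using s by (simp add: field_simps)
		show "(of_real s-1)*((\<Sum>n=1..N. of_nat n powr (-of_real s))-of_nat N powr (-of_real s)/2) + of_nat N powr (1-of_real s)
			 = complex_of_real ((1-s) * S N)" unfolding e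
			by (simp only: p of_real_add of_real_mult of_real_diff of_real_sum of_real_divide of_real_minus of_real_1 of_real_numeral)
	qed
	finally have lim: "(%N. complex_of_real ((1-s) * S N)) \<longlonglongrightarrow> zeta_reg (of_real s)" .
	have "(%N. Im (complex_of_real ((1-s) * S N))) \<longlonglongrightarrow> Im (zeta_reg (of_real s))" by (intro tendsto_intros lim)
	thus "Im (zeta_reg (of_real s)) = 0" by (simp add: LIMSEQ_const_iff)
	have "(%N. Re (complex_of_real ((1-s) * S N))) \<longlonglongrightarrow> Re (zeta_reg (of_real s))" by (intro tendsto_intros lim)
	hence limR: "(%N. (1-s) * S N) \<longlonglongrightarrow> Re (zeta_reg (of_real s))" by simp
	have S0: "S N>=0" if "N > 0" for N using pint_bern_truncated(2)[OF that] by (simp add: S_def)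
	show "Re (zeta_reg (of_real s))>=0"
	proof (rule tendsto_lowerbound[OF limR])
		show "\<forall>\<^sub>F N in sequentially. 0<=(1-s) * S N" using eventually_gt_at_top[of 0] by eventually_elim (use s S0 in auto)
	qed auto
	have limS: "(%N. c * S (Suc N)) \<longlonglongrightarrow> c * Re (zeta_reg (of_real s))/(1-s)"
	proof -
		have "(%N. c*((1-s) * S N)/(1-s)) \<longlonglongrightarrow> c * Re (zeta_reg (of_real s))/(1-s)"
			using s by (intro tendsto_intros limR) auto
		hence "(%N. c * S N) \<longlonglongrightarrow> c * Re (zeta_reg (of_real s))/(1-s)" using s by simp
		thus ?thesis by (rule LIMSEQ_Suc)
	qed
	define f where "f = (%N x. ennreal (indicator {0<..} x*(bern x*(1-exp (- (real (Suc N) * x))) * x powr (s-1))))"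
	have inc: "incseq f" unfolding f_def incseq_def le_fun_def
		by (auto simp: indicator_def intro!: ennreal_leI mult_right_mono mult_left_mono bern_nonneg)
	have f: "integral\<^sup>N lborel (f N) = ennreal (c * S (Suc N))" for N using pint_bern_truncated(1)[of "Suc N"] by (simp add: f_def pint_def S_def)
	have sup: "(SUP N. f N x) = ennreal (indicator {0<..} x*(bern x * x powr (s-1)))" for x
	proof (rule LIMSEQ_unique[OF LIMSEQ_SUP])
		show "incseq (%N. f N x)" using inc by (auto simp: incseq_def le_fun_def)
		show "(%N. f N x) \<longlonglongrightarrow> ennreal (indicator {0<..} x*(bern x * x powr (s-1)))"
		proof (cases "x > 0")
			case True
			have "(%N. exp (-x)^(Suc N)) \<longlonglongrightarrow> 0" using True by (intro LIMSEQ_Suc LIMSEQ_power_zero) auto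
			also have "(%N. exp (-x)^(Suc N)) = (%N. exp (- (real (Suc N) * x)))" by (simp flip: exp_of_nat_mult del: of_nat_Suc power_Suc)
			finally have "(%N. indicator {0<..} x*(bern x*(1-exp (- (real (Suc N) * x))) * x powr (s-1)))
				 \<longlonglongrightarrow> indicator {0<..} x*(bern x*(1-0) * x powr (s-1))" by (intro tendsto_intros)
			thus ?thesis unfolding f_def by (intro tendsto_ennrealI) simp
		qed (auto simp: f_def)
	qed
	have "pint (%x. bern x * x powr (s-1)) = (SUP N. integral\<^sup>N lborel (f N))" unfolding pint_def sup[symmetric]
		by (rule nn_integral_monotone_convergence_SUP[OF inc]) (simp add: f_def)
	also have "... = ennreal (c * Re (zeta_reg (of_real s))/(1-s))"
	proof (rule LIMSEQ_unique[OF LIMSEQ_SUP])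
		show "incseq (%N. integral\<^sup>N lborel (f N))" using inc by (auto simp: incseq_def intro!: nn_integral_mono simp: le_fun_def)
		show "(%N. integral\<^sup>N lborel (f N)) \<longlonglongrightarrow> ennreal (c * Re (zeta_reg (of_real s))/(1-s))"
			unfolding f by (intro tendsto_ennrealI limS)
	qed
	finally show "pint (%x. bern x * x powr (s-1)) = ennreal (c * Re (zeta_reg (of_real s))/(1-s))" .
qed

end

section \<open>Partial fractions of the integrand\<close>

text \<open>The logarithmic derivative of Gamma(z) Gamma(1-z) = pi/sin(pi z) at z = i t expresses pi
  cot(pi z) as a difference of two Digamma values, and the series of Digamma gives the partial
  fractions.\<close>

lemma cot_partial_fractions:
	assumes t: "t~=(0::real)"
	shows "(%k. 2 * t/(t^2+(real (Suc k))^2)) sums (pi * cosh (pi * t)/sinh (pi * t)-1/t)"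
proof -
	define z where "z = \<i> * complex_of_real t"
	have z: "z~=0" "z \<notin> \<int>" using t by (auto simp: z_def complex_is_Int_iff)
	have z': "1-z \<notin> \<int>" using z(2) by (metis Ints_1 Ints_diff diff_diff_eq2 add_diff_cancel_left' )
	have nz: "z \<notin> \<int>\<^sub>\<le>\<^sub>0" "1-z \<notin> \<int>\<^sub>\<le>\<^sub>0" using z z' by auto
	have sin0: "sin (of_real pi * z)~=0" using z(2) by (auto simp: sin_eq_0)
	have D: "((%z. Gamma z * Gamma (1-z)) has_field_derivative
			 (Gamma z * Digamma z * Gamma (1-z)-Gamma z*(Gamma (1-z) * Digamma (1-z)))) (at z)"
		using nz by (auto intro!: derivative_eq_intros simp: algebra_simps)
	have "((%z. of_real pi/sin (of_real pi * z)) has_field_derivative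
			 (- of_real pi*(of_real pi * cos (of_real pi * z))/(sin (of_real pi * z))^2)) (at z)"
		using sin0 by (auto intro!: derivative_eq_intros simp: power2_eq_square)
	with D have eq: "Gamma z * Digamma z * Gamma (1-z)-Gamma z*(Gamma (1-z) * Digamma (1-z))
		 =-of_real pi*(of_real pi * cos (of_real pi * z))/(sin (of_real pi * z))^2" unfolding Gamma_reflection_complex by (rule DERIV_unique)
	have "(of_real pi/sin (of_real pi * z))*(Digamma z-Digamma (1-z)) =
			- of_real pi*(of_real pi * cos (of_real pi * z))/(sin (of_real pi * z))^2"
		unfolding Gamma_reflection_complex[symmetric] eq[symmetric] by (simp add: algebra_simps)
	note h = this
	have cot: "Digamma (1-z)-Digamma z = of_real pi * cos (of_real pi * z)/sin (of_real pi * z)"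
	proof -
		define S C D0 D1 where "S = sin (of_real pi * z)" "C = cos (of_real pi * z)" "D0 = Digamma z" "D1 = Digamma (1-z)"
		note defs = this
		have S0: "S~=0" using sin0 by (simp add: defs)
		have "(of_real pi/S)*(D0-D1)*(S/of_real pi) =-of_real pi*(of_real pi * C)/S^2*(S/of_real pi)" using h by (simp add: defs)
		hence "D0-D1 =-(of_real pi * C/S)" using S0 by (simp add: power2_eq_square)
		hence "D1-D0 = of_real pi * C/S" by (metis minus_diff_eq minus_minus)
		thus ?thesis by (simp flip: defs)
	qed
	have "1-z~=0" using z'  by auto
	have s: "(%k. inverse (z + of_nat k)-inverse (1-z + of_nat k)) sums (Digamma (1-z)-Digamma z)"
		using sums_diff[OF summable_sums[OF summable_Digamma[OF \<open>1 - z ~= 0\<close>]] summable_sums[OF summable_Digamma[OF z(1)]]]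
		by (simp add: Digamma_def)
	\<comment> \<open>Shifts the index of the first half by one, so that the poles pair up as z = k+1
	  and z = -(k+1) and 1/z splits off.\<close>
	have tel: "(%k. inverse (of_nat (Suc k)+z)-inverse (of_nat k+z)) sums (0-inverse (of_nat 0+z))"
		by (intro telescope_sums filterlim_compose[OF tendsto_inverse_0]
							tendsto_add_filterlim_at_infinity'[OF _ tendsto_const] tendsto_of_nat)
	have "(%k. inverse (of_nat (Suc k)+z)-inverse (of_nat (Suc k)-z)) sums (Digamma (1-z)-Digamma z-inverse z)"
		using sums_add[OF s tel] by (simp add: algebra_simps)
	also have "(%k. inverse (of_nat (Suc k)+z)-inverse (of_nat (Suc k)-z)) =
			(%k. - \<i> * of_real (2 * t/(t^2+(real (Suc k))^2)))"
	proof
		fix k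
		define m where "m = real (Suc k)"
		have m: "m > 0" by (simp add: m_def)
		have "of_real m+z~=0" "of_real m-z~=0" using m by (auto simp: z_def complex_eq_iff)
		moreover have "complex_of_real (t^2+m^2)~=0" using m by (metis of_real_eq_0_iff sum_power2_eq_zero_iff less_irrefl)
		moreover have "(of_real m+z)*(of_real m-z) = of_real (t^2+m^2)" by (simp add: z_def algebra_simps power2_eq_square)
		ultimately have "inverse (of_real m+z)-inverse (of_real m-z) = - \<i> * of_real (2 * t/(t^2+m^2))"
			by (simp add: z_def divide_simps) (simp add: z_def algebra_simps power2_eq_square)?
		thus "inverse (of_nat (Suc k)+z)-inverse (of_nat (Suc k)-z) = - \<i> * of_real (2 * t/(t^2+(real (Suc k))^2))" by (simp add: m_def)
	qed
	finally have "(%k. \<i>*(- \<i> * of_real (2 * t/(t^2+(real (Suc k))^2)))) sums (\<i>*(Digamma (1-z)-Digamma z-inverse z))"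
		by (rule sums_mult)
	moreover have "\<i>*(Digamma (1-z)-Digamma z-inverse z) = of_real (pi * cosh (pi * t)/sinh (pi * t)-1/t)"
	proof -
		have c: "cos (of_real pi * z) = of_real (cosh (pi * t))"
			by (simp add: z_def cosh_def cos_exp_eq scaleR_conv_of_real exp_of_real mult_ac flip: of_real_mult of_real_minus)
				 (simp add: mult_ac)?
		have s: "sin (of_real pi * z) = \<i> * of_real (sinh (pi * t))"
			by (simp add: z_def sinh_def sin_exp_eq scaleR_conv_of_real exp_of_real mult_ac flip: of_real_mult of_real_minus)
				 (simp add: mult_ac divide_simps)?
		have "sinh (pi * t)~=0" using t by simp
		thus ?thesis unfolding cot c s using t by (simp add: z_def field_simps)
	qed
	ultimately have "(%k. complex_of_real (2 * t/(t^2+(real (Suc k))^2))) sums of_real (pi * cosh (pi * t)/sinh (pi * t)-1/t)" by simp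
	thus ?thesis by (simp only: sums_of_real_iff)
qed

text \<open>The sum equals coth(x/2)/2 - 1/x, which is the preceding expansion at t = x/(2
  pi).\<close>

lemma bern_partial_fractions:
	assumes x: "x > (0::real)"
	shows "(%k. 2 * x/(x^2+(2 * pi * real (Suc k))^2)) sums (1/(exp x-1)-1/x+1/2)"
proof -
	define t where "t = x/(2 * pi)"
	have t: "t~=0" using x by (simp add: t_def)
	have "(%k. 1/(2 * pi)*(2 * t/(t^2+(real (Suc k))^2))) sums (1/(2 * pi)*(pi * cosh (pi * t)/sinh (pi * t)-1/t))"
		by (intro sums_mult cot_partial_fractions t)
	also have "(%k. 1/(2 * pi)*(2 * t/(t^2+(real (Suc k))^2))) = (%k. 2 * x/(x^2+(2 * pi * real (Suc k))^2))"
	proof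
		fix k
		define m where "m = real (Suc k)"
		have "x^2+(2 * pi * m)^2 > 0" using x by (simp add: add_pos_nonneg)
		hence "1/(2 * pi)*(2 * t/(t^2+m^2)) = 2 * x/(x^2+(2 * pi * m)^2)" by (simp add: t_def field_simps power2_eq_square)
		thus "1/(2 * pi)*(2 * t/(t^2+(real (Suc k))^2)) = 2 * x/(x^2+(2 * pi * real (Suc k))^2)" by (simp only: m_def)
	qed
	also have "1/(2 * pi)*(pi * cosh (pi * t)/sinh (pi * t)-1/t) = 1/(exp x-1)-1/x+1/2"
	proof -
		define q where "q = exp (x/2)"
		have q: "q > 1" using x by (simp add: q_def)
		hence q2: "q^2 > 1" by (simp add: one_less_power)
		have ex: "exp x = q^2" by (simp add: q_def flip: exp_double)
		have "cosh (pi * t) = (q^2+1)/(2 * q)" "sinh (pi * t) = (q^2-1)/(2 * q)"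
			using q by (simp_all add: t_def cosh_def sinh_def q_def exp_minus field_simps power2_eq_square)
		hence "cosh (pi * t)/sinh (pi * t) = (q^2+1)/(q^2-1)" using q by simp
		moreover have "1/(2 * pi)*(pi * cosh (pi * t)/sinh (pi * t)-1/t)
				= 1/2*(cosh (pi * t)/sinh (pi * t))-1/x" using x by (simp add: right_diff_distrib) (simp add: t_def)
		moreover have "1/2*((q^2+1)/(q^2-1)) = 1/(q^2-1)+1/2" using q2 by (simp add: field_simps)
		ultimately show ?thesis using ex by simp
	qed
	finally show ?thesis .
qed

section \<open>Growth of the Gamma function\<close>

text \<open>With \<nu> = Re w and t = Im w, the inequality |w + k| k <= (\<nu> + k) |k + i t|
  compares the finite products for 1/Gamma(w) with those for 1/Gamma(1 + i t) and 1/Gamma(\<nu>).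
  The middle one is explicit: the reflection formula gives |1/Gamma(1 + i t)|^2 = sinh(pi t)/(pi
  t).\<close>

lemma Gamma_vertical_bound:
	fixes w :: complex
	assumes w: "Re w > 0"
	shows "norm (inverse (Gamma w))<=norm w/Re w * exp (pi * \<bar>Im w\<bar>/2)/Gamma (Re w)"
proof -
	define \<nu> t where "\<nu> = Re w" and "t = Im w"
	define w1 where "w1 = 1 + \<i> * complex_of_real t"
	have \<nu>: "\<nu> > 0" using w by (simp add: \<nu>_def)
	have w_eq: "w = of_real \<nu> + \<i> * of_real t" by (simp add: \<nu>_def t_def complex_eq_iff)
	have step: "norm (rGamma_series w n)<=norm w / \<nu> * norm (rGamma_series w1 n) * rGamma_series \<nu> n" if n: "n > 0" for n
	proof -
		have e: "norm (exp (w * of_real (ln (real n)))) = exp (\<nu> * ln (real n))" by (simp add: \<nu>_def)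
		have e1: "norm (exp (w1 * of_real (ln (real n)))) = exp (ln (real n))" by (simp add: w1_def)
		have quot: "norm (w + of_nat k) * real k<=(\<nu>+real k) * norm (w1-1 + of_nat k)" for k
		proof (rule power2_le_imp_le)
			have "(norm (w + of_nat k) * real k)^2 = ((\<nu>+real k)^2+t^2)*(real k)^2" by (simp add: power_mult_distrib cmod_power2 w_eq)
			also have "...<=(\<nu>+real k)^2*((real k)^2+t^2)"
			proof -
				have "t^2*(real k)^2<=t^2*(\<nu>+real k)^2" using \<nu> by (intro mult_left_mono power_mono) auto
				thus ?thesis by (simp add: distrib_left distrib_right mult.commute)
			qed
			also have "... = ((\<nu>+real k) * norm (w1-1 + of_nat k))^2" by (simp add: power_mult_distrib cmod_power2 w1_def)
			finally show "(norm (w + of_nat k) * real k)^2<=((\<nu>+real k) * norm (w1-1 + of_nat k))^2" .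
		qed (use \<nu> in auto)
		have P: "norm (pochhammer w (Suc n)) * fact n<=norm w / \<nu> * norm (pochhammer w1 n) * pochhammer \<nu> (Suc n)"
		proof (induction n)
			case 0 thus ?case using \<nu> by simp
		next
			case (Suc n)
			have "norm (pochhammer w (Suc (Suc n))) * fact (Suc n) =
				 (norm (pochhammer w (Suc n)) * fact n)*(norm (w + of_nat (Suc n)) * real (Suc n))"
				by (simp only: pochhammer_Suc[of w "Suc n"] norm_mult fact_Suc of_nat_mult mult_ac)
			also have "...<=(norm w / \<nu> * norm (pochhammer w1 n) * pochhammer \<nu> (Suc n))*((\<nu>+real (Suc n)) * norm (w1-1 + of_nat (Suc n)))"
				using \<nu> by (intro mult_mono[OF Suc.IH quot]) (auto intro!: mult_nonneg_nonneg divide_nonneg_nonneg pochhammer_nonneg)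
			also have "w1-1 + of_nat (Suc n) = w1 + of_nat n" by simp
			also have "(norm w / \<nu> * norm (pochhammer w1 n) * pochhammer \<nu> (Suc n))*((\<nu>+real (Suc n)) * norm (w1 + of_nat n))
				 = norm w / \<nu> * norm (pochhammer w1 (Suc n)) * pochhammer \<nu> (Suc (Suc n))"
				by (simp only: pochhammer_Suc[of w1 n] pochhammer_Suc[of \<nu> "Suc n"] norm_mult mult_ac)
			finally show ?case .
		qed
		have "norm (w1 + of_nat n)>=real n" using complex_Re_le_cmod[of "w1 + of_nat n"] by (simp add: w1_def)
		have "norm (rGamma_series w n) = norm (pochhammer w (Suc n)) * fact n/(fact n * fact n * exp (\<nu> * ln (real n)))"
			using e by (simp add: rGamma_series_def norm_divide norm_mult)
		also have "...<=(norm w / \<nu> * norm (pochhammer w1 n) * pochhammer \<nu> (Suc n))/(fact n * fact n * exp (\<nu> * ln (real n)))"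
			by (intro divide_right_mono P) auto
		also have "...<=(norm w / \<nu>*(norm (pochhammer w1 (Suc n))/real n) * pochhammer \<nu> (Suc n))/(fact n * fact n * exp (\<nu> * ln (real n)))"
		proof (intro divide_right_mono mult_right_mono mult_left_mono)
			have "norm (pochhammer w1 n) * real n<=norm (pochhammer w1 n) * norm (w1 + of_nat n)"
				by (intro mult_left_mono) (auto simp: \<open>norm (w1 + of_nat n) >= real n\<close>)
			thus "norm (pochhammer w1 n)<=norm (pochhammer w1 (Suc n))/real n"
				using n by (simp only: pos_le_divide_eq of_nat_0_less_iff pochhammer_Suc norm_mult)
		qed (use \<nu> in \<open>auto intro!: pochhammer_nonneg\<close>)
		also have "... = norm w / \<nu> * norm (rGamma_series w1 n) * rGamma_series \<nu> n"
			using e1 n by (simp add: rGamma_series_def norm_divide norm_mult)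
		finally show ?thesis .
	qed
	have "norm (rGamma w)<=norm w / \<nu> * norm (rGamma w1) * rGamma \<nu>"
	proof (rule LIMSEQ_le)
		show "(%n. norm (rGamma_series w n)) \<longlonglongrightarrow> norm (rGamma w)" by (intro tendsto_intros)
		show "(%n. norm w / \<nu> * norm (rGamma_series w1 n) * rGamma_series \<nu> n) \<longlonglongrightarrow> norm w / \<nu> * norm (rGamma w1) * rGamma \<nu>"
			by (intro tendsto_intros)
		show "\<exists>N. \<forall>n\<ge>N. norm (rGamma_series w n)<=norm w / \<nu> * norm (rGamma_series w1 n) * rGamma_series \<nu> n"
			using step by (intro exI[of _ 1]) auto
	qed
	moreover have "norm (rGamma w1)<=exp (pi * \<bar>t\<bar>/2)"
	proof (cases "t = 0")
		case False
		have cn: "norm (rGamma (cnj w1)) = norm (rGamma w1)" by (simp flip: cnj_rGamma)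
		have "rGamma w1 * rGamma (cnj w1)*(\<i> * of_real t) = rGamma (\<i> * of_real t) * rGamma (1 - \<i> * of_real t)"
			using rGamma_plus1[of "\<i> * of_real t"] by (simp add: w1_def algebra_simps)
		also have "... = sin (of_real pi*(\<i> * of_real t))/of_real pi" by (rule rGamma_reflection_complex)
		finally have "norm (rGamma w1 * rGamma (cnj w1)*(\<i> * of_real t)) = norm (sin (of_real pi*(\<i> * of_real t))/of_real pi)" by simp
		hence "(norm (rGamma w1))^2 * \<bar>t\<bar> = norm (sin (of_real pi*(\<i> * of_real t)))/pi"
			by (simp add: norm_mult norm_divide cn power2_eq_square)
		also have "sin (of_real pi*(\<i> * of_real t)) = \<i> * of_real (sinh (pi * t))"
			by (simp add: sinh_def sin_exp_eq scaleR_conv_of_real exp_of_real mult_ac flip: of_real_mult of_real_minus)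
				 (simp add: mult_ac divide_simps)?
		also have "norm (\<i> * complex_of_real (sinh (pi * t))) = \<bar>sinh (pi * t)\<bar>" by (simp add: norm_mult)
		also have "\<bar>sinh (pi * t)\<bar> = sinh (pi * \<bar>t\<bar>)" using mult_pos_neg[of pi t] by (auto simp: abs_if mult_less_0_iff)
		also have "sinh (pi * \<bar>t\<bar>)<=pi * \<bar>t\<bar> * exp (pi * \<bar>t\<bar>)"
		proof -
			define y where "y = pi * \<bar>t\<bar>"
			have "y>=0" by (simp add: y_def)
			have "1-exp (-2*y)<=2 * y" using exp_ge_add_one_self[of "-2*y"] by simp
			hence "exp y*(1-exp (-2*y))<=exp y*(2 * y)" by (intro mult_left_mono) auto
			moreover have "exp y * exp (-2*y) = exp (-y)" by (simp flip: exp_add)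
			ultimately have "sinh y<=y * exp y" by (simp add: sinh_def algebra_simps)
			thus ?thesis by (simp add: y_def)
		qed
		finally have "(norm (rGamma w1))^2 * \<bar>t\<bar><=exp (pi * \<bar>t\<bar>) * \<bar>t\<bar>" by (simp add: field_simps)
		hence "(norm (rGamma w1))^2<=exp (pi * \<bar>t\<bar>)" using False by simp
		also have "... = (exp (pi * \<bar>t\<bar>/2))^2" by (simp flip: exp_double)
		finally show ?thesis by (rule power2_le_imp_le) auto
	qed (auto simp: w1_def)
	ultimately have "norm (rGamma w)<=norm w / \<nu> * exp (pi * \<bar>t\<bar>/2) * rGamma \<nu>"
	proof -
		assume a: "norm (rGamma w)<=norm w / \<nu> * norm (rGamma w1) * rGamma \<nu>" "norm (rGamma w1)<=exp (pi * \<bar>t\<bar>/2)"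
		have "rGamma \<nu>>=0" using \<nu> by (simp add: rGamma_inverse_Gamma Gamma_real_nonneg)
		hence "norm w / \<nu> * norm (rGamma w1) * rGamma \<nu><=norm w / \<nu> * exp (pi * \<bar>t\<bar>/2) * rGamma \<nu>"
			using a(2) \<nu> by (intro mult_right_mono mult_left_mono) auto
		with a(1) show ?thesis by linarith
	qed
	thus ?thesis by (simp only: rGamma_inverse_Gamma \<nu>_def t_def divide_inverse)
qed

text \<open>When x grows by 1, exp(l x) is multiplied by exp l and Gamma(x) by x. Beyond exp l the
  ratio can only decrease, and below it compactness gives the constant.\<close>

lemma Gamma_real_superexponential:
	fixes l a :: real
	assumes "a > 0"
	shows "\<exists>C>0. \<forall>x\<ge>a. exp (l * x)<=C * Gamma x"
proof -
	define M where "M = max a (exp l)"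
	have M: "M > 0" "M>=exp l" "M>=a" using assms by (auto simp: M_def)
	have np: "x \<notin> \<int>\<^sub>\<le>\<^sub>0" if "x > 0" for x :: real
	proof
		assume "x \<in> \<int>\<^sub>\<le>\<^sub>0"
		hence "x<=0" by (rule nonpos_Ints_nonpos)
		thus False using that by simp
	qed
	have "continuous_on {a..M+1} (%x. exp (l * x)/Gamma x)"
	proof (intro continuous_intros continuous_on_Gamma)
		show "\<forall>x\<in>{a..M+1}. Gamma x~=0" using assms by (metis Gamma_real_pos atLeastAtMost_iff less_le_trans less_numeral_extra(3))
		show "{a..M+1} \<inter> \<int>\<^sub>\<le>\<^sub>0 = {}" using assms np by fastforce
	qed
	hence "bounded ((%x. exp (l * x)/Gamma x) ` {a..M+1})" by (intro compact_imp_bounded compact_continuous_image) auto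
	then obtain C where C: "C > 0" "!!x. x \<in> {a..M+1} ==> norm (exp (l * x)/Gamma x)<=C" by (auto simp: bounded_pos)
	have base: "exp (l * x)<=C * Gamma x" if "x \<in> {a..M+1}" for x
	proof -
		have "Gamma x > 0" using that assms by (intro Gamma_real_pos) auto
		thus ?thesis using C(2)[OF that] by (simp add: field_simps)
	qed
	have "exp (l * x)<=C * Gamma x" if "x>=a" "x<=M+1+real n" for x n using that
	proof (induction n arbitrary: x)
		case 0 thus ?case using base by simp
	next
		case (Suc n)
		show ?case
		proof (cases "x<=M+1")
			case False
			hence IH: "exp (l*(x-1))<=C * Gamma (x-1)" using Suc M by (intro Suc.IH) auto
			have x1: "x-1 > 0" "x-1>=exp l" using False M by auto
			have "exp (l * x) = exp (l*(x-1)) * exp l" by (simp add: algebra_simps flip: exp_add)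
			also have "...<=(C * Gamma (x-1))*(x-1)" using IH x1 C(1) by (intro mult_mono) (auto intro!: mult_nonneg_nonneg Gamma_real_nonneg)
			also have "... = C * Gamma x"
			proof -
				have "x-1 \<notin> \<int>\<^sub>\<le>\<^sub>0" using np x1(1) by blast
				from Gamma_plus1[OF this] show ?thesis by simp
			qed
			finally show ?thesis .
		qed (use base Suc in auto)
	qed
	moreover have "\<exists>n. x<=M+1+real n" for x using real_arch_simple[of "x-M-1"] by (auto simp: algebra_simps)
	ultimately show ?thesis using C(1) by blast
qed

section \<open>Second evaluation of the Mellin transform\<close>

text \<open>The substitution rule is applied on compact intervals, which then exhaust the half-line
  by monotone convergence.\<close>

lemma pint_square_substitution:
	assumes [measurable]: "g \<in> borel_measurable borel"
	shows "pint g = pint (%x. 2 * x * g (x^2))"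
proof -
	define h where "h = (%x::real. indicator {0<..} x * g x)"
	have [measurable]: "h \<in> borel_measurable borel" unfolding h_def by measurable
	have hx: "indicator {0<..} x * g x = h x" for x by (simp add: h_def)
	define f1 where "f1 = (%(n::nat) x. ennreal (h x * indicator {0..(real n)^2} x))"
	define f2 where "f2 = (%(n::nat) x. ennreal (h (x^2)*(2 * x) * indicator {0..real n} x))"
	have e: "integral\<^sup>N lborel (f1 n) = integral\<^sup>N lborel (f2 n)" for n
	proof -
		have d: "((%x::real. x^2) has_real_derivative 2 * x) (at x)" for x by (auto intro!: derivative_eq_intros)
		have c: "continuous_on {0..real n} (%x. 2 * x)" by (intro continuous_intros)
		show ?thesis unfolding f1_def f2_def using nn_integral_substitution[of "%x. x^2" 0 "real n" h "%x. 2 * x", OF _ d c]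
			by (simp add: set_borel_measurable_def)
	qed
	have inc1: "incseq f1"
	proof (intro monoI le_funI)
		fix m n :: nat and x :: real assume "m<=n"
		hence "(real m)^2<=(real n)^2" by (intro power_mono) auto
		hence "x \<in> {0..(real n)^2}" if "x \<in> {0..(real m)^2}" using that by (meson atLeastAtMost_iff order_trans)
		thus "f1 m x<=f1 n x" by (cases "x \<in> {0..(real m)^2}") (simp_all add: f1_def)
	qed
	have inc2: "incseq f2" by (intro monoI le_funI) (auto simp: f2_def indicator_def)
	have sup1: "(SUP n. f1 n x) = ennreal (h x)" for x
	proof (rule LIMSEQ_unique[OF LIMSEQ_SUP])
		show "incseq (%n. f1 n x)" using inc1 by (auto simp: incseq_def le_fun_def)
		obtain N where N: "real N>=x" "real N>=1" by (metis real_arch_simple max.bounded_iff)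
		have "\<forall>\<^sub>F n in sequentially. f1 n x = ennreal (h x)" using eventually_ge_at_top[of N]
		proof eventually_elim
			case (elim n)
			have "x<=real n*1" using N elim by auto
			also have "...<=real n * real n" using N elim by (intro mult_left_mono) auto
			finally show ?case by (auto simp: f1_def h_def indicator_def power2_eq_square)
		qed
		thus "(%n. f1 n x) \<longlonglongrightarrow> ennreal (h x)" by (rule tendsto_eventually)
	qed
	have sup2: "(SUP n. f2 n x) = ennreal (indicator {0<..} x*(2 * x * g (x^2)))" for x
	proof (rule LIMSEQ_unique[OF LIMSEQ_SUP])
		show "incseq (%n. f2 n x)" using inc2 by (auto simp: incseq_def le_fun_def)
		obtain N where N: "real N>=x" by (metis real_arch_simple)
		have "\<forall>\<^sub>F n in sequentially. f2 n x = ennreal (indicator {0<..} x*(2 * x * g (x^2)))" using eventually_ge_at_top[of N]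
		proof eventually_elim
			case (elim n)
			have "x<=real n" using N elim by auto
			thus ?case by (cases "x > 0") (auto simp: f2_def h_def indicator_def mult_ac)
		qed
		thus "(%n. f2 n x) \<longlonglongrightarrow> ennreal (indicator {0<..} x*(2 * x * g (x^2)))" by (rule tendsto_eventually)
	qed
	have "pint g = (SUP n. integral\<^sup>N lborel (f1 n))" unfolding pint_def hx sup1[symmetric]
		by (intro nn_integral_monotone_convergence_SUP inc1) (simp add: f1_def)
	also have "... = (SUP n. integral\<^sup>N lborel (f2 n))" by (simp add: e)
	also have "... = pint (%x. 2 * x * g (x^2))" unfolding pint_def sup2[symmetric]
		by (intro nn_integral_monotone_convergence_SUP[symmetric] inc2) (simp add: f2_def)
	finally show ?thesis .
qed

text \<open>1/(1+y) is the integral of exp(-v (1+y)) over v > 0; after the exchange both inner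
  integrals are Gamma integrals.\<close>

lemma pint_powr_over_1_plus:
	assumes a: "0 < a" "a < 1"
	shows "pint (%y. y powr (a-1)/(1+y)) = ennreal (Gamma a * Gamma (1-a))"
proof -
	have "pint (%y. y powr (a-1)/(1+y)) =
		 (\<integral>\<^sup>+u. ennreal (indicator {0<..} u*(Gamma a * u powr (-a) * exp (-u))) \<partial>lborel)"
	proof (rule pint_tonelli[where f = "%y v. y powr (a-1) * exp (- (v * (1+y)))"])
		fix y :: real assume y: "y > 0"
		have "(\<integral>\<^sup>+v. ennreal (indicator {0<..} v * (y powr (a-1) * exp (- (v * (1+y))))) \<partial>lborel)
			 = pint (%v. y powr (a-1) * exp (- (v * (1+y))))" by (simp add: pint_def)
		also have "... = pint (%v. y powr (a-1)*(v powr (1-1) * exp (- ((1+y) * v))))" by (intro pint_cong) (auto simp: mult.commute)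
		also have "... = ennreal (y powr (a-1)) * pint (%v. v powr (1-1) * exp (- ((1+y) * v)))" by (rule pint_cmult) auto
		also have "pint (%v. v powr (1-1) * exp (- ((1+y) * v))) = ennreal (Gamma 1*(1+y) powr (-1))" by (rule pint_Gamma) (use y in auto)
		also have "ennreal (y powr (a-1))*... = ennreal (y powr (a-1)*(Gamma 1*(1+y) powr (-1)))" by (rule ennreal_mult'[symmetric]) auto
		also have "... = ennreal (y powr (a-1)/(1+y))" using y by (simp add: powr_minus divide_inverse)
		finally show "(\<integral>\<^sup>+v. ennreal (indicator {0<..} v * (y powr (a-1) * exp (- (v * (1+y))))) \<partial>lborel)
			 = ennreal (y powr (a-1)/(1+y))" .
	next
		fix v :: real assume "v \<in> {0<..}"
		hence v: "v > 0" by simp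
		have "pint (%y. y powr (a-1) * exp (- (v * (1+y)))) = pint (%y. exp (-v)*(y powr (a-1) * exp (- (v * y))))"
			by (intro pint_cong) (auto simp: algebra_simps simp flip: exp_add)
		also have "... = ennreal (exp (-v)) * ennreal (Gamma a * v powr (-a))" using v a by (subst pint_cmult) (auto simp: pint_Gamma)
		finally show "pint (%y. y powr (a-1) * exp (- (v * (1+y)))) = ennreal (Gamma a * v powr (-a) * exp (-v))"
			by (simp add: mult.commute flip: ennreal_mult')
	qed (auto simp: case_prod_unfold)
	also have "... = pint (%u. Gamma a*(u powr ((1-a)-1) * exp (- (1 * u))))" unfolding pint_def by (intro nn_integral_cong) (auto simp: mult_ac)
	also have "... = ennreal (Gamma a) * pint (%u. u powr ((1-a)-1) * exp (- (1 * u)))" using a Gamma_real_nonneg[of a] by (intro pint_cmult) auto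
	also have "pint (%u. u powr ((1-a)-1) * exp (- (1 * u))) = ennreal (Gamma (1-a)*1 powr (- (1-a)))" by (rule pint_Gamma) (use a in auto)
	also have "ennreal (Gamma a)*... = ennreal (Gamma a * Gamma (1-a))" using a Gamma_real_nonneg[of a] by (simp add: ennreal_mult')
	finally show ?thesis .
qed

lemma pint_powr_over_1_plus_square:
	assumes s: "-1 < s" "s < 1"
	shows "pint (%x. x powr s/(1+x^2)) = ennreal (Gamma ((s+1)/2) * Gamma ((1-s)/2)/2)"
proof -
	have "ennreal 2 * pint (%x. x powr s/(1+x^2)) = pint (%x. 2*(x powr s/(1+x^2)))" by (subst pint_cmult) auto
	also have "... = pint (%x. 2 * x*((x^2) powr ((s+1)/2-1)/(1+x^2)))"
	proof (intro pint_cong)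
		fix x :: real assume x: "x > 0"
		have "(x^2) powr ((s+1)/2-1) = (x powr 2) powr ((s+1)/2-1)" using x by (simp add: powr_realpow)
		also have "... = x powr (2*((s+1)/2-1))" by (rule powr_powr)
		also have "2*((s+1)/2-1) = s-1" by (simp add: field_simps)
		finally show "2*(x powr s/(1+x^2)) = 2 * x*((x^2) powr ((s+1)/2-1)/(1+x^2))" using x by (simp add: powr_diff)
	qed
	also have "... = pint (%y. y powr ((s+1)/2-1)/(1+y))" by (rule pint_square_substitution[symmetric]) auto
	also have "... = ennreal (Gamma ((s+1)/2) * Gamma (1-(s+1)/2))" using s by (intro pint_powr_over_1_plus) auto
	also have "1-(s+1)/2 = (1-s)/2" by (simp add: field_simps)
	finally have "ennreal (1/2) * ennreal 2 * pint (%x. x powr s/(1+x^2)) = ennreal (1/2) * ennreal (Gamma ((s+1)/2) * Gamma ((1-s)/2))"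
		by (simp add: mult.assoc)
	also have "ennreal (1/2) * ennreal 2 = 1" by (subst ennreal_mult'[symmetric]) auto
	also have "ennreal (1/2) * ennreal (Gamma ((s+1)/2) * Gamma ((1-s)/2)) = ennreal (1/2*(Gamma ((s+1)/2) * Gamma ((1-s)/2)))"
		by (subst ennreal_mult'[symmetric]) auto
	finally show ?thesis by simp
qed

text \<open>Scaling x by 2 pi k reduces each partial fraction to the same Beta-type integral, so
  that zeta(1-s) appears as the sum of the scaling factors.\<close>

lemma pint_bern_series:
	assumes s: "-1 < s" "s < 0"
	shows "pint (%x. bern x * x powr (s-1)) =
		ennreal ((2 * pi) powr (s-1) * Gamma ((s+1)/2) * Gamma ((1-s)/2)*(\<Sum>k. real (Suc k) powr (s-1)))"
proof -
	define I where "I = Gamma ((s+1)/2) * Gamma ((1-s)/2)/2"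
	have I: "I>=0" using s by (auto simp: I_def intro!: mult_nonneg_nonneg Gamma_real_nonneg)
	define d where "d = (%k. 2 * pi * real (Suc k))"
	have d: "d k > 0" for k by (simp add: d_def)
	have sm: "summable (%k. real (Suc k) powr (s-1))" using summable_Suc_powr[of "1-s"] s by simp
	have each: "pint (%x. 2 * x/(x^2+(d k)^2) * x powr (s-1)) = ennreal (2 * d k powr (s-1) * I)" for k
	proof -
		have "pint (%x. 2 * x/(x^2+(d k)^2) * x powr (s-1))
			= ennreal (d k) * pint (%x. 2*(d k * x)/((d k * x)^2+(d k)^2)*(d k * x) powr (s-1))" using d[of k] by (intro pint_scale) auto
		also have "pint (%x. 2*(d k * x)/((d k * x)^2+(d k)^2)*(d k * x) powr (s-1))
			= pint (%x. (2 * d k powr (s-2))*(x powr s/(1+x^2)))"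
		proof (intro pint_cong)
			fix x :: real assume x: "x > 0"
			have "1+x^2 > 0" using x by (simp add: add_pos_nonneg)
			have "2*(d k * x)/((d k * x)^2+(d k)^2) = 2 * x/(d k*(1+x^2))"
				using d[of k] \<open>1 + x^2 > 0\<close> by (simp add: divide_simps power2_eq_square) (simp add: algebra_simps)
			moreover have "(d k * x) powr (s-1) = d k powr (s-2) * d k * x powr s/x"
				using x d[of k] by (simp add: powr_mult powr_diff power2_eq_square powr_numeral)
			ultimately show "2*(d k * x)/((d k * x)^2+(d k)^2)*(d k * x) powr (s-1) = (2 * d k powr (s-2))*(x powr s/(1+x^2))"
				using x d[of k] by simp
		qed
		also have "... = ennreal (2 * d k powr (s-2)) * ennreal I" using s by (subst pint_cmult) (auto simp: pint_powr_over_1_plus_square I_def)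
		also have "ennreal (d k)*(ennreal (2 * d k powr (s-2)) * ennreal I) = ennreal (d k*(2 * d k powr (s-2) * I))"
			using d[of k] I by (simp add: ennreal_mult' )
		also have "d k*(2 * d k powr (s-2) * I) = 2 * d k powr (s-1) * I" using d[of k] by (simp add: powr_diff power2_eq_square powr_numeral)
		finally show ?thesis .
	qed
	have "pint (%x. bern x * x powr (s-1)) =
		 (\<integral>\<^sup>+x. (\<Sum>k. ennreal (indicator {0<..} x*(2 * x/(x^2+(d k)^2) * x powr (s-1)))) \<partial>lborel)" unfolding pint_def
	proof (intro nn_integral_cong)
		fix x :: real
		show "ennreal (indicator {0<..} x*(bern x * x powr (s-1))) =
				(\<Sum>k. ennreal (indicator {0<..} x*(2 * x/(x^2+(d k)^2) * x powr (s-1))))"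
		proof (cases "x > 0")
			case True
			have "(%k. 2 * x/(x^2+(d k)^2) * x powr (s-1)) sums (bern x * x powr (s-1))"
				unfolding d_def bern_def by (intro sums_mult2 bern_partial_fractions True)
			hence "(\<Sum>k. ennreal (2 * x/(x^2+(d k)^2) * x powr (s-1))) = ennreal (bern x * x powr (s-1))"
				using True by (intro suminf_ennreal_eq) auto
			thus ?thesis using True by simp
		qed auto
	qed
	also have "... = (\<Sum>k. pint (%x. 2 * x/(x^2+(d k)^2) * x powr (s-1)))" unfolding pint_def by (intro nn_integral_suminf) auto
	also have "... = (\<Sum>k. ennreal (2 * d k powr (s-1) * I))" by (simp only: each)
	also have "... = ennreal (2*(2 * pi) powr (s-1) * I*(\<Sum>k. real (Suc k) powr (s-1)))"
	proof (rule suminf_ennreal_eq)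
		have "(%k. 2*(2 * pi) powr (s-1) * I * real (Suc k) powr (s-1)) sums
			 (2*(2 * pi) powr (s-1) * I*(\<Sum>k. real (Suc k) powr (s-1)))" by (intro sums_mult summable_sums sm)
		also have "(%k. 2*(2 * pi) powr (s-1) * I * real (Suc k) powr (s-1)) = (%k. 2 * d k powr (s-1) * I)"
			by (simp add: d_def powr_mult mult_ac del: of_nat_Suc)
		finally show "(%k. 2 * d k powr (s-1) * I) sums (2*(2 * pi) powr (s-1) * I*(\<Sum>k. real (Suc k) powr (s-1)))" .
	qed (use I in auto)
	finally show ?thesis by (simp add: I_def mult.assoc)
qed

section \<open>The functional equation\<close>

text \<open>Riemann's s (s-1)/2 pi^(-s/2) Gamma(s/2) zeta(s), with s/2 and s - 1 absorbed into the
  Gamma and zeta factors. In this form it is visibly holomorphic on Re s > -1.\<close>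

definition xi :: "complex => complex" where
	"xi s = of_real pi powr (- s/2) * Gamma (s/2+1) * zeta_reg s"

lemma not_nonpos_Ints_of_Re_pos: "Re z > 0 ==> z \<notin> \<int>\<^sub>\<le>\<^sub>0"
	by (metis nonpos_Ints_cases Re_complex_of_real of_int_le_0_iff of_real_of_int_eq not_le)

lemma holomorphic_xi: "xi holomorphic_on {s. Re s > -1}" unfolding xi_def by (intro holomorphic_intros holomorphic_on_subset[OF holomorphic_zeta_reg])
		 (auto intro!: not_nonpos_Ints_of_Re_pos)

lemma zeta_reg_of_real_gt_1:
	assumes "x > 1"
	shows "zeta_reg (of_real x) = of_real ((x-1)*(\<Sum>k. real (Suc k) powr (-x)))"
proof -
	have p: "(of_nat (Suc k) :: complex) powr (- of_real x) = of_real (real (Suc k) powr (-x))" for k using powr_of_real[of "real (Suc k)" "-x"] by simp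
	have "(\<Sum>k. complex_of_real (real (Suc k) powr (-x))) = of_real (\<Sum>k. real (Suc k) powr (-x))"
		using assms by (intro suminf_of_real[symmetric] summable_Suc_powr)
	thus ?thesis using assms by (subst zeta_reg_eq_series) (simp_all only: p, simp_all)
qed

text \<open>The two evaluations of the Mellin transform, brought into symmetric form by Legendre's
  duplication formula at (s+1)/2.\<close>

lemma xi_reflect_real:
	assumes s: "-1 < s" "s < 0"
	shows "xi (of_real s) = xi (1-of_real s)"
proof -
	define w where "w = Re (zeta_reg (of_real s))"
	define S where "S = (\<Sum>k. real (Suc k) powr (s-1))"
	have w: "zeta_reg (of_real s) = of_real w" "w>=0" using pint_bern_conv_zeta_reg(2,3)[OF s] by (auto simp: w_def complex_eq_iff)
	have S: "S>=0" unfolding S_def using summable_Suc_powr[of "1-s"] s by (intro suminf_nonneg) auto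
	have w': "zeta_reg (1-of_real s) = of_real (-s * S)" using zeta_reg_of_real_gt_1[of "1-s"] s by (simp add: S_def)
	have G: "Gamma (s+1) > 0" "Gamma ((s+1)/2) > 0" "Gamma ((1-s)/2) > 0" using s by (auto intro!: Gamma_real_pos)
	have "ennreal (Gamma (s+1)/(-s) * w/(1-s)) = ennreal ((2 * pi) powr (s-1) * Gamma ((s+1)/2) * Gamma ((1-s)/2) * S)"
		using pint_bern_series[OF s] pint_bern_conv_zeta_reg(1)[OF s] by (simp add: S_def w_def)
	hence "Gamma (s+1)/(-s) * w/(1-s) = (2 * pi) powr (s-1) * Gamma ((s+1)/2) * Gamma ((1-s)/2) * S"
	proof (subst (asm) ennreal_inj)
		show "Gamma (s+1)/(-s) * w/(1-s)>=0" by (intro divide_nonneg_pos mult_nonneg_nonneg) (use G S w(2) s in auto)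
		show "(2 * pi) powr (s-1) * Gamma ((s+1)/2) * Gamma ((1-s)/2) * S>=0" using G S by (intro mult_nonneg_nonneg) auto
	qed
	hence eq: "Gamma (s+1) * w = (2 * pi) powr (s-1) * Gamma ((s+1)/2) * Gamma ((1-s)/2)*(1-s)*(-s * S)" using s by (simp add: field_simps)
	have "complex_of_real (Gamma ((s+1)/2) * Gamma (s/2+1)) = of_real (2 powr (-s) * sqrt pi * Gamma (s+1))"
	proof -
		have "Gamma (complex_of_real ((s+1)/2)) * Gamma (of_real ((s+1)/2)+1/2) =
			exp ((1-2 * of_real ((s+1)/2)) * of_real (ln 2)) * of_real (sqrt pi) * Gamma (2 * of_real ((s+1)/2))"
			using s by (intro Gamma_legendre_duplication not_nonpos_Ints_of_Re_pos) (auto simp: field_simps)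
		also have "complex_of_real ((s+1)/2)+1/2 = of_real (s/2+1)" by (simp add: field_simps)
		also have "2 * complex_of_real ((s+1)/2) = of_real (s+1)" by simp
		also have "exp ((1-complex_of_real (s+1)) * of_real (ln 2)) = of_real (2 powr (-s))" by (simp add: powr_def flip: exp_of_real)
		finally show ?thesis by (simp only: Gamma_complex_of_real of_real_mult)
	qed
	hence dup: "Gamma ((s+1)/2) * Gamma (s/2+1) = 2 powr (-s) * sqrt pi * Gamma (s+1)" by (simp only: of_real_eq_iff)
	have G1: "Gamma ((1-s)/2+1) = (1-s)/2 * Gamma ((1-s)/2)"
	proof (rule Gamma_plus1)
		show "(1-s)/2 \<notin> \<int>\<^sub>\<le>\<^sub>0" using s nonpos_Ints_nonpos[of "(1-s)/2"] by fastforce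
	qed
	have "Gamma ((s+1)/2)*(Gamma (s/2+1) * w) = 2 powr (-s) * sqrt pi*(Gamma (s+1) * w)" using dup by (simp add: mult_ac)
	also have "... = Gamma ((s+1)/2)*(2 powr (-s) * sqrt pi*(2 * pi) powr (s-1)*(2 * Gamma ((1-s)/2+1))*(-s * S))"
		unfolding eq G1 by (simp add: mult_ac)
	finally have "Gamma (s/2+1) * w = 2 powr (-s) * sqrt pi*(2 * pi) powr (s-1)*(2 * Gamma ((1-s)/2+1))*(-s * S)"
		using G(2) by (subst (asm) mult_left_cancel) auto
	also have "2 powr (-s) * sqrt pi*(2 * pi) powr (s-1)*(2 * Gamma ((1-s)/2+1))*(-s * S)
		 = (2 powr (-s)*2 powr (s-1)*2)*(pi powr (1/2) * pi powr (s-1)) * Gamma ((1-s)/2+1)*(-s * S)"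
		by (simp add: powr_mult powr_half_sqrt mult_ac)
	also have "2 powr (-s)*2 powr (s-1)*2 = (1::real)" by (simp flip: powr_add)
	also have "pi powr (1/2) * pi powr (s-1) = pi powr (s-1/2)" by (simp flip: powr_add)
	finally have "pi powr (-s/2)*(Gamma (s/2+1) * w) = pi powr (-s/2) * pi powr (s-1/2) * Gamma ((1-s)/2+1)*(-s * S)" by simp
	also have "pi powr (-s/2) * pi powr (s-1/2) = pi powr (-s/2+(s-1/2))" by (rule powr_add[symmetric])
	also have "-s/2+(s-1/2) = -(1-s)/2" by (simp add: field_simps)
	finally have main: "pi powr (-s/2) * Gamma (s/2+1) * w = pi powr (-(1-s)/2) * Gamma ((1-s)/2+1)*(-s * S)" by simp
	have pp: "complex_of_real pi powr (of_real r) = of_real (pi powr r)" for r by (rule powr_of_real) auto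
	have "xi (of_real s) = of_real (pi powr (-s/2) * Gamma (s/2+1) * w)"
	proof -
		have "- complex_of_real s/2 = of_real (-s/2)" "complex_of_real s/2+1 = of_real (s/2+1)" by auto
		thus ?thesis unfolding xi_def by (simp only: pp Gamma_complex_of_real w of_real_mult)
	qed
	also note main
	also have "of_real (pi powr (-(1-s)/2) * Gamma ((1-s)/2+1)*(-s * S)) = xi (1-of_real s)"
	proof -
		have "- (1-complex_of_real s)/2 = of_real (-(1-s)/2)" "(1-complex_of_real s)/2+1 = of_real ((1-s)/2+1)" by auto
		thus ?thesis unfolding xi_def by (simp only: pp Gamma_complex_of_real w' of_real_mult)
	qed
	finally show ?thesis .
qed

text \<open>The strip is where both sides are known to be holomorphic, and they agree on the real
  segment (-1, 0).\<close>

theorem xi_reflect: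
	assumes "-1 < Re s" "Re s < 2"
	shows "xi s = xi (1-s)"
proof -
	define A where "A = {s. Re s > -1} \<inter> {s. Re s < (2::real)}"
	define f where "f = (%s. xi s-xi (1-s))"
	have "f s = 0"
	proof (rule analytic_continuation[of f A "of_real ` {-1<..<0::real}" "of_real (-1/2)"])
		have "xi \<circ> (%s. 1-s) holomorphic_on A"
			by (rule holomorphic_on_compose_gen[OF _ holomorphic_xi]) (auto simp: A_def intro!: holomorphic_intros)
		thus "f holomorphic_on A" unfolding f_def o_def by (intro holomorphic_intros holomorphic_on_subset[OF holomorphic_xi]) (auto simp: A_def)
		show "open A" unfolding A_def by (intro open_Int open_halfspace_Re_gt open_halfspace_Re_lt)
		show "connected A" unfolding A_def by (intro convex_connected convex_Int convex_halfspace_Re_gt convex_halfspace_Re_lt)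
		show "complex_of_real (-1/2) islimpt of_real ` {-1<..<0::real}" unfolding islimpt_approachable
		proof (intro allI impI)
			fix e :: real assume e: "e > 0"
			define d where "d = min (e/2) (1/4)"
			have d: "d > 0" "d < e" "d<=1/4" using e by (auto simp: d_def)
			show "\<exists>x'\<in>of_real ` {-1<..<0}. x'~=complex_of_real (-1/2) \<and> dist x' (complex_of_real (-1/2)) < e"
			proof (intro bexI[of _ "complex_of_real (-1/2+d)"] conjI imageI)
				show "dist (complex_of_real (-1/2+d)) (complex_of_real (-1/2)) < e" using d by (simp only: dist_of_real) (simp add: dist_real_def)
			qed (use d in \<open>auto simp only: of_real_eq_iff greaterThanLessThan_iff\<close>)
		qed
		show "f z = 0" if "z \<in> of_real ` {-1<..<0::real}" for z using that xi_reflect_real by (auto simp: f_def)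
	qed (use assms in \<open>auto simp: A_def\<close>)
	thus ?thesis by (simp add: f_def)
qed

section \<open>The Phragmen-Lindelof principle in a quarter-plane\<close>

text \<open>The argument of w is at most pi/4 in absolute value, that of w^(3/2) at most 3 pi/8, and
  cos(3 pi/8) > 1/4. The proof is algebraic: with csqrt w = a + b i the real part is a (a^2 - 3
  b^2).\<close>

lemma Re_mult_csqrt_ge:
	fixes w :: complex
	assumes w: "\<bar>Im w\<bar><=Re w"
	shows "Re (w * csqrt w)>=norm w * sqrt (norm w)/4"
proof -
	define a b where "a = Re (csqrt w)" and "b = Im (csqrt w)"
	have a: "a>=0" unfolding a_def using csqrt_principal[of w] by linarith
	have sq: "csqrt w = Complex a b" by (simp only: a_def b_def complex_surj)
	have w_eq: "w = Complex (a^2-b^2) (2*a*b)" using power2_csqrt[of w] by (simp add: sq power2_eq_square complex_eq_iff)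
	have nw: "norm w = a^2+b^2"
	proof -
		have "norm w = (norm (csqrt w))^2" by (metis norm_power power2_csqrt)
		thus ?thesis by (simp add: sq cmod_power2)
	qed
	have h: "2 * a * \<bar>b\<bar><=a^2-b^2" using w a by (simp add: w_eq abs_mult)
	have ba: "\<bar>b\<bar><=a/2"
	proof (rule ccontr)
		assume "\<not> \<bar>b\<bar><=a/2"
		hence b: "a < 2 * \<bar>b\<bar>" by simp
		have "a * a<=a*(2 * \<bar>b\<bar>)" using a b by (intro mult_left_mono) auto
		with h have "b^2<=0" by (simp add: power2_eq_square algebra_simps)
		hence "b = 0" by simp
		with b a show False by simp
	qed
	\<comment> \<open>The true bound on |b|/a is tan(pi/8), about 0.4142; 9/20 leaves room and is still
	  good enough for the factor 1/4.\<close>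
	have b2: "b^2<=(81/400) * a^2"
	proof -
		have "\<bar>b\<bar><=9/20 * a"
		proof (rule ccontr)
			assume "\<not> \<bar>b\<bar><=9/20 * a"
			hence c: "\<bar>b\<bar> > 9/20 * a" by simp
			have "a*(9/20 * a)<=a * \<bar>b\<bar>" using a c by (intro mult_left_mono) auto
			hence 1: "9/10 * a^2<=2 * a * \<bar>b\<bar>" by (simp add: power2_eq_square)
			have "(9/20 * a)^2 <= \<bar>b\<bar>^2" using a c by (intro power_mono) auto
			hence 2: "81/400 * a^2<=b^2" by (simp add: power_mult_distrib power2_eq_square)
			have "a^2<=0" using order_trans[OF 1 h] 2 by linarith
			hence "a = 0" by simp
			thus False using ba c by simp
		qed
		hence "\<bar>b\<bar>^2<=(9/20 * a)^2" by (intro power_mono) auto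
		moreover have "(9/20 * a)^2<=81/400 * a^2" by (simp add: power_mult_distrib power2_eq_square)
		ultimately show ?thesis by simp
	qed
	have sn: "sqrt (norm w)<=9/8 * a"
	proof (rule real_le_lsqrt)
		have "a^2+b^2<=81/64 * a^2" using b2 zero_le_power2[of a] by linarith
		thus "norm w<=(9/8 * a)^2" unfolding nw by (simp add: power_mult_distrib power2_eq_square)
	qed (use a in auto)
	have "norm w * sqrt (norm w)/4<=(481/400 * a^2)*(9/8 * a)/4" using b2 sn a unfolding nw by (intro divide_right_mono mult_mono) auto
	also have "...<=a*(157/400 * a^2)" using a by (simp add: power2_eq_square)
	also have "...<=a*(a^2-3 * b^2)" using a b2 by (intro mult_left_mono) auto
	also have "... = Re (w * csqrt w)"
	proof -
		have RI: "Re w = a^2-b^2" "Im w = 2*a*b" using arg_cong[OF w_eq, of Re] arg_cong[OF w_eq, of Im] by simp_all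
		thus ?thesis unfolding times_complex.sel a_def[symmetric] b_def[symmetric] RI by (simp add: power2_eq_square algebra_simps)
	qed
	finally show ?thesis .
qed

text \<open>The exponent 3/2 in the weight exp(-e (z+1)^(3/2)) lies between the growth order 1 of f
  and the critical order 2 of a quarter-plane. The shift by 1 keeps the branch cut of
  \<open>csqrt\<close> outside the sector.\<close>

theorem Phragmen_Lindelof_sector:
	fixes f :: "complex => complex"
	assumes holo: "f holomorphic_on UNIV"
		and growth: "!!z. norm (f z)<=C * exp (A * norm z)"
		and M: "M > 0" and bd: "!!z. \<bar>Im z\<bar> = Re z ==> norm (f z)<=M"
		and z: "\<bar>Im \<xi>\<bar><=Re \<xi>"
	shows "norm (f \<xi>)<=M"
proof -
	have C: "C>=0" using growth[of 0] norm_ge_zero[of "f 0"] by (simp del: norm_ge_zero)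
	define q where "q = (%z::complex. (z+1) * csqrt (z+1))"
	have q_ge: "Re (q w)>=norm w * sqrt (norm w)/4" "Re (q w)>=0" if w: "\<bar>Im w\<bar><=Re w" for w
	proof -
		have R: "Re w>=0" using w by linarith
		have n: "norm w<=norm (w+1)"
		proof (rule power2_le_imp_le)
			show "(norm w)^2<=(norm (w+1))^2" unfolding cmod_power2 using R by (simp add: power2_sum)
		qed simp
		have "norm w * sqrt (norm w)/4<=norm (w+1) * sqrt (norm (w+1))/4" using n by (intro divide_right_mono mult_mono) auto
		also have "...<=Re (q w)" unfolding q_def using w R by (intro Re_mult_csqrt_ge) auto
		finally show 1: "Re (q w)>=norm w * sqrt (norm w)/4" .
		have "0<=norm w * sqrt (norm w)/4" by simp
		with 1 show "Re (q w)>=0" by linarith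
	qed
	have eps: "norm (f \<xi>)<=M * exp (e * Re (q \<xi>))" if e: "e > 0" for e :: real
	proof -
		define g where "g = (%z. f z * exp (- of_real e * q z))"
		\<comment> \<open>On the arc |w| = R the third entry makes the weighted bound at most C exp(-R),
		  and the fourth brings that below M.\<close>
		define R where "R = Max {norm \<xi>, 1, (4*(\<bar>A\<bar>+1)/e)^2, ln ((C+1)/M)}"
		have R: "norm \<xi><=R" "1<=R" "(4*(\<bar>A\<bar>+1)/e)^2<=R" "ln ((C+1)/M)<=R" unfolding R_def by (intro Max_ge; simp)+
		have sR: "4*(\<bar>A\<bar>+1)/e<=sqrt R" using R(3) by (rule real_le_rsqrt)
		define S where "S = {z. \<bar>Im z\<bar><=Re z \<and> norm z<=R}"
		have cl: "closed S"
		proof -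
			have "S = {z. \<bar>Im z\<bar><=Re z} \<inter> {z. norm z<=R}" by (auto simp: S_def)
			thus ?thesis by (auto intro!: closed_Int closed_Collect_le continuous_intros)
		qed
		have ng: "norm (g w) = norm (f w) * exp (- e * Re (q w))" for w by (simp add: g_def norm_mult)
		have "norm (g \<xi>)<=M"
		proof (rule maximum_modulus_frontier[of g S M \<xi>])
			have "g holomorphic_on {z. Re z > -1}" unfolding g_def q_def by (intro holomorphic_intros holomorphic_on_subset[OF holo])
					 (auto simp: complex_nonpos_Reals_iff)
			moreover have "S \<subseteq> {z. Re z > -1}" by (auto simp: S_def)
			ultimately have hS: "g holomorphic_on S" by (rule holomorphic_on_subset)
			thus "g holomorphic_on interior S" using interior_subset holomorphic_on_subset by blast
			show "continuous_on (closure S) g" using hS cl by (simp add: holomorphic_on_imp_continuous_on)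
			show "bounded S" by (auto simp: S_def bounded_iff)
			show "\<xi> \<in> S" using z R by (simp add: S_def)
			fix w assume w: "w \<in> frontier S"
			have wS: "w \<in> S" using w cl frontier_subset_closed by blast
			show "norm (g w)<=M"
			proof (cases "\<bar>Im w\<bar> = Re w")
				case True
				have "norm (g w)<=M*1" unfolding ng using bd[OF True] q_ge(2)[of w] e M True by (intro mult_mono) auto
				thus ?thesis by simp
			next
				case False
				have "norm w = R"
				proof (rule ccontr)
					assume "norm w~=R"
					hence "w \<in> {z. \<bar>Im z\<bar> < Re z} \<inter> {z. norm z < R}" using wS False by (auto simp: S_def)
					moreover have "open ({z. \<bar>Im z\<bar> < Re z} \<inter> {z. norm z < R})" by (intro open_Int open_Collect_less continuous_intros)
					moreover have "{z. \<bar>Im z\<bar> < Re z} \<inter> {z. norm z < R} \<subseteq> S" by (auto simp: S_def)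
					ultimately have "w \<in> interior S" using interiorI by blast
					thus False using w by (simp add: frontier_def)
				qed
				have wq: "Re (q w)>=R * sqrt R/4" using q_ge(1)[of w] wS \<open>norm w = R\<close> by (simp add: S_def)
				have "norm (g w)<=(C * exp (A * R)) * exp (- e*(R * sqrt R/4))"
					unfolding ng using growth[of w] \<open>norm w = R\<close> wq e C by (intro mult_mono) auto
				also have "... = C * exp (R*(A-e * sqrt R/4))" by (simp add: algebra_simps flip: exp_add)
				also have "...<=C * exp (R*(-1))"
				proof -
					have "4*(\<bar>A\<bar>+1)<=e * sqrt R" using sR e by (simp add: field_simps)
					moreover have "A <= \<bar>A\<bar>" by simp
					ultimately have "A-e * sqrt R/4<=-1" by argo
					hence "R*(A-e * sqrt R/4)<=R*(-1)" using R by (intro mult_left_mono) auto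
					thus ?thesis using C by (intro mult_left_mono) auto
				qed
				also have "...<=(C+1) * exp (- ln ((C+1)/M))" using R C by (intro mult_mono) auto
				also have "... = M" using M C by (simp add: exp_minus exp_ln field_simps)
				finally show ?thesis .
			qed
		qed
		hence "norm (f \<xi>) * exp (- e * Re (q \<xi>)) * exp (e * Re (q \<xi>))<=M * exp (e * Re (q \<xi>))"
			unfolding ng by (intro mult_right_mono) auto
		thus ?thesis by (simp add: mult.assoc flip: exp_add)
	qed
	have "((%e. M * exp (e * Re (q \<xi>))) \<longlongrightarrow> M * exp (0 * Re (q \<xi>))) (at_right 0)" by (intro tendsto_intros)
	hence lim: "((%e. M * exp (e * Re (q \<xi>))) \<longlongrightarrow> M) (at_right 0)" by simp
	show ?thesis
	proof (rule tendsto_lowerbound[OF lim])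
		show "\<forall>\<^sub>F e in at_right 0. norm (f \<xi>)<=M * exp (e * Re (q \<xi>))"
			using eventually_at_right_less[of 0] by eventually_elim (rule eps)
	qed auto
qed

text \<open>The bound is constant on the four rays |Im z| = |Re z|, harmless in the sectors around
  the real axis, and of exponential type in the other two, where the sector principle applies after
  a rotation by i or -i. So f is bounded, hence constant, and the decay along the real axis makes it
  0.\<close>

lemma entire_eq_0_of_growth:
	fixes f :: "complex => complex"
	assumes holo: "f holomorphic_on UNIV" and \<tau>: "\<tau> > 0"
		and growth: "!!z. norm (f z)<=C * exp (\<tau> * \<bar>Im z\<bar> - \<tau> * \<bar>Re z\<bar>)"
	shows "f z = 0"
proof -
	define M where "M = max C 1"
	have M: "M > 0" "M>=C" by (auto simp: M_def)
	have growth': "norm (f z)<=M * exp (\<tau> * \<bar>Im z\<bar> - \<tau> * \<bar>Re z\<bar>)" for z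
		using growth[of z] M(2) by (meson exp_ge_zero mult_right_mono order_trans)
	have g1: "norm (f (c * z))<=M" if c: "c = \<i> \<or> c = -\<i>" and z: "\<bar>Im z\<bar><=Re z" for c z
	proof (rule Phragmen_Lindelof_sector[where f = "%z. f (c * z)" and C = M and A = \<tau> and M = M])
		have "f \<circ> (%z. c * z) holomorphic_on UNIV" by (rule holomorphic_on_compose_gen[OF _ holo]) (auto intro!: holomorphic_intros)
		thus "(%z. f (c * z)) holomorphic_on UNIV" by (simp add: o_def)
		show "norm (f (c * w))<=M * exp (\<tau> * norm w)" for w
		proof -
			have nc: "norm (c * w) = norm w" using c by (auto simp: norm_mult)
			have "\<bar>Im (c * w)\<bar> - \<bar>Re (c * w)\<bar><=norm w" using abs_Im_le_cmod[of "c*w"] nc by linarith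
			hence "\<tau> * \<bar>Im (c * w)\<bar> - \<tau> * \<bar>Re (c * w)\<bar> <= \<tau> * norm w"
				using \<tau> by (metis mult_left_mono less_imp_le right_diff_distrib)
			thus ?thesis using growth'[of "c*w"] M(1) by (meson exp_le_cancel_iff less_imp_le mult_left_mono order_trans)
		qed
		show "norm (f (c * w))<=M" if "\<bar>Im w\<bar> = Re w" for w using growth'[of "c*w"] c that by auto
	qed (use M z in auto)
	have bnd: "norm (f z)<=M" for z
	proof (cases "\<bar>Im z\<bar> <= \<bar>Re z\<bar>")
		case True
		hence "\<tau> * \<bar>Im z\<bar> - \<tau> * \<bar>Re z\<bar><=0" using \<tau> by simp
		hence "M * exp (\<tau> * \<bar>Im z\<bar> - \<tau> * \<bar>Re z\<bar>)<=M*1" using M by (intro mult_left_mono) auto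
		thus ?thesis using growth'[of z] by linarith
	next
		case False
		show ?thesis
		proof (cases "Im z>=0")
			case True
			thus ?thesis using g1[of \<i> "-\<i> * z"] False by simp
		next
			case F: False
			thus ?thesis using g1[of "-\<i>" "\<i> * z"] False by simp
		qed
	qed
	have "bounded (range f)" using bnd by (auto simp: bounded_iff)
	then obtain c where c: "!!z. f z = c" using Liouville_theorem[OF holo] by (auto simp: constant_on_def)
	have "((%x::real. M * exp (- (\<tau> * x))) \<longlongrightarrow> M*0) at_top"
		using \<tau> by (intro tendsto_intros filterlim_compose[OF exp_at_bot])
			(auto simp: filterlim_uminus_at_bot intro!: filterlim_tendsto_pos_mult_at_top[OF tendsto_const] filterlim_ident)
	hence "norm c<=0"
	proof (intro tendsto_lowerbound[of "%x::real. M * exp (- (\<tau> * x))" 0 at_top])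
		show "\<forall>\<^sub>F x in at_top. norm c<=M * exp (- (\<tau> * x))" using eventually_ge_at_top[of 0]
		proof eventually_elim
			case (elim x)
			thus ?case using growth'[of "of_real x"] c by simp
		qed
	qed auto
	thus ?thesis using c by simp
qed

section \<open>Elementary growth estimates\<close>

lemma poly_growth:
	fixes p :: "complex poly"
	shows "\<exists>C d. C > 0 \<and> (\<forall>x. norm (poly p x)<=C*(1+norm x)^d)"
proof (induction p)
	case 0
	show ?case by (intro exI[of _ 1] exI[of _ 0]) auto
next
	case (pCons a p)
	then obtain C d where C: "C > 0" "!!x. norm (poly p x)<=C*(1+norm x)^d" by blast
	show ?case
	proof (intro exI[of _ "C+norm a"] exI[of _ "Suc d"] conjI allI)
		show "C+norm a > 0" using C by (simp add: add_pos_nonneg)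
		fix x
		have "norm (poly (pCons a p) x)<=norm a+norm x * norm (poly p x)" by (simp add: norm_triangle_le norm_mult)
		also have "...<=norm a*(1+norm x)^Suc d+(1+norm x)*(C*(1+norm x)^d)"
			using C(1) by (intro add_mono mult_mono C(2)) (auto simp: mult_le_cancel_left1 one_le_power simp del: power_Suc)
		also have "... = (C+norm a)*(1+norm x)^Suc d" by (simp add: algebra_simps)
		finally show "norm (poly (pCons a p) x)<=(C+norm a)*(1+norm x)^Suc d" .
	qed
qed

lemma power_le_exp: "x>=0 ==> (1+x)^m<=(fact m * exp 1) * exp (x::real)"
proof -
	assume x: "x>=0"
	have "(1+x)^m/fact m<=exp (1+x)"
	proof -
		have "(\<Sum>n\<in>{m}. (1+x)^n /\<^sub>R fact n)<=(\<Sum>n. (1+x)^n /\<^sub>R fact n)"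
			using x by (intro sum_le_suminf sums_summable[OF exp_converges]) auto
		thus ?thesis using sums_unique[OF exp_converges[of "1+x"]] by (simp add: divide_inverse mult.commute)
	qed
	thus ?thesis by (simp add: exp_add field_simps)
qed

section \<open>Dirichlet series with nonnegative coefficients and Landau's theorem\<close>

lemma summable_dirichlet_mono:
	fixes a :: "nat => real"
	assumes "!!n. a n>=0" "summable (%n. a n * real (Suc n) powr (-x))" "x<=y"
	shows "summable (%n. a n * real (Suc n) powr (-y))"
proof (rule summable_comparison_test[OF _ assms(2)], intro exI allI impI)
	fix n
	have "norm (a n * real (Suc n) powr (-y)) = a n * real (Suc n) powr (-y)" using assms(1)[of n] by simp
	also have "...<=a n * real (Suc n) powr (-x)" using assms(1)[of n] assms(3) by (intro mult_left_mono powr_mono) auto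
	finally show "norm (a n * real (Suc n) powr (-y))<=a n * real (Suc n) powr (-x)" .
qed

lemma norm_Suc_powr: "norm (of_nat (Suc n) powr s :: complex) = real (Suc n) powr Re s" by (rule norm_of_nat_powr) simp

lemma holomorphic_dirichlet_nonneg:
	fixes a :: "nat => real"
	assumes a: "!!n. a n>=0" and sm: "!!x. x > b ==> summable (%n. a n * real (Suc n) powr (-x))"
	shows "(%s. \<Sum>n. of_real (a n) * of_nat (Suc n) powr (-s)) holomorphic_on {s. Re s > b}"
proof (rule holomorphic_on_suminf_M_test)
	show "(%s. of_real (a n) * of_nat (Suc n) powr (-s)) holomorphic_on {s. Re s > b}" for n by (intro holomorphic_intros)
	fix z assume "z \<in> {s. Re s > b}"
	hence z: "Re z > b" by simp
	define d where "d = (Re z-b)/2"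
	have d: "d > 0" using z by (simp add: d_def)
	have w: "Re w>=b+d" if "w \<in> cball z d" for w
	proof -
		have "Re (z-w)<=d" using complex_Re_le_cmod[of "z-w"] that by (simp add: dist_norm)
		thus ?thesis by (simp add: d_def field_simps)
	qed
	show "\<exists>d M. d > 0 \<and> cball z d \<subseteq> {s. Re s > b} \<and> summable M \<and>
					 (\<forall>n. \<forall>w\<in>cball z d. norm (of_real (a n) * of_nat (Suc n) powr (-w))<=M n)"
	proof (intro exI conjI allI ballI)
		show "summable (%n. a n * real (Suc n) powr (-(b+d)))" by (rule sm) (use d in auto)
		show "cball z d \<subseteq> {s. Re s > b}" using w d by force
		fix n w assume "w \<in> cball z d"
		from w[OF this] show "norm (of_real (a n) * of_nat (Suc n) powr (-w))<=a n * real (Suc n) powr (-(b+d))"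
			unfolding norm_mult norm_Suc_powr norm_of_real using a[of n] by (intro mult_mono powr_mono) auto
	qed (use d in auto)
qed (rule open_Re_gt)

text \<open>The Taylor expansion at x in powers of z. Exchanging the sums over n and k is legitimate
  because the sum over k of (|z| ln n)^k/k! is n^|z|, so the double series converges absolutely as
  soon as the series converges at x - |z|.\<close>

lemma dirichlet_power_series:
	fixes a :: "nat => real" and z :: complex
	assumes a: "!!n. a n>=0" and sm: "summable (%n. a n * real (Suc n) powr (-(x-norm z)))"
	defines "C \<equiv> %k. \<Sum>n. a n * real (Suc n) powr (-x)*(ln (real (Suc n)))^k/fact k"
	shows "(%k. of_real (C k)*(-z)^k) sums (\<Sum>n. of_real (a n) * of_nat (Suc n) powr (-(of_real x+z)))"
		and "z~=0 ==> summable (%n. a n * real (Suc n) powr (-x)*(ln (real (Suc n)))^k/fact k)"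
proof -
	define L where "L = (%n. ln (real (Suc n)))"
	have L: "L n>=0" for n by (simp add: L_def)
	define b where "b = (%n. a n * real (Suc n) powr (-x))"
	have b: "b n>=0" for n using a by (simp add: b_def)
	define f where "f = (%(n,k). of_real (b n)*(-z * of_real (L n))^k/fact k :: complex)"
	have e: "exp (L n * y) = real (Suc n) powr y" for n y by (simp add: L_def powr_def mult.commute)
	have nf: "norm (f (n,k)) = b n*((L n * norm z)^k/fact k)" for n k
		using b[of n] L[of n] by (simp add: f_def norm_mult norm_divide norm_power mult_ac)
	have hs: "((%k. norm (f (n,k))) has_sum (a n * real (Suc n) powr (-(x-norm z)))) UNIV" for n
	proof -
		have "(%k. (L n * norm z)^k /\<^sub>R fact k) sums exp (L n * norm z)" by (rule exp_converges)
		from sums_mult[OF this, of "b n"] have "(%k. norm (f (n,k))) sums (b n * exp (L n * norm z))" by (simp add: nf divide_inverse mult_ac)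
		also have "b n * exp (L n * norm z) = a n * real (Suc n) powr (-(x-norm z))"
			by (simp add: e b_def powr_add[symmetric] mult.assoc del: of_nat_Suc)
		finally show ?thesis by (intro sums_nonneg_imp_has_sum) auto
	qed
	have sm2: "f summable_on (UNIV \<times> UNIV)"
	proof (rule abs_summable_summable, rule summable_on_SigmaI[where f = "%x. norm (f x)"])
		show "((%k. norm (f (n,k))) has_sum (a n * real (Suc n) powr (-(x-norm z)))) UNIV" for n by (rule hs)
		show "(%n. a n * real (Suc n) powr (-(x-norm z))) summable_on UNIV" using sm a by (intro summable_nonneg_imp_summable_on) auto
	qed auto
	have row: "infsum (%k. f (n,k)) UNIV = of_real (a n) * of_nat (Suc n) powr (-(of_real x+z))" for n
	proof (rule infsumI)
		have "(%k. (-z * of_real (L n))^k /\<^sub>R fact k) sums exp (-z * of_real (L n))" by (rule exp_converges)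
		from sums_mult[OF this, of "of_real (b n)"] have "(%k. f (n,k)) sums (of_real (b n) * exp (-z * of_real (L n)))"
			by (simp add: f_def divide_inverse scaleR_conv_of_real mult_ac)
		also have "of_real (b n) * exp (-z * of_real (L n)) = of_real (a n)*(of_nat (Suc n) powr (-of_real x) * of_nat (Suc n) powr (-z))"
		proof -
			have "complex_of_real (real (Suc n) powr (-x)) = of_nat (Suc n) powr (-of_real x)" using powr_of_real[of "real (Suc n)" "-x"] by simp
			moreover have "exp (-z * of_real (L n)) = of_nat (Suc n) powr (-z)"
				using Ln_of_real[of "real (Suc n)"] by (simp add: powr_def L_def del: of_nat_Suc)
			ultimately show ?thesis by (simp add: b_def del: of_nat_Suc)
		qed
		also have "of_nat (Suc n) powr (-of_real x) * of_nat (Suc n) powr (-z) = of_nat (Suc n) powr (-(of_real x+z))"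
			by (simp add: powr_add[symmetric] del: of_nat_Suc)
		finally show "((%k. f (n,k)) has_sum (of_real (a n) * of_nat (Suc n) powr (-(of_real x+z)))) UNIV"
			by (rule norm_summable_imp_has_sum[OF sums_summable[OF has_sum_imp_sums[OF hs[of n]]]])
	qed
	have colsm: "(%n. norm (f (n,k))) summable_on UNIV" for k
	proof -
		have "(%n. norm (f (n,k))) summable_on UNIV"
		proof (rule summable_on_comparison_test)
			show "(%n. a n * real (Suc n) powr (-(x-norm z))) summable_on UNIV" using sm a by (intro summable_nonneg_imp_summable_on) auto
			show "norm (f (n,k))<=a n * real (Suc n) powr (-(x-norm z))" for n
			proof -
				have "sum (%k. norm (f (n,k))) {k}<=infsum (%k. norm (f (n,k))) UNIV"
					using hs[of n] by (intro finite_sum_le_infsum) (auto simp: summable_on_def)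
				thus ?thesis using infsumI[OF hs[of n]] by simp
			qed
		qed auto
		thus ?thesis .
	qed
	have col_term: "f (n,k) = of_real (a n * real (Suc n) powr (-x)*(ln (real (Suc n)))^k/fact k)*(-z)^k" for n k
	proof -
		have "(-z * of_real (L n))^k = (-z)^k * of_real (L n)^k" by (rule power_mult_distrib)
		thus ?thesis by (simp add: f_def b_def L_def del: of_nat_Suc)
	qed
	have csm: "summable (%n. a n * real (Suc n) powr (-x)*(ln (real (Suc n)))^k/fact k)" if "z~=0" for k
	proof -
		have "summable (%n. norm (f (n,k)) * inverse (norm z^k))" using colsm[of k] by (intro summable_mult2 summable_on_imp_summable)
		also have "(%n. norm (f (n,k)) * inverse (norm z^k)) = (%n. a n * real (Suc n) powr (-x)*(ln (real (Suc n)))^k/fact k)"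
		proof
			fix n
			have "norm (f (n,k)) * inverse (norm z^k) = (a n * real (Suc n) powr (-x)*(ln (real (Suc n)))^k/fact k)
					* (norm z^k * inverse (norm z^k))" by (simp only: nf b_def L_def power_mult_distrib divide_inverse mult_ac)
			also have "norm z^k * inverse (norm z^k) = 1" using that by simp
			finally show "norm (f (n,k)) * inverse (norm z^k) = a n * real (Suc n) powr (-x)*(ln (real (Suc n)))^k/fact k" by simp
		qed
		finally show ?thesis .
	qed
	thus "z~=0 ==> summable (%n. a n * real (Suc n) powr (-x)*(ln (real (Suc n)))^k/fact k)" .
	have col: "infsum (%n. f (n,k)) UNIV = of_real (C k)*(-z)^k" for k
	proof (cases "z = 0")
		case False
		have "(%n. f (n,k)) sums (of_real (C k)*(-z)^k)" unfolding col_term C_def by (intro sums_mult2 sums_of_real summable_sums csm False)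
		thus ?thesis using colsm[of k] by (intro infsumI norm_summable_imp_has_sum summable_on_imp_summable)
	next
		case True
		show ?thesis
		proof (cases "k = 0")
			case k0: True
			have "summable (%n. norm (f (n,0)))" using colsm[of 0] by (rule summable_on_imp_summable)
			also have "(%n. norm (f (n,0))) = (%n. a n * real (Suc n) powr (-x))" by (simp add: nf b_def)
			finally have "summable (%n. a n * real (Suc n) powr (-x))" .
			hence "(%n. complex_of_real (a n * real (Suc n) powr (-x))) sums of_real (\<Sum>n. a n * real (Suc n) powr (-x))"
				by (intro sums_of_real summable_sums)
			hence "(%n. f (n,0)) sums of_real (C 0)" by (simp add: col_term C_def del: of_nat_Suc)
			thus ?thesis using colsm[of 0] k0 by (intro infsumI norm_summable_imp_has_sum summable_on_imp_summable) auto
		qed (use True in \<open>simp add: col_term power_0_left\<close>)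
	qed
	have sw: "infsum (%n. infsum (%k. f (n,k)) UNIV) UNIV = infsum (%k. infsum (%n. f (n,k)) UNIV) UNIV"
		using infsum_swap_banach[of "%n k. f (n,k)" UNIV UNIV] sm2 by simp
	have smr: "(%k. infsum (%n. f (n,k)) UNIV) summable_on UNIV"
	proof -
		have "(%(k,n). f (n,k)) summable_on (UNIV \<times> UNIV)" using sm2 by (subst summable_on_swap) (simp add: case_prod_unfold)
		thus ?thesis by (rule summable_on_Sigma_banach)
	qed
	have "((%k. infsum (%n. f (n,k)) UNIV) has_sum infsum (%n. infsum (%k. f (n,k)) UNIV) UNIV) UNIV" unfolding sw using smr by (rule has_sum_infsum)
	hence 1: "(%k. of_real (C k)*(-z)^k) sums infsum (%n. of_real (a n) * of_nat (Suc n) powr (-(of_real x+z))) UNIV"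
		unfolding col row by (rule has_sum_imp_sums)
	have "infsum (%n. of_real (a n) * of_nat (Suc n) powr (-(of_real x+z)) :: complex) UNIV
			= (\<Sum>n. of_real (a n) * of_nat (Suc n) powr (-(of_real x+z)))"
	proof (rule infsumI, rule norm_summable_imp_has_sum)
		have "norm (of_real (a n) * of_nat (Suc n) powr (-(of_real x+z)) :: complex) = a n * real (Suc n) powr (- (x+Re z))" for n
			unfolding norm_mult norm_Suc_powr norm_of_real using a[of n] by simp
		moreover have "summable (%n. a n * real (Suc n) powr (- (x+Re z)))"
			by (rule summable_dirichlet_mono[OF a sm]) (use abs_Re_le_cmod[of z] in linarith)
		ultimately show "summable (%n. norm (of_real (a n) * of_nat (Suc n) powr (-(of_real x+z)) :: complex))" by presburger
		thus "(%n. of_real (a n) * of_nat (Suc n) powr (-(of_real x+z)) :: complex) sums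
			(\<Sum>n. of_real (a n) * of_nat (Suc n) powr (-(of_real x+z)))" by (rule summable_sums[OF summable_norm_cancel])
	qed
	with 1 show "(%k. of_real (C k)*(-z)^k) sums (\<Sum>n. of_real (a n) * of_nat (Suc n) powr (-(of_real x+z)))" by simp
qed

text \<open>Otherwise the abscissa of convergence b satisfies b >= y and \<open>D\<close> is
  analytic at b. The Taylor series at a point just to the right of b then converges beyond b; all
  its terms to the left of that point are nonnegative, so rearranging them shows that the Dirichlet
  series converges beyond b too.\<close>

theorem Landau_dirichlet_nonneg:
	fixes a :: "nat => real" and D :: "complex => complex"
	assumes a: "!!n. a n>=0"
		and D: "D analytic_on (of_real ` {\<nu>\<^sub>0<..})"
		and sm: "!!x. x > c ==> summable (%n. a n * real (Suc n) powr (-x))"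
		and eq: "!!s. Re s > c ==> D s = (\<Sum>n. of_real (a n) * of_nat (Suc n) powr (-s))"
		and y: "y > \<nu>\<^sub>0"
	shows "summable (%n. a n * real (Suc n) powr (-y))"
proof (rule ccontr)
	assume ny: "\<not> summable (%n. a n * real (Suc n) powr (-y))"
	define S where "S = {x. summable (%n. a n * real (Suc n) powr (-x))}"
	have up: "x' \<in> S" if "x \<in> S" "x<=x'" for x x' using summable_dirichlet_mono[of a x x'] a that by (auto simp: S_def)
	have lb: "y<=x" if "x \<in> S" for x
	proof (rule ccontr)
		assume "\<not> y<=x"
		hence "y \<in> S" using up[OF that, of y] by simp
		thus False using ny by (simp add: S_def)
	qed
	have bdd: "bdd_below S" using lb by (auto simp: bdd_below_def)
	have ne: "c+1 \<in> S" using sm[of "c+1"] by (simp add: S_def)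
	define b where "b = Inf S"
	have by_b: "y<=b" unfolding b_def using ne lb by (intro cInf_greatest) auto
	have bS: "x \<in> S" if xb: "x > b" for x
	proof -
		obtain x' where "x' \<in> S" "x' < x" using xb ne bdd cInf_less_iff[of S x] unfolding b_def by blast
		thus ?thesis using up[of x' x] by simp
	qed
	have Sb: "x>=b" if "x \<in> S" for x unfolding b_def using that bdd by (rule cInf_lower)
	define F where "F = (%s. \<Sum>n. of_real (a n) * of_nat (Suc n) powr (-s) :: complex)"
	have F: "F holomorphic_on {s. Re s > b}" unfolding F_def using a bS by (intro holomorphic_dirichlet_nonneg) (auto simp: S_def)
	obtain \<Omega> where \<Omega>: "open \<Omega>" "of_real ` {\<nu>\<^sub>0<..} \<subseteq> \<Omega>" "D holomorphic_on \<Omega>"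
		using D by (auto simp: analytic_on_holomorphic)
	define K where "K = complex_of_real ` {b..max b c+1}"
	have "compact K" unfolding K_def by (intro compact_continuous_image continuous_intros) auto
	moreover have "K \<subseteq> \<Omega>" using \<Omega>(2) by_b y by (auto simp: K_def)
	ultimately obtain e where e: "e > 0" "(\<Union>x\<in>K. ball x e) \<subseteq> \<Omega>"
		using compact_subset_open_imp_ball_epsilon_subset[OF _ \<Omega>(1)] by metis
	\<comment> \<open>A thin rectangle along the real axis: it links the half-plane where
	  \<open>D\<close> is known to be the series with the neighbourhood of the abscissa, and it stays
	  inside the domain of \<open>D\<close>.\<close>
	define Q where "Q = {s. Re s > b} \<inter> {s. Re s < max b c+1} \<inter> {s. Im s > -e} \<inter> {s. Im s < e}"
	have Q\<Omega>: "Q \<subseteq> \<Omega>"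
	proof
		fix s assume s: "s \<in> Q"
		have "dist (of_real (Re s)) s = \<bar>Im s\<bar>" by (simp add: dist_norm cmod_def)
		hence "s \<in> ball (of_real (Re s)) e" using s by (auto simp: Q_def)
		moreover have "complex_of_real (Re s) \<in> K" using s by (auto simp: Q_def K_def)
		ultimately show "s \<in> \<Omega>" using e by blast
	qed
	have DF: "D s = F s" if "s \<in> Q" for s
	proof (rule analytic_continuation_open[of "Q \<inter> {s. Re s > max b c}" Q D F])
		show "open (Q \<inter> {s. Re s > max b c})" "open Q" unfolding Q_def
			by (intro open_Int open_halfspace_Re_gt open_halfspace_Re_lt open_halfspace_Im_gt open_halfspace_Im_lt)+
		show "connected Q" unfolding Q_def
			by (intro convex_connected convex_Int convex_halfspace_Re_gt convex_halfspace_Re_lt convex_halfspace_Im_gt convex_halfspace_Im_lt)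
		show "Q \<inter> {s. Re s > max b c}~={}"
		proof -
			have "complex_of_real (max b c+1/2) \<in> Q \<inter> {s. Re s > max b c}" using e by (auto simp: Q_def max_def)
			thus ?thesis by blast
		qed
		show "D holomorphic_on Q" using \<Omega>(3) Q\<Omega> by (rule holomorphic_on_subset)
		show "F holomorphic_on Q" by (rule holomorphic_on_subset[OF F]) (auto simp: Q_def)
	qed (use that eq in \<open>auto simp: F_def\<close>)
	define h where "h = min (e/4) (1/4)"
	have h: "h > 0" "4 * h<=e" "4 * h<=1" using e by (auto simp: h_def)
	define x where "x = b+h"
	have xpos: "complex_of_real b \<in> K" by (auto simp: K_def)
	have ballsub: "ball (of_real x) (2 * h) \<subseteq> ball (complex_of_real b) e"
	proof
		fix s assume "s \<in> ball (complex_of_real x) (2 * h)"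
		hence "dist (of_real x) s < 2 * h" by simp
		moreover have "dist (of_real b) (complex_of_real x) = h" using h by (simp add: x_def dist_norm)
		ultimately show "s \<in> ball (of_real b) e" using dist_triangle[of "of_real b" s "of_real x"] h by simp
	qed
	define C where "C = (%k. \<Sum>n. a n * real (Suc n) powr (-x)*(ln (real (Suc n)))^k/fact k)"
	define G where "G = (%z. D (of_real x+z))"
	have Gh: "G holomorphic_on ball 0 (2 * h)"
	proof -
		have "D \<circ> (%z. of_real x+z) holomorphic_on ball 0 (2 * h)"
		proof (rule holomorphic_on_compose_gen[OF _ \<Omega>(3)])
			show "(%z. of_real x+z) ` ball 0 (2 * h) \<subseteq> \<Omega>"
			proof safe
				fix z :: complex assume "z \<in> ball 0 (2 * h)"
				hence "of_real x+z \<in> ball (of_real x) (2 * h)" by (simp add: dist_norm)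
				thus "of_real x+z \<in> \<Omega>" using ballsub e xpos by blast
			qed
		qed (intro holomorphic_intros)
		thus ?thesis by (simp add: G_def o_def)
	qed
	have sums1: "(%k. of_real (C k)*(-z)^k) sums G z"
		and csm: "z~=0 ==> summable (%n. a n * real (Suc n) powr (-x)*(ln (real (Suc n)))^k/fact k)"
		if z: "norm z < h" for z k
	proof -
		have sz: "summable (%n. a n * real (Suc n) powr (-(x-norm z)))" using bS[of "x-norm z"] z by (simp add: S_def x_def)
		have "\<bar>Re z\<bar> < h" "\<bar>Im z\<bar> < h" using z abs_Re_le_cmod[of z] abs_Im_le_cmod[of z] by linarith+
		hence "of_real x+z \<in> Q" using h by (auto simp: Q_def x_def)
		hence "G z = F (of_real x+z)" by (simp add: G_def DF)
		thus "(%k. of_real (C k)*(-z)^k) sums G z" using dirichlet_power_series(1)[OF a sz] by (simp add: F_def C_def)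
		show "z~=0 ==> summable (%n. a n * real (Suc n) powr (-x)*(ln (real (Suc n)))^k/fact k)" using dirichlet_power_series(2)[OF a sz] .
	qed
	have csm': "summable (%n. a n * real (Suc n) powr (-x)*(ln (real (Suc n)))^k/fact k)" for k using csm[of "of_real (h/2)"] h by auto
	define P where "P = Abs_fps (%k. complex_of_real (C k*(-1)^k))"
	have Pn: "fps_nth P k = complex_of_real (C k*(-1)^k)" for k by (simp add: P_def)
	have Psums: "(%k. fps_nth P k * z^k) sums G z" if "norm z < h" for z using sums1[OF that] by (simp add: Pn power_minus[of z] mult_ac)
	have "G has_fps_expansion P" unfolding has_fps_expansion_def
	proof
		have "conv_radius (fps_nth P)>=ereal (norm (of_real (h/2) :: complex))"
			using Psums[of "of_real (h/2)"] h by (intro conv_radius_geI sums_summable) auto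
		thus "fps_conv_radius P > 0" using h by (auto simp: fps_conv_radius_def intro: less_le_trans[rotated])
		have "eventually (%z. z \<in> ball 0 h) (nhds (0::complex))" using h by (intro eventually_nhds_in_open) auto
		thus "\<forall>\<^sub>F z in nhds 0. eval_fps P z = G z" by eventually_elim (use Psums in \<open>auto simp: eval_fps_def sums_iff\<close>)
	qed
	hence coeff: "(deriv ^^ k) G 0/fact k = fps_nth P k" for k by (simp add: fps_nth_fps_expansion)
	\<comment> \<open>The centre is b + h and the expansion converges in radius 2 h. Any r strictly
	  between h and 2 h would do: x - r = b - h/2 lies to the left of the abscissa.\<close>
	define r where "r = 3/2 * h"
	have "(%k. (deriv ^^ k) G 0/fact k*(of_real (-r)-0)^k) sums G (of_real (-r))"
		using h by (intro holomorphic_power_series[OF Gh]) (auto simp: r_def)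
	hence "summable (%k. complex_of_real (C k * r^k))"
	proof (rule sums_summable[THEN summable_cong[THEN iffD1, rotated]], intro always_eventually allI)
		fix k
		have "(-1)^k*(-r)^k = r^k" by (simp flip: power_mult_distrib)
		hence "complex_of_real (C k*((-1)^k*(-r)^k)) = of_real (C k * r^k)" by (simp only:)
		thus "(deriv ^^ k) G 0/fact k*(of_real (-r)-0)^k = complex_of_real (C k * r^k)" unfolding coeff Pn by (simp add: mult.assoc)
	qed
	hence smC: "summable (%k. C k * r^k)" by (simp only: summable_of_real_iff)
	have L: "ln (real (Suc n))>=0" for n by simp
	have r: "r > 0" using h by (simp add: r_def)
	have "summable (%n. a n * real (Suc n) powr (-(x-r)))"
	proof (rule summableI_nonneg_bounded)
		fix N
		have e1: "(%k. (a n * real (Suc n) powr (-x)*(ln (real (Suc n)))^k/fact k) * r^k) sums (a n * real (Suc n) powr (-(x-r)))" for n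
		proof -
			have "(%k. (ln (real (Suc n)) * r)^k /\<^sub>R fact k) sums exp (ln (real (Suc n)) * r)" by (rule exp_converges)
			from sums_mult[OF this, of "a n * real (Suc n) powr (-x)"]
			have "(%k. (a n * real (Suc n) powr (-x)*(ln (real (Suc n)))^k/fact k) * r^k) sums
				(a n * real (Suc n) powr (-x) * exp (ln (real (Suc n)) * r))" by (simp add: divide_inverse power_mult_distrib mult_ac del: of_nat_Suc)
			also have "exp (ln (real (Suc n)) * r) = real (Suc n) powr r" by (simp add: powr_def mult.commute)
			also have "a n * real (Suc n) powr (-x) * real (Suc n) powr r = a n * real (Suc n) powr (-(x-r))"
				by (simp add: mult.assoc powr_add[symmetric] del: of_nat_Suc)
			finally show ?thesis .
		qed
		have s1: "(%k. \<Sum>n<N. (a n * real (Suc n) powr (-x)*(ln (real (Suc n)))^k/fact k) * r^k) sums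
			 (\<Sum>n<N. a n * real (Suc n) powr (-(x-r)))" by (intro sums_sum e1)
		have le: "(\<Sum>n<N. (a n * real (Suc n) powr (-x)*(ln (real (Suc n)))^k/fact k) * r^k)<=C k * r^k" for k
			unfolding sum_distrib_right[symmetric] C_def using a L r by (intro mult_right_mono sum_le_suminf csm') auto
		show "(\<Sum>n<N. a n * real (Suc n) powr (-(x-r)))<=(\<Sum>k. C k * r^k)" by (rule sums_le[OF le s1 summable_sums[OF smC]])
	qed (use a in auto)
	hence "x-r \<in> S" by (simp add: S_def)
	from Sb[OF this] show False using h by (simp add: x_def r_def)
qed

section \<open>Abel summation for a series with one-sided bounded partial sums\<close>

lemma Suc_mult_powr: "real (Suc n) * real (Suc n) powr a = real (Suc n) powr (a+1)" by (simp add: powr_add del: of_nat_Suc)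

lemma norm_powr_diff_le:
	fixes s :: complex
	assumes x: "x > 0" and u: "u>=0" "u<=1" and s: "Re s>=-1"
	shows "norm (of_real x powr (-s)-of_real (x+u) powr (-s) :: complex)<=norm s * x powr (- Re s-1)"
proof -
	define g where "g = (%v::real. of_real (x+v) powr (-s) :: complex)"
	have d: "(g has_vector_derivative (-s * of_real (x+v) powr (-s-1))) (at v within {0..u})" if "v \<in> {0..u}" for v
	proof -
		have pos: "complex_of_real x + of_real v \<notin> \<real>\<^sub>\<le>\<^sub>0" using x that by (auto simp: complex_nonpos_Reals_iff)
		have "((%w. (of_real x+w) powr (-s)) has_field_derivative (-s * of_real (x+v) powr (-s-1))) (at (of_real v))"
			using pos by (auto intro!: derivative_eq_intros)
		from has_vector_derivative_real_field[OF this] show ?thesis by (simp add: g_def o_def)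
	qed
	have "norm (g u-g 0)<=(norm s * x powr (- Re s-1)) * norm (u-0)"
	proof (rule differentiable_bound[of "{0..u}" g "%v h. h *\<^sub>R (-s * of_real (x+v) powr (-s-1))"])
		fix v assume v: "v \<in> {0..u}"
		show "(g has_derivative (%h. h *\<^sub>R (-s * of_real (x+v) powr (-s-1)))) (at v within {0..u})"
			using d[OF v] by (simp add: has_vector_derivative_def)
		have "norm (-s * of_real (x+v) powr (-s-1)) = norm s*(x+v) powr (- Re s-1)" using x v by (subst norm_mult, subst norm_of_real_powr) auto
		also have "...<=norm s * x powr (- Re s-1)" using x v s by (intro mult_left_mono powr_mono2') auto
		finally show "onorm (%h. h *\<^sub>R (-s * of_real (x+v) powr (-s-1)))<=norm s * x powr (- Re s-1)"
			by (intro onorm_bound) (auto simp: mult.commute intro!: mult_left_mono)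
	qed (use u in auto)
	also have "...<=(norm s * x powr (- Re s-1))*1" using u by (intro mult_left_mono) auto
	finally show ?thesis by (simp add: g_def norm_minus_commute)
qed

text \<open>n^(-s) - (n+1)^(-s) is the integral of s x^(-s-1) over [n, n+1]; this is the error of
  replacing the integrand by its value at n. It allows Abel summation to produce a Dirichlet series
  instead of an integral.\<close>

definition abel_term :: "nat => complex => complex" where
	"abel_term n s = s * of_nat n powr (-s-1)-(of_nat n powr (-s)-of_nat (Suc n) powr (-s))"

lemma norm_abel_term_le:
	assumes n: "n > 0" and s: "Re s>=-2"
	shows "norm (abel_term n s)<=norm s * norm (s+1) * real n powr (- Re s-2)"
proof -
	define x where "x = real n"
	have x: "x > 0" using n by (simp add: x_def)
	define g where "g = (%u::real. s * of_real u * of_real x powr (-s-1) + of_real (x+u) powr (-s) :: complex)"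
	define g' where "g' = (%u::real. s*(of_real x powr (-(s+1))-of_real (x+u) powr (-(s+1))))"
	have d: "(g has_vector_derivative g' v) (at v within {0..1})" if "v \<in> {0..1}" for v
	proof -
		have pos: "complex_of_real x + of_real v \<notin> \<real>\<^sub>\<le>\<^sub>0" using x that by (auto simp: complex_nonpos_Reals_iff)
		have e: "- (s+1) = -s-1" by simp
		have "((%w. s * w * of_real x powr (-s-1)+(of_real x+w) powr (-s)) has_field_derivative
			 (s * of_real x powr (-s-1)+(-s * of_real (x+v) powr (-s-1)))) (at (of_real v))" using pos by (auto intro!: derivative_eq_intros)
		also have "(s * of_real x powr (-s-1)+(-s * of_real (x+v) powr (-s-1))) = g' v" unfolding g'_def e by (simp add: algebra_simps)
		finally show ?thesis using has_vector_derivative_real_field by (fastforce simp: g_def o_def)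
	qed
	have "norm (g 1-g 0)<=(norm s * norm (s+1) * x powr (- Re s-2)) * norm (1-0 :: real)"
	proof (rule differentiable_bound[of "{0..1}" g "%v h. h *\<^sub>R g' v"])
		fix v :: real assume v: "v \<in> {0..1}"
		show "(g has_derivative (%h. h *\<^sub>R g' v)) (at v within {0..1})" using d[OF v] by (simp add: has_vector_derivative_def)
		have "norm (g' v) = norm s * norm (of_real x powr (-(s+1))-of_real (x+v) powr (-(s+1)) :: complex)" by (simp add: g'_def norm_mult)
		also have "...<=norm s*(norm (s+1) * x powr (- Re (s+1)-1))" using x v s by (intro mult_left_mono norm_powr_diff_le) auto
		also have "- Re (s+1)-1 =-Re s-2" by simp
		finally have "norm (g' v)<=norm s * norm (s+1) * x powr (- Re s-2)" by (simp only: mult.assoc)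
		thus "onorm (%h. h *\<^sub>R g' v)<=norm s * norm (s+1) * x powr (- Re s-2)"
			by (intro onorm_bound) (auto simp: mult.commute intro!: mult_left_mono)
	qed auto
	moreover have "g 1-g 0 = abel_term n s" by (simp add: g_def abel_term_def x_def add.commute)
	ultimately show ?thesis by (simp add: x_def)
qed

text \<open>1/T extends to a function that is differentiable at the pole and vanishes there, so it
  is O(|s - s0|).\<close>

lemma is_pole_lower_bound:
	assumes "is_pole T s0" "isolated_singularity_at T s0"
	shows "\<exists>c>0. \<forall>\<^sub>F s in at s0. norm (T s)>=c/norm (s-s0)"
proof -
	obtain r where r: "r > 0" "T analytic_on ball s0 r-{s0}" using assms(2) by (auto simp: isolated_singularity_at_def)
	have "eventually (%s. T s~=0) (at s0)" using assms(1) by (rule non_zero_neighbour_pole)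
	then obtain r' where r': "r' > 0" "!!s. s~=s0 ==> dist s s0 < r' ==> T s~=0" by (auto simp: eventually_at)
	define q where "q = min r r'"
	have q: "q > 0" using r r' by (simp add: q_def)
	define g where "g = (%s. if s = s0 then 0 else inverse (T s))"
	have "g holomorphic_on ball s0 q" unfolding g_def
	proof (rule is_pole_inverse_holomorphic)
		show "open (ball s0 q)" by simp
		have "T analytic_on ball s0 q-{s0}" using r(2) by (rule analytic_on_subset) (auto simp: q_def)
		thus "T holomorphic_on ball s0 q-{s0}" by (rule analytic_imp_holomorphic)
		show "is_pole T s0" by fact
		show "\<forall>z\<in>ball s0 q-{s0}. T z~=0" using r' by (auto simp: q_def dist_commute)
	qed
	hence "g field_differentiable (at s0)" using q by (intro holomorphic_on_imp_differentiable_at[of _ "ball s0 q"]) auto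
	then obtain D where "(g has_field_derivative D) (at s0)" by (auto simp: field_differentiable_def)
	hence lim: "((%s. (g s-g s0)/(s-s0)) \<longlongrightarrow> D) (at s0)" by (simp add: has_field_derivative_iff)
	hence "((%s. norm ((g s-g s0)/(s-s0))) \<longlongrightarrow> norm D) (at s0)" by (rule tendsto_norm)
	hence "eventually (%s. norm ((g s-g s0)/(s-s0)) < norm D+1) (at s0)" by (rule order_tendstoD) auto
	moreover have "eventually (%s. s \<in> ball s0 q-{s0}) (at s0)" using q by (intro eventually_at_in_open) auto
	ultimately have "eventually (%s. norm (T s)>=(1/(norm D+1))/norm (s-s0)) (at s0)"
	proof eventually_elim
		case (elim s)
		have s: "s~=s0" "T s~=0" using elim r' by (auto simp: q_def dist_commute)
		have "inverse (norm (T s))/norm (s-s0) < norm D+1" using elim s by (simp add: g_def norm_divide norm_inverse)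
		hence "inverse (norm (T s)) < (norm D+1) * norm (s-s0)" using s by (simp add: divide_less_eq)
		hence "1 < (norm D+1) * norm (s-s0) * norm (T s)" using s by (simp add: field_simps)
		moreover have "norm D+1 > 0" by (simp add: add_nonneg_pos)
		ultimately show ?case using s by (simp add: divide_simps mult_ac)
	qed
	moreover have "1/(norm D+1) > 0" by (simp add: add_nonneg_pos)
	ultimately show ?thesis by blast
qed

text \<open>The identity theorem for T - g with its singularities removed. The limit of T at s then
  equals g s, so T has no pole at s, and by niceness its value is the limit.\<close>

lemma nicely_meromorphic_eq_holomorphic:
	assumes "T nicely_meromorphic_on A" "g holomorphic_on A" "open A" "connected A"
		and "open B" "B~={}" "B \<subseteq> A" "!!s. s \<in> B ==> T s = g s" "s \<in> A"
	shows "T s = g s" "T analytic_on {s}"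
proof -
	define h where "h = remove_sings (%s. T s-g s)"
	have gm: "g meromorphic_on A" using assms(2,3) by (simp add: analytic_on_imp_meromorphic_on analytic_on_open)
	have Tm: "T meromorphic_on A" using assms(1) by (simp add: nicely_meromorphic_on_def)
	have dm: "(%s. T s-g s) meromorphic_on A" by (intro meromorphic_intros gm Tm)
	have hm: "h nicely_meromorphic_on A" unfolding h_def by (rule remove_sings_nicely_meromorphic[OF dm])
	have hB: "h z = 0" if "z \<in> B" for z
	proof -
		have "eventually (%w. w \<in> B) (nhds z)" using assms(5) that by (intro eventually_nhds_in_open)
		hence "eventually (%w. T w-g w = 0) (at z)" unfolding eventually_at_filter by eventually_elim (use assms(8) in auto)
		hence "(%w. T w-g w) \<midarrow>z\<rightarrow> 0" by (rule tendsto_eventually)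
		thus ?thesis unfolding h_def by (rule remove_sings_eqI)
	qed
	have "h constant_on A" by (rule constant_on_extend_nicely_meromorphic_on[OF hm, of B]) (use hB assms in \<open>auto simp: constant_on_def\<close>)
	then obtain k where k: "!!z. z \<in> A ==> h z = k" by (auto simp: constant_on_def)
	obtain z0 where z0: "z0 \<in> B" using assms(6) by blast
	have "k = 0" using k[of z0] hB[OF z0] z0 assms(7) by auto
	hence h0: "h z = 0" if "z \<in> A" for z using k that by simp
	have ev: "eventually (%w. T w = g w) (at s)"
	proof -
		have "eventually (%w. remove_sings (%s. T s-g s) w = T w-g w) (at s)"
			using dm assms(9) by (intro eventually_remove_sings_eq_at meromorphic_on_isolated_singularity)
				(auto intro: meromorphic_on_subset)
		moreover have "eventually (%w. w \<in> A) (at s)" using assms(3,9) by (intro eventually_at_in_open') auto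
		ultimately show ?thesis by eventually_elim (use h0 in \<open>auto simp: h_def\<close>)
	qed
	have ga: "g analytic_on {s}" using assms(2,3,9) by (simp add: holomorphic_on_imp_analytic_at)
	have "g \<midarrow>s\<rightarrow> g s" using ga by (meson analytic_at_imp_isCont isContD)
	hence lim: "T \<midarrow>s\<rightarrow> g s" using tendsto_cong[OF ev] by simp
	hence np: "\<not> is_pole T s" using not_tendsto_and_filterlim_at_infinity[OF _ lim] by (auto simp: is_pole_def)
	hence "T \<midarrow>s\<rightarrow> T s" using assms(1,9) by (auto simp: nicely_meromorphic_on_def)
	thus "T s = g s" using lim by (rule LIM_unique)
	show "T analytic_on {s}" using assms(1,9) np by (rule nicely_meromorphic_on_imp_analytic_at)
qed

text \<open>\<open>b/2\<close> has the role of the residue of \<open>T\<close> at 1/2, with 0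
  allowed, and \<open>upper\<close> says that the normalized partial sums have upper limit at most
  b. Analyticity is assumed only on the real axis, where zeta has no zeros in question; on the rest
  of the half-plane it is a conclusion.\<close>

locale one_sided_bound =
	fixes f :: "nat => real" and T :: "complex => complex" and b :: real
	assumes f_le: "!!n. \<bar>f n\<bar><=1"
		and T_mero: "T nicely_meromorphic_on {s. Re s>=1/2}"
		and T_eq: "!!s. Re s > 1 ==> T s = (\<Sum>n. of_real (f (Suc n)) * of_nat (Suc n) powr (-s))"
		and T_an: "!!x. x > 1/2 ==> T analytic_on {of_real x}"
		and T_lim: "((%x::real. of_real (x-1/2) * T (of_real x)) \<longlongrightarrow> of_real (b/2)) (at_right (1/2))"
		and upper: "!!\<delta>. \<delta> > 0 ==> \<forall>\<^sub>F N in sequentially. (\<Sum>n=1..N. f n)<=(b + \<delta>) * sqrt (real N)"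
begin

definition F :: "nat => real" where "F N = (\<Sum>n=1..N. f n)"

lemma F_le: "\<bar>F N\<bar><=real N"
proof -
	have "\<bar>F N\<bar><=(\<Sum>n=1..N. \<bar>f n\<bar>)" unfolding F_def by (rule sum_abs)
	also have "...<=(\<Sum>n=1..N. 1)" by (intro sum_mono f_le)
	finally show ?thesis by simp
qed

text \<open>The correction term in Abel summation. As |F N| <= N, its terms are O(n^(-Re s - 1)), so
  it is harmless on Re s > 0.\<close>

definition H :: "complex => complex" where
	"H s = (\<Sum>n. of_real (F (Suc n)) * abel_term (Suc n) s)"

lemma H_term_le:
	assumes "Re s>=x" "x > 0"
	shows "norm (of_real (F (Suc n)) * abel_term (Suc n) s)<=norm s * norm (s+1) * real (Suc n) powr (-(x+1))"
proof -
	have "norm (of_real (F (Suc n)) * abel_term (Suc n) s) = \<bar>F (Suc n)\<bar> * norm (abel_term (Suc n) s)" by (simp add: norm_mult)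
	also have "...<=real (Suc n)*(norm s * norm (s+1) * real (Suc n) powr (- Re s-2))"
		using assms F_le[of "Suc n"] by (intro mult_mono norm_abel_term_le) auto
	also have "... = norm s * norm (s+1)*(real (Suc n) * real (Suc n) powr (- Re s-2))" by simp
	also have "real (Suc n) * real (Suc n) powr (- Re s-2) = real (Suc n) powr (- Re s-2+1)" by (rule Suc_mult_powr)
	also have "- Re s-2+1 =-Re s-1" by simp
	also have "norm s * norm (s+1) * real (Suc n) powr (- Re s-1)<=norm s * norm (s+1) * real (Suc n) powr (-(x+1))"
		using assms by (intro mult_left_mono powr_mono) auto
	finally show ?thesis .
qed

lemma summable_H: "Re s > 0 ==> summable (%n. of_real (F (Suc n)) * abel_term (Suc n) s)"
proof (rule summable_comparison_test)
	assume s: "Re s > 0"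
	show "\<exists>N. \<forall>n\<ge>N. norm (of_real (F (Suc n)) * abel_term (Suc n) s)<=norm s * norm (s+1) * real (Suc n) powr (-(Re s+1))"
		using s by (intro exI[of _ 0] allI impI H_term_le) auto
	show "summable (%n. norm s * norm (s+1) * real (Suc n) powr (-(Re s+1)))" using s by (intro summable_mult summable_Suc_powr) auto
qed

lemma norm_H_le:
	assumes "Re s>=1/2"
	shows "norm (H s)<=norm s * norm (s+1)*(\<Sum>n. real (Suc n) powr (-(3/2)))"
proof -
	have sm: "summable (%n. norm s * norm (s+1) * real (Suc n) powr (-(1/2+1)))" by (intro summable_mult summable_Suc_powr) auto
	have "norm (H s)<=(\<Sum>n. norm s * norm (s+1) * real (Suc n) powr (-(1/2+1)))"
		unfolding H_def using assms by (intro norm_suminf_le sm H_term_le) auto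
	also have "... = norm s * norm (s+1)*(\<Sum>n. real (Suc n) powr (-(1/2+1)))" by (intro suminf_mult summable_Suc_powr) auto
	finally show ?thesis by simp
qed

lemma holomorphic_H: "H holomorphic_on {s. Re s > 0}" unfolding H_def
proof (rule holomorphic_on_suminf_M_test)
	show "(%s. of_real (F (Suc n)) * abel_term (Suc n) s) holomorphic_on {s. Re s > 0}" for n
		unfolding abel_term_def by (auto intro!: holomorphic_intros)
	fix z assume "z \<in> {s. Re s > 0}"
	hence z: "Re z > 0" by simp
	define d where "d = Re z/2"
	have d: "d > 0" using z by (simp add: d_def)
	define R where "R = norm z+d+1"
	have w: "Re w>=d" "norm w<=R" "norm (w+1)<=R" if "w \<in> cball z d" for w
	proof -
		have *: "norm (z-w)<=d" using that by (simp add: dist_norm)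
		have "Re (z-w)<=d" using complex_Re_le_cmod[of "z-w"] * by linarith
		thus "Re w>=d" by (simp add: d_def field_simps)
		have **: "norm w<=norm z+d" using * norm_triangle_sub[of w z] by (simp add: norm_minus_commute)
		thus "norm w<=R" "norm (w+1)<=R" using norm_triangle_ineq[of w 1] by (auto simp: R_def)
	qed
	show "\<exists>d M. d > 0 \<and> cball z d \<subseteq> {s. Re s > 0} \<and> summable M \<and>
			(\<forall>n. \<forall>w\<in>cball z d. norm (of_real (F (Suc n)) * abel_term (Suc n) w)<=M n)"
	proof (intro exI conjI allI ballI)
		show "cball z d \<subseteq> {s. Re s > 0}" using w(1) d by force
		show "summable (%n. R * R * real (Suc n) powr (-(d+1)))" using d by (intro summable_mult summable_Suc_powr) auto
		fix n w assume *: "w \<in> cball z d"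
		have "norm (of_real (F (Suc n)) * abel_term (Suc n) w)<=norm w * norm (w+1) * real (Suc n) powr (-(d+1))" by (intro H_term_le w * d)
		also have "...<=R * R * real (Suc n) powr (-(d+1))" using w[OF *] z d by (intro mult_right_mono mult_mono) (auto simp: R_def)
		finally show "norm (of_real (F (Suc n)) * abel_term (Suc n) w)<=R * R * real (Suc n) powr (-(d+1))" .
	qed (use d in auto)
qed (rule open_Re_gt)

lemma summable_F_series:
	assumes "Re s > 1"
	shows "summable (%n. of_real (F (Suc n)) * of_nat (Suc n) powr (-s-1) :: complex)"
proof (rule summable_comparison_test)
	show "summable (%n. real (Suc n) powr (- Re s))" using assms by (rule summable_Suc_powr)
	show "\<exists>N. \<forall>n\<ge>N. norm (of_real (F (Suc n)) * of_nat (Suc n) powr (-s-1) :: complex)<=real (Suc n) powr (- Re s)"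
	proof (intro exI allI impI)
		fix n
		have "norm (of_real (F (Suc n)) * of_nat (Suc n) powr (-s-1) :: complex)<=real (Suc n) * real (Suc n) powr (- Re s-1)"
			unfolding norm_mult norm_Suc_powr norm_of_real using F_le[of "Suc n"] by (intro mult_mono) auto
		also have "... = real (Suc n) powr (- Re s-1+1)" by (rule Suc_mult_powr)
		also have "- Re s-1+1 =-Re s" by simp
		finally show "norm (of_real (F (Suc n)) * of_nat (Suc n) powr (-s-1) :: complex)<=real (Suc n) powr (- Re s)" .
	qed
qed

lemma T_eq_abel:
	assumes s: "Re s > 1"
	shows "T s = s*(\<Sum>n. of_real (F (Suc n)) * of_nat (Suc n) powr (-s-1))-H s"
proof -
	define c where "c = (%n. of_real (F (Suc n))*(of_nat (Suc n) powr (-s)-of_nat (Suc (Suc n)) powr (-s)) :: complex)"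
	have c: "c n = s*(of_real (F (Suc n)) * of_nat (Suc n) powr (-s-1))-of_real (F (Suc n)) * abel_term (Suc n) s" for n
		by (simp add: c_def abel_term_def algebra_simps)
	have cs: "c sums (s*(\<Sum>n. of_real (F (Suc n)) * of_nat (Suc n) powr (-s-1))-H s)"
		unfolding c H_def using s by (intro sums_diff sums_mult summable_sums summable_F_series summable_H) auto
	have part: "(\<Sum>n<M. c n) = (\<Sum>n<M. of_real (f (Suc n)) * of_nat (Suc n) powr (-s))-of_real (F M) * of_nat (Suc M) powr (-s)" for M
	proof (induction M)
		case 0 show ?case by (simp add: F_def)
	next
		case (Suc M)
		have F: "F (Suc M) = F M+f (Suc M)" by (simp add: F_def)
		have "(\<Sum>n<Suc M. c n) = (\<Sum>n<M. c n)+c M" by simp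
		also note Suc.IH
		finally show ?case by (simp add: c_def F algebra_simps del: of_nat_Suc)
	qed
	have sT: "summable (%n. of_real (f (Suc n)) * of_nat (Suc n) powr (-s) :: complex)"
	proof (rule summable_comparison_test)
		show "\<exists>N. \<forall>n\<ge>N. norm (of_real (f (Suc n)) * of_nat (Suc n) powr (-s) :: complex)<=real (Suc n) powr (- Re s)"
		proof (intro exI allI impI)
			fix n
			have "norm (of_real (f (Suc n)) * of_nat (Suc n) powr (-s) :: complex)<=1 * real (Suc n) powr (- Re s)"
				unfolding norm_mult norm_Suc_powr norm_of_real using f_le by (intro mult_mono) auto
			thus "norm (of_real (f (Suc n)) * of_nat (Suc n) powr (-s) :: complex)<=real (Suc n) powr (- Re s)" by simp
		qed
	qed (rule summable_Suc_powr[OF s])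
	have z: "(%M. of_real (F M) * of_nat (Suc M) powr (-s) :: complex) \<longlonglongrightarrow> 0"
	proof (rule Lim_null_comparison)
		show "\<forall>\<^sub>F M in sequentially. norm (of_real (F M) * of_nat (Suc M) powr (-s) :: complex)<=real (Suc M) powr (1-Re s)"
		proof (intro always_eventually allI)
			fix M
			have "norm (of_real (F M) * of_nat (Suc M) powr (-s) :: complex)<=real (Suc M) * real (Suc M) powr (- Re s)"
				unfolding norm_mult norm_Suc_powr norm_of_real using F_le[of M] by (intro mult_mono) auto
			also have "... = real (Suc M) powr (- Re s+1)" by (rule Suc_mult_powr)
			also have "- Re s+1 = 1-Re s" by simp
			finally show "norm (of_real (F M) * of_nat (Suc M) powr (-s) :: complex)<=real (Suc M) powr (1-Re s)" .
		qed
		show "(%M. real (Suc M) powr (1-Re s)) \<longlonglongrightarrow> 0"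
			using s by (intro LIMSEQ_Suc[of "%M. real M powr (1-Re s)"] tendsto_neg_powr filterlim_real_sequentially) auto
	qed
	have "(%M. \<Sum>n<M. c n) \<longlonglongrightarrow> T s-0" unfolding part T_eq[OF s] by (intro tendsto_diff summable_LIMSEQ sT z)
	moreover have "(%M. \<Sum>n<M. c n) \<longlonglongrightarrow> s*(\<Sum>n. of_real (F (Suc n)) * of_nat (Suc n) powr (-s-1))-H s"
		using cs by (simp add: sums_def)
	ultimately show ?thesis using LIMSEQ_unique by fastforce
qed

end

section \<open>Why P(2^(-s))/zeta(s) cannot be analytic up to the critical line\<close>

text \<open>From n = 2 on the terms sum to at most 1/2, because 1/(m+1)^3 <= 1/(2 m (m+1)) and the
  right-hand side telescopes.\<close>

lemma zeta_reg_lower_bound: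
	assumes s: "Re s>=3"
	shows "norm (zeta_reg s)>=norm (s-1)/2"
proof -
	define f where "f = (%n. of_nat (Suc n) powr (-s) :: complex)"
	have smn: "summable (%n. norm (f n))" using summable_dirichlet_zeta[of s] s by (simp add: f_def del: of_nat_Suc)
	have sm: "summable f" using smn by (rule summable_norm_cancel)
	have b: "norm (f (Suc n))<=1/2*(1/real (Suc n)-1/real (Suc (Suc n)))" for n
	proof -
		have "norm (f (Suc n)) = real (Suc (Suc n)) powr (- Re s)" unfolding f_def by (subst norm_of_nat_powr) auto
		also have "...<=real (Suc (Suc n)) powr (-3)" using s by (intro powr_mono) auto
		also have "... = 1/(real (Suc (Suc n)))^3" by (simp add: powr_minus powr_numeral divide_inverse)
		also have "...<=1/(2 * real (Suc n) * real (Suc (Suc n)))"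
			by (intro divide_left_mono) (auto simp: power3_eq_cube algebra_simps intro!: mult_pos_pos add_pos_nonneg)
		also have "... = 1/2*(1/real (Suc n)-1/real (Suc (Suc n)))" by (simp add: field_simps)
		finally show ?thesis .
	qed
	have "(%n. 1/real (Suc n)-1/real (Suc (Suc n))) sums (1/real (Suc 0)-0)"
		by (rule telescope_sums') (use LIMSEQ_inverse_real_of_nat in \<open>simp add: inverse_eq_divide\<close>)
	hence t: "(%n. 1/2*(1/real (Suc n)-1/real (Suc (Suc n)))) sums (1/2*(1/real (Suc 0)-0))" by (rule sums_mult)
	have smn': "summable (%n. norm (f (Suc n)))" using smn by (subst summable_Suc_iff)
	have "norm (\<Sum>n. f (Suc n))<=(\<Sum>n. norm (f (Suc n)))" by (rule summable_norm[OF smn'])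
	also have "...<=1/2*(1/real (Suc 0)-0)" using sums_le[OF b summable_sums[OF smn'] t] .
	finally have tail: "norm (\<Sum>n. f (Suc n))<=1/2" by simp
	have "(\<Sum>n. f n) = f 0+(\<Sum>n. f (Suc n))" using suminf_split_head[OF sm] by simp
	also have "f 0 = 1" by (simp add: f_def)
	finally have "norm (\<Sum>n. f n)>=1-norm (\<Sum>n. f (Suc n))" using norm_triangle_ineq2[of 1 "- (\<Sum>n. f (Suc n))"] by simp
	hence "norm (\<Sum>n. f n)>=1/2" using tail by linarith
	hence "norm (s-1) * norm (\<Sum>n. f n)>=norm (s-1)*(1/2)" by (intro mult_left_mono) auto
	thus ?thesis using s by (simp add: zeta_reg_eq_series f_def norm_mult)
qed

lemma pi_powr_half_le_exp:
	assumes "x>=0"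
	shows "pi powr (x/2)<=exp x"
proof -
	have "ln pi<=ln (2*2)" using pi_less_4 by (subst ln_le_cancel_iff) auto
	also have "... = ln 2+ln 2" by (rule ln_mult_pos) auto
	also have "...<=2" using ln_le_minus_one[of 2] by simp
	finally have "x/2 * ln pi<=x/2*2" using assms by (intro mult_left_mono) auto
	thus ?thesis by (simp add: powr_def)
qed

text \<open>By the identity theorem the alternative would be xi 3 = 0, which the lower bound for Re
  s >= 3 excludes.\<close>

lemma xi_nonzero_on_ball:
	assumes z: "Re z = 1/2" and r: "r > 0" "r<=1"
	shows "\<exists>w\<in>ball z r. xi w~=0"
proof (rule ccontr)
	assume "\<not> ?thesis"
	hence 0: "!!w. w \<in> ball z r ==> xi w = 0" by blast
	have sub: "ball z r \<subseteq> {s. Re s > -1}"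
	proof
		fix w assume "w \<in> ball z r"
		hence "Re (z-w) < r" using complex_Re_le_cmod[of "z-w"] by (simp add: dist_norm)
		thus "w \<in> {s. Re s > -1}" using z r by simp
	qed
	have "xi 3 = 0"
	proof (rule analytic_continuation_open[of "ball z r" "{s. Re s > -1}" xi "%_. 0"])
		show "connected {s. Re s > -1}" by (intro convex_connected convex_halfspace_Re_gt)
	qed (use sub r 0 holomorphic_xi open_Re_gt in auto)
	moreover have "(3/2+1 :: complex) \<notin> \<int>\<^sub>\<le>\<^sub>0" by (rule not_nonpos_Ints_of_Re_pos) simp
	hence "Gamma (3/2+1 :: complex)~=0" unfolding Gamma_eq_zero_iff .
	ultimately have "zeta_reg 3 = 0" by (simp add: xi_def)
	moreover have "norm (zeta_reg 3)>=norm (3-1 :: complex)/2" by (rule zeta_reg_lower_bound) simp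
	ultimately show False by simp
qed

text \<open>The singular factor (Re s - 1/2)^(-2) in \<open>bd\<close> is what the estimates for the
  series and for 1/zeta(2s) produce; it is removed by a local maximum principle. Beyond Re s = 3 a
  bound for \<open>K\<close> follows from \<open>rel\<close> itself.\<close>

theorem poly_cancellation_impossible:
	fixes P :: "complex poly"
	assumes P: "P~=0" and K: "K analytic_on {s. Re s>=1/2}"
		and rel: "!!s. Re s > 1/2 ==> zeta_reg s * K s = (s-1) * poly P (2 powr (-s))"
		and bd: "!!s. Re s > 1/2 ==> Re s<=3 ==> norm (K s)<=B*(1+norm s)^m/(Re s-1/2)^2"
	shows False
proof -
	obtain S where S: "open S" "{s. Re s>=1/2} \<subseteq> S" "K holomorphic_on S" using K by (auto simp: analytic_on_holomorphic)
	define R where "R = (%s. complex_of_real pi powr (s/2) * rGamma (s/2+1))"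
	\<comment> \<open>Made so that xi s times \<open>G1 s\<close> is \<open>Q s\<close>: the factors s
	  and P(2^(s-1)) complete the right-hand side of \<open>rel\<close> to something symmetric under s
	  -> 1-s.\<close>
	define G1 where "G1 = (%s. s * poly P (2 powr (s-1)) * K s * R s)"
	define Q where "Q = (%s. s*(s-1) * poly P (2 powr (-s)) * poly P (2 powr (s-1)))"
	have Qsym: "Q (1-s) = Q s" for s by (simp add: Q_def algebra_simps)
	have hol_poly: "(%s. poly P (2 powr (c * s+d))) holomorphic_on A" for c d A
	proof -
		have "poly P \<circ> (%s. 2 powr (c * s+d)) holomorphic_on A"
			by (rule holomorphic_on_compose_gen[where t = UNIV]) (auto intro!: holomorphic_intros)
		thus ?thesis by (simp add: o_def)
	qed
	have hol_p1: "(%s. poly P (2 powr (s-1))) holomorphic_on A" for A using hol_poly[of 1 "-1"] by simp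
	have hol_p2: "(%s. poly P (2 powr (-s))) holomorphic_on A" for A using hol_poly[of "-1" 0] by simp
	have hol_R: "R holomorphic_on A" for A unfolding R_def by (intro holomorphic_intros) auto
	have hol_G1: "G1 holomorphic_on S" unfolding G1_def by (intro holomorphic_intros hol_p1 hol_R S)
	have hol_Q: "Q holomorphic_on A" for A unfolding Q_def by (intro holomorphic_intros hol_p1 hol_p2)
	have xiG: "xi s * G1 s = Q s" if s: "Re s > 1/2" for s
	proof -
		have "xi s * R s = zeta_reg s"
		proof -
			have "s/2+1 \<notin> \<int>\<^sub>\<le>\<^sub>0" using s by (intro not_nonpos_Ints_of_Re_pos) auto
			hence "Gamma (s/2+1) * rGamma (s/2+1) = 1" by (simp add: rGamma_inverse_Gamma Gamma_eq_zero_iff)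
			moreover have "complex_of_real pi powr (-s/2) * complex_of_real pi powr (s/2) = 1" by (simp flip: powr_add)
			ultimately show ?thesis by (simp add: xi_def R_def) (metis (no_types, lifting) mult.assoc mult.left_commute mult.right_neutral)
		qed
		hence "xi s * G1 s = s * poly P (2 powr (s-1))*(zeta_reg s * K s)" by (simp add: G1_def mult_ac)
		thus ?thesis using rel[OF s] by (simp add: Q_def mult_ac)
	qed
	obtain C d where C: "C > 0" "!!x. norm (poly P x)<=C*(1+norm x)^d" using poly_growth[of P] by blast
	have B: "B>=0"
	proof -
		have "0<=norm (K 1)" by simp
		also have "...<=B*(1+norm (1::complex))^m/(Re 1-1/2)^2" by (rule bd) auto
		finally have "0<=B*(2^m*4)" by (simp add: power2_eq_square)
		moreover have "(2^m*4 :: real) > 0" by simp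
		ultimately show ?thesis by (metis mult_le_0_iff not_le mult_neg_pos)
	qed
	define B' where "B' = B+2*(C*2^d)"
	have B': "B' > 0" using B C by (simp add: B'_def add_nonneg_pos)
	have Kbd: "norm (K s)<=B'*(1+norm s)^m*(1+1/(Re s-1/2)^2)" if s: "Re s > 1/2" for s
	proof (cases "Re s<=3")
		case True
		have "norm (K s)<=B*(1+norm s)^m/(Re s-1/2)^2" by (rule bd[OF s True])
		also have "... = B*(1+norm s)^m*(0+1/(Re s-1/2)^2)" by simp
		also have "...<=B'*(1+norm s)^m*(1+1/(Re s-1/2)^2)" using B C by (intro mult_mono add_mono) (auto simp: B'_def)
		finally show ?thesis .
	next
		case False
		hence s3: "Re s>=3" by simp
		have s1: "norm (s-1) > 0" using s3 by auto
		have n2: "norm (2 powr (-s) :: complex)<=1"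
		proof -
			have "norm (2 powr (-s) :: complex) = 2 powr (- Re s)" using norm_of_real_powr[of 2 "-s"] by simp
			also have "...<=2 powr 0" using s3 by (intro powr_mono) auto
			finally show ?thesis by simp
		qed
		have "norm (s-1)/2 * norm (K s)<=norm (zeta_reg s) * norm (K s)" by (intro mult_right_mono zeta_reg_lower_bound s3) auto
		also have "... = norm (s-1) * norm (poly P (2 powr (-s)))" using rel[OF s] by (metis norm_mult)
		also have "...<=norm (s-1)*(C*2^d)"
		proof (intro mult_left_mono)
			have "norm (poly P (2 powr (-s)))<=C*(1+norm (2 powr (-s) :: complex))^d" by (rule C)
			also have "...<=C*2^d" using C n2 by (intro mult_left_mono power_mono) auto
			finally show "norm (poly P (2 powr (-s)))<=C*2^d" .
		qed auto
		finally have "norm (K s)<=2*(C*2^d)" using s1 by (simp add: field_simps)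
		also have "...<=B'" using B by (simp add: B'_def)
		also have "... = B'*1*1" by simp
		also have "...<=B'*(1+norm s)^m*(1+1/(Re s-1/2)^2)" using B' by (intro mult_mono) (auto simp: one_le_power)
		finally show ?thesis .
	qed
	\<comment> \<open>P(2^(s-1)) costs exp(d Re s) and the power of pi costs exp(Re s), while 1/Gamma
	  at s/2 gains exp(-(d+4) Re s). The remaining exp(-3 Re s) pays for the polynomial factor exp(Re s
	  + |Im s|) and leaves exp(-2 Re s).\<close>
	define l where "l = 2*(real d+4)"
	obtain Cl where Cl: "Cl > 0" "!!x. x>=1 ==> exp (l * x)<=Cl * Gamma x" using Gamma_real_superexponential[of 1 l] by auto
	have Rbd: "norm (R s)<=exp (Re s)*((1+norm s) * exp \<bar>Im s\<bar>*(Cl * exp (- l * Re s/2)))" if s: "Re s > 1/2" for s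
	proof -
		define w where "w = s/2+1"
		have w: "Re w = Re s/2+1" "Im w = Im s/2" by (auto simp: w_def)
		have wpos: "Re w > 0" "Re w>=1" using s w by auto
		have nw: "norm w<=1+norm s"
		proof -
			have "norm w<=norm (s/2)+norm (1::complex)" unfolding w_def by (rule norm_triangle_ineq)
			also have "... = norm s/2+1" by (simp add: norm_divide)
			also have "...<=1+norm s" using norm_ge_zero[of s] by linarith
			finally show ?thesis .
		qed
		have gpos: "Gamma (Re w) > 0" using wpos by (intro Gamma_real_pos) auto
		have "exp (l * Re s/2)<=exp (l * Re w)" by (auto simp: w l_def algebra_simps)
		also have "...<=Cl * Gamma (Re w)" by (rule Cl(2)) (use wpos in auto)
		finally have e1: "exp (l * Re s/2)<=Cl * Gamma (Re w)" .
		have e2: "exp (l * Re s/2) * exp (- l * Re s/2) = 1" by (simp add: mult_exp_exp)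
		have "exp (l * Re s/2) * exp (- l * Re s/2)<=Cl * Gamma (Re w) * exp (- l * Re s/2)" using e1 by (intro mult_right_mono) auto
		hence "1<=(Cl * exp (- l * Re s/2)) * Gamma (Re w)" unfolding e2 by (simp only: mult_ac)
		hence g1: "1/Gamma (Re w)<=Cl * exp (- l * Re s/2)" by (simp only: pos_divide_le_eq[OF gpos])
		have "norm (inverse (Gamma w))<=norm w/Re w * exp (pi * \<bar>Im w\<bar>/2)/Gamma (Re w)"
			by (rule Gamma_vertical_bound) (use wpos in auto)
		also have "... = norm w/Re w * exp (pi * \<bar>Im w\<bar>/2)*(1/Gamma (Re w))" by simp
		also have "...<=(1+norm s) * exp \<bar>Im s\<bar>*(Cl * exp (- l * Re s/2))"
		proof (intro mult_mono g1)
			have "norm w/Re w<=norm w/1" using wpos by (intro divide_left_mono) auto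
			thus "norm w/Re w<=1+norm s" using nw by simp
			have "pi * \<bar>Im s\<bar><=4 * \<bar>Im s\<bar>" using pi_less_4 by (intro mult_right_mono) auto
			thus "exp (pi * \<bar>Im w\<bar>/2)<=exp \<bar>Im s\<bar>" by (simp add: w)
		qed (use gpos Cl in auto)
		finally have i: "norm (rGamma w)<=(1+norm s) * exp \<bar>Im s\<bar>*(Cl * exp (- l * Re s/2))" by (simp only: rGamma_inverse_Gamma)
		have "norm (complex_of_real pi powr (s/2)) = pi powr (Re s/2)" by (subst norm_of_real_powr) auto
		also have "...<=exp (Re s)" using s by (intro pi_powr_half_le_exp) auto
		finally show ?thesis unfolding R_def norm_mult using i by (intro mult_mono) (auto simp: w_def)
	qed
	have Pbd: "norm (poly P (2 powr (s-1)))<=C*2^d * exp (real d * Re s)" if s: "Re s > 1/2" for s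
	proof -
		have "norm (2 powr (s-1) :: complex) = 2 powr (Re s-1)" using norm_of_real_powr[of 2 "s-1"] by simp
		also have "...<=exp (Re s)"
		proof -
			have "(Re s-1) * ln 2<=Re s*1"
			proof (cases "Re s>=1")
				case True
				thus ?thesis using ln_le_minus_one[of 2] by (intro mult_mono) auto
			next
				case False
				hence "(Re s-1) * ln 2<=0" by (intro mult_nonpos_nonneg) auto
				thus ?thesis using s by simp
			qed
			thus ?thesis by (simp add: powr_def)
		qed
		finally have n: "norm (2 powr (s-1) :: complex)<=exp (Re s)" .
		have "1<=exp (Re s)" using s by simp
		hence n': "1+norm (2 powr (s-1) :: complex)<=2 * exp (Re s)" using n by linarith
		have "norm (poly P (2 powr (s-1)))<=C*(1+norm (2 powr (s-1) :: complex))^d" by (rule C)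
		also have "...<=C*(2 * exp (Re s))^d" using C n' by (intro mult_left_mono power_mono) auto
		also have "... = C*2^d * exp (real d * Re s)" by (simp add: power_mult_distrib exp_of_nat_mult)
		finally show ?thesis .
	qed
	define C1 where "C1 = C*2^d * B' * Cl*(fact (m+2) * exp 1) * exp 2"
	have C1: "C1 > 0" using C B' Cl by (simp add: C1_def)
	have G1bd: "norm (G1 s)<=(C1/exp 2)*(1+1/(Re s-1/2)^2) * exp (2 * \<bar>Im s\<bar>-2 * Re s)" if s: "Re s > 1/2" for s
	proof -
		have "norm (G1 s) = norm s * norm (poly P (2 powr (s-1))) * norm (K s) * norm (R s)" by (simp add: G1_def norm_mult)
		also have "...<=(1+norm s)*(C*2^d * exp (real d * Re s))*(B'*(1+norm s)^m*(1+1/(Re s-1/2)^2))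
				* (exp (Re s)*((1+norm s) * exp \<bar>Im s\<bar>*(Cl * exp (- l * Re s/2))))" using C B' Cl by (intro mult_mono Pbd Kbd Rbd s) auto
		also have "... = C*2^d * B' * Cl*(1+norm s)^(m+2)*(1+1/(Re s-1/2)^2) *
				(exp (real d * Re s) * exp (Re s) * exp \<bar>Im s\<bar> * exp (- l * Re s/2))" by (simp add: power_add power2_eq_square mult_ac)
		also have "exp (real d * Re s) * exp (Re s) * exp \<bar>Im s\<bar> * exp (- l * Re s/2) = exp (\<bar>Im s\<bar>-3 * Re s)"
		proof -
			have "real d * Re s+Re s + \<bar>Im s\<bar>+(- l * Re s/2) = \<bar>Im s\<bar>-3 * Re s" by (simp add: l_def field_simps)
			thus ?thesis by (simp only: mult_exp_exp)
		qed
		also have "C*2^d * B' * Cl*(1+norm s)^(m+2)*(1+1/(Re s-1/2)^2) * exp (\<bar>Im s\<bar>-3 * Re s)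
			<= C*2^d * B' * Cl*((fact (m+2) * exp 1) * exp (Re s + \<bar>Im s\<bar>))*(1+1/(Re s-1/2)^2) * exp (\<bar>Im s\<bar>-3 * Re s)"
		proof (intro mult_right_mono mult_left_mono)
			have "(1+norm s)^(m+2)<=(fact (m+2) * exp 1) * exp (norm s)" by (rule power_le_exp) auto
			also have "...<=(fact (m+2) * exp 1) * exp (Re s + \<bar>Im s\<bar>)" using cmod_le[of s] s by (intro mult_left_mono) auto
			finally show "(1+norm s)^(m+2)<=(fact (m+2) * exp 1) * exp (Re s + \<bar>Im s\<bar>)" .
		qed (use C B' Cl in auto)
		also have "... = (C1/exp 2)*(1+1/(Re s-1/2)^2)*(exp (Re s + \<bar>Im s\<bar>) * exp (\<bar>Im s\<bar>-3 * Re s))"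
			by (simp add: C1_def)
		also have "exp (Re s + \<bar>Im s\<bar>) * exp (\<bar>Im s\<bar>-3 * Re s) = exp (2 * \<bar>Im s\<bar>-2 * Re s)" by (simp flip: exp_add)
		finally show ?thesis .
	qed
	define G where "G = (%s. if Re s>=1/2 then G1 s else G1 (1-s))"
	\<comment> \<open>\<open>K\<close> is analytic in a neighbourhood of the line, so xi G1 = Q
	  continues a little to its left. Dividing by xi at points where it does not vanish gives G1 s = G1
	  (1-s) there, hence near z.\<close>
	have glue: "\<exists>r>0. \<forall>s\<in>ball z r. G s = G1 s" if z: "Re z = 1/2" for z
	proof -
		have "z \<in> S" "1-z \<in> S" using S z by auto
		then obtain r1 r2 where r12: "r1 > 0" "ball z r1 \<subseteq> S" "r2 > 0" "ball (1-z) r2 \<subseteq> S" using S(1) openE by metis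
		define r where "r = min (min r1 r2) 1"
		have r: "r > 0" "r<=1" "ball z r \<subseteq> S" "ball (1-z) r \<subseteq> S" using r12 by (auto simp: r_def)
		have Re_w: "Re w > -1" "Re w < 2" if "w \<in> ball z r" for w
		proof -
			have "\<bar>Re (z-w)\<bar> < 1" using that r abs_Re_le_cmod[of "z-w"] by (simp add: dist_norm)
			thus "Re w > -1" "Re w < 2" using z by auto
		qed
		have xiG': "xi s * G1 s = Q s" if s: "s \<in> ball z' r" and z': "z' = z \<or> z' = 1-z" for s z'
		proof (rule analytic_continuation_open[of "ball z' r \<inter> {s. Re s > 1/2}" "ball z' r" "%s. xi s * G1 s" Q])
			have Rez: "Re z' = 1/2" using z z' by auto
			show "ball z' r \<inter> {s. Re s > 1/2}~={}"
			proof -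
				have "z' + of_real (r/2) \<in> ball z' r \<inter> {s. Re s > 1/2}" using r Rez by (auto simp: dist_norm)
				thus ?thesis by blast
			qed
			have "Re w > -1" if "w \<in> ball z' r" for w using abs_Re_le_cmod[of "z'-w"] that r Rez by (simp add: dist_norm)
			hence "xi holomorphic_on ball z' r" by (intro holomorphic_on_subset[OF holomorphic_xi]) auto
			moreover have "ball z' r \<subseteq> S" using r z' by blast
			hence "G1 holomorphic_on ball z' r" by (rule holomorphic_on_subset[OF hol_G1])
			ultimately show "(%s. xi s * G1 s) holomorphic_on ball z' r" by (intro holomorphic_intros)
			show "open (ball z' r \<inter> {s. Re s > 1/2})" by (intro open_Int open_Re_gt) auto
		qed (use s xiG hol_Q in auto)
		obtain w where w: "w \<in> ball z r" "xi w~=0" using xi_nonzero_on_ball[OF z r(1,2)] by blast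
		define U where "U = {s \<in> ball z r. xi s~=0}"
		have cont: "continuous_on (ball z r) xi" using holomorphic_xi Re_w by (intro holomorphic_on_imp_continuous_on[OF holomorphic_on_subset]) auto
		have "open U"
		proof -
			have "U = ball z r \<inter> xi -` (- {0})" by (auto simp: U_def)
			thus ?thesis using continuous_open_preimage[OF cont open_ball, of "- {0}"] by auto
		qed
		have inr: "1-s \<in> ball (1-z) r" if "s \<in> ball z r" for s using that by (simp add: dist_norm norm_minus_commute)
		have U: "G1 s = G1 (1-s)" if "s \<in> U" for s
		proof -
			have s: "s \<in> ball z r" "xi s~=0" using that by (auto simp: U_def)
			have "xi s * G1 s = Q s" using xiG'[of s z] s by simp
			moreover have "xi (1-s) * G1 (1-s) = Q (1-s)" using xiG'[of "1-s" "1-z"] inr[OF s(1)] by simp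
			moreover have "xi s = xi (1-s)" using Re_w[OF s(1)] by (intro xi_reflect) auto
			ultimately show ?thesis using s(2) Qsym by (metis mult_left_cancel)
		qed
		have eq: "G1 s = G1 (1-s)" if s: "s \<in> ball z r" for s
		proof (rule analytic_continuation_open[of U "ball z r" G1 "%s. G1 (1-s)"])
			show "G1 holomorphic_on ball z r" using hol_G1 r(3) by (rule holomorphic_on_subset)
			have "G1 \<circ> (%s. 1-s) holomorphic_on ball z r"
				by (rule holomorphic_on_compose_gen[OF _ hol_G1]) (use inr r in \<open>auto intro!: holomorphic_intros\<close>)
			thus "(%s. G1 (1-s)) holomorphic_on ball z r" by (simp add: o_def)
		qed (use \<open>open U\<close> w U s in \<open>auto simp: U_def\<close>)
		show ?thesis using r(1) eq by (intro exI[of _ r]) (auto simp: G_def)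
	qed
	have "G analytic_on {z}" for z
	proof -
		consider "Re z > 1/2" | "Re z < 1/2" | "Re z = 1/2" by linarith
		thus ?thesis
		proof cases
			case 1
			have "G1 analytic_on {z}" by (rule holomorphic_on_imp_analytic_at[OF hol_G1 S(1)]) (use S(2) 1 in auto)
			moreover have "eventually (%w. w \<in> {w. Re w > 1/2}) (nhds z)" by (rule eventually_nhds_in_open[OF open_Re_gt]) (use 1 in auto)
			hence "eventually (%w. G w = G1 w) (nhds z)" by eventually_elim (auto simp: G_def)
			ultimately show ?thesis using analytic_at_cong by blast
		next
			case 2
			have "G1 \<circ> (%s. 1-s) analytic_on {z}" by (rule analytic_on_compose_gen[where T = S])
					 (use 2 S hol_G1 in \<open>auto intro!: analytic_intros simp: analytic_on_open\<close>)
			moreover have "eventually (%w. w \<in> {w. Re w < 1/2}) (nhds z)" by (rule eventually_nhds_in_open[OF open_halfspace_Re_lt]) (use 2 in auto)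
			hence "eventually (%w. G w = (G1 \<circ> (%s. 1-s)) w) (nhds z)" by eventually_elim (auto simp: G_def)
			ultimately show ?thesis using analytic_at_cong by blast
		next
			case 3
			obtain r where r: "r > 0" "!!s. s \<in> ball z r ==> G s = G1 s" using glue[OF 3] by blast
			have "G1 analytic_on {z}" by (rule holomorphic_on_imp_analytic_at[OF hol_G1 S(1)]) (use S(2) 3 in auto)
			moreover have "eventually (%w. w \<in> ball z r) (nhds z)" using r by (intro eventually_nhds_in_open) auto
			hence "eventually (%w. G w = G1 w) (nhds z)" by eventually_elim (use r in auto)
			ultimately show ?thesis using analytic_at_cong by blast
		qed
	qed
	hence hol_G: "G holomorphic_on UNIV" by (meson analytic_on_analytic_at analytic_imp_holomorphic)
	have Gbd1: "norm (G s)<=C1*(1+1/(Re s-1/2)^2) * exp (2 * \<bar>Im s\<bar>-2 * \<bar>Re s\<bar>)" if s: "Re s~=1/2" for s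
	proof -
		define s' where "s' = (if Re s > 1/2 then s else 1-s)"
		have s': "Re s' > 1/2" "\<bar>Im s'\<bar> = \<bar>Im s\<bar>" "(Re s'-1/2)^2 = (Re s-1/2)^2" "G s = G1 s'" "2 * \<bar>Re s\<bar>-2<=2 * Re s'"
			using s by (auto simp: s'_def G_def power2_eq_square algebra_simps)
		have "norm (G s)<=(C1/exp 2)*(1+1/(Re s-1/2)^2) * exp (2 * \<bar>Im s\<bar>-2 * Re s')" using G1bd[OF s'(1)] s' by simp
		also have "...<=(C1/exp 2)*(1+1/(Re s-1/2)^2) * exp (2+(2 * \<bar>Im s\<bar>-2 * \<bar>Re s\<bar>))"
			using C1 s'(5) by (intro mult_left_mono) auto
		also have "... = C1*(1+1/(Re s-1/2)^2) * exp (2 * \<bar>Im s\<bar>-2 * \<bar>Re s\<bar>)" by (simp add: exp_add)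
		finally show ?thesis .
	qed
	have Gbd: "norm (G s)<=(8 * C1 * exp 4) * exp (2 * \<bar>Im s\<bar>-2 * \<bar>Re s\<bar>)" for s
	proof (cases "\<bar>Re s-1/2\<bar>>=1/2")
		case True
		hence "(1/2)^2 <= \<bar>Re s-1/2\<bar>^2" by (intro power_mono) auto
		hence q: "1/4<=(Re s-1/2)^2" by (simp add: power2_eq_square)
		have "1/y<=4" if "1/4<=y" for y :: real using that by (simp add: field_simps)
		from this[OF q] have 5: "1+1/(Re s-1/2)^2<=8" by linarith
		have "Re s~=1/2" using True by auto
		hence "norm (G s)<=C1*(1+1/(Re s-1/2)^2) * exp (2 * \<bar>Im s\<bar>-2 * \<bar>Re s\<bar>)" by (rule Gbd1)
		also have "...<=C1*8 * exp (2 * \<bar>Im s\<bar>-2 * \<bar>Re s\<bar>)" using C1 5 by (intro mult_mono) auto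
		also have "...<=(8 * C1 * exp 4) * exp (2 * \<bar>Im s\<bar>-2 * \<bar>Re s\<bar>)"
			using C1 by (intro mult_right_mono) (auto simp: mult_le_cancel_left1)
		finally show ?thesis .
	next
		case False
		define s0 where "s0 = Complex (1/2) (Im s)"
		\<comment> \<open>The extra factor has double zeros where the unit circle around s0 meets the
		  critical line. On that circle, with u = z - s0, its modulus is 4 (Re u)^2, which absorbs 1/(Re
		  u)^2; at s itself its modulus is at least 1.\<close>
		define h where "h = (%z. G z*((z-s0)^2+1)^2)"
		have "norm (h s)<=8 * C1 * exp (2 * \<bar>Im s\<bar>+2)"
		proof (rule maximum_modulus_frontier[of h "cball s0 1"])
			have hol: "h holomorphic_on A" for A unfolding h_def by (intro holomorphic_intros holomorphic_on_subset[OF hol_G]) auto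
			show "h holomorphic_on interior (cball s0 1)" "continuous_on (closure (cball s0 1)) h" using hol holomorphic_on_imp_continuous_on by blast+
			have "norm (s0-s) = \<bar>Re s-1/2\<bar>" by (simp add: s0_def cmod_def)
			thus "s \<in> cball s0 1" using False by (simp add: dist_norm)
			fix z assume "z \<in> frontier (cball s0 1)"
			hence "norm (z-s0) = 1" by (simp add: dist_norm norm_minus_commute)
			define u where "u = z-s0"
			have u: "norm u = 1" using \<open>norm (z - s0) = 1\<close> by (simp add: u_def)
			have "u^2+1 = u*(u+cnj u)" using complex_norm_square[of u] u by (simp add: algebra_simps power2_eq_square)
			also have "u+cnj u = of_real (2 * Re u)" by (simp add: complex_add_cnj)
			finally have "norm (u^2+1) = 2 * \<bar>Re u\<bar>" using u by (simp add: norm_mult)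
			hence nh: "norm (h z) = norm (G z)*(4*(Re u)^2)" by (simp add: h_def u_def[symmetric] norm_mult norm_power power_mult_distrib)
			have Rz: "Re z-1/2 = Re u" "Im z = Im s+Im u" by (auto simp: u_def s0_def)
			have ru: "(Re u)^2<=1" using u abs_Re_le_cmod[of u] by (simp add: abs_square_le_1)
			have iu: "\<bar>Im u\<bar><=1" using u abs_Im_le_cmod[of u] by simp
			show "norm (h z)<=8 * C1 * exp (2 * \<bar>Im s\<bar>+2)"
			proof (cases "Re u = 0")
				case True
				thus ?thesis using nh C1 by simp
			next
				case F: False
				hence "Re z~=1/2" using Rz by auto
				hence "norm (G z)<=C1*(1+1/(Re u)^2) * exp (2 * \<bar>Im z\<bar>-2 * \<bar>Re z\<bar>)" using Gbd1[of z] Rz by simp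
				also have "...<=C1*(1+1/(Re u)^2) * exp (2 * \<bar>Im s\<bar>+2)"
				proof -
					have "2 * \<bar>Im z\<bar>-2 * \<bar>Re z\<bar><=2 * \<bar>Im s\<bar>+2" using iu Rz abs_triangle_ineq[of "Im s" "Im u"] by linarith
					thus ?thesis using C1 by (intro mult_left_mono) auto
				qed
				finally have "norm (h z)<=C1*(1+1/(Re u)^2) * exp (2 * \<bar>Im s\<bar>+2)*(4*(Re u)^2)"
					unfolding nh by (intro mult_right_mono) auto
				also have "... = C1*(4*(Re u)^2+4) * exp (2 * \<bar>Im s\<bar>+2)" using F by (simp add: field_simps)
				also have "...<=C1*8 * exp (2 * \<bar>Im s\<bar>+2)" using C1 ru by (intro mult_right_mono mult_left_mono) auto
				finally show ?thesis by (simp add: mult_ac)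
			qed
		qed auto
		moreover have "norm (G s)<=norm (h s)"
		proof -
			have "s-s0 = of_real (Re s-1/2)" by (simp add: s0_def complex_eq_iff)
			hence "(s-s0)^2+1 = of_real ((Re s-1/2)^2+1)" by simp
			hence "norm ((s-s0)^2+1) = (Re s-1/2)^2+1" by (simp only: norm_of_real) simp
			hence "1<=norm (((s-s0)^2+1)^2)" by (simp only: norm_power) (simp add: one_le_power)
			hence "norm (G s)*1<=norm (G s) * norm (((s-s0)^2+1)^2)" by (intro mult_left_mono) auto
			thus ?thesis by (simp add: h_def norm_mult)
		qed
		moreover have "8 * C1 * exp (2 * \<bar>Im s\<bar>+2)<=8 * C1 * exp (4+(2 * \<bar>Im s\<bar>-2 * \<bar>Re s\<bar>))"
		proof -
			have "\<bar>Re s\<bar><=1" using False by (smt (verit) field_sum_of_halves)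
			thus ?thesis using C1 by (intro mult_left_mono) auto
		qed
		ultimately have "norm (G s)<=8 * C1 * exp (4+(2 * \<bar>Im s\<bar>-2 * \<bar>Re s\<bar>))" by linarith
		thus ?thesis by (simp add: exp_add)
	qed
	have G0: "G s = 0" for s by (rule entire_eq_0_of_growth[OF hol_G, of 2 "8 * C1 * exp 4"]) (use Gbd in auto)
	have Q0: "Q s = 0" if "Re s > 1/2" for s using xiG[OF that] G0[of s] that by (simp add: G_def)
	\<comment> \<open>For x > 1 the factor s (s-1) of \<open>Q\<close> is not 0. Both arguments of P
	  depend injectively on x, so P would have infinitely many roots.\<close>
	have roots: "poly P (2 powr (- of_real x)) = 0 \<or> poly P (2 powr (of_real x-1)) = 0" if "x > 1" for x :: real
		using Q0[of "of_real x"] that by (auto simp: Q_def)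
	have fin: "finite {x. poly P x = 0}" using P by (rule poly_roots_finite)
	have inj1: "inj (%x::real. 2 powr (- complex_of_real x))"
	proof (rule injI)
		fix x y :: real assume "2 powr (- complex_of_real x) = 2 powr (- complex_of_real y)"
		hence "norm (2 powr (- complex_of_real x)) = norm (2 powr (- complex_of_real y))" by simp
		hence "2 powr (-x) = (2 powr (-y) :: real)" using norm_of_real_powr[of 2 "- complex_of_real x"] norm_of_real_powr[of 2 "- complex_of_real y"] by simp
		thus "x = y" by (simp add: powr_inj)
	qed
	have inj2: "inj (%x::real. 2 powr (complex_of_real x-1))"
	proof (rule injI)
		fix x y :: real assume "2 powr (complex_of_real x-1) = 2 powr (complex_of_real y-1)"
		hence "norm (2 powr (complex_of_real x-1)) = norm (2 powr (complex_of_real y-1))" by simp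
		hence "2 powr (x-1) = (2 powr (y-1) :: real)" using norm_of_real_powr[of 2 "complex_of_real x-1"] norm_of_real_powr[of 2 "complex_of_real y-1"] by simp
		thus "x = y" by (simp add: powr_inj)
	qed
	have "finite ((%x::real. 2 powr (- complex_of_real x)) -` {x. poly P x = 0} \<union> (%x::real. 2 powr (complex_of_real x-1)) -` {x. poly P x = 0})"
		by (intro finite_UnI finite_vimageI fin inj1 inj2)
	moreover have "{1<..} \<subseteq> ((%x::real. 2 powr (- complex_of_real x)) -` {x. poly P x = 0} \<union> (%x::real. 2 powr (complex_of_real x-1)) -` {x. poly P x = 0})"
		using roots by auto
	ultimately have "finite {1::real<..}" by (rule finite_subset[rotated])
	thus False by (simp add: infinite_Ioi)
qed

section \<open>What a one-sided bound implies for the continuation\<close>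

lemma minus_half_nonzero:
	assumes "Re s > 1/2"
	shows "s-1/2~=0"
proof
	assume "s-1/2 = 0"
	hence "Re s = Re (1/2)" by (simp only: right_minus_eq)
	thus False using assms by simp
qed

lemma times_2_neq_1: "1 < Re z*2 ==> z*2~=1" using minus_half_nonzero[of z] by auto

context one_sided_bound
begin

text \<open>Landau's theorem is applied to the series with coefficients ((b+\<delta>) sqrt n -
  F(n))/n, which sums to (b+\<delta>) zeta(s+1/2) - (T s + H s)/s. Solving for \<open>T\<close>
  gives its analyticity, and by positivity of the coefficients the series at s is bounded by its
  value \<phi> at Re s. This is the only place where the bound on the partial sums enters.\<close>

lemma core:
	assumes \<delta>: "\<delta> > 0"
	obtains E \<phi> CE where "E holomorphic_on UNIV" "!!s. Re s > 0 ==> norm (E s)<=CE"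
		"!!s. Re s > 1/2 ==> T analytic_on {s}"
		"!!s. Re s > 1/2 ==> norm (T s)<=norm s*(\<bar>b + \<delta>\<bar> * norm (zeta_reg (s+1/2)/(s-1/2))+norm (E s) + \<phi> (Re s))+norm (H s)"
		"((%x. (x-1/2) * \<phi> x) \<longlongrightarrow> \<delta>) (at_right (1/2))"
		"!!x y. 1/2 < x ==> x<=y ==> \<phi> y <= \<phi> x" "!!x. \<phi> x>=0"
proof -
	obtain N0 where N0: "!!N. N>=N0 ==> F N<=(b + \<delta>) * sqrt (real N)"
		using upper[OF \<delta>] by (auto simp: eventually_at_top_linorder F_def)
	\<comment> \<open>The finitely many coefficients that may be negative are set to 0 in
	  \<open>a\<close>; the Dirichlet polynomial \<open>E\<close> accounts for the difference.\<close>
	define a0 where "a0 = (%n. ((b + \<delta>) * sqrt (real (Suc n))-F (Suc n))/real (Suc n))"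
	define a where "a = (%n. if Suc n>=N0 then a0 n else 0)"
	define E where "E = (%s. \<Sum>n<N0. of_real (a0 n-a n) * of_nat (Suc n) powr (-s) :: complex)"
	have a: "a n>=0" for n using N0[of "Suc n"] by (auto simp: a_def a0_def intro!: divide_nonneg_pos)
	have a0_le: "\<bar>a0 n\<bar> <= \<bar>b + \<delta>\<bar>+1" for n
	proof -
		have "sqrt (real (Suc n))<=sqrt (real (Suc n)^2)" unfolding real_sqrt_le_iff by (simp add: power2_eq_square)
		hence sq: "sqrt (real (Suc n))<=real (Suc n)" by simp
		have "\<bar>(b + \<delta>) * sqrt (real (Suc n))-F (Suc n)\<bar> <= \<bar>b + \<delta>\<bar> * sqrt (real (Suc n)) + \<bar>F (Suc n)\<bar>"
			by (rule order_trans[OF abs_triangle_ineq4]) (simp add: abs_mult)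
		also have "... <= \<bar>b + \<delta>\<bar> * real (Suc n)+real (Suc n)" using sq F_le[of "Suc n"] by (intro add_mono mult_left_mono) auto
		also have "... = (\<bar>b + \<delta>\<bar>+1) * real (Suc n)" by (simp add: algebra_simps)
		finally show ?thesis by (simp add: a0_def abs_divide divide_le_eq)
	qed
	have a_le: "a n <= \<bar>b + \<delta>\<bar>+1" for n using a0_le[of n] by (auto simp: a_def)
	have sm1: "summable (%n. a n * real (Suc n) powr (-x))" if "x > 1" for x
	proof (rule summable_comparison_test)
		show "\<exists>N. \<forall>n\<ge>N. norm (a n * real (Suc n) powr (-x))<=(\<bar>b + \<delta>\<bar>+1) * real (Suc n) powr (-x)"
			using a a_le by (auto simp: abs_mult intro!: mult_right_mono)
		show "summable (%n. (\<bar>b + \<delta>\<bar>+1) * real (Suc n) powr (-x))" using that by (intro summable_mult summable_Suc_powr)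
	qed
	define \<Phi> where "\<Phi> = (%s. \<Sum>n. of_real (a n) * of_nat (Suc n) powr (-s) :: complex)"
	define D where "D = (%s. of_real (b + \<delta>)*(zeta_reg (s+1/2)/(s-1/2))-(T s+H s)/s-E s)"
	have holE: "E holomorphic_on A" for A unfolding E_def by (intro holomorphic_intros)
	have D_eq: "D s = \<Phi> s" if s: "Re s > 1" for s
	proof -
		have s0: "s~=0" using s by auto
		have pw: "of_nat (Suc n) powr (-(s+1/2)) = of_real (sqrt (real (Suc n))/real (Suc n))*(of_nat (Suc n) powr (-s) :: complex)" for n
		proof -
			have "-(s+1/2) = -s + of_real (-1/2)" by simp
			hence "of_nat (Suc n) powr (-(s+1/2)) = of_nat (Suc n) powr (-s)*(of_nat (Suc n) powr (of_real (-1/2)) :: complex)" by (simp only: powr_add)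
			also have "of_nat (Suc n) powr (of_real (-1/2)) = complex_of_real (real (Suc n) powr (-1/2))"
				using powr_of_real[of "real (Suc n)" "-1/2"] by simp
			also have "real (Suc n) powr (-1/2) = sqrt (real (Suc n))/real (Suc n)"
				using real_div_sqrt[of "real (Suc n)"] by (simp add: powr_minus_divide powr_half_sqrt divide_simps del: of_nat_Suc)
			finally show ?thesis by (simp only: mult.commute)
		qed
		have F1: "of_nat (Suc n) powr (-s-1) = of_nat (Suc n) powr (-s)/(of_nat (Suc n) :: complex)" for n by (simp add: powr_diff del: of_nat_Suc)
		have sz: "(%n. of_nat (Suc n) powr (-(s+1/2)) :: complex) sums (zeta_reg (s+1/2)/(s-1/2))"
		proof -
			have R: "Re (s+1/2) > 1" using s by simp
			have "s+1/2-1 = s-1/2" by (simp add: field_simps)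
			moreover have "s-1/2~=0" using s by (intro minus_half_nonzero) auto
			ultimately have "zeta_reg (s+1/2)/(s-1/2) = (\<Sum>n. of_nat (Suc n) powr (-(s+1/2)))" using zeta_reg_eq_series[OF R] by simp
			thus ?thesis using summable_sums[OF summable_norm_cancel[OF summable_dirichlet_zeta[OF R]]] by simp
		qed
		have sF: "(%n. of_real (F (Suc n)) * of_nat (Suc n) powr (-s-1)) sums ((T s+H s)/s)"
		proof -
			have "(T s+H s)/s = (\<Sum>n. of_real (F (Suc n)) * of_nat (Suc n) powr (-s-1))" using T_eq_abel[OF s] s0 by (simp add: field_simps)
			thus ?thesis using summable_sums[OF summable_F_series[OF s]] by simp
		qed
		have s_a0: "(%n. of_real (a0 n) * of_nat (Suc n) powr (-s)) sums
				 (of_real (b + \<delta>)*(zeta_reg (s+1/2)/(s-1/2))-(T s+H s)/s)"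
		proof -
			have "of_real (b + \<delta>) * of_nat (Suc n) powr (-(s+1/2))-of_real (F (Suc n)) * of_nat (Suc n) powr (-s-1)
				 = of_real (a0 n)*(of_nat (Suc n) powr (-s) :: complex)" for n
				unfolding pw F1 a0_def by (simp add: diff_divide_distrib left_diff_distrib del: of_nat_Suc)
			with sums_diff[OF sums_mult[OF sz, of "of_real (b + \<delta>)"] sF] show ?thesis by simp
		qed
		have "(%n. of_real (a0 n-a n) * of_nat (Suc n) powr (-s)) sums E s" unfolding E_def by (rule sums_finite) (auto simp: a_def)
		from sums_diff[OF s_a0 this] have "(%n. of_real (a n) * of_nat (Suc n) powr (-s)) sums D s" by (simp add: D_def algebra_simps)
		thus ?thesis by (simp add: \<Phi>_def sums_iff)
	qed
	have D_an: "D analytic_on (of_real ` {1/2<..})"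
	proof (rule iffD2[OF analytic_on_analytic_at], rule ballI)
		fix z assume "z \<in> complex_of_real ` {1/2<..}"
		then obtain x where x: "z = of_real x" "x > 1/2" by auto
		have "H analytic_on {z}" by (rule holomorphic_on_imp_analytic_at[OF holomorphic_H open_Re_gt]) (use x in auto)
		moreover have "E analytic_on {z}" by (rule holomorphic_on_imp_analytic_at[OF holE open_UNIV]) auto
		moreover have "(%s. zeta_reg (s+1/2)) analytic_on {z}"
		proof -
			have "zeta_reg \<circ> (%s. s+1/2) analytic_on {z}" by (rule analytic_on_compose)
					 (use x holomorphic_on_imp_analytic_at[OF holomorphic_zeta_reg open_Re_gt, of "z+1/2"] in \<open>auto intro!: analytic_intros\<close>)
			thus ?thesis by (simp add: o_def)
		qed
		moreover have "T analytic_on {z}" using T_an x by simp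
		moreover have "z-1/2~=0" by (rule minus_half_nonzero) (use x in simp)
		moreover have "z~=0" using x by auto
		ultimately show "D analytic_on {z}" unfolding D_def by (intro analytic_intros) simp_all
	qed
	have sm: "summable (%n. a n * real (Suc n) powr (-x))" if "x > 1/2" for x
		by (rule Landau_dirichlet_nonneg[OF a D_an sm1 _ that]) (use D_eq in \<open>auto simp: \<Phi>_def\<close>)
	have hol\<Phi>: "\<Phi> holomorphic_on {s. Re s > 1/2}" unfolding \<Phi>_def by (rule holomorphic_dirichlet_nonneg[OF a sm])
	define T2 where "T2 = (%s. s*(of_real (b + \<delta>)*(zeta_reg (s+1/2)/(s-1/2))-E s - \<Phi> s)-H s)"
	have "(%s. zeta_reg (s+1/2)) holomorphic_on {s. Re s > 1/2}"
	proof -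
		have "zeta_reg \<circ> (%s. s+1/2) holomorphic_on {s. Re s > 1/2}"
			by (rule holomorphic_on_compose_gen[OF _ holomorphic_zeta_reg]) (auto intro!: holomorphic_intros)
		thus ?thesis by (simp add: o_def)
	qed
	hence holT2: "T2 holomorphic_on {s. Re s > 1/2}"
		unfolding T2_def by (intro holomorphic_intros holE hol\<Phi> holomorphic_on_subset[OF holomorphic_H])
			(auto dest: times_2_neq_1)
	have TT2: "T s = T2 s" "T analytic_on {s}" if s: "Re s > 1/2" for s
	proof -
		have m: "T nicely_meromorphic_on {s. Re s > 1/2}" using T_mero by (rule nicely_meromorphic_on_subset) auto
		have e: "T s = T2 s" if "s \<in> {s. Re s > 1}" for s
		proof -
			have "s~=0" using that by auto
			thus ?thesis using D_eq[of s] that by (simp add: T2_def D_def field_simps)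
		qed
		have c: "connected {s. Re s > (1/2::real)}" by (intro convex_connected convex_halfspace_Re_gt)
		have ne: "{s. Re s > (1::real)}~={}" by (auto intro!: exI[of _ 2])
		have sub: "{s. Re s > (1::real)} \<subseteq> {s. Re s > 1/2}" by auto
		have s': "s \<in> {s. Re s > 1/2}" using s by simp
		show "T s = T2 s" by (rule nicely_meromorphic_eq_holomorphic(1)[OF m holT2 open_Re_gt c open_Re_gt ne sub e s'])
		show "T analytic_on {s}" by (rule nicely_meromorphic_eq_holomorphic(2)[OF m holT2 open_Re_gt c open_Re_gt ne sub e s'])
	qed
	define \<phi> where "\<phi> = (%x. if x > 1/2 then \<Sum>n. a n * real (Suc n) powr (-x) else 0)"
	have \<Phi>_le: "norm (\<Phi> s) <= \<phi> (Re s)" if s: "Re s > 1/2" for s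
	proof -
		have n: "norm (of_real (a n) * of_nat (Suc n) powr (-s) :: complex) = a n * real (Suc n) powr (- Re s)" for n
			unfolding norm_mult norm_Suc_powr norm_of_real using a[of n] by simp
		have "norm (\<Phi> s)<=(\<Sum>n. a n * real (Suc n) powr (- Re s))"
			unfolding \<Phi>_def using n by (intro norm_suminf_le sm[OF s]) (metis order_refl)
		thus ?thesis using s by (simp add: \<phi>_def)
	qed
	have \<Phi>_real: "\<Phi> (of_real x) = of_real (\<phi> x)" if x: "x > 1/2" for x
	proof -
		have "of_real (a n) * of_nat (Suc n) powr (- of_real x) = complex_of_real (a n * real (Suc n) powr (-x))" for n
			using powr_of_real[of "real (Suc n)" "-x"] by simp
		hence "\<Phi> (of_real x) = (\<Sum>n. complex_of_real (a n * real (Suc n) powr (-x)))" by (simp only: \<Phi>_def)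
		also have "... = of_real (\<Sum>n. a n * real (Suc n) powr (-x))" by (rule suminf_of_real[OF sm[OF x], symmetric])
		finally show ?thesis using x by (simp add: \<phi>_def)
	qed
	define CE where "CE = (\<Sum>n<N0. \<bar>a0 n-a n\<bar>)"
	show ?thesis
	proof (rule that[of E CE \<phi>])
		show "E holomorphic_on UNIV" by (rule holE)
		show "norm (E s)<=CE" if "Re s > 0" for s unfolding E_def CE_def
		proof (rule sum_norm_le)
			fix n
			have "norm (of_real (a0 n-a n) * of_nat (Suc n) powr (-s) :: complex) = \<bar>a0 n-a n\<bar> * real (Suc n) powr (- Re s)"
				unfolding norm_mult norm_Suc_powr norm_of_real by simp
			also have "... <= \<bar>a0 n-a n\<bar> * real (Suc n) powr 0" using that by (intro mult_left_mono powr_mono) auto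
			finally show "norm (of_real (a0 n-a n) * of_nat (Suc n) powr (-s) :: complex) <= \<bar>a0 n-a n\<bar>" by simp
		qed
		show "T analytic_on {s}" if "Re s > 1/2" for s by (rule TT2(2)[OF that])
		show "norm (T s)<=norm s*(\<bar>b + \<delta>\<bar> * norm (zeta_reg (s+1/2)/(s-1/2))+norm (E s) + \<phi> (Re s))+norm (H s)"
			if s: "Re s > 1/2" for s
		proof -
			define zz where "zz = zeta_reg (s+1/2)/(s-1/2)"
			have "norm (T s)<=norm (s*(of_real (b + \<delta>) * zz-E s - \<Phi> s))+norm (H s)"
				unfolding TT2(1)[OF s] T2_def zz_def by (rule norm_triangle_ineq4)
			also have "norm (s*(of_real (b + \<delta>) * zz-E s - \<Phi> s))<=norm s*(\<bar>b + \<delta>\<bar> * norm zz+norm (E s) + \<phi> (Re s))"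
			proof -
				have "norm (of_real (b + \<delta>) * zz-E s - \<Phi> s)<=norm (of_real (b + \<delta>) * zz-E s)+norm (\<Phi> s)" by (rule norm_triangle_ineq4)
				also have "norm (of_real (b + \<delta>) * zz-E s)<=norm (of_real (b + \<delta>) * zz)+norm (E s)" by (rule norm_triangle_ineq4)
				also have "norm (of_real (b + \<delta>) * zz) = \<bar>b + \<delta>\<bar> * norm zz" unfolding norm_mult norm_of_real ..
				finally show ?thesis unfolding norm_mult[of s] using \<Phi>_le[OF s] by (intro mult_left_mono) auto
			qed
			finally show "norm (T s)<=norm s*(\<bar>b + \<delta>\<bar> * norm (zeta_reg (s+1/2)/(s-1/2))+norm (E s) + \<phi> (Re s))+norm (H s)"
				by (simp add: zz_def)
		qed
		show "\<phi> y <= \<phi> x" if "1/2 < x" "x<=y" for x y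
			using that a unfolding \<phi>_def by (auto intro!: suminf_le sm mult_left_mono powr_mono simp del: of_nat_Suc)
		show "\<phi> x>=0" for x using sm[of x] a by (auto simp: \<phi>_def intro!: suminf_nonneg)
		show "((%x. (x-1/2) * \<phi> x) \<longlongrightarrow> \<delta>) (at_right (1/2))"
		proof -
			\<comment> \<open>The limit is computed from the singular parts at 1/2: b + \<delta> from
			  zeta(s+1/2), minus b/2 divided by s = 1/2. Only the slack \<delta> is left.\<close>
			define g where "g = (%x::real. of_real (b + \<delta>) * zeta_reg (of_real x+1/2)
					- (of_real (x-1/2) * T (of_real x) + of_real (x-1/2) * H (of_real x))/of_real x-of_real (x-1/2) * E (of_real x))"
			have ev: "\<forall>\<^sub>F x in at_right (1/2). g x = complex_of_real ((x-1/2) * \<phi> x)" using eventually_at_right_less[of "1/2::real"]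
			proof eventually_elim
				case (elim x)
				define xx where "xx = complex_of_real x"
				have xx: "xx~=0" "xx-1/2~=0" using elim by (auto simp: xx_def complex_eq_iff)
				have "of_real (\<phi> x) = \<Phi> xx" using \<Phi>_real[OF elim] by (simp add: xx_def)
				also have "... = of_real (b + \<delta>)*(zeta_reg (xx+1/2)/(xx-1/2))-(T xx+H xx)/xx-E xx"
					using TT2(1)[of xx] elim xx by (simp add: T2_def xx_def[symmetric]) (simp add: xx_def field_simps)?
				finally have e: "of_real (\<phi> x) = of_real (b + \<delta>)*(zeta_reg (xx+1/2)/(xx-1/2))-(T xx+H xx)/xx-E xx" .
				have "complex_of_real ((x-1/2) * \<phi> x) = (xx-1/2) * of_real (\<phi> x)" by (simp add: xx_def)
				also have "... = g x" unfolding e g_def xx_def[symmetric] of_real_diff using xx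
					by (simp add: right_diff_distrib add_divide_distrib distrib_left)
				finally show ?case ..
			qed
			have c1: "((%x::real. zeta_reg (of_real x+1/2)) \<longlongrightarrow> zeta_reg (of_real (1/2)+1/2)) (at_right (1/2))"
			proof -
				have "isCont zeta_reg 1" by (rule analytic_at_imp_isCont, rule holomorphic_on_imp_analytic_at[OF holomorphic_zeta_reg open_Re_gt]) auto
				hence "isCont zeta_reg (of_real (1/2)+1/2)" by simp
				moreover have "((%x::real. complex_of_real x+1/2) \<longlongrightarrow> of_real (1/2)+1/2) (at_right (1/2))" by (intro tendsto_intros)
				ultimately show ?thesis by (rule isCont_tendsto_compose)
			qed
			have c2: "((%x::real. H (of_real x)) \<longlongrightarrow> H (of_real (1/2))) (at_right (1/2))"
			proof -
				have "isCont H (of_real (1/2))" by (rule analytic_at_imp_isCont, rule holomorphic_on_imp_analytic_at[OF holomorphic_H open_Re_gt]) auto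
				moreover have "((%x::real. complex_of_real x) \<longlongrightarrow> of_real (1/2)) (at_right (1/2))" by (intro tendsto_intros)
				ultimately show ?thesis by (rule isCont_tendsto_compose)
			qed
			have c3: "((%x::real. E (of_real x)) \<longlongrightarrow> E (of_real (1/2))) (at_right (1/2))"
			proof -
				have "isCont E (of_real (1/2))" by (rule analytic_at_imp_isCont, rule holomorphic_on_imp_analytic_at[OF holE open_UNIV]) auto
				moreover have "((%x::real. complex_of_real x) \<longlongrightarrow> of_real (1/2)) (at_right (1/2))" by (intro tendsto_intros)
				ultimately show ?thesis by (rule isCont_tendsto_compose)
			qed
			have "(g \<longlongrightarrow> of_real (b + \<delta>) * zeta_reg (of_real (1/2)+1/2)
					- (of_real (b/2) + of_real (1/2-1/2) * H (of_real (1/2)))/of_real (1/2)-of_real (1/2-1/2) * E (of_real (1/2))) (at_right (1/2))"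
				unfolding g_def by (intro tendsto_intros c1 c2 c3 T_lim) auto
			also have "of_real (b + \<delta>) * zeta_reg (of_real (1/2)+1/2)
					- (of_real (b/2) + of_real (1/2-1/2) * H (of_real (1/2)))/of_real (1/2)-of_real (1/2-1/2) * E (of_real (1/2)) = of_real \<delta>"
				by simp
			finally have "((%x. complex_of_real ((x-1/2) * \<phi> x)) \<longlongrightarrow> of_real \<delta>) (at_right (1/2))"
				using tendsto_cong[OF ev] by simp
			thus ?thesis by (simp only: tendsto_of_real_iff)
		qed
	qed
qed

lemma T_analytic_right: "Re s > 1/2 ==> T analytic_on {s}" by (rule core[OF zero_less_one])

lemma norm_zeta_shift_le:
	assumes "Re s > 1/2"
	shows "norm (zeta_reg (s+1/2)/(s-1/2))<=Re (zeta_reg (of_real (Re s+1/2)))/(Re s-1/2)"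
proof -
	have R: "Re (s+1/2) > 1" using assms by simp
	have s0: "s-1/2~=0" using assms by (rule minus_half_nonzero)
	have e: "s+1/2-1 = s-1/2" by (simp add: field_simps)
	have eq: "zeta_reg (s+1/2)/(s-1/2) = (\<Sum>n. of_nat (Suc n) powr (-(s+1/2)))" using zeta_reg_eq_series[OF R] s0 e by simp
	have "norm (zeta_reg (s+1/2)/(s-1/2))<=(\<Sum>n. norm (of_nat (Suc n) powr (-(s+1/2)) :: complex))"
		unfolding eq by (rule summable_norm[OF summable_dirichlet_zeta[OF R]])
	also have "... = (\<Sum>n. real (Suc n) powr (-(Re s+1/2)))"
	proof -
		have "norm (of_nat (Suc n) powr (-(s+1/2)) :: complex) = real (Suc n) powr (-(Re s+1/2))" for n unfolding norm_Suc_powr by simp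
		thus ?thesis by (simp only:)
	qed
	also have "... = Re (zeta_reg (of_real (Re s+1/2)))/(Re s-1/2)" using zeta_reg_of_real_gt_1[of "Re s+1/2"] assms by simp
	finally show ?thesis .
qed

text \<open>The slack 1 is enough here. Near 1/2 the growth of \<phi> is known from its residue;
  further to the right \<phi> is bounded because it is nonincreasing.\<close>

lemma T_bound:
	obtains C where "!!s. Re s > 1/2 ==> Re s<=3 ==> norm (T s)<=C*(1+norm s)^2/(Re s-1/2)"
proof -
	obtain E :: "complex => complex" and \<phi> CE where "E holomorphic_on UNIV" and EC: "!!s. Re s > 0 ==> norm (E s)<=CE"
		and "!!s. Re s > 1/2 ==> T analytic_on {s}"
		and Tb: "!!s. Re s > 1/2 ==> norm (T s)<=norm s*(\<bar>b+1\<bar> * norm (zeta_reg (s+1/2)/(s-1/2))+norm (E s) + \<phi> (Re s))+norm (H s)"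
		and lim: "((%x. (x-1/2) * \<phi> x) \<longlongrightarrow> 1) (at_right (1/2))"
		and mono: "!!x y. 1/2 < x ==> x<=y ==> \<phi> y <= \<phi> x" and \<phi>0: "!!x. \<phi> x>=0" by (rule core[OF zero_less_one]) (rule that)
	have "eventually (%x. (x-1/2) * \<phi> x < 2) (at_right (1/2))" using lim by (rule order_tendstoD) auto
	then obtain \<eta> where \<eta>: "\<eta> > 1/2" "!!x. x > 1/2 ==> x < \<eta> ==> (x-1/2) * \<phi> x < 2" by (auto simp: eventually_at_right_field)
	define p where "p = 2+5/2 * \<phi> \<eta>"
	have p: "(x-1/2) * \<phi> x<=p" if "x > 1/2" "x<=3" for x
	proof (cases "x < \<eta>")
		case True
		thus ?thesis using \<eta>(2)[OF that(1) True] \<phi>0[of \<eta>] by (simp add: p_def)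
	next
		case False
		hence "(x-1/2) * \<phi> x<=5/2 * \<phi> \<eta>" using that mono[OF \<eta>(1), of x] \<phi>0[of x] by (intro mult_mono) auto
		thus ?thesis by (simp add: p_def)
	qed
	have "continuous_on {1/2..3} (%x. Re (zeta_reg (of_real (x+1/2))))"
		by (intro continuous_intros continuous_on_compose2[OF holomorphic_on_imp_continuous_on[OF holomorphic_zeta_reg]]) auto
	hence "bounded ((%x. Re (zeta_reg (of_real (x+1/2)))) ` {1/2..3})" by (intro compact_imp_bounded compact_continuous_image) auto
	then obtain Z where Z: "Z > 0" "!!x. x \<in> {1/2..3} ==> \<bar>Re (zeta_reg (of_real (x+1/2)))\<bar><=Z" by (auto simp: bounded_pos)
	define h where "h = (\<Sum>n. real (Suc n) powr (-(3/2)))"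
	have h: "h>=0" unfolding h_def by (intro suminf_nonneg summable_Suc_powr) auto
	have CE: "CE>=0" using EC[of 1] norm_ge_zero[of "E 1"] by (simp del: norm_ge_zero)
	have pp: "p>=0" using \<phi>0[of \<eta>] by (simp add: p_def)
	show ?thesis
	proof (rule that[of "\<bar>b+1\<bar> * Z+5/2 * CE+p+5/2 * h"])
		fix s assume s: "Re s > 1/2" "Re s<=3"
		define d where "d = Re s-1/2"
		have d: "d > 0" "d<=5/2" using s by (auto simp: d_def)
		have n: "norm s<=1+norm s" "norm (s+1)<=1+norm s" using norm_triangle_ineq[of s 1] by auto
		have "d * norm (T s)<=d*(norm s*(\<bar>b+1\<bar> * norm (zeta_reg (s+1/2)/(s-1/2))+norm (E s) + \<phi> (Re s))+norm (H s))"
			using d by (intro mult_left_mono Tb s) auto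
		also have "... = norm s*(\<bar>b+1\<bar>*(d * norm (zeta_reg (s+1/2)/(s-1/2)))+d * norm (E s)+d * \<phi> (Re s))+d * norm (H s)"
			by (simp add: algebra_simps)
		also have "...<=norm s*(\<bar>b+1\<bar> * Z+5/2 * CE+p)+5/2*(norm s * norm (s+1) * h)"
		proof (intro add_mono mult_left_mono mult_mono)
			have "d * norm (zeta_reg (s+1/2)/(s-1/2))<=d*(Re (zeta_reg (of_real (Re s+1/2)))/(Re s-1/2))"
				using d s by (intro mult_left_mono norm_zeta_shift_le) auto
			also have "... = Re (zeta_reg (of_real (Re s+1/2)))" using d by (simp add: d_def)
			also have "...<=Z" using Z(2)[of "Re s"] s by auto
			finally show "d * norm (zeta_reg (s+1/2)/(s-1/2))<=Z" .
			show "norm (E s)<=CE" using EC s by simp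
			show "d * \<phi> (Re s)<=p" using p[of "Re s"] s by (simp add: d_def)
			show "norm (H s)<=norm s * norm (s+1) * h" unfolding h_def using s by (intro norm_H_le) auto
		qed (use d in auto)
		also have "...<=(1+norm s)^2*(\<bar>b+1\<bar> * Z+5/2 * CE+p)+5/2*((1+norm s)^2 * h)"
		proof (intro add_mono mult_left_mono mult_right_mono)
			have "norm s*1<=(1+norm s)*(1+norm s)" by (intro mult_mono) auto
			thus "norm s<=(1+norm s)^2" by (simp add: power2_eq_square)
			show "norm s * norm (s+1)<=(1+norm s)^2" unfolding power2_eq_square using n by (intro mult_mono) auto
		qed (use Z CE pp h in auto)
		finally have "d * norm (T s)<=(\<bar>b+1\<bar> * Z+5/2 * CE+p+5/2 * h)*(1+norm s)^2" by (simp add: algebra_simps)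
		thus "norm (T s)<=(\<bar>b+1\<bar> * Z+5/2 * CE+p+5/2 * h)*(1+norm s)^2/(Re s-1/2)" using d by (simp add: d_def field_simps)
	qed
qed

text \<open>A pole at s would give |T| >= c/(x - 1/2) on the horizontal approach to s. The only
  comparably large term of the upper bound is |s| \<phi>(x), about |s| \<delta>/(x - 1/2), and
  \<delta> = c/(2|s|) makes it too small by a factor 2. At 1/2 the argument does not apply, as
  zeta(s+1/2) has its pole there.\<close>

lemma T_analytic_line:
	assumes s: "Re s = 1/2" "s~=1/2"
	shows "T analytic_on {s}"
proof (rule ccontr)
	assume na: "\<not> T analytic_on {s}"
	have pole: "is_pole T s" using nicely_meromorphic_on_imp_analytic_at[OF T_mero, of s] na s by auto
	have "isolated_singularity_at T s"
	proof (rule meromorphic_on_isolated_singularity)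
		have "T meromorphic_on {s. Re s>=1/2}" using T_mero by (simp add: nicely_meromorphic_on_def)
		thus "T meromorphic_on {s}" by (rule meromorphic_on_subset) (use s in auto)
	qed
	from is_pole_lower_bound[OF pole this] obtain c where c: "c > 0"
		"\<forall>\<^sub>F w in at s. norm (T w)>=c/norm (w-s)" by blast
	define \<delta> where "\<delta> = c/(2 * norm s)"
	have s0: "norm s > 0" using s by auto
	have \<delta>: "\<delta> > 0" using c s0 by (simp add: \<delta>_def)
	obtain E :: "complex => complex" and \<phi> and CE :: real where E: "E holomorphic_on UNIV"
		and "!!s. Re s > 0 ==> norm (E s)<=CE" and "!!s. Re s > 1/2 ==> T analytic_on {s}"
		and Tb: "!!s. Re s > 1/2 ==> norm (T s)<=norm s*(\<bar>b + \<delta>\<bar> * norm (zeta_reg (s+1/2)/(s-1/2))+norm (E s) + \<phi> (Re s))+norm (H s)"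
		and lim: "((%x. (x-1/2) * \<phi> x) \<longlongrightarrow> \<delta>) (at_right (1/2))"
		and "!!x y. 1/2 < x ==> x<=y ==> \<phi> y <= \<phi> x" "!!x. \<phi> x>=0" by (rule core[OF \<delta>]) (rule that)
	define w where "w = (%x::real. s + of_real (x-1/2))"
	have wl: "(w \<longlongrightarrow> s) (at_right (1/2))"
	proof -
		have "(w \<longlongrightarrow> s + of_real (1/2-1/2)) (at_right (1/2))" unfolding w_def by (intro tendsto_intros)
		thus ?thesis by simp
	qed
	have wRe: "Re (w x) = x" for x using s by (simp add: w_def)
	have cont: "((%x. g (w x)) \<longlongrightarrow> g s) (at_right (1/2))" if "isCont g s" for g :: "complex => complex"
		using isCont_tendsto_compose[OF that wl] .
	have cz: "((%x. zeta_reg (w x+1/2)/(w x-1/2)) \<longlongrightarrow> zeta_reg (s+1/2)/(s-1/2)) (at_right (1/2))"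
	proof (rule cont)
		have "isCont zeta_reg (s+1/2)"
			by (rule analytic_at_imp_isCont, rule holomorphic_on_imp_analytic_at[OF holomorphic_zeta_reg open_Re_gt]) (use s in auto)
		hence "isCont (%x. zeta_reg (x+1/2)) s" by (rule isCont_o2[where f = "%x. x+1/2", rotated]) (intro continuous_intros)
		thus "isCont (%x. zeta_reg (x+1/2)/(x-1/2)) s" using s by (intro continuous_intros) auto
	qed
	have cE: "((%x. E (w x)) \<longlongrightarrow> E s) (at_right (1/2))"
		by (rule cont, rule analytic_at_imp_isCont, rule holomorphic_on_imp_analytic_at[OF E open_UNIV UNIV_I])
	have cH: "((%x. H (w x)) \<longlongrightarrow> H s) (at_right (1/2))"
		by (rule cont, rule analytic_at_imp_isCont, rule holomorphic_on_imp_analytic_at[OF holomorphic_H open_Re_gt]) (use s in auto)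
	define U where "U = (%x. norm (w x)*((x-1/2)*(\<bar>b + \<delta>\<bar> * norm (zeta_reg (w x+1/2)/(w x-1/2))+norm (E (w x)))
			+ (x-1/2) * \<phi> x)+(x-1/2) * norm (H (w x)))"
	have "(U \<longlongrightarrow> norm s*((1/2-1/2)*(\<bar>b + \<delta>\<bar> * norm (zeta_reg (s+1/2)/(s-1/2))+norm (E s)) + \<delta>)
			+ (1/2-1/2) * norm (H s)) (at_right (1/2))" unfolding U_def by (intro tendsto_intros wl cz cE cH lim)
	hence Ul: "(U \<longlongrightarrow> norm s * \<delta>) (at_right (1/2))" by simp
	have "c<=norm s * \<delta>"
	proof (rule tendsto_lowerbound[OF Ul])
		have "filterlim w (at s) (at_right (1/2))"
		proof (rule filterlim_atI[OF wl])
			show "\<forall>\<^sub>F x in at_right (1/2). w x~=s" using eventually_at_right_less[of "1/2::real"]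
			proof eventually_elim
				case (elim x)
				have "complex_of_real (x-1/2)~=0" using elim by (simp only: of_real_eq_0_iff)
				thus "w x~=s" unfolding w_def by (metis add_cancel_right_right)
			qed
		qed
		from eventually_compose_filterlim[OF c(2) this]
		show "\<forall>\<^sub>F x in at_right (1/2). c<=U x" using eventually_at_right_less[of "1/2::real"]
		proof eventually_elim
			case (elim x)
			have "norm (w x-s) = norm (complex_of_real (x-1/2))" by (simp add: w_def)
			also have "... = x-1/2" unfolding norm_of_real using elim by simp
			finally have nw: "norm (w x-s) = x-1/2" .
			have "c/(x-1/2)<=norm (T (w x))" using elim nw by simp
			hence "c<=(x-1/2) * norm (T (w x))" using elim by (simp add: field_simps)
			also have "...<=(x-1/2)*(norm (w x)*(\<bar>b + \<delta>\<bar> * norm (zeta_reg (w x+1/2)/(w x-1/2))+norm (E (w x)) + \<phi> (Re (w x)))+norm (H (w x)))"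
				using elim wRe by (intro mult_left_mono Tb) auto
			also have "... = U x" unfolding U_def wRe by (simp only: algebra_simps)
			finally show ?case .
		qed
	qed auto
	thus False using c(1) s0 by (simp add: \<delta>_def)
qed

end

section \<open>Euler products of absolutely convergent series\<close>

definition smooth_nums :: "nat set => nat set" where
	"smooth_nums S = {n. n > 0 \<and> prime_factors n \<subseteq> S}"

lemma smooth_nums_empty: "smooth_nums {} = {1}" by (auto simp: smooth_nums_def prime_factorization_empty_iff)

text \<open>Splits off the exact power of p; this is the induction step by which one more prime
  enters the finite Euler product.\<close>

lemma smooth_nums_insert_bij:
	assumes p: "prime p" "p \<notin> S"
	shows "bij_betw (%(k, m). p^k * m) (UNIV \<times> smooth_nums S) (smooth_nums (insert p S))"
proof -
	define F where "F = (%(k::nat, m::nat). p^k * m)"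
	define G where "G = (%n. (multiplicity p n, n div p^multiplicity p n))"
	have nd: "\<not> p dvd m" if "m \<in> smooth_nums S" for m using that p by (auto simp: smooth_nums_def prime_factors_dvd)
	have "bij_betw F (UNIV \<times> smooth_nums S) (smooth_nums (insert p S))"
	proof (rule bij_betw_byWitness[where f' = G])
		show "\<forall>a\<in>UNIV \<times> smooth_nums S. G (F a) = a"
		proof safe
			fix k :: nat and m assume m: "m \<in> smooth_nums S"
			have "m > 0" using m by (simp add: smooth_nums_def)
			have "multiplicity p (p^k * m) = multiplicity p (p^k)+multiplicity p m"
				using p \<open>m > 0\<close> by (intro prime_elem_multiplicity_mult_distrib) auto
			also have "... = k" using p nd[OF m] by (simp add: not_dvd_imp_multiplicity_0)
			finally show "G (F (k, m)) = (k, m)" using p by (simp add: F_def G_def prime_gt_0_nat)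
		qed
		show "\<forall>n\<in>smooth_nums (insert p S). F (G n) = n" by (auto simp: F_def G_def multiplicity_dvd)
		show "F ` (UNIV \<times> smooth_nums S) \<subseteq> smooth_nums (insert p S)"
		proof (rule image_subsetI)
			fix x :: "nat \<times> nat" assume "x \<in> UNIV \<times> smooth_nums S"
			then obtain k m where x: "x = (k, m)" and m: "m \<in> smooth_nums S" by auto
			hence "m > 0" by (simp add: smooth_nums_def)
			moreover have "q \<in> insert p S" if "q \<in> prime_factors (p^k * m)" for q
			proof -
				have q: "prime q" "q dvd p^k * m" using that by (auto simp: prime_factors_dvd)
				hence "q dvd p^k \<or> q dvd m" by (simp add: prime_dvd_mult_iff)
				thus ?thesis
				proof
					assume "q dvd p^k"
					hence "q dvd p" using q(1) prime_dvd_power by blast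
					thus ?thesis using primes_dvd_imp_eq[OF q(1) p(1)] by simp
				next
					assume "q dvd m"
					thus ?thesis using m q(1) \<open>m > 0\<close> by (auto simp: smooth_nums_def prime_factors_dvd)
				qed
			qed
			ultimately show "F x \<in> smooth_nums (insert p S)" using p unfolding x by (auto simp: F_def smooth_nums_def prime_gt_0_nat)
		qed
		show "G ` smooth_nums (insert p S) \<subseteq> UNIV \<times> smooth_nums S"
		proof (rule image_subsetI)
			fix n assume n: "n \<in> smooth_nums (insert p S)"
			define m where "m = n div p^multiplicity p n"
			have n0: "n > 0" using n by (simp add: smooth_nums_def)
			have nm: "n = p^multiplicity p n * m" by (simp add: m_def multiplicity_dvd)
			have "m > 0" using nm n0 by (cases "m = 0") auto
			have ndm: "\<not> p dvd m" unfolding m_def using n0 p not_prime_unit by (intro multiplicity_decompose) auto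
			have "prime_factors m \<subseteq> S"
			proof
				fix q assume q': "q \<in> prime_factors m"
				hence q: "prime q" "q dvd m" by (auto simp: prime_factors_dvd)
				hence "q dvd n" using nm by (metis dvd_mult)
				hence "q \<in> prime_factors n" using n0 \<open>prime q\<close> by (simp add: prime_factors_dvd)
				thus "q \<in> S" using n q ndm by (auto simp: smooth_nums_def)
			qed
			thus "G n \<in> UNIV \<times> smooth_nums S" using \<open>m > 0\<close> by (simp add: smooth_nums_def m_def G_def)
		qed
	qed
	thus ?thesis by (simp only: F_def)
qed

context
	fixes g :: "nat => complex"
	assumes g1: "g 1 = 1" and gmult: "!!m n. coprime m n ==> g (m * n) = g m * g n"
		and gsum: "summable (%n. norm (g (Suc n)))"
begin

lemma g_norm_summable_on: "(%n. norm (g n)) summable_on {0<..}"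
proof -
	have "(%n. norm (g (Suc n))) summable_on UNIV" using gsum by (intro norm_summable_imp_summable_on) auto
	moreover have "bij_betw Suc UNIV {0<..}" by (rule bij_betw_byWitness[where f' = "%n. n-1"]) auto
	ultimately show ?thesis using summable_on_reindex_bij_betw[of Suc UNIV "{0<..}" "%n. norm (g n)"] by simp
qed

lemma g_norm_summable_on_subset: "A \<subseteq> {0<..} ==> (%n. norm (g n)) summable_on A" using g_norm_summable_on summable_on_subset_banach by blast

lemma g_summable_on_subset: "A \<subseteq> {0<..} ==> g summable_on A" using g_norm_summable_on_subset abs_summable_summable by blast

lemma prime_power_norm_summable_on:
	assumes "prime p"
	shows "(%k. norm (g (p^k))) summable_on UNIV"
proof -
	have inj: "inj (%k. p^k)" using assms by (auto simp: inj_def dest: power_inject_exp[THEN iffD1, rotated] prime_gt_1_nat)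
	have "(%n. norm (g n)) summable_on (range (%k. p^k))" using assms by (intro g_norm_summable_on_subset) (auto simp: prime_gt_0_nat)
	thus ?thesis using summable_on_reindex[OF inj, of "%n. norm (g n)"] by (simp add: o_def)
qed

lemma infsum_smooth_nums:
	assumes "finite S" "!!p. p \<in> S ==> prime p"
	shows "infsum g (smooth_nums S) = (\<Prod>p\<in>S. \<Sum>k. g (p^k))" using assms
proof (induction S rule: finite_induct)
	case empty
	show ?case using g1 by (simp add: smooth_nums_empty)
next
	case (insert p S)
	have p: "prime p" using insert by auto
	have cop: "coprime (p^k) m" if "m \<in> smooth_nums S" for k m
	proof -
		have "\<not> p dvd m"
		proof
			assume "p dvd m"
			hence "p \<in> prime_factors m" using p that by (simp add: prime_factors_dvd smooth_nums_def)
			thus False using that insert(2) by (auto simp: smooth_nums_def)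
		qed
		thus ?thesis using p by (simp add: prime_imp_coprime)
	qed
	define F where "F = (%(k::nat, m::nat). p^k * m)"
	have bij: "bij_betw F (UNIV \<times> smooth_nums S) (smooth_nums (insert p S))" unfolding F_def by (rule smooth_nums_insert_bij[OF p insert(2)])
	have sub: "smooth_nums A \<subseteq> {0<..}" for A by (auto simp: smooth_nums_def)
	have "(%x. g (F x)) summable_on (UNIV \<times> smooth_nums S)" using summable_on_reindex_bij_betw[OF bij, of g] g_summable_on_subset[OF sub] by simp
	hence "infsum (%k. infsum (%m. g (F (k, m))) (smooth_nums S)) UNIV = infsum (%x. g (F x)) (UNIV \<times> smooth_nums S)"
		by (rule infsum_Sigma_banach)
	also have "... = infsum g (smooth_nums (insert p S))" by (rule infsum_reindex_bij_betw[OF bij])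
	finally have "infsum g (smooth_nums (insert p S)) = infsum (%k. infsum (%m. g (F (k, m))) (smooth_nums S)) UNIV" ..
	also have "... = infsum (%k. infsum (%m. g (p^k) * g m) (smooth_nums S)) UNIV"
		by (intro infsum_cong) (auto simp: F_def intro!: gmult cop simp del: coprime_power_left_iff)
	also have "... = infsum (%k. g (p^k)) UNIV * infsum g (smooth_nums S)" by (simp only: infsum_cmult_right' infsum_cmult_left')
	also have "infsum (%k. g (p^k)) UNIV = (\<Sum>k. g (p^k))"
	proof (rule infsumI, rule norm_summable_imp_has_sum)
		show "summable (%k. norm (g (p^k)))" by (rule summable_on_imp_summable[OF prime_power_norm_summable_on[OF p]])
		thus "(%k. g (p^k)) sums (\<Sum>k. g (p^k))" by (rule summable_sums[OF summable_norm_cancel])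
	qed
	finally show ?case using insert by simp
qed

text \<open>Every n < N has all its prime factors below N, so the N-th partial product differs from
  the whole sum by at most the tail of the absolute series from N on.\<close>

theorem euler_product_LIMSEQ:
	"(%N. \<Prod>n<N. if prime n then \<Sum>k. g (n^k) else 1) \<longlonglongrightarrow> (\<Sum>n. g (Suc n))"
proof -
	define S where "S = (%N::nat. {p. p < N \<and> prime p})"
	have fin: "finite (S N)" for N by (simp add: S_def)
	have prod: "(\<Prod>n<N. if prime n then \<Sum>k. g (n^k) else 1) = infsum g (smooth_nums (S N))" for N
	proof -
		have "(\<Prod>n<N. if prime n then \<Sum>k. g (n^k) else 1) = (\<Prod>n\<in>S N. \<Sum>k. g (n^k))"
			by (rule prod.mono_neutral_cong_right) (auto simp: S_def)
		also have "... = infsum g (smooth_nums (S N))" by (rule infsum_smooth_nums[symmetric]) (auto simp: S_def)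
		finally show ?thesis .
	qed
	have total: "infsum g {0<..} = (\<Sum>n. g (Suc n))"
	proof -
		have "bij_betw Suc UNIV {0<..}" by (rule bij_betw_byWitness[where f' = "%n. n-1"]) auto
		hence "infsum g {0<..} = infsum (%n. g (Suc n)) UNIV" by (rule infsum_reindex_bij_betw[symmetric])
		also have "... = (\<Sum>n. g (Suc n))"
			by (rule infsumI, rule norm_summable_imp_has_sum[OF gsum]) (rule summable_sums[OF summable_norm_cancel[OF gsum]])
		finally show ?thesis .
	qed
	have sub: "smooth_nums A \<subseteq> {0<..}" for A by (auto simp: smooth_nums_def)
	have bound: "norm (infsum g (smooth_nums (S N))-(\<Sum>n. g (Suc n)))<=(\<Sum>n. norm (g (Suc (n+(N-1)))))" if N: "N > 0" for N
	proof -
		define A where "A = {0<..}-smooth_nums (S N)"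
		have "infsum g {0<..} = infsum g (smooth_nums (S N))+infsum g A"
		proof -
			have "{0<..} = smooth_nums (S N) \<union> A" using sub by (auto simp: A_def)
			moreover have "infsum g (smooth_nums (S N) \<union> A) = infsum g (smooth_nums (S N))+infsum g A"
				by (rule infsum_Un_disjoint) (auto intro!: g_summable_on_subset simp: A_def smooth_nums_def)
			ultimately show ?thesis by simp
		qed
		hence "norm (infsum g (smooth_nums (S N))-(\<Sum>n. g (Suc n))) = norm (infsum g A)" unfolding total by (simp add: norm_minus_commute)
		also have "...<=infsum (%n. norm (g n)) A" by (rule norm_infsum_bound) (auto intro!: g_norm_summable_on_subset simp: A_def)
		also have "...<=infsum (%n. norm (g n)) {N..}"
		proof (rule infsum_mono2)
			show "A \<subseteq> {N..}"
			proof
				fix n assume n: "n \<in> A"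
				show "n \<in> {N..}"
				proof (rule ccontr)
					assume "n \<notin> {N..}"
					hence "n < N" by simp
					hence "prime_factors n \<subseteq> S N" using n by (auto simp: S_def A_def prime_factors_dvd dest!: dvd_imp_le)
					thus False using n by (auto simp: A_def smooth_nums_def)
				qed
			qed
		qed (use N in \<open>auto intro!: g_norm_summable_on_subset simp: A_def\<close>)
		also have "... = infsum (%n. norm (g (Suc (n+(N-1))))) UNIV"
			by (rule infsum_reindex_bij_betw[symmetric, where g = "%n. Suc (n+(N-1))"], rule bij_betw_byWitness[where f' = "%n. n-N"])
				 (use N in auto)
		also have "... = (\<Sum>n. norm (g (Suc (n+(N-1)))))"
		proof (rule infsumI, rule norm_summable_imp_has_sum)
			show "summable (%n. norm (norm (g (Suc (n+(N-1))))))" using summable_ignore_initial_segment[OF gsum, of "N-1"] by simp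
			thus "(%n. norm (g (Suc (n+(N-1))))) sums (\<Sum>n. norm (g (Suc (n+(N-1)))))" by (intro summable_sums) simp
		qed
		finally show ?thesis .
	qed
	have tail: "(%N. \<Sum>n. norm (g (Suc (n+(N-1))))) \<longlonglongrightarrow> 0"
	proof -
		have "(%N. \<Sum>n. norm (g (Suc (n+N)))) \<longlonglongrightarrow> 0" using suminf_exist_split2[OF gsum] by simp
		hence "(%N. \<Sum>n. norm (g (Suc (n+(Suc N-1))))) \<longlonglongrightarrow> 0" by simp
		thus ?thesis by (subst (asm) filterlim_sequentially_Suc)
	qed
	have "(%N. infsum g (smooth_nums (S N))-(\<Sum>n. g (Suc n))) \<longlonglongrightarrow> 0"
	proof (rule Lim_null_comparison[OF _ tail])
		show "\<forall>\<^sub>F N in sequentially. norm (infsum g (smooth_nums (S N))-(\<Sum>n. g (Suc n)))<=(\<Sum>n. norm (g (Suc (n+(N-1)))))"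
			using eventually_gt_at_top[of "0::nat"] by eventually_elim (rule bound)
	qed
	thus ?thesis unfolding prod by (simp add: LIM_zero_iff)
qed

end

section \<open>Zeta as an Euler product, and its nonvanishing on Re s = 1\<close>

text \<open>The zeta function on Re s > -1; at the pole 1 the division by zero yields the value
  0.\<close>

definition dseries :: "complex => complex" where
	"dseries s = zeta_reg s/(s-1)"

lemma dseries_eq: "Re s > 1 ==> dseries s = (\<Sum>n. of_nat (Suc n) powr (-s))" by (auto simp: dseries_def zeta_reg_eq_series)

lemma of_nat_powr_mult: "of_nat (m * n) powr s = of_nat m powr s*(of_nat n powr s :: complex)"
	using powr_times_real[of "of_nat m" "of_nat n" s] by simp

lemma of_nat_power_powr: "of_nat (n^k) powr s = (of_nat n powr s :: complex)^k"
	by (induction k) (auto simp: of_nat_powr_mult simp del: of_nat_mult of_nat_power)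

lemma norm_prime_powr:
	assumes "prime p"
	shows "norm (of_nat p powr (-s) :: complex) = real p powr (- Re s)" using assms by (subst norm_of_nat_powr) (auto simp: prime_gt_0_nat)

lemma norm_prime_powr_le:
	assumes "prime p" "Re s>=a" "a > 0"
	shows "norm (of_nat p powr (-s) :: complex)<=2 powr (-a)" "norm (of_nat p powr (-s) :: complex) < 1"
proof -
	have p: "real p>=2" using prime_ge_2_nat[OF assms(1)] by simp
	have "norm (of_nat p powr (-s) :: complex) = real p powr (- Re s)" by (rule norm_prime_powr[OF assms(1)])
	also have "...<=real p powr (-a)" using p assms by (intro powr_mono) auto
	also have "...<=2 powr (-a)" using p assms by (intro powr_mono2') auto
	finally show *: "norm (of_nat p powr (-s) :: complex)<=2 powr (-a)" .
	have "2 powr (-a) < 2 powr (0::real)" using assms by (intro powr_less_mono) auto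
	with * show "norm (of_nat p powr (-s) :: complex) < 1" by simp
qed

theorem euler_product_dseries:
	assumes s: "Re s > 1"
	shows "(%N. \<Prod>n<N. if prime n then 1/(1-of_nat n powr (-s)) else 1) \<longlonglongrightarrow> dseries s"
proof -
	have "(%N. \<Prod>n<N. if prime n then \<Sum>k. of_nat (n^k) powr (-s) else 1) \<longlonglongrightarrow> (\<Sum>n. of_nat (Suc n) powr (-s) :: complex)"
	proof (rule euler_product_LIMSEQ)
		show "of_nat 1 powr (-s) = (1::complex)" by simp
	qed (rule of_nat_powr_mult, rule summable_dirichlet_zeta[OF s])
	also have "(%N. \<Prod>n<N. if prime n then \<Sum>k. of_nat (n^k) powr (-s) else 1)
			= (%N. \<Prod>n<N. if prime n then 1/(1-of_nat n powr (-s)) else (1::complex))"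
	proof (intro ext prod.cong refl if_cong)
		fix n :: nat assume n: "prime n"
		have "norm (of_nat n powr (-s) :: complex) < 1" using norm_prime_powr_le(2)[OF n, of 1 s] s by auto
		thus "(\<Sum>k. of_nat (n^k) powr (-s)) = 1/(1-of_nat n powr (-s) :: complex)" by (simp only: of_nat_power_powr suminf_geometric)
	qed
	finally show ?thesis by (simp only: dseries_eq[OF s])
qed

text \<open>Factor by factor: with r = p^(-Re s), |1 - p^(-s)| (1 - r) <= (1 + r)(1 - r) <= 1. This
  gives both the nonvanishing for Re s > 1 and a bound for 1/zeta in terms of zeta on the real
  axis.\<close>

lemma dseries_mult_real_ge_1:
	assumes s: "Re s > 1"
	shows "1<=norm (dseries s) * norm (dseries (of_real (Re s)))"
proof -
	define \<nu> where "\<nu> = Re s"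
	have lim1: "(%N. norm (\<Prod>n<N. if prime n then 1/(1-of_nat n powr (-s)) else (1::complex))) \<longlonglongrightarrow> norm (dseries s)"
		by (intro tendsto_norm euler_product_dseries s)
	have lim2: "(%N. norm (\<Prod>n<N. if prime n then 1/(1-of_nat n powr (-(of_real \<nu>))) else (1::complex))) \<longlonglongrightarrow> norm (dseries (of_real \<nu>))"
		using s by (intro tendsto_norm euler_product_dseries) (auto simp: \<nu>_def)
	have "1<=norm (dseries s) * norm (dseries (of_real \<nu>))"
	proof (rule tendsto_lowerbound[OF tendsto_mult[OF lim1 lim2]])
		show "\<forall>\<^sub>F N in sequentially. 1<=norm (\<Prod>n<N. if prime n then 1/(1-of_nat n powr (-s)) else (1::complex)) *
			 norm (\<Prod>n<N. if prime n then 1/(1-of_nat n powr (-(of_real \<nu>))) else (1::complex))"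
		proof (intro always_eventually allI)
			fix N
			have "1<=(\<Prod>n<N. norm (if prime n then 1/(1-of_nat n powr (-s)) else (1::complex)) *
				 norm (if prime n then 1/(1-of_nat n powr (-(of_real \<nu>))) else (1::complex)))"
			proof (rule prod_ge_1)
				fix n assume "n \<in> {..<N}"
				show "1<=norm (if prime n then 1/(1-of_nat n powr (-s)) else (1::complex)) *
				 norm (if prime n then 1/(1-of_nat n powr (-(of_real \<nu>))) else (1::complex))"
				proof (cases "prime n")
					case True
					define r where "r = real n powr (-\<nu>)"
					have nr: "norm (of_nat n powr (-s) :: complex) = r" using norm_prime_powr[OF True] by (simp add: r_def \<nu>_def)
					have r1: "r < 1" using norm_prime_powr_le(2)[OF True, of 1 s] s nr by auto
					have r0: "r>=0" by (simp add: r_def)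
					have rr: "of_nat n powr (-(of_real \<nu>)) = complex_of_real r" using powr_of_real[of "real n" "-\<nu>"] by (simp add: r_def)
					have a: "norm (1-of_nat n powr (-s) :: complex)<=1+r" using norm_triangle_ineq4[of 1 "of_nat n powr (-s) :: complex"] nr by simp
					have pos: "norm (1-of_nat n powr (-s) :: complex) > 0" using nr r1 by auto
					have b: "norm (1-complex_of_real r) = 1-r"
						using r1 by (metis norm_of_real of_real_1 of_real_diff abs_of_nonneg diff_ge_0_iff_ge less_imp_le)
					have "norm (1-of_nat n powr (-s) :: complex)*(1-r)<=(1+r)*(1-r)" using a r1 by (intro mult_right_mono) auto
					also have "... = 1-r * r" by (simp add: algebra_simps)
					also have "...<=1" by simp
					finally have "norm (1-of_nat n powr (-s) :: complex)*(1-r)<=1" .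
					thus ?thesis using True rr b pos r1 by (simp add: norm_divide divide_simps)
				qed auto
			qed
			thus "1<=norm (\<Prod>n<N. if prime n then 1/(1-of_nat n powr (-s)) else (1::complex)) *
			 norm (\<Prod>n<N. if prime n then 1/(1-of_nat n powr (-(of_real \<nu>))) else (1::complex))" by (simp only: prod_norm prod.distrib)
		qed
	qed auto
	thus ?thesis by (simp only: \<nu>_def)
qed

lemma dseries_nonzero: "Re s > 1 ==> dseries s~=0" using dseries_mult_real_ge_1[of s] by auto

text \<open>Taking logarithms, the k-th coefficient is a negative multiple of 3 + 4 Re u + Re u^2
  with u = z^k on the unit circle, and this equals 2 (1 + Re u)^2.\<close>

lemma mertens_341:
	fixes z :: complex and r :: real
	assumes z: "norm z = 1" and r: "0<=r" "r < 1"
	shows "(1-r)^3 * norm (1-of_real r * z)^4 * norm (1-of_real r * z^2)<=1"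
proof -
	have lnsums: "(%k.-(r^k * Re (w^k))/real k) sums ln (norm (1-of_real r * w))" if w: "norm w = 1" for w
	proof -
		have n: "norm (- (of_real r * w)) < 1" using r w by (simp add: norm_mult)
		from Ln_series'[OF n] have "(%k.-((of_real r * w)^k)/of_nat k) sums Ln (1+(- (of_real r * w)))" by simp
		hence A: "(%k. Re (- ((of_real r * w)^k)/of_nat k)) sums Re (Ln (1+(- (of_real r * w))))" by (rule sums_Re)
		have m: "Re (- ((of_real r * w)^k)/of_nat k) =-(r^k * Re (w^k))/real k" for k
			by (simp add: power_mult_distrib Re_divide_of_nat flip: of_real_power)
		have "1-of_real r * w~=0" using n by auto
		hence "Re (Ln (1+(- (of_real r * w)))) = ln (norm (1-of_real r * w))" by simp
		with A show ?thesis unfolding m by simp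
	qed
	have p1: "norm (1-of_real r * w) > 0" if "norm w = 1" for w :: complex
	proof -
		have "norm (of_real r * w) < 1" using r that by (simp add: norm_mult)
		thus ?thesis by auto
	qed
	have z2: "norm (z^2) = 1" using z by (simp add: norm_power)
	have one: "norm (1-of_real r*1 :: complex) = 1-r"
		using r by (metis norm_of_real of_real_1 of_real_diff abs_of_nonneg diff_ge_0_iff_ge less_imp_le mult.right_neutral)
	have s: "(%k. 3*(- (r^k * Re (1^k))/real k)+4*(- (r^k * Re (z^k))/real k)+(- (r^k * Re ((z^2)^k))/real k))
		 sums (3 * ln (1-r)+4 * ln (norm (1-of_real r * z))+ln (norm (1-of_real r * z^2)))"
		using lnsums[of 1] one by (intro sums_add sums_mult lnsums z z2) auto
	have "3 * ln (1-r)+4 * ln (norm (1-of_real r * z))+ln (norm (1-of_real r * z^2))<=0"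
	proof (rule sums_le[OF _ s sums_zero])
		fix k
		define u where "u = z^k"
		have u: "(Re u)^2+(Im u)^2 = 1" using z by (simp add: u_def norm_power flip: cmod_power2)
		have "Re ((z^2)^k) = (Re u)^2-(Im u)^2"
		proof -
			have "(z^2)^k = u^2" by (simp add: u_def mult.commute flip: power_mult)
			thus ?thesis by (simp add: power2_eq_square)
		qed
		hence "3+4 * Re u+Re ((z^2)^k) = 2*(1+Re u)^2" using u by (simp add: power2_eq_square algebra_simps)
		hence "3+4 * Re u+Re ((z^2)^k)>=0" by simp
		hence "- (r^k/real k)*(3+4 * Re u+Re ((z^2)^k))<=0" using r by (intro mult_nonpos_nonneg) auto
		thus "3*(- (r^k * Re (1^k))/real k)+4*(- (r^k * Re (z^k))/real k)+(- (r^k * Re ((z^2)^k))/real k)<=0"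
			by (simp add: u_def algebra_simps add_divide_distrib)
	qed
	also have "3 * ln (1-r)+4 * ln (norm (1-of_real r * z))+ln (norm (1-of_real r * z^2))
		 = ln ((1-r)^3 * norm (1-of_real r * z)^4 * norm (1-of_real r * z^2))" using p1[OF z] p1[OF z2] r by (simp add: ln_mult_pos ln_realpow)
	finally show ?thesis using p1[OF z] p1[OF z2] r by (simp add: ln_le_zero_iff)
qed

lemma zeta_341:
	assumes "x > 1"
	shows "1<=norm (dseries (of_real x))^3 * norm (dseries (of_real x + \<i> * of_real t))^4 * norm (dseries (of_real x+2 * \<i> * of_real t))"
proof -
	define P where "P = (%s n. if prime n then 1/(1-of_nat n powr (-s)) else (1::complex))"
	have lim: "(%N. norm (\<Prod>n<N. P s n)) \<longlonglongrightarrow> norm (dseries s)" if "Re s > 1" for s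
		unfolding P_def by (intro tendsto_norm euler_product_dseries that)
	define s0 s1 s2 where "s0 = complex_of_real x" and "s1 = of_real x + \<i> * of_real t" and "s2 = of_real x+2 * \<i> * of_real t"
	have R: "Re s0 = x" "Re s1 = x" "Re s2 = x" by (simp_all add: s0_def s1_def s2_def)
	have "(%N. norm (\<Prod>n<N. P s0 n)^3 * norm (\<Prod>n<N. P s1 n)^4 * norm (\<Prod>n<N. P s2 n)) \<longlonglongrightarrow>
		 norm (dseries s0)^3 * norm (dseries s1)^4 * norm (dseries s2)" using assms R by (intro tendsto_intros lim) auto
	moreover have "1<=norm (\<Prod>n<N. P s0 n)^3 * norm (\<Prod>n<N. P s1 n)^4 * norm (\<Prod>n<N. P s2 n)" for N
	proof -
		have "1<=(\<Prod>n<N. norm (P s0 n)^3 * norm (P s1 n)^4 * norm (P s2 n))"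
		proof (rule prod_ge_1)
			fix n assume "n \<in> {..<N}"
			show "1<=norm (P s0 n)^3 * norm (P s1 n)^4 * norm (P s2 n)"
			proof (cases "prime n")
				case True
				define r where "r = real n powr (-x)"
				define z where "z = (of_nat n powr (-(\<i> * of_real t)) :: complex)"
				have nz: "norm z = 1" using True unfolding z_def by (subst norm_of_nat_powr) (auto simp: prime_gt_0_nat)
				have e0: "of_nat n powr (-s0) = complex_of_real r" using powr_of_real[of "real n" "-x"] by (simp add: r_def s0_def)
				have "-s1 = -s0+-(\<i> * of_real t)" by (simp add: s0_def s1_def)
				hence e1: "of_nat n powr (-s1) = complex_of_real r * z" by (simp only: powr_add e0 z_def)
				have "-s2 = -s0+(-(\<i> * of_real t)+-(\<i> * of_real t))" by (simp add: s0_def s2_def)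
				hence e2: "of_nat n powr (-s2) = complex_of_real r * z^2" by (simp only: powr_add e0 z_def power2_eq_square)
				have r: "0<=r" "r < 1" using norm_prime_powr_le(2)[OF True, of 1 s0] assms R by (auto simp: e0) (simp_all add: r_def)
				have m: "(1-r)^3 * norm (1-of_real r * z)^4 * norm (1-of_real r * z^2)<=1" by (rule mertens_341[OF nz r])
				have n0: "norm (1-complex_of_real r) = 1-r"
					using r by (metis norm_of_real of_real_1 of_real_diff abs_of_nonneg diff_ge_0_iff_ge less_imp_le)
				have lt: "norm (of_real r * z) < 1" "norm (of_real r * z^2) < 1" using r nz by (simp_all add: norm_mult norm_power)
				hence pos: "norm (1-of_real r * z) > 0" "norm (1-of_real r * z^2) > 0" by auto
				have "norm (P s0 n)^3 * norm (P s1 n)^4 * norm (P s2 n) = 1/((1-r)^3 * norm (1-of_real r * z)^4 * norm (1-of_real r * z^2))"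
					using True by (simp only: P_def if_True e0 e1 e2 norm_divide norm_one n0 power_one_over) simp
				also have "...>=1" using m pos r by (simp add: le_divide_eq)
				finally show ?thesis .
			qed (auto simp: P_def)
		qed
		thus ?thesis by (simp add: prod.distrib prod_power_distrib flip: prod_norm)
	qed
	ultimately show ?thesis unfolding s0_def s1_def s2_def by (intro tendsto_lowerbound) auto
qed

text \<open>At a zero 1 + i t the product in \<open>zeta_341\<close> would be O((x-1)^(-3) (x-1)^4)
  and tend to 0 as x -> 1, although it is at least 1. The result makes division by zeta(2s) possible
  on the critical line.\<close>

theorem zeta_reg_nonzero_line:
	assumes s: "Re s = 1"
	shows "zeta_reg s~=0"
proof (cases "s = 1")
	case False
	define t where "t = Im s"
	have s_eq: "s = 1 + \<i> * of_real t" using s by (simp add: t_def complex_eq_iff)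
	have t: "t~=0" using False s_eq by auto
	show ?thesis
	proof
		assume 0: "zeta_reg s = 0"
		have an: "zeta_reg analytic_on {w}" if "Re w > -1" for w
			by (rule holomorphic_on_imp_analytic_at[OF holomorphic_zeta_reg open_Re_gt]) (use that in auto)
		define w where "w = (%m x::real. complex_of_real x+m * \<i> * of_real t)"
		have wl: "(w m \<longlongrightarrow> of_real 1+m * \<i> * of_real t) (at_right 1)" for m unfolding w_def by (intro tendsto_intros)
		have cont: "((%x. zeta_reg (w m x)) \<longlongrightarrow> zeta_reg (of_real 1+m * \<i> * of_real t)) (at_right 1)" if "m \<in> {0,1,2}" for m
			using that by (intro isCont_tendsto_compose[OF _ wl] analytic_at_imp_isCont an) auto
		obtain D where D: "(zeta_reg has_field_derivative D) (at s)"
			using analytic_on_imp_differentiable_at[OF an[of s], of s] s by (auto simp: field_differentiable_def)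
		hence Dl: "((%v. (zeta_reg v-zeta_reg s)/(v-s)) \<longlongrightarrow> D) (at s)" by (simp add: has_field_derivative_iff)
		have w1: "filterlim (w 1) (at s) (at_right 1)"
		proof (rule filterlim_atI)
			show "(w 1 \<longlongrightarrow> s) (at_right 1)" using wl[of 1] by (simp add: s_eq)
			show "\<forall>\<^sub>F x in at_right 1. w 1 x~=s"
				using eventually_at_right_less[of "1::real"] by eventually_elim (auto simp: w_def s_eq complex_eq_iff)
		qed
		have q: "((%x. zeta_reg (w 1 x)/of_real (x-1)) \<longlongrightarrow> D) (at_right 1)"
		proof -
			have "((%x. (zeta_reg (w 1 x)-zeta_reg s)/(w 1 x-s)) \<longlongrightarrow> D) (at_right 1)" using filterlim_compose[OF Dl w1] .
			moreover have "(zeta_reg (w 1 x)-zeta_reg s)/(w 1 x-s) = zeta_reg (w 1 x)/of_real (x-1)" for x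
			proof -
				have "w 1 x-s = of_real (x-1)" by (simp add: w_def s_eq)
				thus ?thesis unfolding 0 by simp
			qed
			ultimately show ?thesis by (simp only:)
		qed
		define K where "K = (%x. norm (zeta_reg (w 0 x))^3 * norm (zeta_reg (w 1 x)/of_real (x-1)/(w 1 x-1))^4 *
				norm (zeta_reg (w 2 x)/(w 2 x-1))*(x-1))"
		have ne: "of_real 1+1 * \<i> * of_real t-1~=(0::complex)" "of_real 1+2 * \<i> * of_real t-1~=(0::complex)" using t by auto
		have "(K \<longlongrightarrow> norm (zeta_reg (of_real 1+0 * \<i> * of_real t))^3 * norm (D/(of_real 1+1 * \<i> * of_real t-1))^4 *
			 norm (zeta_reg (of_real 1+2 * \<i> * of_real t)/(of_real 1+2 * \<i> * of_real t-1))*(1-1)) (at_right 1)"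
			unfolding K_def using ne by (intro tendsto_intros cont wl q) auto
		hence K0: "(K \<longlongrightarrow> 0) (at_right 1)" by simp
		have "1<=(0::real)"
		proof (rule tendsto_lowerbound[OF K0])
			show "\<forall>\<^sub>F x in at_right 1. 1<=K x" using eventually_at_right_less[of "1::real"]
			proof eventually_elim
				case (elim x)
				have "1<=norm (dseries (w 0 x))^3 * norm (dseries (w 1 x))^4 * norm (dseries (w 2 x))"
					using zeta_341[OF elim, of t] by (simp add: w_def)
				also have "... = K x"
				proof -
					define d where "d = x-1"
					have d: "d > 0" using elim by (simp add: d_def)
					have w0: "w 0 x-1 = of_real d" by (simp add: w_def d_def)
					have n: "norm (w 0 x-1) = d" unfolding w0 norm_of_real using d by simp
					have "norm (zeta_reg (w 1 x)/of_real (x-1)/(w 1 x-1)) = norm (zeta_reg (w 1 x))/d/norm (w 1 x-1)"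
						unfolding norm_divide d_def[symmetric] norm_of_real using d by simp
					thus ?thesis unfolding K_def dseries_def norm_divide n d_def[symmetric] using d by (simp add: field_simps power3_eq_cube power4_eq_xxxx)
				qed
				finally show ?case .
			qed
		qed auto
		thus False by simp
	qed
qed simp

section \<open>Factoring the series into zeta powers and a product converging beyond Re s =
  1/2\<close>

text \<open>The Euler factor as a function of x = p^(-s). It is the same for all primes, and the
  case distinction supplies the constant term in place of the unconstrained sign at index 0.\<close>

definition efac :: "(nat => int) => complex => complex" where
	"efac \<mu> x = (\<Sum>k. of_int (if k = 0 then 1 else \<mu> k) * x^k)"

definition etail :: "(nat => int) => complex => complex" where
	"etail \<mu> x = (\<Sum>k. of_int (\<mu> (k+3)) * x^k)"

lemma sign_series_norm_le:
	fixes x :: complex and e :: "nat => int"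
	assumes "!!k. \<bar>e k\<bar><=1"
	shows "norm (of_int (e k) * x^k)<=norm x^k"
proof -
	have "norm (of_int (e k) * x^k) = \<bar>real_of_int (e k)\<bar> * norm x^k" by (simp add: norm_mult norm_power)
	also have "...<=1 * norm x^k" using assms[of k] by (intro mult_right_mono) auto
	finally show ?thesis by simp
qed

lemma sign_series_summable:
	fixes x :: complex and e :: "nat => int"
	assumes e: "!!k. \<bar>e k\<bar><=1" and x: "norm x < 1"
	shows "summable (%k. norm (of_int (e k) * x^k))" "summable (%k. of_int (e k) * x^k)"
		"norm (\<Sum>k. of_int (e k) * x^k)<=1/(1-norm x)"
proof -
	have g: "summable (%k. norm x^k)" using x by (intro summable_geometric) auto
	show s: "summable (%k. norm (of_int (e k) * x^k))"
	proof (rule summable_comparison_test'[OF g, of 0])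
		fix n
		show "norm (norm (of_int (e n) * x^n))<=norm x^n" using sign_series_norm_le[of e n x, OF e] by simp
	qed
	thus "summable (%k. of_int (e k) * x^k)" by (rule summable_norm_cancel)
	have "norm (\<Sum>k. of_int (e k) * x^k)<=(\<Sum>k. norm x^k)" by (intro norm_suminf_le g sign_series_norm_le e)
	also have "... = 1/(1-norm x)" using x by (intro suminf_geometric) auto
	finally show "norm (\<Sum>k. of_int (e k) * x^k)<=1/(1-norm x)" .
qed

lemma holomorphic_etail:
	assumes e: "!!k. k>=1 ==> \<bar>\<mu> k\<bar><=1"
	shows "etail \<mu> holomorphic_on ball 0 1" unfolding etail_def
proof (rule holomorphic_on_suminf_M_test)
	fix z :: complex assume z: "z \<in> ball 0 1"
	define d where "d = (1-norm z)/2"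
	have d: "d > 0" "norm z+d < 1" using z by (auto simp: d_def field_simps)
	have w: "norm w<=norm z+d" if "w \<in> cball z d" for w using that norm_triangle_sub[of w z] by (simp add: dist_norm norm_minus_commute)
	show "\<exists>d M. d > 0 \<and> cball z d \<subseteq> ball 0 1 \<and> summable M \<and>
		 (\<forall>n. \<forall>w\<in>cball z d. norm (of_int (\<mu> (n+3)) * w^n)<=M n)"
	proof (intro exI conjI allI ballI)
		show "cball z d \<subseteq> ball 0 1" using w d by force
		show "summable (%n. (norm z+d)^n)" using d by (intro summable_geometric) auto
		fix n w assume "w \<in> cball z d"
		have "norm (of_int (\<mu> (n+3)) * w^n)<=norm w^n" using e by (intro sign_series_norm_le[of "%n. \<mu> (n+3)"]) auto
		also have "...<=(norm z+d)^n" using w[OF \<open>w \<in> cball z d\<close>] by (intro power_mono) auto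
		finally show "norm (of_int (\<mu> (n+3)) * w^n)<=(norm z+d)^n" .
	qed (use d in auto)
qed (auto intro!: holomorphic_intros)

lemma efac_expand:
	assumes e: "!!k. k>=1 ==> \<bar>\<mu> k\<bar><=1" and x: "norm x < 1"
	shows "efac \<mu> x = 1 + of_int (\<mu> 1) * x + of_int (\<mu> 2) * x^2+x^3 * etail \<mu> x"
proof -
	define e where "e = (%k. if k = 0 then 1 else \<mu> k)"
	have s: "summable (%k. of_int (e k) * x^k)" using assms by (intro sign_series_summable) (auto simp: e_def)
	have "efac \<mu> x = (\<Sum>k. of_int (e k) * x^k)" by (simp only: efac_def e_def)
	also have "... = (\<Sum>k. of_int (e (k+3)) * x^(k+3))+(\<Sum>k<3. of_int (e k) * x^k)" by (rule suminf_split_initial_segment[OF s])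
	also have "(\<Sum>k. of_int (e (k+3)) * x^(k+3)) = (\<Sum>k. x^3*(of_int (\<mu> (k+3)) * x^k))"
		by (intro suminf_cong) (simp add: e_def power_add mult_ac)
	also have "... = x^3 * etail \<mu> x"
		unfolding etail_def using e x by (intro suminf_mult sign_series_summable[of "%k. \<mu> (k+3)"]) auto
	also have "(\<Sum>k<3. of_int (e k) * x^k) = 1 + of_int (\<mu> 1) * x + of_int (\<mu> 2) * x^2"
		by (simp add: e_def numeral_3_eq_3 numeral_2_eq_2)
	finally show ?thesis by (simp add: algebra_simps)
qed

text \<open>What remains of the Euler factor after division by those of the zeta powers: the terms
  in x and x^2 have been cancelled, and \<open>r\<close> carries the rest.\<close>

definition hfac :: "(complex => complex) => nat => complex => complex" where
	"hfac r n s = 1+(of_nat n powr (-s))^3 * r (of_nat n powr (-s))"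

definition vfac :: "(complex => complex) => nat => complex => complex" where
	"vfac r n s = (if prime n \<and> n~=2 then hfac r n s else 1)"

text \<open>The prime 2 is kept apart, because its factor is the only one that can vanish in Re s >=
  1/2 in the case \<epsilon> 1 = -1, \<epsilon> 2 = 1.\<close>

definition V :: "(complex => complex) => complex => complex" where
	"V r s = lim (%N. \<Prod>n<N. vfac r n s)"

lemma holomorphic_hfac:
	assumes r: "r holomorphic_on ball 0 1" and n: "prime n"
	shows "hfac r n holomorphic_on {s. Re s > 0}"
proof -
	have "r \<circ> (%s. of_nat n powr (-s)) holomorphic_on {s. Re s > 0}"
	proof (rule holomorphic_on_compose_gen[OF _ r])
		show "(%s. of_nat n powr (-s)) ` {s. Re s > 0} \<subseteq> ball 0 1"
		proof safe
			fix s :: complex assume "Re s > 0"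
			thus "of_nat n powr (-s) \<in> ball (0::complex) 1" using norm_prime_powr_le(2)[OF n, of "Re s" s] by simp
		qed
	qed (use n in \<open>auto intro!: holomorphic_intros\<close>)
	thus ?thesis unfolding hfac_def o_def using n by (intro holomorphic_intros) auto
qed

lemma holomorphic_vfac:
	assumes r: "r holomorphic_on ball 0 1"
	shows "vfac r n holomorphic_on {s. Re s > 0}" using holomorphic_hfac[OF r, of n] unfolding vfac_def by (cases "prime n \<and> n~=2") auto

text \<open>6/5 is 3 times 2/5: the abscissa 2/5 lies between 1/3, where absolute convergence ends,
  and 1/2, so that a neighbourhood of the critical line is covered.\<close>

lemma vfac_bound:
	assumes r: "r holomorphic_on ball 0 1"
	obtains C where "C>=0" "!!n s. Re s>=2/5 ==> norm (vfac r n s-1)<=C * real n powr (-(6/5))"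
proof -
	have lt: "2 powr (-(2/5)) < (1::real)" using powr_less_mono[of "-(2/5)" 0 "2::real"] by simp
	have "cball 0 (2 powr (-(2/5))) \<subseteq> ball (0::complex) 1" using lt by auto
	hence "continuous_on (cball 0 (2 powr (-(2/5)))) r" using r holomorphic_on_imp_continuous_on holomorphic_on_subset by blast
	hence "bounded (r ` cball 0 (2 powr (-(2/5))))" by (intro compact_imp_bounded compact_continuous_image) auto
	then obtain C where C: "C > 0" "!!x. norm x<=2 powr (-(2/5)) ==> norm (r x)<=C" by (auto simp: bounded_pos)
	show ?thesis
	proof (rule that[of C])
		fix n and s :: complex assume s: "Re s>=2/5"
		show "norm (vfac r n s-1)<=C * real n powr (-(6/5))"
		proof (cases "prime n \<and> n~=2")
			case True
			define x where "x = (of_nat n powr (-s) :: complex)"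
			have p: "prime n" using True by simp
			have n1: "real n>=1" using prime_ge_1_nat[OF p] by simp
			have x1: "norm x<=2 powr (-(2/5))" using norm_prime_powr_le(1)[OF p s] by (simp add: x_def)
			have x2: "norm x<=real n powr (-(2/5))" unfolding x_def norm_prime_powr[OF p] using s n1 by (intro powr_mono) auto
			have "norm (vfac r n s-1) = norm x^3 * norm (r x)" using True by (simp add: vfac_def hfac_def x_def norm_mult norm_power)
			also have "...<=(real n powr (-(2/5)))^3 * C" using C x1 x2 by (intro mult_mono power_mono) auto
			also have "(real n powr (-(2/5)))^3 = real n powr (-(6/5))" using n1 by (simp add: powr_powr flip: powr_realpow)
			finally show ?thesis by (simp add: mult.commute)
		qed (use C in \<open>auto simp: vfac_def\<close>)
	qed (use C in auto)
qed

lemma V_convergence: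
	assumes r: "r holomorphic_on ball 0 1"
	shows "V r holomorphic_on {s. Re s > 2/5}"
		"!!s. Re s > 2/5 ==> (%N. \<Prod>n<N. vfac r n s) \<longlonglongrightarrow> V r s"
proof -
	obtain C where C: "C>=0" "!!n s. Re s>=2/5 ==> norm (vfac r n s-1)<=C * real n powr (-(6/5))" using vfac_bound[OF r] by blast
	have unif: "uniform_limit A (%N s. \<Prod>n<N. vfac r n s) (V r) sequentially"
		if A: "compact A" "A \<subseteq> {s. Re s > 2/5}" for A
	proof -
		have "uniformly_convergent_on A (%N s. \<Prod>n<N. vfac r n s)"
		proof (rule uniformly_convergent_on_prod')
			show "continuous_on A (vfac r n)" for n
				by (rule holomorphic_on_imp_continuous_on, rule holomorphic_on_subset[OF holomorphic_vfac[OF r]]) (use A in auto)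
			show "uniformly_convergent_on A (%N s. \<Sum>n<N. norm (vfac r n s-1))"
			proof (rule Weierstrass_m_test')
				show "summable (%n. C * real n powr (-(6/5)))" by (intro summable_mult) (simp add: summable_real_powr_iff)
				show "norm (norm (vfac r n s-1))<=C * real n powr (-(6/5))" if "s \<in> A" for n s using C(2)[of s n] that A by auto
			qed
		qed (rule A)
		thus ?thesis unfolding V_def by (simp only: uniformly_convergent_uniform_limit_iff)
	qed
	show "V r holomorphic_on {s. Re s > 2/5}"
	proof (rule holomorphic_uniform_sequence)
		show "(%s. \<Prod>n<N. vfac r n s) holomorphic_on {s. Re s > 2/5}" for N
			by (intro holomorphic_on_prod holomorphic_on_subset[OF holomorphic_vfac[OF r]]) auto
		fix z assume z: "z \<in> {s. Re s > (2/5::real)}"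
		have "\<exists>d>0. cball z d \<subseteq> {s. Re s > 2/5}" using iffD1[OF open_contains_cball open_Re_gt[of "2/5"]] z by (rule bspec)
		then obtain d where d: "d > 0" "cball z d \<subseteq> {s. Re s > 2/5}" by (elim exE conjE)
		have "uniform_limit (cball z d) (%N s. \<Prod>n<N. vfac r n s) (V r) sequentially" by (rule unif[OF compact_cball d(2)])
		with d show "\<exists>d>0. cball z d \<subseteq> {s. Re s > 2/5} \<and> uniform_limit (cball z d) (%N s. \<Prod>n<N. vfac r n s) (V r) sequentially"
			by (intro exI[of _ d] conjI)
	qed (rule open_Re_gt)
	fix s :: complex assume "Re s > 2/5"
	hence "uniform_limit {s} (%N s. \<Prod>n<N. vfac r n s) (V r) sequentially" by (intro unif) auto
	thus "(%N. \<Prod>n<N. vfac r n s) \<longlonglongrightarrow> V r s" by (rule tendsto_uniform_limitI) simp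
qed

definition Ufun :: "(complex => complex) => complex => complex" where
	"Ufun r s = hfac r 2 s * V r s"

lemma holomorphic_Ufun:
	assumes r: "r holomorphic_on ball 0 1"
	shows "Ufun r holomorphic_on {s. Re s > 2/5}" unfolding Ufun_def
	by (intro holomorphic_intros V_convergence(1)[OF r] holomorphic_on_subset[OF holomorphic_hfac[OF r]]) auto

lemma Ufun_LIMSEQ:
	assumes r: "r holomorphic_on ball 0 1" and s: "Re s > 2/5"
	shows "(%N. \<Prod>n<N. if prime n then hfac r n s else 1) \<longlonglongrightarrow> Ufun r s"
proof -
	have "(%N. hfac r 2 s*(\<Prod>n<N. vfac r n s)) \<longlonglongrightarrow> Ufun r s"
		unfolding Ufun_def by (intro tendsto_intros V_convergence(2)[OF r s])
	moreover have "\<forall>\<^sub>F N in sequentially. hfac r 2 s*(\<Prod>n<N. vfac r n s) = (\<Prod>n<N. if prime n then hfac r n s else 1)"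
		using eventually_ge_at_top[of 3]
	proof eventually_elim
		case (elim N)
		have "(\<Prod>n<N. if prime n then hfac r n s else 1) = (\<Prod>n<N. (if n = 2 then hfac r 2 s else 1) * vfac r n s)"
			by (intro prod.cong) (auto simp: vfac_def)
		also have "... = (\<Prod>n<N. if n = 2 then hfac r 2 s else 1)*(\<Prod>n<N. vfac r n s)" by (rule prod.distrib)
		also have "(\<Prod>n<N. if n = 2 then hfac r 2 s else 1) = hfac r 2 s" using elim by simp
		finally show ?case by simp
	qed
	ultimately show ?thesis by (rule Lim_transform_eventually)
qed

lemma sign_multiplicative_facts:
	assumes "sign_multiplicative \<mu> f"
	shows "f 1 = 1" "coprime m n ==> f (m * n) = f m * f n" "k>=1 ==> \<bar>\<mu> k\<bar><=1"
		"prime p ==> f (p^k) = (if k = 0 then 1 else \<mu> k)" "\<bar>f n\<bar><=1"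
proof -
	show f1: "f 1 = 1" and mult: "!!m n. coprime m n ==> f (m * n) = f m * f n" using assms by (auto simp: sign_multiplicative_def multiplicative_def)
	have f0: "f 0 = 0" using assms by (simp add: sign_multiplicative_def multiplicative_def)
	show eps: "!!k. k>=1 ==> \<bar>\<mu> k\<bar><=1" using assms by (force simp: sign_multiplicative_def)
	show pk: "!!p k. prime p ==> f (p^k) = (if k = 0 then 1 else \<mu> k)" using assms f1 by (auto simp: sign_multiplicative_def)
	show "\<bar>f n\<bar><=1"
	proof (induction n rule: less_induct)
		case (less n)
		show ?case
		proof (cases "n<=1")
			case True
			thus ?thesis using f0 f1 by (cases n) auto
		next
			case False
			then obtain p where p: "prime p" "p dvd n" using prime_factor_nat[of n] by auto
			define k where "k = multiplicity p n"
			define m where "m = n div p^k"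
			have nm: "n = p^k * m" by (simp add: m_def k_def multiplicity_dvd)
			have ndm: "\<not> p dvd m" unfolding m_def k_def using False p not_prime_unit by (intro multiplicity_decompose) auto
			have "coprime (p^k) m" using prime_imp_coprime[OF p(1) ndm] by simp
			hence "f n = f (p^k) * f m" using mult nm by metis
			moreover have "\<bar>f (p^k)\<bar><=1" using pk[OF p(1), of k] eps[of k] by auto
			moreover have "m < n"
			proof -
				have "m~=n" using ndm p by auto
				moreover have "m<=n" unfolding m_def by (rule div_le_dividend)
				ultimately show ?thesis by simp
			qed
			hence "\<bar>f m\<bar><=1" by (rule less.IH)
			ultimately show ?thesis by (simp add: abs_mult mult_le_one)
		qed
	qed
qed

definition Mfun :: "(complex => complex) => int => int => complex => complex" where
	"Mfun r a c s = Ufun r s * dseries s powi a * dseries (2 * s) powi c"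

text \<open>Removing singularities makes the function nicely meromorphic: where
  \<open>dseries\<close> has a pole, the defining expression may take an accidental value.\<close>

definition Tfun :: "(complex => complex) => int => int => complex => complex" where
	"Tfun r a c = remove_sings (Mfun r a c)"

lemma prod_power_int_distrib':
	fixes f :: "'b => complex"
	shows "(\<Prod>x\<in>A. f x powi n) = (\<Prod>x\<in>A. f x) powi n"
	by (induction A rule: infinite_finite_induct) (auto simp: power_int_mult_distrib)

text \<open>The identity \<open>fac\<close> is applied at x = p^(-s) for each prime, so that the
  partial Euler products already agree before passing to the limit.\<close>

lemma dirichlet_series_eq:
	assumes sm: "sign_multiplicative \<mu> f" and r: "r holomorphic_on ball 0 1"
		and fac: "!!x. norm x < 1 ==> efac \<mu> x = (1+x^3 * r x)*(1/(1-x)) powi a*(1/(1-x^2)) powi c"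
		and s: "Re s > 1"
	shows "dirichlet_series f s = Mfun r a c s"
proof -
	note F = sign_multiplicative_facts[OF sm]
	define g where "g = (%n. of_int (f n) * of_nat n powr (-s) :: complex)"
	have ds: "dirichlet_series f s = (\<Sum>n. g (Suc n))" unfolding dirichlet_series_def g_def by (simp add: powr_minus divide_inverse)
	have "(%N. \<Prod>n<N. if prime n then \<Sum>k. g (n^k) else 1) \<longlonglongrightarrow> (\<Sum>n. g (Suc n))"
	proof (rule euler_product_LIMSEQ)
		show "g 1 = 1" using F(1) by (simp add: g_def)
		show "coprime m n ==> g (m * n) = g m * g n" for m n unfolding g_def of_nat_powr_mult by (simp add: F(2))
		show "summable (%n. norm (g (Suc n)))"
		proof (rule summable_comparison_test[OF _ summable_dirichlet_zeta[OF s]], intro exI allI impI)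
			fix n
			have "norm (norm (g (Suc n))) = \<bar>real_of_int (f (Suc n))\<bar> * norm (of_nat (Suc n) powr (-s) :: complex)"
				unfolding g_def norm_mult by simp
			also have "...<=1 * norm (of_nat (Suc n) powr (-s) :: complex)" using F(5)[of "Suc n"] by (intro mult_right_mono) auto
			finally show "norm (norm (g (Suc n)))<=norm (of_nat (Suc n) powr (-s) :: complex)" by simp
		qed
	qed
	moreover have "(%N. \<Prod>n<N. if prime n then \<Sum>k. g (n^k) else 1) =
		 (%N. (\<Prod>n<N. if prime n then hfac r n s else 1)*(\<Prod>n<N. if prime n then 1/(1-of_nat n powr (-s)) else 1) powi a *
					(\<Prod>n<N. if prime n then 1/(1-of_nat n powr (-(2 * s))) else 1) powi c)"
	proof
		fix N
		have "(if prime n then \<Sum>k. g (n^k) else 1) = (if prime n then hfac r n s else 1) *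
			(if prime n then 1/(1-of_nat n powr (-s)) else 1) powi a*(if prime n then 1/(1-of_nat n powr (-(2 * s))) else 1) powi c" for n
		proof (cases "prime n")
			case True
			define x where "x = (of_nat n powr (-s) :: complex)"
			have x: "norm x < 1" using norm_prime_powr_le(2)[OF True, of 1 s] s by (simp add: x_def)
			have "g (n^k) = of_int (if k = 0 then 1 else \<mu> k) * x^k" for k unfolding g_def x_def of_nat_power_powr F(4)[OF True] ..
			hence "(\<Sum>k. g (n^k)) = efac \<mu> x" by (simp only: efac_def)
			also have "... = (1+x^3 * r x)*(1/(1-x)) powi a*(1/(1-x^2)) powi c" by (rule fac[OF x])
			also have "x^2 = of_nat n powr (-(2 * s))"
			proof -
				have "-(2 * s) = -s+-s" by simp
				thus ?thesis by (simp only: powr_add x_def power2_eq_square)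
			qed
			finally show ?thesis using True by (simp add: hfac_def x_def)
		qed auto
		thus "(\<Prod>n<N. if prime n then \<Sum>k. g (n^k) else 1) =
			 (\<Prod>n<N. if prime n then hfac r n s else 1)*(\<Prod>n<N. if prime n then 1/(1-of_nat n powr (-s)) else 1) powi a *
					(\<Prod>n<N. if prime n then 1/(1-of_nat n powr (-(2 * s))) else 1) powi c" by (simp only: prod.distrib prod_power_int_distrib')
	qed
	moreover have "... \<longlonglongrightarrow> Mfun r a c s" unfolding Mfun_def using s
		by (intro tendsto_mult tendsto_power_int Ufun_LIMSEQ[OF r] euler_product_dseries dseries_nonzero) auto
	ultimately show ?thesis unfolding ds by (metis LIMSEQ_unique)
qed

lemma meromorphic_dseries: "dseries meromorphic_on {s. Re s > -1}" unfolding dseries_def by (intro meromorphic_intros analytic_on_imp_meromorphic_on)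
		 (auto simp: analytic_on_open open_Re_gt holomorphic_zeta_reg intro!: analytic_intros)

lemma meromorphic_dseries_double: "(%s. dseries (2 * s)) meromorphic_on {s. Re s > 0}"
proof -
	have "(%s. zeta_reg (2 * s)) analytic_on {s. Re s > 0}"
	proof -
		have "zeta_reg \<circ> (%s. 2 * s) holomorphic_on {s. Re s > 0}"
			by (rule holomorphic_on_compose_gen[OF _ holomorphic_zeta_reg]) (auto intro!: holomorphic_intros)
		thus ?thesis by (simp add: o_def analytic_on_open open_Re_gt)
	qed
	thus ?thesis unfolding dseries_def by (intro meromorphic_intros analytic_on_imp_meromorphic_on) (auto intro!: analytic_intros)
qed

lemma meromorphic_Mfun:
	assumes r: "r holomorphic_on ball 0 1"
	shows "Mfun r a c meromorphic_on {s. Re s > 2/5}"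
proof -
	have "Ufun r meromorphic_on {s. Re s > 2/5}"
		by (rule analytic_on_imp_meromorphic_on) (simp only: analytic_on_open[OF open_Re_gt] holomorphic_Ufun[OF r])
	moreover have "dseries meromorphic_on {s. Re s > 2/5}" by (rule meromorphic_on_subset[OF meromorphic_dseries]) auto
	moreover have "(%s. dseries (2 * s)) meromorphic_on {s. Re s > 2/5}" by (rule meromorphic_on_subset[OF meromorphic_dseries_double]) auto
	ultimately show ?thesis unfolding Mfun_def by (intro meromorphic_intros)
qed

lemma nicely_meromorphic_Tfun:
	assumes r: "r holomorphic_on ball 0 1"
	shows "Tfun r a c nicely_meromorphic_on {s. Re s > 2/5}" unfolding Tfun_def by (rule remove_sings_nicely_meromorphic[OF meromorphic_Mfun[OF r]])

lemma analytic_dseries: "Re s > -1 ==> s~=1 ==> dseries analytic_on {s}" unfolding dseries_def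
	by (intro analytic_intros holomorphic_on_imp_analytic_at[OF holomorphic_zeta_reg open_Re_gt]) auto

lemma analytic_dseries_double:
	assumes "Re s > 0" "s~=1/2"
	shows "(%s. dseries (2 * s)) analytic_on {s}"
proof -
	have "2 * s~=1" using assms(2) by (metis nonzero_mult_div_cancel_left zero_neq_numeral)
	hence "dseries \<circ> (%s. 2 * s) analytic_on {s}" using assms by (intro analytic_on_compose) (auto intro!: analytic_intros analytic_dseries)
	thus ?thesis by (simp add: o_def)
qed

lemma continues_series_Tfun:
	assumes sm: "sign_multiplicative \<mu> f" and r: "r holomorphic_on ball 0 1"
		and fac: "!!x. norm x < 1 ==> efac \<mu> x = (1+x^3 * r x)*(1/(1-x)) powi a*(1/(1-x^2)) powi c"
	shows "continues_series f (Tfun r a c)" unfolding continues_series_def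
proof (intro conjI allI impI)
	show "Tfun r a c nicely_meromorphic_on {s. Re s>=1/2}" by (rule nicely_meromorphic_on_subset[OF nicely_meromorphic_Tfun[OF r]]) auto
	fix s :: complex assume s: "Re s > 1"
	have "Mfun r a c analytic_on {s}"
	proof -
		have "Ufun r analytic_on {s}" by (rule holomorphic_on_imp_analytic_at[OF holomorphic_Ufun[OF r] open_Re_gt]) (use s in auto)
		moreover have "dseries analytic_on {s}" using s by (intro analytic_dseries) auto
		moreover have "s~=1/2"
		proof
			assume "s = 1/2"
			hence "Re s = Re (1/2)" by (rule arg_cong)
			thus False using s by simp
		qed
		hence "(%s. dseries (2 * s)) analytic_on {s}" using s by (intro analytic_dseries_double) auto
		moreover have "dseries s~=0" "dseries (2 * s)~=0" using s by (auto intro!: dseries_nonzero)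
		ultimately show ?thesis unfolding Mfun_def by (intro analytic_intros) auto
	qed
	hence "Tfun r a c s = Mfun r a c s" by (simp add: Tfun_def)
	thus "Tfun r a c s = dirichlet_series f s" using dirichlet_series_eq[OF sm r fac s] by simp
qed

section \<open>Zeta on the positive real axis, and zeros in a disc\<close>

lemma zeta_reg_real:
	assumes x: "x > -1"
	shows "(%N. (x-1)*((\<Sum>n=1..N. real n powr (-x))-real N powr (-x)/2)+real N powr (1-x)) \<longlonglongrightarrow> Re (zeta_reg (of_real x))"
		and "zeta_reg (of_real x) = of_real (Re (zeta_reg (of_real x)))"
proof -
	define S where "S = (%N. (x-1)*((\<Sum>n=1..N. real n powr (-x))-real N powr (-x)/2)+real N powr (1-x))"
	have p: "complex_of_real (real n powr y) = of_nat n powr (of_real y)" for n y using powr_of_real[of "real n" y] by simp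
	have "(%N. (of_real x-1)*((\<Sum>n=1..N. of_nat n powr (-of_real x))-of_nat N powr (-of_real x)/2) + of_nat N powr (1-of_real x))
					 \<longlonglongrightarrow> zeta_reg (of_real x)" using x by (intro zeta_reg_LIMSEQ) auto
	also have "(%N. (of_real x-1)*((\<Sum>n=1..N. of_nat n powr (-of_real x))-of_nat N powr (-of_real x)/2) + of_nat N powr (1-of_real x))
		= (%N. complex_of_real (S N))" unfolding S_def
		by (simp only: p of_real_add of_real_mult of_real_diff of_real_sum of_real_divide of_real_minus of_real_1 of_real_numeral)
	finally have lim: "(%N. complex_of_real (S N)) \<longlonglongrightarrow> zeta_reg (of_real x)" .
	from tendsto_Im[OF lim] have im: "Im (zeta_reg (of_real x)) = 0" by (simp add: LIMSEQ_const_iff)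
	thus "zeta_reg (of_real x) = of_real (Re (zeta_reg (of_real x)))" by (simp add: complex_eq_iff)
	from tendsto_Re[OF lim] show "(%N. (x-1)*((\<Sum>n=1..N. real n powr (-x))-real N powr (-x)/2)+real N powr (1-x)) \<longlonglongrightarrow> Re (zeta_reg (of_real x))"
		by (simp add: S_def)
qed

text \<open>N^(1-x) - (1-x) times the sum of n^(-x) up to N is nondecreasing in N, by the mean value
  theorem, and equals x at N = 1. In particular zeta(1/2) < 0.\<close>

lemma zeta_reg_real_ge:
	assumes x: "0 < x" "x < 1"
	shows "Re (zeta_reg (of_real x))>=x"
proof (rule tendsto_lowerbound[OF zeta_reg_real(1)])
	have A: "x<=real (Suc N) powr (1-x)-(1-x)*(\<Sum>n=1..Suc N. real n powr (-x))" for N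
	proof (induction N)
		case (Suc N)
		define m where "m = real (Suc N)"
		have m: "m > 0" by (simp add: m_def)
		have "\<exists>z>m. z < m+1 \<and> (m+1) powr (1-x)-m powr (1-x) = (m+1-m)*((1-x) * z powr (-x))"
			using m by (intro MVT2) (auto intro!: derivative_eq_intros)
		then obtain z where z: "z > m" "z < m+1" "(m+1) powr (1-x)-m powr (1-x) = (1-x) * z powr (-x)" by auto
		have "(1-x)*(m+1) powr (-x)<=(1-x) * z powr (-x)" using x z m by (intro mult_left_mono powr_mono2') auto
		hence "(1-x)*(m+1) powr (-x)<=(m+1) powr (1-x)-m powr (1-x)" using z by simp
		moreover have "m+1 = real (Suc (Suc N))" by (simp add: m_def)
		ultimately show ?case using Suc by (simp add: m_def algebra_simps)
	qed simp
	show "\<forall>\<^sub>F N in sequentially. x<=(x-1)*((\<Sum>n=1..N. real n powr (-x))-real N powr (-x)/2)+real N powr (1-x)"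
		using eventually_gt_at_top[of 0]
	proof eventually_elim
		case (elim N)
		then obtain M where N: "N = Suc M" by (cases N) auto
		have "(1-x)*(real N powr (-x)/2)>=0" using x by simp
		moreover have "(x-1)*((\<Sum>n=1..N. real n powr (-x))-real N powr (-x)/2)+real N powr (1-x)
				= (real N powr (1-x)-(1-x)*(\<Sum>n=1..N. real n powr (-x)))+(1-x)*(real N powr (-x)/2)" by (simp add: field_simps)
		ultimately show ?case using A[of M] unfolding N[symmetric] by linarith
	qed
qed (use x in auto)

lemma zeta_reg_real_nonzero:
	assumes x: "x > 0"
	shows "zeta_reg (of_real x)~=0"
proof -
	consider "x < 1" | "x = 1" | "x > 1" by linarith
	thus ?thesis
	proof cases
		case 1
		with zeta_reg_real_ge[of x] x show ?thesis by auto
	next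
		case 3
		with dseries_nonzero[of "of_real x"] show ?thesis by (auto simp: dseries_def)
	qed auto
qed

text \<open>The hypothesis concerns a punctured neighbourhood of z only; each nearby point again has
  such a neighbourhood, so the corrected values agree at all of them.\<close>

lemma remove_sings_eq_analytic:
	assumes g: "g analytic_on {z}" "\<forall>\<^sub>F x in at z. f x = g x"
	shows "\<forall>\<^sub>F x in nhds z. remove_sings f x = g x"
proof -
	have "\<forall>\<^sub>F y in nhds z. \<forall>\<^sub>F x in at y. f x = g x"
	proof -
		obtain A where A: "open A" "z \<in> A" "!!x. x \<in> A ==> x~=z ==> f x = g x" using g(2) unfolding eventually_at_topological by auto
		have "\<forall>\<^sub>F y in nhds z. y \<in> A" using A by (intro eventually_nhds_in_open)
		thus ?thesis
		proof eventually_elim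
			case (elim y)
			show ?case
			proof (cases "y = z")
				case True thus ?thesis using g(2) by simp
			next
				case False
				have "\<forall>\<^sub>F x in nhds y. x \<in> A-{z}" using A(1) elim False by (intro eventually_nhds_in_open) auto
				thus ?thesis unfolding eventually_at_filter by eventually_elim (use A(3) in auto)
			qed
		qed
	qed
	hence "\<forall>\<^sub>F y in nhds z. remove_sings f y = remove_sings g y" by eventually_elim (rule remove_sings_cong, auto)
	thus ?thesis using eventually_remove_sings_eq_nhds[OF g(1)] by eventually_elim simp
qed

text \<open>Multiplying by a polynomial removes the finitely many zeros of \<open>h\<close> from a compact disc.\<close>
lemma polynomial_multiple:
	assumes h: "h holomorphic_on ball 0 1" "h 0~=0" and \<rho>: "\<rho> < 1"
	obtains P :: "complex poly" and R where "P~=0" "R analytic_on cball 0 \<rho>"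
		"!!x. x \<in> cball 0 \<rho> ==> poly P x = R x * h x"
proof (cases "\<rho> < 0")
	case True
	thus ?thesis using that[of 1 "%_. 1"] by auto
next
	case False
	have han: "h analytic_on ball 0 1" using h by (simp add: analytic_on_open)
	have sub: "cball 0 \<rho> \<subseteq> ball (0::complex) 1" using \<rho> by auto
	have hnc: "\<not> h constant_on ball 0 1 \<or> (\<forall>x\<in>ball 0 1. h x~=0)" using h(2) by (auto simp: constant_on_def)
	define Z where "Z = {x \<in> cball 0 \<rho>. h x = 0}"
	have finZ: "finite Z"
	proof (cases "h constant_on ball 0 1")
		case True
		hence "Z = {}" using hnc sub h(2) by (auto simp: Z_def constant_on_def)
		thus ?thesis by simp
	next
		case False
		have "finite {z \<in> cball 0 \<rho>. h z = 0}" by (rule holomorphic_compact_finite_zeros[of h "ball 0 1"])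
				 (use h sub False in \<open>auto simp: analytic_on_open constant_on_def\<close>)
		thus ?thesis by (simp add: Z_def)
	qed
	define m where "m = (%z. nat (zorder h z))"
	define P where "P = (\<Prod>z\<in>Z. [:-z, 1:]^m z)"
	have P0: "P~=0" using finZ by (auto simp: P_def)
	have polyP: "poly P x = (\<Prod>z\<in>Z. (x-z)^m z)" for x by (simp add: P_def poly_prod)
	have loc: "\<exists>g. g analytic_on {z} \<and> (\<forall>\<^sub>F x in at z. poly P x/h x = g x) \<and> poly P z = g z * h z" if z: "z \<in> cball 0 \<rho>" for z
	proof (cases "h z = 0")
		case False
		have "h analytic_on {z}" using han sub z by (auto intro: analytic_on_subset)
		moreover have "poly P analytic_on {z}"
		proof -
			have "(%x. \<Prod>z\<in>Z. (x-z)^m z) analytic_on {z}" by (intro analytic_intros)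
			thus ?thesis by (simp only: polyP[symmetric])
		qed
		ultimately show ?thesis using False by (intro exI[of _ "%x. poly P x/h x"]) (auto intro!: analytic_intros)
	next
		case True
		have zb: "z \<in> ball 0 1" using z sub by blast
		have "\<exists>w\<in>ball 0 1. h w~=0" using h(2) by (intro bexI[of _ 0]) auto
		from zorder_exist_zero[OF h(1) open_ball _ zb this] True
		obtain g r where g: "0 < zorder h z" "r > 0" "cball z r \<subseteq> ball 0 1" "g holomorphic_on cball z r"
			"!!w. w \<in> cball z r ==> h w = g w*(w-z)^nat (zorder h z) \<and> g w~=0" by (auto simp: Let_def connected_ball)
		have zZ: "z \<in> Z" using True z by (simp add: Z_def)
		define q where "q = (%x. (\<Prod>w\<in>Z-{z}. (x-w)^m w)/g x)"
		have ga: "g analytic_on {z}" by (rule holomorphic_on_imp_analytic_at[of _ "ball z r"]) (use g in \<open>auto intro: holomorphic_on_subset\<close>)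
		have gz: "g z~=0" using g(5)[of z] g(2) by auto
		have qa: "q analytic_on {z}" unfolding q_def using ga gz by (intro analytic_intros) auto
		have split: "poly P x = (x-z)^m z*(\<Prod>w\<in>Z-{z}. (x-w)^m w)" for x unfolding polyP using finZ zZ by (rule prod.remove)
		have ev: "\<forall>\<^sub>F x in at z. x \<in> ball z r-{z}" using g(2) by (intro eventually_at_in_open) auto
		have "\<forall>\<^sub>F x in at z. poly P x/h x = q x" using ev
		proof eventually_elim
			case (elim x)
			hence "h x = g x*(x-z)^m z" "g x~=0" using g(5)[of x] by (auto simp: m_def)
			thus ?case using elim by (simp add: split q_def)
		qed
		moreover have "poly P z = q z * h z" using True g(1) by (simp add: split m_def)
		ultimately show ?thesis using qa by blast
	qed
	define R where "R = remove_sings (%x. poly P x/h x)"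
	have R: "R analytic_on {z} \<and> poly P z = R z * h z" if z: "z \<in> cball 0 \<rho>" for z
	proof -
		obtain g where g: "g analytic_on {z}" "\<forall>\<^sub>F x in at z. poly P x/h x = g x" "poly P z = g z * h z" using loc[OF z] by blast
		have ev: "\<forall>\<^sub>F x in nhds z. R x = g x" unfolding R_def by (rule remove_sings_eq_analytic[OF g(1,2)])
		have "R analytic_on {z} \<longleftrightarrow> g analytic_on {z}" "R z = g z"
			using analytic_at_cong[OF ev refl] eventually_nhds_x_imp_x[OF ev] by simp_all
		thus ?thesis using g by simp
	qed
	have "R analytic_on cball 0 \<rho>" using R analytic_on_analytic_at[of R "cball 0 \<rho>"] by blast
	thus ?thesis using R by (intro that[OF P0, of R]) blast+
qed

section \<open>The factors at the odd primes stay away from 0\<close>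

text \<open>For signs starting with -1, 1: the local factor of zeta(2s)/zeta(s) is 1/(1+x), so the
  remaining factor is (1+x) times the Euler factor, that is 1 + x^3
  \<open>rfun \<mu> x\<close>.\<close>

definition rfun :: "(nat => int) => complex => complex" where
	"rfun \<mu> x = 1+(1+x) * etail \<mu> x"

lemma holomorphic_rfun:
	assumes "!!k. k>=1 ==> \<bar>\<mu> k\<bar><=1"
	shows "rfun \<mu> holomorphic_on ball 0 1" unfolding rfun_def by (intro holomorphic_intros holomorphic_etail assms)

lemma rfun_bound:
	assumes e: "!!k. k>=1 ==> \<bar>\<mu> k\<bar><=1" and x: "norm x<=y" "y < 1"
	shows "norm (x^3 * rfun \<mu> x)<=2 * y^3/(1-y)"
proof -
	have x1: "norm x < 1" and y: "y>=0" using x norm_ge_zero[of x] by linarith+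
	have t: "norm (etail \<mu> x)<=1/(1-norm x)"
		unfolding etail_def using e by (intro sign_series_summable(3)[of "%k. \<mu> (k+3)"] x1) auto
	have "norm (rfun \<mu> x)<=1+norm (1+x) * norm (etail \<mu> x)"
		unfolding rfun_def by (rule order_trans[OF norm_triangle_ineq]) (simp add: norm_mult)
	also have "...<=1+(1+norm x)*(1/(1-norm x))" using t x1 norm_triangle_ineq[of 1 x] by (intro add_left_mono mult_mono) auto
	also have "... = 2/(1-norm x)" using x1 by (simp add: field_simps)
	also have "...<=2/(1-y)" using x by (intro divide_left_mono) auto
	finally have r: "norm (rfun \<mu> x)<=2/(1-y)" .
	have "norm (x^3 * rfun \<mu> x)<=y^3*(2/(1-y))" unfolding norm_mult norm_power using x y r by (intro mult_mono power_mono) auto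
	thus ?thesis by (simp add: mult.commute)
qed

text \<open>The bound of \<open>rfun_bound\<close> at x = p^(-1/2). It is below 1 from p = 3 on, but
  about 2.4 at p = 2, which is why 2 needs a separate treatment.\<close>

definition mbd :: "nat => real" where
	"mbd n = (if prime n \<and> n~=2 then 2*(1/sqrt (real n))^3/(1-1/sqrt (real n)) else 0)"

lemma mbd_bounds: "0<=mbd n" "mbd n < 1" "mbd n<=5 * real n powr (-(3/2))"
proof -
	have *: "0<=mbd n \<and> mbd n < 1 \<and> mbd n<=5 * real n powr (-(3/2))"
	proof (cases "prime n \<and> n~=2")
		case True
		hence n3: "n>=3" using prime_ge_2_nat[of n] by linarith
		define y where "y = 1/sqrt (real n)"
		have "sqrt 3<=sqrt (real n)" using n3 by simp
		moreover have "1.7<=sqrt (3::real)" by (rule real_le_rsqrt) (simp add: power2_eq_square)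
		ultimately have "1.7<=sqrt (real n)" by linarith
		hence "1/sqrt (real n)<=1/1.7" using n3 by (intro divide_left_mono) auto
		hence "y<=10/17" by (simp add: y_def)
		moreover have "y > 0" using n3 by (simp add: y_def)
		ultimately have y: "0 < y" "y<=10/17" by auto
		have "1/real n<=1/3" using n3 by (intro divide_left_mono) auto
		hence y2: "y^2<=1/3" by (simp add: y_def power_divide)
		have y3: "y^3 = real n powr (-(3/2))"
		proof -
			have "y = real n powr (-(1/2))" unfolding powr_minus powr_half_sqrt[OF of_nat_0_le_iff] by (simp add: y_def divide_inverse)
			hence "y^3 = (real n powr (-(1/2)))^3" by (rule arg_cong)
			also have "... = real n powr (real 3*(-(1/2)))" by (rule powr_power) (use n3 in auto)
			finally show ?thesis by simp
		qed
		have "2 * y^3 = 2 * y * y^2" by (simp add: power2_eq_square power3_eq_cube)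
		also have "...<=2 * y*(1/3)" using y y2 by (intro mult_left_mono) auto
		also have "... < 1-y" using y by simp
		finally have 1: "2 * y^3 < 1-y" .
		have "2/(1-y)<=5" using y by (simp add: field_simps)
		hence "y^3*(2/(1-y))<=y^3*5" using y by (intro mult_left_mono) auto
		thus ?thesis using True y 1 by (simp add: mbd_def y_def[symmetric] y3[symmetric] mult.commute)
	qed (auto simp: mbd_def)
	thus "0<=mbd n" "mbd n < 1" "mbd n<=5 * real n powr (-(3/2))" by auto
qed

text \<open>Each factor has modulus at least 1 - \<open>mbd n\<close> on the whole half-plane, and
  the product of these numbers converges to a positive constant.\<close>

lemma V_lower_bound:
	assumes e: "!!k. k>=1 ==> \<bar>\<mu> k\<bar><=1"
	obtains c where "c > 0" "!!s. Re s>=1/2 ==> norm (V (rfun \<mu>) s)>=c"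
proof -
	have sm: "summable mbd" by (rule summable_comparison_test'[of "%n. 5 * real n powr (-(3/2))" 0])
			 (use mbd_bounds in \<open>auto intro!: summable_mult simp: summable_real_powr_iff\<close>)
	have "summable (%n. \<bar>- mbd n\<bar>)" using sm mbd_bounds(1) by simp
	hence conv: "convergent_prod (%n. 1+(- mbd n))" using mbd_bounds(2) by (intro summable_imp_convergent_prod_real) (auto simp: less_le)
	define c where "c = prodinf (%n. 1-mbd n)"
	have conv': "convergent_prod (%n. 1-mbd n)" using conv by simp
	have c: "c > 0" unfolding c_def by (rule less_0_prodinf[OF conv']) (use mbd_bounds(2) in auto)
	have lim: "(%N. \<Prod>n<N. 1-mbd n) \<longlonglongrightarrow> c"
	proof -
		have "(%N. \<Prod>n\<le>N. 1-mbd n) \<longlonglongrightarrow> c" unfolding c_def by (rule convergent_prod_LIMSEQ[OF conv'])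
		hence "(%N. \<Prod>n<Suc N. 1-mbd n) \<longlonglongrightarrow> c" by (simp only: lessThan_Suc_atMost)
		thus ?thesis by (subst (asm) filterlim_sequentially_Suc)
	qed
	show ?thesis
	proof (rule that[OF c])
		fix s :: complex assume s: "Re s>=1/2"
		have v: "norm (vfac (rfun \<mu>) n s)>=1-mbd n" for n
		proof (cases "prime n \<and> n~=2")
			case True
			define x where "x = (of_nat n powr (-s) :: complex)"
			have p: "prime n" using True by simp
			have n1: "real n > 1" using prime_gt_1_nat[OF p] by simp
			have "norm x = real n powr (- Re s)" unfolding x_def by (rule norm_prime_powr[OF p])
			also have "...<=real n powr (-(1/2))" using s n1 by (intro powr_mono) auto
			also have "... = 1/sqrt (real n)" unfolding powr_minus powr_half_sqrt[OF of_nat_0_le_iff] by (simp add: divide_inverse)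
			finally have x: "norm x<=1/sqrt (real n)" .
			have "norm (x^3 * rfun \<mu> x)<=mbd n" using rfun_bound[of \<mu> x "1/sqrt (real n)", OF e x] n1 True by (simp add: mbd_def)
			moreover have "norm (1+x^3 * rfun \<mu> x)>=1-norm (x^3 * rfun \<mu> x)"
				using norm_triangle_ineq2[of 1 "- (x^3 * rfun \<mu> x)"] by simp
			ultimately show ?thesis using True by (simp add: vfac_def hfac_def x_def)
		qed (auto simp: vfac_def mbd_def)
		have "norm (V (rfun \<mu>) s)>=c"
		proof (rule LIMSEQ_le[OF lim])
			show "(%N. norm (\<Prod>n<N. vfac (rfun \<mu>) n s)) \<longlonglongrightarrow> norm (V (rfun \<mu>) s)"
				using s by (intro tendsto_norm V_convergence(2) holomorphic_rfun e) auto
			show "\<exists>N. \<forall>n\<ge>N. (\<Prod>k<n. 1-mbd k)<=norm (\<Prod>k<n. vfac (rfun \<mu>) k s)"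
				unfolding prod_norm[symmetric] using v mbd_bounds(2)[THEN less_imp_le] by (intro exI[of _ 0] allI impI prod_mono conjI) simp_all
		qed
		thus "norm (V (rfun \<mu>) s)>=c" .
	qed
qed

section \<open>Exclusion of a one-sided bound\<close>

lemma analytic_zeta_reg: "Re s > -1 ==> zeta_reg analytic_on {s}" by (rule holomorphic_on_imp_analytic_at[OF holomorphic_zeta_reg open_Re_gt]) auto

lemma not_half_of_Re: "Re s > 1/2 ==> s~=1/2"
proof
	assume "Re s > 1/2" "s = 1/2"
	hence "Re s = Re (1/2)" by (intro arg_cong[of _ _ Re])
	thus False using \<open>Re s > 1/2\<close> by simp
qed

lemma eventually_zeta_reg_nonzero:
	assumes "Re s > -1"
	shows "\<forall>\<^sub>F z in at s. zeta_reg z~=0"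
proof -
	have "\<forall>\<^sub>F z in at s. zeta_reg z~=0 \<and> z \<in> {z. Re z > -1}"
	proof (rule non_zero_neighbour_alt[OF holomorphic_zeta_reg open_Re_gt])
		show "connected {z::complex. Re z > -1}" by (intro convex_connected convex_halfspace_Re_gt)
		show "s \<in> {z. Re z > -1}" "(1::complex) \<in> {z. Re z > -1}" "zeta_reg 1~=0" using assms by auto
	qed
	thus ?thesis by eventually_elim simp
qed

lemma dseries_double_nonzero:
	assumes "Re s>=1/2" "s~=1/2"
	shows "dseries (2 * s)~=0"
proof (cases "Re s = 1/2")
	case True
	hence "zeta_reg (2 * s)~=0" by (intro zeta_reg_nonzero_line) simp
	moreover have "2 * s~=1" using assms(2) by (metis nonzero_mult_div_cancel_left zero_neq_numeral)
	ultimately show ?thesis by (simp add: dseries_def)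
qed (use assms in \<open>auto intro!: dseries_nonzero\<close>)

text \<open>|1/zeta(2s)| is at most zeta(2 Re s), whose simple pole at Re s = 1/2 determines the
  blow-up.\<close>

lemma inverse_dseries_double_bound:
	obtains Z where "!!s. Re s > 1/2 ==> Re s<=3 ==> norm (1/dseries (2 * s))<=Z/(Re s-1/2)"
proof -
	have "continuous_on (cball 0 6 \<inter> {s. Re s>=0}) zeta_reg"
		by (intro holomorphic_on_imp_continuous_on holomorphic_on_subset[OF holomorphic_zeta_reg]) auto
	moreover have "compact (cball 0 6 \<inter> {s. Re s>=0} :: complex set)" by (intro compact_Int_closed closed_halfspace_Re_ge) auto
	ultimately have "bounded (zeta_reg ` (cball 0 6 \<inter> {s. Re s>=0}))" by (intro compact_imp_bounded compact_continuous_image)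
	then obtain Z where Z: "Z > 0" "!!s. s \<in> cball 0 6 \<inter> {s. Re s>=0} ==> norm (zeta_reg s)<=Z" by (auto simp: bounded_pos)
	show ?thesis
	proof (rule that[of Z])
		fix s :: complex assume s: "Re s > 1/2" "Re s<=3"
		define x where "x = Re s"
		have one: "1<=norm (dseries (2 * s)) * norm (dseries (of_real (2 * x)))" using dseries_mult_real_ge_1[of "2 * s"] s by (simp add: x_def)
		have nz: "norm (dseries (2 * s)) > 0" using s dseries_nonzero[of "2 * s"] by simp
		have "norm (1/dseries (2 * s)) = 1/norm (dseries (2 * s))" by (simp add: norm_divide)
		also have "...<=norm (dseries (of_real (2 * x)))" using one nz by (simp add: field_simps)
		also have "... = norm (zeta_reg (of_real (2 * x)))/(2 * x-1)"
		proof -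
			have "norm (of_real (2 * x)-1 :: complex) = 2 * x-1" using s norm_of_real[of "2 * x-1", where 'a = complex] by (simp add: x_def)
			thus ?thesis unfolding dseries_def norm_divide by (simp only:)
		qed
		also have "...<=Z/(2 * x-1)"
		proof (rule divide_right_mono[OF Z(2)])
			have "norm (of_real (2 * x) :: complex)<=6" unfolding norm_of_real using s by (simp add: x_def)
			thus "of_real (2 * x) \<in> cball 0 6 \<inter> {s::complex. Re s>=0}" using s by (simp add: x_def)
		qed (use s in \<open>simp add: x_def\<close>)
		also have "...<=Z/(x-1/2)" using s Z(1) by (intro divide_left_mono) (auto simp: x_def)
		finally show "norm (1/dseries (2 * s))<=Z/(Re s-1/2)" by (simp add: x_def)
	qed
qed

lemma analytic_V:
	assumes "r holomorphic_on ball 0 1" "Re s > 2/5"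
	shows "V r analytic_on {s}" by (rule holomorphic_on_imp_analytic_at[OF V_convergence(1)[OF assms(1)] open_Re_gt]) (use assms in auto)

text \<open>Multiplied by $1/\zeta(2s)$ and divided by the factors at the odd primes, the series becomes
	the factor at 2 over $\zeta(s)$. A one-sided bound would make that quotient analytic up to the
	critical line, so all but finitely many of the zeros of $\zeta$ would have to be zeros of a
	nonzero polynomial in $2^{-s}$.\<close>
lemma not_one_sided_bound:
	assumes e: "!!k. k>=1 ==> \<bar>\<mu> k\<bar><=1"
		and osb: "one_sided_bound g T b"
		and T: "!!s. Re s>=1/2 ==> \<forall>\<^sub>F z in at s. T z = \<nu> * Mfun (rfun \<mu>) (-1) 1 z"
		and \<nu>: "norm \<nu> = 1"
	shows False
proof -
	define r where "r = rfun \<mu>"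
	have r: "r holomorphic_on ball 0 1" unfolding r_def using e by (rule holomorphic_rfun)
	have \<nu>0: "\<nu>~=0" using \<nu> by auto
	obtain c where c: "c > 0" "!!s. Re s>=1/2 ==> norm (V r s)>=c" using V_lower_bound[of \<mu>] e unfolding r_def by blast
	have V0: "V r s~=0" if "Re s>=1/2" for s using c(2)[OF that] c(1) by auto
	define h where "h = (%x. 1+x^3 * r x)"
	have h: "h holomorphic_on ball 0 1" unfolding h_def by (intro holomorphic_intros r)
	have hh: "hfac r 2 s = h (2 powr (-s))" for s by (simp add: hfac_def h_def)
	define N where "N = (%s. hfac r 2 s*(s-1)/zeta_reg s)"
	define Q where "Q = (%s. T s/(\<nu> * dseries (2 * s) * V r s))"
	define K where "K = remove_sings N"
	have hfa: "hfac r 2 analytic_on {s}" if "Re s>=1/2" for s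
		by (rule holomorphic_on_imp_analytic_at[OF holomorphic_hfac[OF r two_is_prime_nat] open_Re_gt]) (use that in auto)
	have evV: "\<forall>\<^sub>F z in at s. V r z~=0" if s: "Re s>=1/2" for s
	proof -
		have "isCont (V r) s" using analytic_V[OF r, of s] s by (intro analytic_at_imp_isCont) auto
		hence "(V r \<longlongrightarrow> V r s) (at s)" by (simp add: isCont_def)
		thus ?thesis using V0[OF s] by (rule tendsto_imp_eventually_ne)
	qed
	have NQ: "\<forall>\<^sub>F z in at s. N z = Q z" and Qa: "Q analytic_on {s}" if s: "Re s>=1/2" "s~=1/2" for s
	proof -
		have da: "(%s. dseries (2 * s)) analytic_on {s}" using s by (intro analytic_dseries_double) auto
		have dn: "dseries (2 * s)~=0" using s by (rule dseries_double_nonzero)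
		have "((%s. dseries (2 * s)) \<longlongrightarrow> dseries (2 * s)) (at s)" using analytic_at_imp_isCont[OF da] by (simp add: isCont_def)
		hence "\<forall>\<^sub>F z in at s. dseries (2 * z)~=0" using dn by (rule tendsto_imp_eventually_ne)
		with T[OF s(1)] evV[OF s(1)] show "\<forall>\<^sub>F z in at s. N z = Q z"
		proof eventually_elim
			case (elim z)
			have "Q z = hfac r 2 z * dseries z powi (-1)" using elim \<nu>0 by (simp add: Q_def Mfun_def Ufun_def r_def)
			thus ?case by (simp add: N_def dseries_def power_int_minus)
		qed
		have "T analytic_on {s}" using one_sided_bound.T_analytic_right[OF osb, of s] one_sided_bound.T_analytic_line[OF osb, of s] s
			by (cases "Re s = 1/2") auto
		thus "Q analytic_on {s}" unfolding Q_def using da dn V0[OF s(1)] \<nu>0 s by (intro analytic_intros analytic_V[OF r]) auto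
	qed
	have KQ: "K analytic_on {s}" "K s = Q s" if s: "Re s>=1/2" "s~=1/2" for s
	proof -
		have ev: "\<forall>\<^sub>F z in nhds s. K z = Q z" unfolding K_def by (rule remove_sings_eq_analytic[OF Qa[OF s] NQ[OF s]])
		show "K s = Q s" by (rule eventually_nhds_x_imp_x[OF ev])
		show "K analytic_on {s}" using analytic_at_cong[OF ev refl] Qa[OF s] by simp
	qed
	\<comment> \<open>At 1/2 the series itself may have a pole, so the other expression for
	  \<open>K\<close> is used; it is analytic there since zeta(1/2) is not 0.\<close>
	have Kan: "K analytic_on {s}" if s: "Re s>=1/2" for s
	proof (cases "s = 1/2")
		case True
		have nz: "zeta_reg z~=0" if "z \<in> {1/2}" for z using zeta_reg_real_nonzero[of "1/2"] that by (simp only: singleton_iff) simp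
		hence "N analytic_on {1/2}" unfolding N_def by (intro analytic_intros hfa[of "1/2"] analytic_zeta_reg[of "1/2"]) (erule nz | simp)+
		thus ?thesis unfolding K_def True by (rule remove_sings_analytic_on)
	qed (use KQ(1)[OF s] in auto)
	have rel: "zeta_reg s * K s = (s-1) * hfac r 2 s" if s: "Re s > 1/2" for s
	proof -
		have s': "Re s>=1/2" "s~=1/2" using s not_half_of_Re[of s] by (simp, blast)
		define D where "D = (%z. zeta_reg z * Q z-(z-1) * hfac r 2 z)"
		have "D analytic_on {s}" unfolding D_def using s by (intro analytic_intros analytic_zeta_reg Qa[OF s'] hfa[OF s'(1)]) auto
		hence "(D \<longlongrightarrow> D s) (at s)" using analytic_at_imp_isCont by (simp add: isCont_def)
		moreover have "\<forall>\<^sub>F z in at s. D z = 0"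
		proof -
			have "\<forall>\<^sub>F z in at s. zeta_reg z~=0" using s by (intro eventually_zeta_reg_nonzero) auto
			thus ?thesis using NQ[OF s'] by eventually_elim (auto simp: D_def N_def field_simps)
		qed
		hence "(D \<longlongrightarrow> 0) (at s)" by (rule tendsto_eventually)
		ultimately have "D s = 0" by (intro tendsto_unique[of "at s"]) auto
		thus ?thesis using KQ(2)[OF s'] by (simp add: D_def)
	qed
	obtain C where C: "!!s. Re s > 1/2 ==> Re s<=3 ==> norm (T s)<=C*(1+norm s)^2/(Re s-1/2)" using one_sided_bound.T_bound[OF osb] by blast
	obtain Z where Z: "!!s. Re s > 1/2 ==> Re s<=3 ==> norm (1/dseries (2 * s))<=Z/(Re s-1/2)" using inverse_dseries_double_bound by blast
	\<comment> \<open>One factor 1/(Re s - 1/2) comes from the bound for \<open>T\<close>, the other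
	  from 1/zeta(2s).\<close>
	have Kb: "norm (K s)<=(C * Z/c)*(1+norm s)^2/(Re s-1/2)^2" if s: "Re s > 1/2" "Re s<=3" for s
	proof -
		have s': "Re s>=1/2" "s~=1/2" using s not_half_of_Re[of s] by (simp, blast)
		have "norm (K s) = norm (T s) * norm (1/dseries (2 * s))*(1/norm (V r s))"
			using KQ(2)[OF s'] \<nu> by (simp add: Q_def norm_divide norm_mult)
		also have "...<=(C*(1+norm s)^2/(Re s-1/2))*(Z/(Re s-1/2))*(1/c)"
		proof (intro mult_mono C[OF s] Z[OF s])
			show "1/norm (V r s)<=1/c" using c(1) c(2)[OF s'(1)] by (intro divide_left_mono) (auto intro!: mult_pos_pos)
			show "0<=C*(1+norm s)^2/(Re s-1/2)" using C[OF s] norm_ge_zero[of "T s"] by linarith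
			show "0<=C*(1+norm s)^2/(Re s-1/2)*(Z/(Re s-1/2))"
				using C[OF s] norm_ge_zero[of "T s"] Z[OF s] norm_ge_zero[of "1/dseries (2 * s)"] by (intro mult_nonneg_nonneg) linarith+
		qed auto
		also have "... = (C * Z/c)*(1+norm s)^2/(Re s-1/2)^2" by (simp add: power2_eq_square mult_ac)
		finally show ?thesis .
	qed
	define \<rho> :: real where "\<rho> = 2 powr (-(1/2))"
	have \<rho>: "\<rho> < 1" using powr_less_mono[of "-(1/2)" 0 "2::real"] by (simp add: \<rho>_def)
	have "h 0~=0" by (simp add: h_def)
	then obtain P :: "complex poly" and R where P: "P~=0" "R analytic_on cball 0 \<rho>"
		"!!x. x \<in> cball 0 \<rho> ==> poly P x = R x * h x" using polynomial_multiple[OF h _ \<rho>] by blast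
	have inb: "2 powr (-s) \<in> cball (0::complex) \<rho>" if "Re s>=1/2" for s
		using norm_prime_powr_le(1)[OF two_is_prime_nat, of "1/2" s] that by (simp add: \<rho>_def)
	have "continuous_on (cball 0 \<rho>) R" by (rule holomorphic_on_imp_continuous_on[OF analytic_imp_holomorphic[OF P(2)]])
	hence "bounded (R ` cball 0 \<rho>)" by (intro compact_imp_bounded compact_continuous_image) auto
	then obtain B where B: "!!x. x \<in> cball 0 \<rho> ==> norm (R x)<=B" unfolding bounded_iff by blast
	show False
	proof (rule poly_cancellation_impossible[OF P(1), of "%s. K s * R (2 powr (-s))" "C * Z/c * B" 2])
		have "(%s. K s * R (2 powr (-s))) analytic_on {s}" if s: "Re s>=1/2" for s
		proof -
			have "R \<circ> (%s. 2 powr (-s)) analytic_on {s}"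
				using inb[OF s] by (intro analytic_on_compose) (auto intro!: analytic_intros intro: analytic_on_subset[OF P(2)])
			hence "(%s. R (2 powr (-s))) analytic_on {s}" by (simp add: o_def)
			thus ?thesis by (intro analytic_intros Kan[OF s])
		qed
		thus "(%s. K s * R (2 powr (-s))) analytic_on {s. Re s>=1/2}" by (subst analytic_on_analytic_at) blast
		show "zeta_reg s*(K s * R (2 powr (-s))) = (s-1) * poly P (2 powr (-s))" if "Re s > 1/2" for s
		proof -
			have "poly P (2 powr (-s)) = R (2 powr (-s)) * hfac r 2 s" unfolding hh using that by (intro P(3) inb) auto
			thus ?thesis using rel[OF that] by (metis (no_types, lifting) mult.assoc mult.commute)
		qed
		fix s :: complex assume s: "Re s > 1/2" "Re s<=3"
		have "norm (K s * R (2 powr (-s)))<=(C * Z/c)*(1+norm s)^2/(Re s-1/2)^2 * B" unfolding norm_mult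
			by (intro mult_mono Kb[OF s] B inb order_trans[OF norm_ge_zero Kb[OF s]]) (use s in auto)
		thus "norm (K s * R (2 powr (-s)))<=C * Z/c * B*(1+norm s)^2/(Re s-1/2)^2" by (simp add: mult_ac)
	qed
qed

lemma geometric_expand:
	assumes "!!k. k>=1 ==> \<bar>\<mu> k\<bar><=1" "norm x < 1" "\<mu> 1 = -1" "\<mu> 2 = 1"
	shows "efac \<mu> x = (1+x^3 * rfun \<mu> x)*(1/(1-x)) powi (-1)*(1/(1-x^2)) powi 1"
proof -
	have "x~=1" "x~=-1" using assms(2) by auto
	hence nz: "1-x~=0" "1+x~=0" using eq_neg_iff_add_eq_0[of x 1] by (simp, metis add.commute)
	have "(1/(1-x)) powi (-1)*(1/(1-x^2)) powi 1 = (1-x)/((1-x)*(1+x))"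
		by (simp add: power_int_minus power2_eq_square algebra_simps)
	also have "... = 1/(1+x)" using nz by simp
	finally have M: "(1+x^3 * rfun \<mu> x)*(1/(1-x)) powi (-1)*(1/(1-x^2)) powi 1 = (1+x^3 * rfun \<mu> x)/(1+x)"
		by (metis mult.assoc times_divide_eq_right mult.right_neutral)
	have H: "1+x^3 * rfun \<mu> x = (1+x)*(1-x+x^2+x^3 * etail \<mu> x)"
		by (simp add: rfun_def power2_eq_square power3_eq_cube algebra_simps)
	have "(1+x^3 * rfun \<mu> x)/(1+x) = 1-x+x^2+x^3 * etail \<mu> x" unfolding H using nz by simp
	moreover have "efac \<mu> x = 1-x+x^2+x^3 * etail \<mu> x" using efac_expand[of \<mu> x] assms by simp
	ultimately show ?thesis using M by (simp only:)
qed

section \<open>The continuation near 1/2, the bias and the oscillation\<close>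

text \<open>s - 1/2 times the series, with the pole of zeta(2s) cancelled explicitly; its value at
  1/2 is half the bias.\<close>

definition Gfun :: "(nat => int) => complex => complex" where
	"Gfun \<mu> s = Ufun (rfun \<mu>) s*((s-1)/zeta_reg s)*(zeta_reg (2 * s)/2)"

lemma Mfun_eq_Gfun: "Mfun (rfun \<mu>) (-1) 1 s = Gfun \<mu> s/(s-1/2)"
proof -
	have "dseries (2 * s) = zeta_reg (2 * s)/2/(s-1/2)"
	proof -
		have "2 * s-1 = 2*(s-1/2)" by (simp add: algebra_simps)
		thus ?thesis unfolding dseries_def by (simp only: divide_divide_eq_left)
	qed
	moreover have "dseries s powi (-1) = (s-1)/zeta_reg s" by (simp add: dseries_def power_int_minus)
	ultimately show ?thesis unfolding Mfun_def Gfun_def by simp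
qed

lemma analytic_Gfun:
	assumes e: "!!k. k>=1 ==> \<bar>\<mu> k\<bar><=1" and s: "Re s > 2/5" "zeta_reg s~=0"
	shows "Gfun \<mu> analytic_on {s}"
proof -
	have U: "Ufun (rfun \<mu>) analytic_on {s}"
		by (rule holomorphic_on_imp_analytic_at[OF holomorphic_Ufun[OF holomorphic_rfun[OF e]] open_Re_gt]) (use s in auto)
	have "zeta_reg \<circ> (%s. 2 * s) analytic_on {s}"
		by (intro analytic_on_compose) (use s in \<open>auto intro!: analytic_intros analytic_zeta_reg\<close>)
	hence d: "(%s. zeta_reg (2 * s)) analytic_on {s}" by (simp add: o_def)
	have z: "zeta_reg analytic_on {s}" using s by (intro analytic_zeta_reg) auto
	have nz: "zeta_reg z~=0" if "z \<in> {s}" for z using that s(2) by (simp only: singleton_iff not_False_eq_True)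
	show ?thesis unfolding Gfun_def by (intro analytic_intros U d z) (erule nz | simp)+
qed

lemma Gfun_quotient_analytic:
	assumes e: "!!k. k>=1 ==> \<bar>\<mu> k\<bar><=1" and s: "Re s > 2/5" "zeta_reg s~=0" "s~=1/2"
	shows "(%s. \<nu>*(Gfun \<mu> s/(s-1/2))) analytic_on {s}"
proof -
	have "s-1/2~=0" using s(3) by (metis eq_iff_diff_eq_0)
	hence nz: "z-1/2~=0" if "z \<in> {s}" for z using that by (simp only: singleton_iff not_False_eq_True)
	show ?thesis by (intro analytic_intros analytic_Gfun[OF e s(1,2)]) (assumption | erule nz)+
qed

text \<open>The parameter \<nu> is 1 or -1 in the applications: upper bounds on the partial sums of
  f and of -f are then treated alike.\<close>

definition Tsig :: "(nat => int) => complex => complex => complex" where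
	"Tsig \<mu> \<nu> = remove_sings (%s. \<nu>*(Gfun \<mu> s/(s-1/2)))"

lemma meromorphic_Gfun_quotient:
	assumes e: "!!k. k>=1 ==> \<bar>\<mu> k\<bar><=1"
	shows "(%s. \<nu>*(Gfun \<mu> s/(s-1/2))) meromorphic_on {s. Re s > 2/5}"
proof -
	have "(%s. \<nu> * Mfun (rfun \<mu>) (-1) 1 s) meromorphic_on {s. Re s > 2/5}"
		by (intro meromorphic_intros meromorphic_Mfun holomorphic_rfun e)
	thus ?thesis by (simp only: Mfun_eq_Gfun)
qed

lemma Tsig_nicely_meromorphic:
	assumes e: "!!k. k>=1 ==> \<bar>\<mu> k\<bar><=1"
	shows "Tsig \<mu> \<nu> nicely_meromorphic_on {s. Re s>=1/2}"
proof -
	have "Tsig \<mu> \<nu> nicely_meromorphic_on {s. Re s > 2/5}"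
		unfolding Tsig_def by (intro remove_sings_nicely_meromorphic meromorphic_Gfun_quotient e)
	thus ?thesis by (rule nicely_meromorphic_on_subset) auto
qed

lemma eventually_Tsig:
	assumes e: "!!k. k>=1 ==> \<bar>\<mu> k\<bar><=1" and s: "Re s>=1/2"
	shows "\<forall>\<^sub>F z in at s. Tsig \<mu> \<nu> z = \<nu>*(Gfun \<mu> z/(z-1/2))" unfolding Tsig_def
proof (rule eventually_remove_sings_eq_at)
	have "(%s. \<nu>*(Gfun \<mu> s/(s-1/2))) meromorphic_on {s}"
		by (rule meromorphic_on_subset[OF meromorphic_Gfun_quotient[OF e]]) (use s in auto)
	thus "isolated_singularity_at (%s. \<nu>*(Gfun \<mu> s/(s-1/2))) s" by (intro meromorphic_on_isolated_singularity)
qed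

lemma Tsig_regular:
	assumes e: "!!k. k>=1 ==> \<bar>\<mu> k\<bar><=1" and s: "Re s > 2/5" "zeta_reg s~=0" "s~=1/2"
	shows "Tsig \<mu> \<nu> analytic_on {s}" "Tsig \<mu> \<nu> s = \<nu>*(Gfun \<mu> s/(s-1/2))"
	using Gfun_quotient_analytic[OF e s] unfolding Tsig_def by (auto intro: remove_sings_analytic_on)

lemma Tsig_series:
	assumes sm: "sign_multiplicative \<mu> f" and e12: "\<mu> 1 = -1" "\<mu> 2 = 1" and s: "Re s > 1"
	shows "Tsig \<mu> \<nu> s = \<nu> * dirichlet_series f s"
proof -
	note e = sign_multiplicative_facts(3)[OF sm]
	have "zeta_reg s~=0" using dseries_nonzero[OF s] by (auto simp: dseries_def)
	hence "Tsig \<mu> \<nu> s = \<nu> * Mfun (rfun \<mu>) (-1) 1 s"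
		using s not_half_of_Re[of s] unfolding Mfun_eq_Gfun by (intro Tsig_regular(2) e) auto
	also have "Mfun (rfun \<mu>) (-1) 1 s = dirichlet_series f s"
		by (rule dirichlet_series_eq[OF sm holomorphic_rfun geometric_expand s, symmetric]) (use e e12 in auto)
	finally show ?thesis .
qed

lemma continues_series_Tsig:
	assumes sm: "sign_multiplicative \<mu> f" and e12: "\<mu> 1 = -1" "\<mu> 2 = 1"
	shows "continues_series f (Tsig \<mu> 1)" unfolding continues_series_def
	using Tsig_nicely_meromorphic[OF sign_multiplicative_facts(3)[OF sm]] Tsig_series[OF sm e12] by simp

lemma zeta_reg_half_nonzero: "zeta_reg (1/2)~=0" using zeta_reg_real_nonzero[of "1/2"] by simp

lemma Gfun_tendsto:
	assumes e: "!!k. k>=1 ==> \<bar>\<mu> k\<bar><=1"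
	shows "((%x. Gfun \<mu> (complex_of_real x)) \<longlongrightarrow> Gfun \<mu> (1/2)) (at_right (1/2))"
proof -
	have "isCont (Gfun \<mu>) (complex_of_real (1/2))" by (intro analytic_at_imp_isCont analytic_Gfun e) (use zeta_reg_half_nonzero in auto)
	hence "isCont (%x. Gfun \<mu> (complex_of_real x)) (1/2)" by (rule isCont_o2[of "1/2" complex_of_real, rotated]) (intro continuous_intros)
	hence "((%x. Gfun \<mu> (complex_of_real x)) \<longlongrightarrow> Gfun \<mu> (complex_of_real (1/2))) (at (1/2))"
		by (simp add: isCont_def)
	hence "((%x. Gfun \<mu> (complex_of_real x)) \<longlongrightarrow> Gfun \<mu> (complex_of_real (1/2))) (at_right (1/2))"
		by (rule filterlim_mono[OF _ order_refl at_le]) auto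
	thus ?thesis by simp
qed

lemma one_sided_bound_Tsig:
	assumes sm: "sign_multiplicative \<mu> f" and e12: "\<mu> 1 = -1" "\<mu> 2 = 1"
		and \<nu>: "\<bar>\<nu>\<bar> = 1" and b: "of_real b = 2 * Gfun \<mu> (1/2)"
		and upper: "!!\<delta>. \<delta> > 0 ==> \<forall>\<^sub>F N in sequentially. (\<Sum>n=1..N. \<nu> * real_of_int (f n))<=(\<nu> * b + \<delta>) * sqrt (real N)"
	shows "one_sided_bound (%n. \<nu> * real_of_int (f n)) (Tsig \<mu> (of_real \<nu>)) (\<nu> * b)"
proof
	note e = sign_multiplicative_facts(3)[OF sm]
	show "\<bar>\<nu> * real_of_int (f n)\<bar><=1" for n using sign_multiplicative_facts(5)[OF sm, of n] \<nu> by (simp add: abs_mult)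
	show "Tsig \<mu> (of_real \<nu>) nicely_meromorphic_on {s. Re s>=1/2}" by (intro Tsig_nicely_meromorphic e)
	show "Tsig \<mu> (of_real \<nu>) s = (\<Sum>n. of_real (\<nu> * real_of_int (f (Suc n))) * of_nat (Suc n) powr (-s))" if "Re s > 1" for s
	proof -
		define g where "g = (%n. of_int (f (Suc n)) * of_nat (Suc n) powr (-s) :: complex)"
		have "summable g"
		proof (rule summable_norm_cancel, rule summable_comparison_test[OF _ summable_dirichlet_zeta[OF that]], intro exI allI impI)
			fix n
			have "norm (norm (g n)) = \<bar>real_of_int (f (Suc n))\<bar> * norm (of_nat (Suc n) powr (-s) :: complex)" unfolding g_def norm_mult by simp
			also have "...<=1 * norm (of_nat (Suc n) powr (-s) :: complex)"
				using sign_multiplicative_facts(5)[OF sm, of "Suc n"] by (intro mult_right_mono) auto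
			finally show "norm (norm (g n))<=norm (of_nat (Suc n) powr (-s) :: complex)" by simp
		qed
		hence "(\<Sum>n. of_real \<nu> * g n) = of_real \<nu>*(\<Sum>n. g n)" by (rule suminf_mult)
		moreover have "dirichlet_series f s = (\<Sum>n. g n)" unfolding dirichlet_series_def g_def by (simp add: powr_minus divide_inverse)
		ultimately show ?thesis unfolding Tsig_series[OF sm e12 that] g_def by (simp only: of_real_mult of_real_of_int_eq mult.assoc)
	qed
	show "Tsig \<mu> (of_real \<nu>) analytic_on {of_real x}" if "x > 1/2" for x
		using that by (intro Tsig_regular(1) e zeta_reg_real_nonzero not_half_of_Re) auto
	have L1: "((%x. of_real \<nu> * Gfun \<mu> (complex_of_real x)) \<longlongrightarrow> of_real \<nu> * Gfun \<mu> (1/2)) (at_right (1/2))"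
		by (intro tendsto_intros Gfun_tendsto e)
	have L2: "of_real \<nu> * Gfun \<mu> (1/2) = of_real (\<nu> * b/2)" using b by simp
	have L3: "\<forall>\<^sub>F x in at_right (1/2). of_real \<nu> * Gfun \<mu> (complex_of_real x) = of_real (x-1/2) * Tsig \<mu> (of_real \<nu>) (of_real x)"
	proof -
		have "\<forall>\<^sub>F x::real in at_right (1/2). x > 1/2" by (rule eventually_at_right_less)
		thus ?thesis
		proof eventually_elim
			case (elim x)
			have nz: "complex_of_real (x-1/2)~=0" unfolding of_real_eq_0_iff using elim by linarith
			have "complex_of_real x-1/2 = complex_of_real (x-1/2)" by simp
			moreover have "Tsig \<mu> (of_real \<nu>) (of_real x) = of_real \<nu>*(Gfun \<mu> (of_real x)/(of_real x-1/2))"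
				using elim by (intro Tsig_regular(2) e zeta_reg_real_nonzero not_half_of_Re) auto
			ultimately have eq: "Tsig \<mu> (of_real \<nu>) (of_real x) = of_real \<nu>*(Gfun \<mu> (of_real x)/complex_of_real (x-1/2))"
				by (simp only:)
			have gen: "a * g = c*(a*(g/c))" if "c~=0" for a g c :: complex using that by simp
			show ?case unfolding eq by (rule gen[OF nz])
		qed
	qed
	show "((%x. of_real (x-1/2) * Tsig \<mu> (of_real \<nu>) (of_real x)) \<longlongrightarrow> of_real (\<nu> * b/2)) (at_right (1/2))"
		unfolding L2[symmetric] by (rule Lim_transform_eventually[OF L1 L3])
qed (use upper in auto)

lemma not_one_sided:
	assumes sm: "sign_multiplicative \<mu> f" and e12: "\<mu> 1 = -1" "\<mu> 2 = 1"
		and \<nu>: "\<bar>\<nu>\<bar> = 1" and b: "of_real b = 2 * Gfun \<mu> (1/2)"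
		and upper: "!!\<delta>. \<delta> > 0 ==> \<forall>\<^sub>F N in sequentially. (\<Sum>n=1..N. \<nu> * real_of_int (f n))<=(\<nu> * b + \<delta>) * sqrt (real N)"
	shows False
proof (rule not_one_sided_bound)
	note e = sign_multiplicative_facts(3)[OF sm]
	show "\<bar>\<mu> k\<bar><=1" if "k>=1" for k using e that by blast
	show "one_sided_bound (%n. \<nu> * real_of_int (f n)) (Tsig \<mu> (of_real \<nu>)) (\<nu> * b)" by (rule one_sided_bound_Tsig) fact+
	show "\<forall>\<^sub>F z in at s. Tsig \<mu> (of_real \<nu>) z = of_real \<nu> * Mfun (rfun \<mu>) (-1) 1 z" if "Re s>=1/2" for s
		unfolding Mfun_eq_Gfun using that by (intro eventually_Tsig e)
qed (use \<nu> in simp)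

lemma normalized_summatory_nat: "normalized_summatory f 0 (real N) = (\<Sum>n=1..N. real_of_int (f n))/sqrt (real N)"
	by (simp add: normalized_summatory_def summatory_def)

text \<open>If one of the two strict inequalities failed, the partial sums of f (with \<nu> = 1) or
  of -f (with \<nu> = -1) would be one-sidedly bounded. Only integer arguments are needed for
  that.\<close>

lemma oscillates:
	assumes sm: "sign_multiplicative \<mu> f" and e12: "\<mu> 1 = -1" "\<mu> 2 = 1"
		and b: "of_real b = 2 * Gfun \<mu> (1/2)"
	shows "oscillates_about (normalized_summatory f 0) b" unfolding oscillates_about_def
proof (intro conjI; rule ccontr)
	define g where "g = normalized_summatory f 0"
	have fin: "(\<Sum>n=1..N. real_of_int (f n)) = g (real N) * sqrt (real N)" if "N > 0" for N using that by (simp add: g_def normalized_summatory_nat)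
	{
		assume "\<not> ereal b < Limsup at_top (%x. ereal (normalized_summatory f 0 x))"
		hence L: "Limsup at_top (%x. ereal (g x))<=ereal b" by (simp add: g_def not_less)
		show False
		proof (rule not_one_sided[OF sm e12 _ b, of 1])
			fix \<delta> :: real assume "\<delta> > 0"
			hence "ereal b < ereal (b + \<delta>)" by simp
			hence "Limsup at_top (%x. ereal (g x)) < ereal (b + \<delta>)" using L by (rule le_less_trans[rotated])
			hence "\<forall>\<^sub>F x in at_top. ereal (g x) < ereal (b + \<delta>)" by (rule Limsup_lessD)
			hence "\<forall>\<^sub>F N in sequentially. ereal (g (real N)) < ereal (b + \<delta>)"
				using filterlim_real_sequentially by (rule eventually_compose_filterlim)
			thus "\<forall>\<^sub>F N in sequentially. (\<Sum>n=1..N. 1 * real_of_int (f n))<=(1 * b + \<delta>) * sqrt (real N)"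
				using eventually_gt_at_top[of 0]
			proof eventually_elim
				case (elim N)
				hence "g (real N) * sqrt (real N)<=(b + \<delta>) * sqrt (real N)" by (intro mult_right_mono) auto
				thus ?case using fin[of N] elim by simp
			qed
		qed simp
	}
	{
		assume "\<not> Liminf at_top (%x. ereal (normalized_summatory f 0 x)) < ereal b"
		hence L: "ereal b<=Liminf at_top (%x. ereal (g x))" by (simp add: g_def not_less)
		show False
		proof (rule not_one_sided[OF sm e12 _ b, of "-1"])
			fix \<delta> :: real assume "\<delta> > 0"
			hence "ereal (b - \<delta>) < ereal b" by simp
			hence "ereal (b - \<delta>) < Liminf at_top (%x. ereal (g x))" using L by (rule less_le_trans)
			hence "\<forall>\<^sub>F x in at_top. ereal (b - \<delta>) < ereal (g x)" by (rule less_LiminfD)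
			hence "\<forall>\<^sub>F N in sequentially. ereal (b - \<delta>) < ereal (g (real N))"
				using filterlim_real_sequentially by (rule eventually_compose_filterlim)
			thus "\<forall>\<^sub>F N in sequentially. (\<Sum>n=1..N. -1 * real_of_int (f n))<=(-1 * b + \<delta>) * sqrt (real N)"
				using eventually_gt_at_top[of 0]
			proof eventually_elim
				case (elim N)
				hence "(b - \<delta>) * sqrt (real N)<=g (real N) * sqrt (real N)" by (intro mult_right_mono) auto
				thus ?case using fin[of N] elim by (simp add: sum_negf algebra_simps)
			qed
		qed simp
	}
qed

text \<open>1/zeta(s) vanishes at 1, so the series is regular there and there is no linear main
  term.\<close>

lemma linear_coeff_0:
	assumes sm: "sign_multiplicative \<mu> f" and e12: "\<mu> 1 = -1" "\<mu> 2 = 1"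
	shows "linear_coeff f 0"
proof -
	note e = sign_multiplicative_facts(3)[OF sm]
	have "Tsig \<mu> 1 analytic_on {1}" using e by (intro Tsig_regular(1)) (auto intro: not_half_of_Re)
	then obtain S where "open S" "1 \<in> S" "Tsig \<mu> 1 holomorphic_on S" by (auto simp: analytic_on_holomorphic)
	hence "residue (Tsig \<mu> 1) 1 = 0" by (intro residue_holo)
	thus ?thesis unfolding linear_coeff_def using continues_series_Tsig[OF sm e12] by auto
qed

lemma simple_pole_quotient:
	fixes z0 :: complex
	assumes S: "open S" "z0 \<in> S" "G holomorphic_on S" and G0: "G z0~=0"
		and ev: "\<forall>\<^sub>F z in at z0. T z = G z/(z-z0)"
	shows "is_pole T z0" "zorder T z0 = -1" "residue T z0 = G z0"
proof -
	have "is_pole (%s. G s/(s-z0)) z0" using is_pole_basic[OF S(3,1,2) G0, of 1] by simp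
	thus "is_pole T z0" using is_pole_cong[OF ev refl] by simp
	have "zorder (%s. G s/(s-z0)) z0 = -1" by (rule zorder_eqI[OF S(1,2,3) G0]) (simp add: power_int_minus divide_inverse)
	thus "zorder T z0 = -1" using zorder_cong[OF ev refl] by simp
	show "residue T z0 = G z0" using residue_cong[OF ev refl] residue_simple[OF S] by simp
qed

lemma removable_quotient:
	fixes z0 :: complex
	assumes G: "G analytic_on {z0}" "G z0 = 0"
	shows "remove_sings (%s. G s/(s-z0)) analytic_on {z0}"
proof -
	define q where "q = (%z. if z = z0 then deriv G z0 else G z/(z-z0)-G z0/(z-z0))"
	have q: "q analytic_on {z0}" unfolding q_def
	proof (rule pole_theorem_analytic)
		show "\<exists>d>0. \<forall>w\<in>ball z d-{z0}. G w = (w-z0)*(G w/(w-z0))" for z by (intro exI[of _ 1]) auto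
	qed (rule G(1))
	have "\<forall>\<^sub>F z in at z0. G z/(z-z0) = q z" using G(2) by (auto simp: eventually_at_filter q_def)
	hence "\<forall>\<^sub>F z in nhds z0. remove_sings (%s. G s/(s-z0)) z = q z" by (rule remove_sings_eq_analytic[OF q])
	from analytic_at_cong[OF this refl] q show ?thesis by simp
qed

lemma bias_exists:
	assumes sm: "sign_multiplicative \<mu> f" and e12: "\<mu> 1 = -1" "\<mu> 2 = 1"
		and b: "of_real b = 2 * Gfun \<mu> (1/2)"
	shows "bias f b"
proof -
	note e = sign_multiplicative_facts(3)[OF sm]
	let ?M = "%s. Gfun \<mu> s/(s-1/2)"
	have ev: "\<forall>\<^sub>F z in at (1/2). Tsig \<mu> 1 z = ?M z"
		using eventually_Tsig[of \<mu> "1/2" 1, OF e] by (simp only: mult_1_left) simp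
	have G1: "Gfun \<mu> analytic_on {1/2}" using zeta_reg_half_nonzero by (intro analytic_Gfun e) auto
	then obtain S where S: "open S" "1/2 \<in> S" "Gfun \<mu> holomorphic_on S" unfolding analytic_on_holomorphic by blast
	show ?thesis
	proof (cases "b = 0")
		case False
		hence G0: "Gfun \<mu> (1/2)~=0" using b by auto
		note P = simple_pole_quotient[OF S G0 ev]
		have "complex_of_real b = 2 * residue (Tsig \<mu> 1) (1/2)" unfolding P(3) by (rule b)
		with P(1,2) show ?thesis unfolding bias_def using continues_series_Tsig[OF sm e12] by blast
	next
		case True
		hence G0: "Gfun \<mu> (1/2) = 0" using b by simp
		have "remove_sings ?M analytic_on {1/2}" by (rule removable_quotient[OF G1 G0])
		hence "Tsig \<mu> 1 analytic_on {1/2}" by (simp only: Tsig_def mult_1_left)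
		thus ?thesis unfolding bias_def using continues_series_Tsig[OF sm e12] True by blast
	qed
qed

text \<open>The definition of the bias allows any continuation, so uniqueness is needed. Possible
  zeros of zeta prevent a direct comparison of T with a holomorphic function on Re s > 1/2;
  multiplied by \<open>zeta_reg\<close> it equals the holomorphic \<open>g\<close>. On the real axis
  \<open>zeta_reg\<close> can be divided out again, and (x - 1/2) T(x) has the limit
  \<open>Gfun \<mu> (1/2)\<close>.\<close>

lemma Gfun_half_of_bias:
	assumes sm: "sign_multiplicative \<mu> f" and e12: "\<mu> 1 = -1" "\<mu> 2 = 1" and b: "bias f b"
	shows "of_real b = 2 * Gfun \<mu> (1/2)"
proof -
	note e = sign_multiplicative_facts(3)[OF sm]
	obtain T where T: "continues_series f T" and cases: "is_pole T (1/2) \<and> zorder T (1/2) = -1 \<and> complex_of_real b = 2 * residue T (1/2)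
				 \<or> T analytic_on {1/2} \<and> b = 0" using b unfolding bias_def by blast
	have Tm: "T nicely_meromorphic_on {s. Re s>=1/2}" and Teq: "!!s. Re s > 1 ==> T s = dirichlet_series f s"
		using T by (auto simp: continues_series_def)
	have Tm1: "T meromorphic_on {s. Re s > 1/2}" using Tm by (auto simp: nicely_meromorphic_on_def intro: meromorphic_on_subset)
	have conv: "connected {s::complex. Re s > 1/2}" by (intro convex_connected convex_halfspace_Re_gt)
	define g where "g = (%s. Ufun (rfun \<mu>) s*(s-1) * dseries (2 * s))"
	have ghol: "g holomorphic_on {s. Re s > 1/2}"
	proof -
		have "g analytic_on {s}" if s: "Re s > 1/2" for s
		proof -
			have "Ufun (rfun \<mu>) analytic_on {s}"
				by (rule holomorphic_on_imp_analytic_at[OF holomorphic_Ufun[OF holomorphic_rfun[OF e]] open_Re_gt]) (use s in auto)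
			thus ?thesis unfolding g_def using s not_half_of_Re[OF s] by (intro analytic_intros analytic_dseries_double) auto
		qed
		hence "g analytic_on {s. Re s > 1/2}" by (subst analytic_on_analytic_at) blast
		thus ?thesis by (rule analytic_imp_holomorphic)
	qed
	have zm: "zeta_reg meromorphic_on {s. Re s > 1/2}"
	proof (rule analytic_on_imp_meromorphic_on)
		have "zeta_reg holomorphic_on {s. Re s > 1/2}" by (rule holomorphic_on_subset[OF holomorphic_zeta_reg]) auto
		thus "zeta_reg analytic_on {s. Re s > 1/2}" by (simp only: analytic_on_open[OF open_Re_gt])
	qed
	define W where "W = remove_sings (%s. zeta_reg s * T s)"
	have Wn: "W nicely_meromorphic_on {s. Re s > 1/2}" unfolding W_def by (intro remove_sings_nicely_meromorphic meromorphic_intros zm Tm1)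
	have Tan1: "T analytic_on {s}" if s: "Re s > 1" for s
	proof -
		have ev: "\<forall>\<^sub>F z in nhds s. Tsig \<mu> 1 z = T z"
		proof -
			have "\<forall>\<^sub>F z in nhds s. z \<in> {z. Re z > 1}" by (rule eventually_nhds_in_open[OF open_Re_gt]) (use s in simp)
			thus ?thesis by eventually_elim (simp add: Teq Tsig_series[OF sm e12])
		qed
		have "zeta_reg s~=0" using dseries_nonzero[OF s] by (auto simp: dseries_def)
		hence "Tsig \<mu> 1 analytic_on {s}" using s by (intro Tsig_regular(1) e not_half_of_Re) auto
		thus ?thesis using analytic_at_cong[OF ev refl] by simp
	qed
	have Wg: "W s = g s" if "Re s > 1/2" for s
	proof (rule nicely_meromorphic_eq_holomorphic(1)[OF Wn ghol open_Re_gt conv open_Re_gt[of 1]])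
		show "{s::complex. Re s > 1}~={}" by (intro ex_in_conv[THEN iffD1] exI[of _ 2]) simp
		fix s :: complex assume "s \<in> {s. Re s > 1}"
		hence s: "Re s > 1" by simp
		have z0: "zeta_reg s~=0" using dseries_nonzero[OF s] by (auto simp: dseries_def)
		have "W s = zeta_reg s * T s" unfolding W_def by (intro remove_sings_at_analytic analytic_intros Tan1 s analytic_zeta_reg) (use s in auto)
		also have "T s = Mfun (rfun \<mu>) (-1) 1 s" unfolding Teq[OF s]
			by (rule dirichlet_series_eq[OF sm holomorphic_rfun geometric_expand s]) (use e e12 in auto)
		finally show "W s = g s" using z0 by (simp add: Mfun_def g_def dseries_def power_int_minus)
	qed (use that in auto)
	have GT: "((%x. Gfun \<mu> (complex_of_real x)) \<longlongrightarrow> Gfun \<mu> (1/2)) (at_right (1/2))" by (rule Gfun_tendsto) (rule e)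
	have iso: "isolated_singularity_at T (1/2)" by (rule meromorphic_on_isolated_singularity, rule meromorphic_on_subset)
			 (use Tm in \<open>auto simp: nicely_meromorphic_on_def\<close>)
	then obtain \<rho> where \<rho>: "\<rho> > 0" "T analytic_on ball (1/2) \<rho>-{1/2}" by (auto simp: isolated_singularity_at_def)
	have "\<forall>\<^sub>F x in at_right (1/2). x \<in> {1/2<..<1/2 + \<rho>}" using \<rho>(1) by (intro eventually_at_right_real) auto
	hence "\<forall>\<^sub>F x in at_right (1/2). Gfun \<mu> (of_real x) = T (of_real x)*(of_real x-1/2)"
	proof eventually_elim
		case (elim x)
		hence x: "x > 1/2" by simp
		have "dist (1/2) (complex_of_real x) = \<bar>1/2-x\<bar>" unfolding dist_norm using norm_of_real[of "1/2-x", where 'a = complex] by simp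
		moreover have "complex_of_real x~=1/2" using x by (intro not_half_of_Re) simp
		ultimately have "of_real x \<in> ball (1/2 :: complex) \<rho>-{1/2}" using elim by auto
		hence "{complex_of_real x} \<subseteq> ball (1/2) \<rho>-{1/2}" by (simp only: insert_subset empty_subsetI simp_thms)
		hence Tx: "T analytic_on {complex_of_real x}" by (rule analytic_on_subset[OF \<rho>(2)])
		have "W (of_real x) = zeta_reg (of_real x) * T (of_real x)" unfolding W_def
			by (intro remove_sings_at_analytic analytic_intros Tx analytic_zeta_reg) (use x in auto)
		hence "zeta_reg (of_real x) * T (of_real x) = g (of_real x)" using Wg[of "of_real x"] x by simp
		moreover have "zeta_reg (of_real x)~=0" using x by (intro zeta_reg_real_nonzero) auto
		ultimately have "T (of_real x) = g (of_real x)/zeta_reg (of_real x)" by (metis nonzero_mult_div_cancel_left)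
		also have "... = Mfun (rfun \<mu>) (-1) 1 (of_real x)" by (simp add: Mfun_def g_def dseries_def power_int_minus)
		finally have "T (of_real x) = Gfun \<mu> (of_real x)/(of_real x-1/2)" by (simp only: Mfun_eq_Gfun)
		moreover have "complex_of_real x-1/2~=0" using \<open>complex_of_real x ~= 1/2\<close> by (metis eq_iff_diff_eq_0)
		ultimately show ?case by (metis nonzero_eq_divide_eq)
	qed
	hence lim: "((%x. T (of_real x)*(of_real x-1/2)) \<longlongrightarrow> Gfun \<mu> (1/2)) (at_right (1/2))"
		by (rule Lim_transform_eventually[OF GT])
	have fl: "filterlim complex_of_real (at (1/2)) (at_right (1/2))"
	proof -
		have "((%x. complex_of_real x) \<longlongrightarrow> complex_of_real (1/2)) (at_right (1/2))" by (intro tendsto_intros)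
		moreover have "\<forall>\<^sub>F x in at_right (1/2). complex_of_real x~=complex_of_real (1/2)"
		proof -
			have "\<forall>\<^sub>F x::real in at_right (1/2). x > 1/2" by (rule eventually_at_right_less)
			thus ?thesis by eventually_elim (metis of_real_eq_iff less_irrefl)
		qed
		ultimately have "filterlim complex_of_real (at (complex_of_real (1/2))) (at_right (1/2))" by (simp only: filterlim_at) simp
		thus ?thesis by simp
	qed
	show ?thesis using cases
	proof
		assume "is_pole T (1/2) \<and> zorder T (1/2) = -1 \<and> complex_of_real b = 2 * residue T (1/2)"
		moreover from this have "residue T (1/2) = Gfun \<mu> (1/2)" by (intro residue_simple_pole_limit[OF iso _ _ lim fl]) auto
		ultimately show ?thesis by simp
	next
		assume a: "T analytic_on {1/2} \<and> b = 0"
		hence "(T \<longlongrightarrow> T (1/2)) (at (1/2))" using analytic_at_imp_isCont by (auto simp: isCont_def)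
		hence "((%x. T (complex_of_real x)) \<longlongrightarrow> T (1/2)) (at_right (1/2))" using fl by (rule filterlim_compose)
		moreover have "((%x. complex_of_real x-1/2) \<longlongrightarrow> complex_of_real (1/2)-1/2) (at_right (1/2))" by (intro tendsto_intros)
		ultimately have "((%x. T (of_real x)*(of_real x-1/2)) \<longlongrightarrow> T (1/2)*(complex_of_real (1/2)-1/2)) (at_right (1/2))"
			by (rule tendsto_mult)
		with lim have "Gfun \<mu> (1/2) = T (1/2)*(complex_of_real (1/2)-1/2)" by (intro tendsto_unique[OF _ lim]) auto
		thus ?thesis using a by simp
	qed
qed

section \<open>The sign patterns without bias\<close>

text \<open>With exponent -n <= 0 the factor zeta(2s) contributes no pole at 1/2, and zeta(s) is
  finite and nonzero there.\<close>

lemma no_bias_of_Mfun: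
	assumes sm: "sign_multiplicative \<mu> f" and r: "r holomorphic_on ball 0 1"
		and fac: "!!x. norm x < 1 ==> efac \<mu> x = (1+x^3 * r x)*(1/(1-x)) powi a*(1/(1-x^2)) powi (- int n)"
		and a: "a = 1 \<or> a = -1"
	shows "no_bias f"
proof -
	have nz: "zeta_reg z~=0" if "z \<in> {1/2}" for z using zeta_reg_real_nonzero[of "1/2"] that by (simp only: singleton_iff) simp
	have U: "Ufun r analytic_on {1/2}" by (rule holomorphic_on_imp_analytic_at[OF holomorphic_Ufun[OF r] open_Re_gt]) auto
	have d: "(%s. dseries s powi a) analytic_on {1/2}" using a
	proof
		assume "a = 1"
		thus ?thesis using analytic_dseries[of "1/2"] by simp
	next
		assume a: "a = -1"
		have "(%s. (s-1)/zeta_reg s) analytic_on {1/2}" by (intro analytic_intros analytic_zeta_reg) (erule nz | simp)+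
		thus ?thesis unfolding a by (simp add: dseries_def power_int_minus)
	qed
	have nz2: "zeta_reg (2 * z)~=0" if "z \<in> {1/2}" for z using that by (simp only: singleton_iff) simp
	have "zeta_reg \<circ> (%s. 2 * s) analytic_on {1/2}" by (intro analytic_on_compose) (auto intro!: analytic_intros analytic_zeta_reg)
	hence z2: "(%s. zeta_reg (2 * s)) analytic_on {1/2}" by (simp add: o_def)
	have "(%s. ((2 * s-1)/zeta_reg (2 * s))^n) analytic_on {1/2}" by (intro analytic_intros z2) (erule nz2 | simp)+
	moreover have "((2 * s-1)/zeta_reg (2 * s))^n = dseries (2 * s) powi (- int n)" for s by (simp add: dseries_def power_int_minus power_divide)
	ultimately have d2: "(%s. dseries (2 * s) powi (- int n)) analytic_on {1/2}" by simp
	have "Mfun r a (- int n) analytic_on {1/2}" unfolding Mfun_def by (intro analytic_on_mult U d d2)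
	hence "Tfun r a (- int n) analytic_on {1/2}" unfolding Tfun_def by (rule remove_sings_analytic_on)
	moreover have "continues_series f (Tfun r a (- int n))" by (rule continues_series_Tfun[OF sm r fac])
	ultimately show ?thesis unfolding no_bias_def bias_def by blast
qed

text \<open>Modulo x^3: 1+x+x^2 = 1/(1-x), 1+x-x^2 = (1-x^2)^2/(1-x), and 1-x-x^2 = (1-x)(1-x^2). So
  the zeta powers are zeta(s), zeta(s)/zeta(2s)^2 and 1/(zeta(s) zeta(2s)).\<close>

lemma no_bias_cases:
	assumes sm: "sign_multiplicative \<mu> f" and c: "\<mu> 1 = 1 \<or> (\<mu> 1 = -1 \<and> \<mu> 2 = -1)"
	shows "no_bias f"
proof -
	note e = sign_multiplicative_facts(3)[OF sm]
	have t: "etail \<mu> holomorphic_on ball 0 1" by (intro holomorphic_etail e)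
	have e2: "\<mu> 2 = 1 \<or> \<mu> 2 = -1"
	proof -
		have "\<forall>k\<ge>1. \<mu> k \<in> {-1, 1}" using sm unfolding sign_multiplicative_def by blast
		hence "\<mu> 2 \<in> {-1, 1}" by simp
		thus ?thesis by auto
	qed
	have nz: "1-x~=0" "1-x^2~=0" if "norm x < 1" for x :: complex
	proof -
		show "1-x~=0" using that by auto
		have "norm (x^2) < 1" using that by (simp add: norm_power power_less_one_iff abs_square_less_1)
		thus "1-x^2~=0" by auto
	qed
	have E: "efac \<mu> x = 1 + of_int (\<mu> 1) * x + of_int (\<mu> 2) * x^2+x^3 * etail \<mu> x" if "norm x < 1" for x
		using efac_expand[of \<mu> x] e that by blast
	consider "\<mu> 1 = 1" "\<mu> 2 = 1" | "\<mu> 1 = 1" "\<mu> 2 = -1" | "\<mu> 1 = -1" "\<mu> 2 = -1" using c e2 by blast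
	thus ?thesis
	proof cases
		case 1
		show ?thesis
		proof (rule no_bias_of_Mfun[OF sm, of "%x. -1+(1-x) * etail \<mu> x" 1 0])
			show "(%x. -1+(1-x) * etail \<mu> x) holomorphic_on ball 0 1" by (intro holomorphic_intros t)
			fix x :: complex assume x: "norm x < 1"
			have "efac \<mu> x*(1-x) = 1+x^3*(-1+(1-x) * etail \<mu> x)"
				unfolding E[OF x] 1 by (simp add: algebra_simps power2_eq_square power3_eq_cube)
			thus "efac \<mu> x = (1+x^3*(-1+(1-x) * etail \<mu> x))*(1/(1-x)) powi 1*(1/(1-x^2)) powi (- int 0)"
				using nz[OF x] by (simp add: eq_divide_eq)
		qed simp
	next
		case 2
		show ?thesis
		proof (rule no_bias_of_Mfun[OF sm, of "%x. (1-x)*(1+etail \<mu> x)/(1-x^2)^2" 1 2])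
			show "(%x. (1-x)*(1+etail \<mu> x)/(1-x^2)^2) holomorphic_on ball 0 1" using nz by (intro holomorphic_intros t) auto
			fix x :: complex assume x: "norm x < 1"
			define q where "q = 1-x^2"
			have q: "q~=0" using nz(2)[OF x] by (simp add: q_def)
			have "efac \<mu> x*(1-x) = q^2+x^3*((1-x)*(1+etail \<mu> x))"
				unfolding E[OF x] 2 q_def by (simp add: algebra_simps power2_eq_square power3_eq_cube)
			hence "efac \<mu> x = (q^2+x^3*((1-x)*(1+etail \<mu> x)))/(1-x)" using nz(1)[OF x] by (simp add: eq_divide_eq)
			also have "... = (1+x^3*((1-x)*(1+etail \<mu> x)/q^2))*(1/(1-x)) * q^2"
				using q by (simp add: add_divide_distrib distrib_right)
			also have "... = (1+x^3*((1-x)*(1+etail \<mu> x)/q^2))*(1/(1-x)) powi 1*(1/q) powi (- int 2)"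
				by (simp add: power_int_minus power_divide)
			finally show "efac \<mu> x = (1+x^3*((1-x)*(1+etail \<mu> x)/(1-x^2)^2))*(1/(1-x)) powi 1*(1/(1-x^2)) powi (- int 2)"
				unfolding q_def .
		qed simp
	next
		case 3
		show ?thesis
		proof (rule no_bias_of_Mfun[OF sm, of "%x. (etail \<mu> x-1)/((1-x)*(1-x^2))" "-1" 1])
			show "(%x. (etail \<mu> x-1)/((1-x)*(1-x^2))) holomorphic_on ball 0 1" using nz by (intro holomorphic_intros t) auto
			fix x :: complex assume x: "norm x < 1"
			define q where "q = (1-x)*(1-x^2)"
			have q: "q~=0" using nz[OF x] by (simp add: q_def)
			have "efac \<mu> x = q+x^3*(etail \<mu> x-1)"
				unfolding E[OF x] 3 q_def by (simp add: algebra_simps power2_eq_square power3_eq_cube)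
			also have "... = (1+x^3*((etail \<mu> x-1)/q)) * q" using q by (simp add: distrib_right)
			also have "... = (1+x^3*((etail \<mu> x-1)/q))*(1/(1-x)) powi (-1)*(1/(1-x^2)) powi (- int 1)"
				by (simp add: power_int_minus q_def)
			finally show "efac \<mu> x = (1+x^3*((etail \<mu> x-1)/((1-x)*(1-x^2))))*(1/(1-x)) powi (-1)*(1/(1-x^2)) powi (- int 1)"
				unfolding q_def .
		qed simp
	qed
qed

section \<open>Existence of the functions, and uncountably many with vanishing factor at 2\<close>

definition fmul :: "(nat => int) => nat => int" where
	"fmul \<mu> n = (if n = 0 then 0 else \<Prod>p\<in>prime_factors n. \<mu> (multiplicity p n))"

lemma sign_multiplicative_fmul:
	assumes e: "!!k. k>=1 ==> \<mu> k \<in> {-1, 1}"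
	shows "sign_multiplicative \<mu> (fmul \<mu>)" unfolding sign_multiplicative_def multiplicative_def
proof (intro conjI allI impI)
	show "fmul \<mu> 0 = 0" "fmul \<mu> 1 = 1" by (simp_all add: fmul_def)
	show "\<mu> k \<in> {-1, 1}" if "1<=k" for k using e[OF that] .
	fix m n :: nat assume cop: "coprime m n"
	show "fmul \<mu> (m * n) = fmul \<mu> m * fmul \<mu> n"
	proof (cases "m = 0 \<or> n = 0")
		case True
		thus ?thesis by (auto simp: fmul_def)
	next
		case False
		have disj: "prime_factors m \<inter> prime_factors n = {}" using cop by (auto simp: in_prime_factors_iff dest: coprime_common_divisor)
		have mul: "multiplicity p (m * n) = multiplicity p m" if "p \<in> prime_factors m" for p
		proof -
			have "p \<notin> prime_factors n" using disj that by blast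
			hence "multiplicity p n = 0" using that False by (auto simp: in_prime_factors_iff not_dvd_imp_multiplicity_0)
			thus ?thesis using that False by (simp add: prime_elem_multiplicity_mult_distrib in_prime_factors_iff)
		qed
		have mul': "multiplicity p (m * n) = multiplicity p n" if "p \<in> prime_factors n" for p
		proof -
			have "p \<notin> prime_factors m" using disj that by blast
			hence "multiplicity p m = 0" using that False by (auto simp: in_prime_factors_iff not_dvd_imp_multiplicity_0)
			thus ?thesis using that False by (simp add: prime_elem_multiplicity_mult_distrib in_prime_factors_iff)
		qed
		have "prime_factors (m * n) = prime_factors m \<union> prime_factors n" using False by (simp add: prime_factors_product)
		hence "fmul \<mu> (m * n) = (\<Prod>p\<in>prime_factors m. \<mu> (multiplicity p (m * n)))*(\<Prod>p\<in>prime_factors n. \<mu> (multiplicity p (m * n)))"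
			using False disj by (simp add: fmul_def prod.union_disjoint)
		thus ?thesis using False mul mul' by (simp add: fmul_def)
	qed
next
	fix p k :: nat assume p: "prime p" and k: "1<=k"
	hence "prime_factors (p^k) = {p}" by (simp add: prime_factorization_prime_power)
	thus "fmul \<mu> (p^k) = \<mu> k" using p by (simp add: fmul_def)
qed

text \<open>A greedy binary expansion with digits 1 and -1; \<open>t j\<close> is the remainder
  after j digits scaled by 2^j, and it stays in [-1, 1].\<close>

lemma sign_expansion:
	fixes x :: real
	assumes "\<bar>x\<bar><=1"
	obtains d :: "nat => int" where "!!j. d j \<in> {-1, 1}" "(%j. of_int (d j)/2^Suc j) sums x"
proof -
	define t where "t = rec_nat x (%_ u. 2 * u-(if u>=0 then 1 else -1))"
	have t: "t 0 = x" "!!j. t (Suc j) = 2 * t j-(if t j>=0 then 1 else -1)" by (simp_all add: t_def)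
	have bd: "\<bar>t j\<bar><=1" for j by (induction j) (use assms t in \<open>auto simp: abs_le_iff\<close>)
	define d :: "nat => int" where "d = (%j. if t j>=0 then 1 else -1)"
	have part: "(\<Sum>j<n. of_int (d j)/2^Suc j) = x-t n/2^n" for n by (induction n) (auto simp: t d_def field_simps)
	have "(%n. t n/2^n) \<longlonglongrightarrow> 0"
	proof (rule Lim_null_comparison[of "%n. t n/2^n" "%n. (1/2)^n"])
		show "\<forall>\<^sub>F n in sequentially. norm (t n/2^n)<=(1/2)^n"
			using bd by (intro always_eventually) (simp add: abs_mult power_divide divide_right_mono)
		show "(%n. (1/2::real)^n) \<longlonglongrightarrow> 0" by (intro LIMSEQ_realpow_zero) auto
	qed
	hence "(%n. x-t n/2^n) \<longlonglongrightarrow> x-0" by (intro tendsto_intros)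
	hence "(%j. of_int (d j)/2^Suc j) sums x" by (simp add: sums_def part del: power_Suc)
	thus ?thesis by (intro that[of d]) (auto simp: d_def)
qed

text \<open>With y = 1/sqrt 2 and y^2 = 1/2, the signs of odd index and those of even index give two
  independent binary expansions. The odd ones encode an arbitrary w in [-1, -1/2], the even ones
  restore the prescribed sum; w can be read off from f(2^(2j+3)).\<close>

lemma uncountable_sign_sequences:
	"uncountable {f. \<exists>\<mu>. sign_multiplicative \<mu> f \<and> \<mu> 1 = -1 \<and> \<mu> 2 = 1 \<and>
		 (\<Sum>k. real_of_int (\<mu> (Suc k))/sqrt 2^Suc k) = -1}" (is "uncountable ?S")
proof -
	define y :: real where "y = 1/sqrt 2"
	have y2: "y^2 = 1/2" by (simp add: y_def power_divide)
	have yb: "0.7 < y" "y < 0.72"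
	proof -
		show "0.7 < y" by (rule power2_less_imp_less) (use y2 in \<open>simp_all add: y_def power2_eq_square\<close>)
		show "y < 0.72" by (rule power2_less_imp_less) (use y2 in \<open>simp_all add: power2_eq_square\<close>)
	qed
	have "\<exists>\<mu>. (\<forall>k\<ge>1. \<mu> k \<in> {-1, 1::int}) \<and> \<mu> 1 = -1 \<and> \<mu> 2 = 1 \<and>
			(%k. real_of_int (\<mu> (Suc k)) * y^Suc k) sums (-1) \<and>
			(%j. of_int (\<mu> (2 * j+3))/2^Suc j) sums w" if w: "w \<in> {-1 .. -1/2}" for w :: real
	proof -
		\<comment> \<open>The signs from index 3 on contribute y w + v/2, and this has to be -1 - (-y +
		  1/2). The restriction on w serves to keep v in [-1, 1].\<close>
		define v where "v = 2 * y-3-2 * y * w"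
		have "\<bar>v\<bar><=1"
		proof -
			have "y * w<=y*(-1/2)" "y * w>=y*(-1)" using mult_left_mono[of w "-1/2" y] mult_left_mono[of "-1" w y] w yb by auto
			thus ?thesis unfolding v_def abs_le_iff using yb by (simp add: algebra_simps)
		qed
		then obtain d' where d': "!!j. d' j \<in> {-1, 1::int}" "(%j. of_int (d' j)/2^Suc j) sums v" by (rule sign_expansion) (rule that)
		have "\<bar>w\<bar><=1" using w by auto
		then obtain d where d: "!!j. d j \<in> {-1, 1::int}" "(%j. of_int (d j)/2^Suc j) sums w" by (rule sign_expansion) (rule that)
		define \<mu> where "\<mu> k = (if k = 1 then -1 else if k = 2 then 1 else if odd k then d ((k-3) div 2) else d' ((k-4) div 2))" for k
		have eo: "\<mu> (2 * j+3) = d j" for j by (simp add: \<mu>_def)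
		have ee: "\<mu> (2 * j+4) = d' j" for j by (simp add: \<mu>_def)
		have "(%j. y*(of_int (d j)/2^Suc j)+(1/2)*(of_int (d' j)/2^Suc j)) sums (y * w+(1/2) * v)" by (intro sums_add sums_mult d d')
		also have "(%j. y*(of_int (d j)/2^Suc j)+(1/2)*(of_int (d' j)/2^Suc j))
				= (%j. \<Sum>k\<in>{j*2..<j*2+2}. real_of_int (\<mu> (k+3)) * y^(k+3))"
		proof
			fix j
			have p: "y^(2 * j) = 1/2^j" by (simp add: power_mult y2 power_divide)
			have "{j*2..<j*2+2} = {2 * j, Suc (2 * j)}" by auto
			hence "(\<Sum>k\<in>{j*2..<j*2+2}. real_of_int (\<mu> (k+3)) * y^(k+3))
				 = of_int (\<mu> (2 * j+3))*(y^(2 * j) * y^2 * y) + of_int (\<mu> (2 * j+4))*(y^(2 * j) * y^2 * y^2)"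
				by (simp add: power_add power2_eq_square power3_eq_cube eval_nat_numeral)
			also have "... = y*(of_int (d j)/2^Suc j)+(1/2)*(of_int (d' j)/2^Suc j)" unfolding eo ee p y2 by (simp add: mult_ac)
			finally show "y*(of_int (d j)/2^Suc j)+(1/2)*(of_int (d' j)/2^Suc j)
				= (\<Sum>k\<in>{j*2..<j*2+2}. real_of_int (\<mu> (k+3)) * y^(k+3))" ..
		qed
		finally have s1: "(%j. \<Sum>k\<in>{j*2..<j*2+2}. real_of_int (\<mu> (k+3)) * y^(k+3)) sums (y * w+(1/2) * v)" .
		have eps: "\<mu> k \<in> {-1, 1}" for k using d(1) d'(1) by (auto simp: \<mu>_def)
		have "summable (%k. real_of_int (\<mu> (k+3)) * y^(k+3))"
		proof (rule summable_comparison_test'[of "%k. y^k" 0])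
			show "summable (%k. y^k)" using yb by (intro summable_geometric) auto
			show "norm (real_of_int (\<mu> (k+3)) * y^(k+3))<=y^k" for k
			proof -
				have "norm (real_of_int (\<mu> (k+3)) * y^(k+3)) = y^(k+3)" using eps[of "k+3"] yb by (auto simp: abs_mult)
				also have "...<=y^k" using yb by (intro power_decreasing) auto
				finally show ?thesis .
			qed
		qed
		then obtain S where S: "(%k. real_of_int (\<mu> (k+3)) * y^(k+3)) sums S" by (auto simp: summable_def)
		have "S = y * w+(1/2) * v" using sums_group[OF S, of 2] s1 sums_unique2 by force
		hence S': "S = y-3/2" by (simp add: v_def field_simps)
		have e1: "\<mu> (Suc 0) = -1" and e2: "\<mu> (Suc (Suc 0)) = 1" by (simp_all add: \<mu>_def)
		have "-1-(\<Sum>k<2. real_of_int (\<mu> (Suc k)) * y^Suc k) = -1-(- y+y^2)" by (simp add: e1 e2 numeral_2_eq_2)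
		also have "... = S" unfolding y2 S' by simp
		finally have "-1-(\<Sum>k<2. real_of_int (\<mu> (Suc k)) * y^Suc k) = S" .
		moreover have "Suc (k+2) = k+3" for k by simp
		ultimately have "(%k. real_of_int (\<mu> (Suc (k+2))) * y^Suc (k+2)) sums (-1-(\<Sum>k<2. real_of_int (\<mu> (Suc k)) * y^Suc k))"
			using S by (simp only:)
		hence "(%k. real_of_int (\<mu> (Suc k)) * y^Suc k) sums (-1)" by (subst (asm) sums_iff_shift) (simp only: diff_add_cancel)
		note total = this
		show ?thesis
		proof (intro exI[of _ \<mu>] conjI)
			show "\<forall>k\<ge>1. \<mu> k \<in> {-1, 1}" using eps by blast
			show "\<mu> 1 = -1" by (simp add: e1)
			show "\<mu> 2 = 1" by (simp add: e2 numeral_2_eq_2)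
			show "(%k. real_of_int (\<mu> (Suc k)) * y^Suc k) sums (-1)" by (rule total)
			show "(%j. of_int (\<mu> (2 * j+3))/2^Suc j) sums w" using d(2) by (simp only: eo)
		qed
	qed
	note ex = this
	define P where "P = (%w (\<mu> :: nat => int). (\<forall>k\<ge>1. \<mu> k \<in> {-1, 1::int}) \<and> \<mu> 1 = -1 \<and> \<mu> 2 = 1 \<and>
			(%k. real_of_int (\<mu> (Suc k)) * y^Suc k) sums (-1) \<and>
			(%j. of_int (\<mu> (2 * j+3))/2^Suc j) sums (w::real))"
	have "\<exists>\<mu>. P w \<mu>" if "w \<in> {-1 .. -1/2}" for w unfolding P_def using that by (rule ex)
	hence "\<forall>w\<in>{-1 .. -1/2}. \<exists>\<mu>. P w \<mu>" by blast
	from bchoice[OF this] obtain E where "\<forall>w\<in>{-1 .. -1/2}. P w (E w)" by blast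
	hence "P w (E w)" if "w \<in> {-1 .. -1/2}" for w using that by blast
	hence E: "\<forall>k\<ge>1. E w k \<in> {-1, 1}" "E w 1 = -1" "E w 2 = 1"
			"(%k. real_of_int (E w (Suc k)) * y^Suc k) sums (-1)"
			"(%j. of_int (E w (2 * j+3))/2^Suc j) sums w" if "w \<in> {-1 .. -1/2}" for w unfolding P_def using that by blast+
	have sm: "sign_multiplicative (E w) (fmul (E w))" if "w \<in> {-1 .. -1/2}" for w by (rule sign_multiplicative_fmul) (use E(1)[OF that] in blast)
	have "inj_on (%w. fmul (E w)) {-1 .. -1/2}"
	proof (rule inj_onI)
		fix w w' assume w: "w \<in> {-1 .. -1/2}" "w' \<in> {-1 .. -1/2}" and eq: "fmul (E w) = fmul (E w')"
		have same: "E w (2 * j+3) = E w' (2 * j+3)" for j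
		proof -
			have pk: "f (2^k) = \<mu> k" if "sign_multiplicative \<mu> f" "1<=k" for \<mu> f k
				using that two_is_prime_nat unfolding sign_multiplicative_def by blast
			have "fmul (E w) (2^(2 * j+3)) = E w (2 * j+3)" by (rule pk[OF sm[OF w(1)]]) simp
			moreover have "fmul (E w') (2^(2 * j+3)) = E w' (2 * j+3)" by (rule pk[OF sm[OF w(2)]]) simp
			ultimately show ?thesis using eq by (simp only:)
		qed
		have "(%j. of_int (E w' (2 * j+3))/2^Suc j) sums w" using E(5)[OF w(1)] unfolding same .
		thus "w = w'" using E(5)[OF w(2)] by (rule sums_unique2)
	qed
	moreover have "uncountable {-1 .. (-1/2::real)}" by (simp add: uncountable_closed_interval)
	ultimately have "uncountable ((%w. fmul (E w)) ` {-1 .. -1/2})" using countable_image_inj_on by blast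
	moreover have "(%w. fmul (E w)) ` {-1 .. -1/2} \<subseteq> ?S"
	proof safe
		fix w :: real assume w: "w \<in> {-1 .. -1/2}"
		have "(%k. real_of_int (E w (Suc k))/sqrt 2^Suc k) = (%k. real_of_int (E w (Suc k)) * y^Suc k)" by (simp add: y_def power_divide)
		hence "(\<Sum>k. real_of_int (E w (Suc k))/sqrt 2^Suc k) = -1" using sums_unique[OF E(4)[OF w]] by simp
		thus "\<exists>\<mu>. sign_multiplicative \<mu> (fmul (E w)) \<and> \<mu> 1 = -1 \<and> \<mu> 2 = 1 \<and> (\<Sum>k. real_of_int (\<mu> (Suc k))/sqrt 2^Suc k) = -1"
			using sm[OF w] E(2,3)[OF w] by (intro exI[of _ "E w"] conjI)
	qed
	ultimately show ?thesis using countable_subset by blast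
qed

section \<open>The bias as a real Euler product\<close>

definition sgn_series :: "(nat => int) => real => real" where
	"sgn_series \<mu> y = (\<Sum>k. real_of_int (\<mu> (k+3)) * y^k)"

text \<open>The real value of \<open>hfac\<close> at s = 1/2, as a function of y = p^(-1/2). For
  signs starting with -1, 1 it is 1 + y times the Euler factor.\<close>

definition hreal :: "(nat => int) => real => real" where
	"hreal \<mu> y = 1+y^3+(1+y)*(y^3 * sgn_series \<mu> y)"

definition ypow :: "nat => real" where
	"ypow n = 1/sqrt (real n)"

lemma ypow_bounds: "n>=2 ==> 0 < ypow n" "n>=2 ==> ypow n < 1" "n>=1 ==> ypow n^2 = 1/real n" by (auto simp: ypow_def power_divide)

lemma ypow_le: "1<=m ==> m<=n ==> ypow n<=ypow m" unfolding ypow_def by (intro divide_left_mono) auto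

lemma sgn_series_summable:
	assumes e: "!!k. k>=1 ==> \<bar>\<mu> k\<bar><=(1::int)" and y: "0<=y" "y < (1::real)"
	shows "summable (%k. real_of_int (\<mu> (k+3)) * y^k)"
proof (rule summable_comparison_test'[of "%k. y^k" 0])
	show "summable (%k. y^k)" using y by (intro summable_geometric) auto
	fix k
	have "norm (real_of_int (\<mu> (k+3)) * y^k) = real_of_int \<bar>\<mu> (k+3)\<bar> * y^k" using y by (simp add: abs_mult)
	also have "...<=1 * y^k" using e[of "k+3"] y by (intro mult_right_mono) auto
	finally show "norm (real_of_int (\<mu> (k+3)) * y^k)<=y^k" by simp
qed

lemma etail_of_real:
	assumes e: "!!k. k>=1 ==> \<bar>\<mu> k\<bar><=(1::int)" and y: "0<=y" "y < (1::real)"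
	shows "etail \<mu> (of_real y) = of_real (sgn_series \<mu> y)"
proof -
	have s: "summable (%k. real_of_int (\<mu> (k+3)) * y^k)" by (rule sgn_series_summable) (use assms in auto)
	show ?thesis using suminf_of_real[OF s, where 'a = complex] by (simp add: sgn_series_def etail_def)
qed

lemma hfac_half:
	assumes e: "!!k. k>=1 ==> \<bar>\<mu> k\<bar><=(1::int)" and n: "n>=2"
	shows "hfac (rfun \<mu>) n (1/2) = of_real (hreal \<mu> (ypow n))"
proof -
	have "of_nat n powr (-(1/2)) = complex_of_real (real n powr (-(1/2)))" using powr_of_real[of "real n" "-(1/2)"] by simp
	also have "real n powr (-(1/2)) = ypow n" unfolding powr_minus powr_half_sqrt[OF of_nat_0_le_iff] by (simp add: ypow_def divide_inverse)
	finally have x: "of_nat n powr (-(1/2)) = complex_of_real (ypow n)" .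
	have t: "etail \<mu> (of_real (ypow n)) = of_real (sgn_series \<mu> (ypow n))"
		using ypow_bounds(1,2)[OF n] by (intro etail_of_real e) auto
	have "hfac (rfun \<mu>) n (1/2) = 1+complex_of_real (ypow n)^3*(1+(1 + of_real (ypow n)) * of_real (sgn_series \<mu> (ypow n)))"
		unfolding hfac_def x rfun_def t ..
	thus ?thesis by (simp add: hreal_def algebra_simps)
qed

definition pprod :: "(nat => int) => nat => real" where
	"pprod \<mu> N = (\<Prod>n<N. if prime n then hreal \<mu> (ypow n) else 1)"

definition Ureal :: "(nat => int) => real" where
	"Ureal \<mu> = Re (Ufun (rfun \<mu>) (1/2))"

lemma Ureal:
	assumes e: "!!k. k>=1 ==> \<bar>\<mu> k\<bar><=(1::int)"
	shows "pprod \<mu> \<longlonglongrightarrow> Ureal \<mu>" "Ufun (rfun \<mu>) (1/2) = of_real (Ureal \<mu>)"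
proof -
	have r: "rfun \<mu> holomorphic_on ball 0 1" by (rule holomorphic_rfun) (rule e)
	have "(%N. \<Prod>n<N. if prime n then hfac (rfun \<mu>) n (1/2) else 1) \<longlonglongrightarrow> Ufun (rfun \<mu>) (1/2)"
		by (rule Ufun_LIMSEQ[OF r]) simp
	also have "(%N. \<Prod>n<N. if prime n then hfac (rfun \<mu>) n (1/2) else 1) = (%N. complex_of_real (pprod \<mu> N))"
	proof
		fix N
		have "(if prime n then hfac (rfun \<mu>) n (1/2) else 1) = complex_of_real (if prime n then hreal \<mu> (ypow n) else 1)" for n
			using hfac_half[of \<mu> n, OF e] prime_ge_2_nat[of n] by auto
		thus "(\<Prod>n<N. if prime n then hfac (rfun \<mu>) n (1/2) else 1) = complex_of_real (pprod \<mu> N)"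
			unfolding pprod_def by (simp only: of_real_prod)
	qed
	finally have lim: "(%N. complex_of_real (pprod \<mu> N)) \<longlonglongrightarrow> Ufun (rfun \<mu>) (1/2)" .
	from tendsto_Re[OF lim] show "pprod \<mu> \<longlonglongrightarrow> Ureal \<mu>" by (simp add: Ureal_def)
	from tendsto_Im[OF lim] have "Im (Ufun (rfun \<mu>) (1/2)) = 0" by (simp add: LIMSEQ_const_iff)
	thus "Ufun (rfun \<mu>) (1/2) = of_real (Ureal \<mu>)" by (simp add: complex_eq_iff Ureal_def)
qed

definition zhalf :: real where
	"zhalf = Re (zeta (1/2))"

lemma zhalf_eq: "zhalf = -2 * Re (zeta_reg (1/2))"
proof -
	have h: "(1/2::complex)~=1" by (simp add: complex_eq_iff)
	have "zeta (1/2) = zeta_reg (1/2)/(1/2-1)" by (rule zeta_eq) (use h in auto)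
	also have "... = -2 * zeta_reg (1/2)" by (simp add: field_simps)
	finally show ?thesis by (simp add: zhalf_def)
qed

lemma zhalf_neg: "zhalf < 0" using zeta_reg_real_ge[of "1/2"] by (simp add: zhalf_eq)

lemma Gfun_half:
	assumes e: "!!k. k>=1 ==> \<bar>\<mu> k\<bar><=(1::int)"
	shows "2 * Gfun \<mu> (1/2) = of_real (Ureal \<mu>/zhalf)"
proof -
	define z where "z = Re (zeta_reg (1/2))"
	have z: "zeta_reg (1/2) = of_real z" using zeta_reg_real(2)[of "1/2"] by (simp add: z_def)
	have u: "Ufun (rfun \<mu>) (1/2) = of_real (Ureal \<mu>)" by (rule Ureal(2)) (rule e)
	have "2 * Gfun \<mu> (1/2) = 2*(of_real (Ureal \<mu>)*((1/2-1)/of_real z)*(zeta_reg (2*(1/2))/2))" unfolding Gfun_def u z ..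
	also have "... = of_real (Ureal \<mu>)*((1/2-1)/of_real z)" by simp
	also have "... = complex_of_real (Ureal \<mu>*((1/2-1)/z))" by simp
	also have "Ureal \<mu>*((1/2-1)/z) = Ureal \<mu>/zhalf" by (simp add: zhalf_eq z_def)
	finally show ?thesis .
qed

theorem bias_main:
	assumes sm: "sign_multiplicative \<mu> f" and e12: "\<mu> 1 = -1" "\<mu> 2 = 1"
	shows "apparent_bias f (Ureal \<mu>/zhalf)" "no_bias f \<longleftrightarrow> Ureal \<mu> = 0"
proof -
	note e = sign_multiplicative_facts(3)[OF sm]
	have b: "of_real (Ureal \<mu>/zhalf) = 2 * Gfun \<mu> (1/2)" by (rule Gfun_half[symmetric]) (rule e)
	show "apparent_bias f (Ureal \<mu>/zhalf)" unfolding apparent_bias_def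
		using bias_exists[OF sm e12 b] linear_coeff_0[OF sm e12] oscillates[OF sm e12 b] by blast
	show "no_bias f \<longleftrightarrow> Ureal \<mu> = 0"
	proof
		assume "no_bias f"
		hence "of_real 0 = 2 * Gfun \<mu> (1/2)" unfolding no_bias_def by (rule Gfun_half_of_bias[OF sm e12])
		hence "complex_of_real (Ureal \<mu>/zhalf) = of_real 0" using b by simp
		thus "Ureal \<mu> = 0" using zhalf_neg by (simp only: of_real_eq_iff) simp
	next
		assume "Ureal \<mu> = 0"
		thus "no_bias f" unfolding no_bias_def using bias_exists[OF sm e12 b] by simp
	qed
qed

lemma hreal_factor:
	"hreal \<mu> y = (1+y)*(1-y+y^2+y^3 * sgn_series \<mu> y)"
	by (simp add: hreal_def algebra_simps power2_eq_square power3_eq_cube)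

text \<open>The product over the odd primes is bounded away from 0, so only the factor at 2 can make
  the bias vanish.\<close>

lemma Ureal_eq_0_iff:
	assumes e: "!!k. k>=1 ==> \<bar>\<mu> k\<bar><=(1::int)"
	shows "Ureal \<mu> = 0 \<longleftrightarrow> hreal \<mu> (ypow 2) = 0"
proof -
	obtain c where c: "c > 0" "!!s. Re s>=1/2 ==> norm (V (rfun \<mu>) s)>=c" using V_lower_bound[of \<mu>] e by blast
	have "norm (V (rfun \<mu>) (1/2))>=c" by (rule c(2)) simp
	hence V: "V (rfun \<mu>) (1/2)~=0" using c(1) by auto
	have u: "Ufun (rfun \<mu>) (1/2) = of_real (Ureal \<mu>)" by (rule Ureal(2)) (rule e)
	have h: "hfac (rfun \<mu>) 2 (1/2) = of_real (hreal \<mu> (ypow 2))" by (rule hfac_half) (use e in auto)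
	have "of_real (Ureal \<mu>) = of_real (hreal \<mu> (ypow 2)) * V (rfun \<mu>) (1/2)" unfolding u[symmetric] Ufun_def h ..
	thus ?thesis using V by (metis mult_eq_0_iff of_real_eq_0_iff)
qed

lemma hreal_two_eq_0_iff:
	assumes e: "!!k. k>=1 ==> \<bar>\<mu> k\<bar><=(1::int)" and e12: "\<mu> 1 = -1" "\<mu> 2 = 1"
	shows "hreal \<mu> (ypow 2) = 0 \<longleftrightarrow> (\<Sum>k. real_of_int (\<mu> (Suc k))/sqrt 2^Suc k) = -1"
proof -
	define y where "y = ypow 2"
	have y: "0 < y" "y < 1" using ypow_bounds[of 2] by (auto simp: y_def)
	have e12': "\<mu> (Suc 0) = -1" "\<mu> (Suc (Suc 0)) = 1" using e12 by (simp_all add: numeral_2_eq_2)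
	have "(%k. real_of_int (\<mu> (k+3)) * y^k) sums sgn_series \<mu> y"
		unfolding sgn_series_def by (intro summable_sums sgn_series_summable e) (use y in auto)
	hence "(%k. y^3*(real_of_int (\<mu> (k+3)) * y^k)) sums (y^3 * sgn_series \<mu> y)" by (rule sums_mult)
	also have "(%k. y^3*(real_of_int (\<mu> (k+3)) * y^k)) = (%k. real_of_int (\<mu> (Suc (k+2))) * y^Suc (k+2))"
		by (simp add: fun_eq_iff eval_nat_numeral)
	finally have "(%k. real_of_int (\<mu> (Suc k)) * y^Suc k) sums (y^3 * sgn_series \<mu> y+(\<Sum>k<2. real_of_int (\<mu> (Suc k)) * y^Suc k))"
		by (subst (asm) sums_iff_shift)
	moreover have "(\<Sum>k<2. real_of_int (\<mu> (Suc k)) * y^Suc k) =-y+y^2" by (simp add: numeral_2_eq_2 e12')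
	moreover have "(%k. real_of_int (\<mu> (Suc k)) * y^Suc k) = (%k. real_of_int (\<mu> (Suc k))/sqrt 2^Suc k)"
		by (simp add: fun_eq_iff y_def ypow_def power_divide)
	ultimately have "(%k. real_of_int (\<mu> (Suc k))/sqrt 2^Suc k) sums (y^3 * sgn_series \<mu> y+(- y+y^2))" by (simp only:)
	hence "(\<Sum>k. real_of_int (\<mu> (Suc k))/sqrt 2^Suc k) = y^3 * sgn_series \<mu> y+(- y+y^2)" by (simp only: sums_iff)
	moreover have "hreal \<mu> y = 0 \<longleftrightarrow> 1-y+y^2+y^3 * sgn_series \<mu> y = 0" unfolding hreal_factor using y by simp
	ultimately show ?thesis unfolding y_def[symmetric] by (simp only:) linarith
qed

section \<open>The extreme values\<close>

text \<open>\<open>epsA\<close> and \<open>epsB\<close> have all signs from index 3 on equal to 1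
  and to -1 respectively. Since zeta(1/2) < 0, the largest product belongs to the lower end A1 of
  the range and the smallest to B1.\<close>

definition epsA :: "nat => int" where "epsA k = (if k = 1 then -1 else 1)"
definition epsB :: "nat => int" where "epsB k = (if k = 2 then 1 else -1)"

lemma sgn_series_extreme:
	assumes y: "0<=y" "y < (1::real)"
	shows "sgn_series epsA y = 1/(1-y)" "sgn_series epsB y =-(1/(1-y))"
proof -
	have a: "epsA (k+3) = 1" "epsB (k+3) = -1" for k by (simp_all add: epsA_def epsB_def)
	have g: "(\<Sum>k. y^k) = 1/(1-y)" "summable (%k. y^k)" using y by (auto intro: suminf_geometric summable_geometric)
	show "sgn_series epsA y = 1/(1-y)" unfolding sgn_series_def a using g by simp
	show "sgn_series epsB y =-(1/(1-y))" unfolding sgn_series_def a using g suminf_minus[OF g(2)] by simp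
qed

lemma hreal_extreme:
	assumes y: "0<=y" "y < (1::real)"
	shows "hreal epsA y = 1+2 * y^3/(1-y)" "hreal epsB y = 1-2 * y^4/(1-y)"
proof -
	have n: "1-y~=0" using y by simp
	have "hreal epsA y = 1+(y^3*(1-y)+(1+y) * y^3)/(1-y)"
		unfolding hreal_def sgn_series_extreme[OF y] using n by (simp add: add_divide_distrib)
	also have "y^3*(1-y)+(1+y) * y^3 = 2 * y^3" by (simp add: algebra_simps)
	finally show "hreal epsA y = 1+2 * y^3/(1-y)" .
	have "hreal epsB y = 1+(y^3*(1-y)-(1+y) * y^3)/(1-y)"
		unfolding hreal_def sgn_series_extreme[OF y] using n by (simp add: diff_divide_distrib)
	also have "y^3*(1-y)-(1+y) * y^3 = -(2 * y^4)" by (simp add: algebra_simps eval_nat_numeral)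
	finally show "hreal epsB y = 1-2 * y^4/(1-y)" by simp
qed

text \<open>Identifies the infinite product over all naturals with the limit of the partial
  products. The criterion used for its convergence asks for summable deviations from 1 and for
  nonvanishing factors.\<close>

lemma prime_prod_eq:
	assumes eq: "!!n. prime n ==> g n = hreal \<mu> (ypow n)" and e: "!!k. k>=1 ==> \<bar>\<mu> k\<bar><=(1::int)"
		and n0: "!!n. prime n ==> g n~=0"
	shows "prime_prod g = Ureal \<mu>"
proof -
	define z where "z = (%n. (if prime n then g n else 1)-1)"
	have zb: "\<bar>z n\<bar><=5 * real n powr (-(3/2))" if "n>=3" for n
	proof (cases "prime n")
		case True
		have "z n = ypow n^3*(1+(1+ypow n) * sgn_series \<mu> (ypow n))" using True eq[OF True] by (simp add: z_def hreal_def algebra_simps)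
		moreover have y: "0<=ypow n" "ypow n < 1" using ypow_bounds[of n] that by auto
		have "complex_of_real (ypow n)^3 * rfun \<mu> (of_real (ypow n)) = of_real (ypow n^3*(1+(1+ypow n) * sgn_series \<mu> (ypow n)))"
			using etail_of_real[of \<mu> "ypow n"] e y by (simp add: rfun_def)
		moreover have "norm (complex_of_real (ypow n)^3 * rfun \<mu> (of_real (ypow n)))<=2 * ypow n^3/(1-ypow n)"
			by (rule rfun_bound) (use e y in auto)
		ultimately have "\<bar>z n\<bar><=2 * ypow n^3/(1-ypow n)" by (simp only: norm_of_real)
		also have "... = mbd n" using True that by (simp add: mbd_def ypow_def)
		also have "...<=5 * real n powr (-(3/2))" by (rule mbd_bounds)
		finally show ?thesis .
	qed (simp add: z_def)
	have "summable (%n. \<bar>z n\<bar>)"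
	proof (rule summable_comparison_test'[of "%n. 5 * real n powr (-(3/2))" 3])
		show "summable (%n. 5 * real n powr (-(3/2)))" by (intro summable_mult) (simp add: summable_real_powr_iff)
	qed (use zb in auto)
	moreover have "z n~=-1" for n using n0[of n] by (auto simp: z_def)
	ultimately have "convergent_prod (%n. 1+z n)" by (rule summable_imp_convergent_prod_real)
	hence "convergent_prod (%n. if prime n then g n else 1)" by (simp add: z_def)
	hence "(%N. \<Prod>n\<le>N. if prime n then g n else 1) \<longlonglongrightarrow> prime_prod g"
		unfolding prime_prod_def by (rule convergent_prod_LIMSEQ)
	hence "(%N. \<Prod>n<Suc N. if prime n then g n else 1) \<longlonglongrightarrow> prime_prod g" by (simp only: lessThan_Suc_atMost)
	hence "(%N. \<Prod>n<N. if prime n then g n else 1) \<longlonglongrightarrow> prime_prod g" by (subst (asm) filterlim_sequentially_Suc)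
	also have "(%N. \<Prod>n<N. if prime n then g n else 1) = pprod \<mu>" unfolding pprod_def[abs_def] using eq by (intro ext prod.cong) auto
	finally have "pprod \<mu> \<longlonglongrightarrow> prime_prod g" .
	moreover have "pprod \<mu> \<longlonglongrightarrow> Ureal \<mu>" by (rule Ureal(1)) (rule e)
	ultimately show ?thesis by (rule LIMSEQ_unique)
qed

lemma eps_abs: "\<bar>epsA k\<bar><=1" "\<bar>epsB k\<bar><=1" by (simp_all add: epsA_def epsB_def)

text \<open>At y^2 = 1/2 one has 2 y^4 = 1/2 and (1+y)(1-y) = 1/2, so 1 - 2 y^4/(1-y) is exactly -y.
  All other factors are positive, with margins that enter the comparison of products below.\<close>

lemma B_factor_bounds:
	"n>=3 ==> 0.47<=hreal epsB (ypow n)" "n>=5 ==> 0.85<=hreal epsB (ypow n)"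
	"hreal epsB (ypow 2) =-ypow 2"
proof -
	have h: "hreal epsB (ypow n) = 1-2 * ypow n^4/(1-ypow n)" if "n>=2" for n using ypow_bounds(1,2)[OF that] by (intro hreal_extreme(2)) auto
	have y4: "ypow n^4 = 1/real n^2" if "n>=1" for n
	proof -
		have "ypow n^4 = (ypow n^2)^2" by simp
		thus ?thesis unfolding ypow_bounds(3)[OF that] by (simp add: power_divide)
	qed
	have sq: "ypow n<=c" if "n>=1" "1/real n<=c^2" "c>=0" for n c
		using that by (intro power2_le_imp_le[of "ypow n" c]) (simp_all add: ypow_bounds)
	show "0.47<=hreal epsB (ypow n)" if n: "n>=3" for n
	proof -
		have i: "1/real n<=1/3" using n by (intro divide_left_mono) auto
		have "1/3<=(0.5774::real)^2" by (simp add: power2_eq_square)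
		hence "1/real n<=0.5774^2" using i by linarith
		hence y: "ypow n<=0.5774" using n by (intro sq) auto
		have "1/real n^2<=1/3^2" using n by (intro divide_left_mono power_mono) auto
		also have "(1::real)/3^2 = 1/9" by (simp add: power2_eq_square)
		finally have i2: "1/real n^2<=1/9" .
		have "ypow n^4 = 1/real n^2" by (rule y4) (use n in simp)
		hence "2 * ypow n^4<=2/9" using i2 by linarith
		hence "2 * ypow n^4/(1-ypow n)<=(2/9)/(1-0.5774)" using y by (intro frac_le) auto
		thus ?thesis using h[of n] n by simp
	qed
	show "0.85<=hreal epsB (ypow n)" if n: "n>=5" for n
	proof -
		have i: "1/real n<=1/5" using n by (intro divide_left_mono) auto
		have "1/5<=(0.4473::real)^2" by (simp add: power2_eq_square)
		hence "1/real n<=0.4473^2" using i by linarith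
		hence y: "ypow n<=0.4473" using n by (intro sq) auto
		have "1/real n^2<=1/5^2" using n by (intro divide_left_mono power_mono) auto
		also have "(1::real)/5^2 = 1/25" by (simp add: power2_eq_square)
		finally have i2: "1/real n^2<=1/25" .
		have "ypow n^4 = 1/real n^2" by (rule y4) (use n in simp)
		hence "2 * ypow n^4<=2/25" using i2 by linarith
		hence "2 * ypow n^4/(1-ypow n)<=(2/25)/(1-0.4473)" using y by (intro frac_le) auto
		thus ?thesis using h[of n] n by simp
	qed
	define y where "y = ypow 2"
	have y: "y^2 = 1/2" "0 < y" "y < 1" using ypow_bounds[of 2] by (auto simp: y_def)
	have "2 * y^4 = 2*(y^2)^2" by simp
	hence y4h: "2 * y^4 = 1/2" unfolding y by (simp add: power2_eq_square)
	moreover have "hreal epsB y = 1-2 * y^4/(1-y)" unfolding y_def by (rule h) simp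
	ultimately have "hreal epsB y = 1-(1/2)/(1-y)" by (simp only:)
	also have "... =-y"
	proof -
		have "(1+y)*(1-y) = 1/2" using y(1) by (simp add: algebra_simps power2_eq_square)
		hence "(1/2)/(1-y) = 1+y" using y by (simp add: field_simps)
		thus ?thesis by simp
	qed
	finally show "hreal epsB (ypow 2) =-ypow 2" by (simp add: y_def)
qed

lemma A1_B1_eq: "A1 = Ureal epsA/zhalf" "B1 = Ureal epsB/zhalf"
proof -
	have y: "0 < ypow n" "ypow n < 1" "ypow n^2 = 1/real n" "sqrt (real n) = 1/ypow n" if "prime n" for n
		using ypow_bounds[of n] prime_ge_2_nat[OF that] by (auto simp: ypow_def)
	have 1: "real n = 1/ypow n^2" if "prime n" for n using y(3)[OF that] by simp
	have gen: "2/(1/a^2*(1/a-1)) = 2 * a^3/(1-a)" if "0 < a" "a < 1" for a :: real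
		using that by (simp add: field_simps power2_eq_square power3_eq_cube)
	have gen': "2/(1/a^3*(1/a-1)) = 2 * a^4/(1-a)" if "0 < a" "a < 1" for a :: real using that by (simp add: field_simps eval_nat_numeral)
	have A: "1+2/(real n*(sqrt (real n)-1)) = hreal epsA (ypow n)" if p: "prime n" for n
	proof -
		have "2/(real n*(sqrt (real n)-1)) = 2/(1/ypow n^2*(1/ypow n-1))" using 1[OF p] y(4)[OF p] by simp
		also have "... = 2 * ypow n^3/(1-ypow n)" by (rule gen[OF y(1,2)[OF p]])
		finally show ?thesis using hreal_extreme(1)[of "ypow n"] y[OF p] by simp
	qed
	have B: "1-2/(real n powr (3/2)*(sqrt (real n)-1)) = hreal epsB (ypow n)" if p: "prime n" for n
	proof -
		have n0: "real n > 0" using prime_gt_0_nat[OF p] by simp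
		have "real n powr (3/2) = real n powr (1+1/2)" by simp
		also have "... = real n powr 1 * real n powr (1/2)" by (rule powr_add)
		also have "... = real n * sqrt (real n)" using n0 by (simp add: powr_half_sqrt)
		also have "... = 1/ypow n^2*(1/ypow n)" using 1[OF p] y(4)[OF p] by simp
		also have "... = 1/ypow n^3" by (simp add: power2_eq_square power3_eq_cube)
		finally have q: "real n powr (3/2) = 1/ypow n^3" .
		have "2/(real n powr (3/2)*(sqrt (real n)-1)) = 2/(1/ypow n^3*(1/ypow n-1))" unfolding q y(4)[OF p] ..
		also have "... = 2 * ypow n^4/(1-ypow n)" by (rule gen'[OF y(1,2)[OF p]])
		finally show ?thesis using hreal_extreme(2)[of "ypow n"] y[OF p] by simp
	qed
	have "prime_prod (%p. 1+2/(real p*(sqrt (real p)-1))) = Ureal epsA"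
	proof (rule prime_prod_eq[OF A])
		show "1+2/(real n*(sqrt (real n)-1))~=0" if "prime n" for n
		proof -
			have "2 * ypow n^3/(1-ypow n)>=0" using y[OF that] by simp
			hence "hreal epsA (ypow n) > 0" using hreal_extreme(1)[of "ypow n"] y(1,2)[OF that] by linarith
			thus ?thesis unfolding A[OF that] by simp
		qed
	qed (use eps_abs in auto)
	thus "A1 = Ureal epsA/zhalf" by (simp add: A1_def zhalf_def)
	have "prime_prod (%p. 1-2/(real p powr (3/2)*(sqrt (real p)-1))) = Ureal epsB"
	proof (rule prime_prod_eq[OF B])
		show "1-2/(real n powr (3/2)*(sqrt (real n)-1))~=0" if "prime n" for n
		proof (cases "n = 2")
			case True
			thus ?thesis unfolding B[OF that] using B_factor_bounds(3) ypow_bounds(1)[of 2] by simp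
		next
			case False
			hence "n>=3" using prime_ge_2_nat[OF that] by linarith
			hence "hreal epsB (ypow n) > 0" using B_factor_bounds(1)[of n] by simp
			thus ?thesis unfolding B[OF that] by simp
		qed
	qed (use eps_abs in auto)
	thus "B1 = Ureal epsB/zhalf" by (simp add: B1_def zhalf_def)
qed

text \<open>The lower extreme: a negative factor at 2 forces \<open>\<epsilon> 3 = \<epsilon> 4 = -1\<close>. Passing from \<open>epsB\<close> to \<open>\<epsilon>\<close> then
	shrinks the factor at 2 by a proportion that outweighs the total growth at the odd primes.\<close>
definition gain :: "(nat => int) => real => real" where
	"gain \<mu> y = (1+y)*(y^3*(\<Sum>k. real_of_int (1 + \<mu> (k+3)) * y^k))"

lemma gain_facts:
	assumes e: "!!k. k>=1 ==> \<mu> k \<in> {-1, 1::int}" and y: "0 < y" "y < (1::real)"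
	shows "hreal \<mu> y = hreal epsB y+gain \<mu> y" "0<=gain \<mu> y"
		"summable (%k. real_of_int (1 + \<mu> (k+3)) * y^k)"
		"hreal \<mu> y<=hreal epsA y"
proof -
	have e': "\<bar>\<mu> k\<bar><=1" if "k>=1" for k using e[OF that] by auto
	have s: "summable (%k. real_of_int (\<mu> (k+3)) * y^k)" by (rule sgn_series_summable) (use e' y in auto)
	have g: "(\<Sum>k. y^k) = 1/(1-y)" "summable (%k. y^k)" using y by (auto intro: suminf_geometric summable_geometric)
	show sm: "summable (%k. real_of_int (1 + \<mu> (k+3)) * y^k)" using summable_add[OF g(2) s] by (simp add: distrib_right)
	have "(\<Sum>k. real_of_int (1 + \<mu> (k+3)) * y^k) = (\<Sum>k. y^k+real_of_int (\<mu> (k+3)) * y^k)"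
		by (simp add: distrib_right)
	also have "... = 1/(1-y)+sgn_series \<mu> y" using suminf_add[OF g(2) s] by (simp add: g sgn_series_def)
	finally have S: "(\<Sum>k. real_of_int (1 + \<mu> (k+3)) * y^k) = 1/(1-y)+sgn_series \<mu> y" .
	have sB: "sgn_series epsB y =-(1/(1-y))" using y by (intro sgn_series_extreme) auto
	show "hreal \<mu> y = hreal epsB y+gain \<mu> y" unfolding hreal_def gain_def S sB by (simp add: algebra_simps)
	have "0<=(\<Sum>k. real_of_int (1 + \<mu> (k+3)) * y^k)"
	proof (rule suminf_nonneg[OF sm])
		fix k
		have "\<mu> (k+3) \<in> {-1, 1}" using e[of "k+3"] by simp
		hence "0<=real_of_int (1 + \<mu> (k+3))" by auto
		thus "0<=real_of_int (1 + \<mu> (k+3)) * y^k" using y by simp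
	qed
	thus "0<=gain \<mu> y" unfolding gain_def using y by simp
	have "sgn_series \<mu> y<=(\<Sum>k. y^k)" unfolding sgn_series_def
	proof (rule suminf_le[OF _ s g(2)])
		fix k
		have "real_of_int (\<mu> (k+3)) * y^k<=1 * y^k" using e'[of "k+3"] y by (intro mult_right_mono) auto
		thus "real_of_int (\<mu> (k+3)) * y^k<=y^k" by simp
	qed
	hence "sgn_series \<mu> y<=sgn_series epsA y" using y g(1) sgn_series_extreme(1)[of y] by simp
	hence "(1+y)*(y^3 * sgn_series \<mu> y)<=(1+y)*(y^3 * sgn_series epsA y)" using y by (intro mult_left_mono) auto
	thus "hreal \<mu> y<=hreal epsA y" unfolding hreal_def by simp
qed

text \<open>With the coefficients for k = 0 and k = 1 equal to 0, \<open>gain \<mu> y\<close>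
  divided by y^5 (1+y) is a power series with nonnegative coefficients, hence nondecreasing in
  y.\<close>

lemma gain_scaling:
	assumes e: "!!k. k>=1 ==> \<mu> k \<in> {-1, 1::int}" and e34: "\<mu> 3 = -1" "\<mu> 4 = -1"
		and y: "0 < y" "y<=x" "x < (1::real)"
	shows "gain \<mu> y * x^5*(1+x)<=gain \<mu> x * y^5*(1+y)"
proof -
	define a where "a = (%k. real_of_int (1 + \<mu> (k+3)))"
	have a: "a 0 = 0" "a 1 = 0" using e34 by (simp_all add: a_def)
	have an: "a k>=0" for k using e[of "k+3"] by (auto simp: a_def)
	have s: "summable (%k. a k * z^k)" if "0 < z" "z < 1" for z unfolding a_def using gain_facts(3)[of \<mu> z] e that by blast
	have sx: "summable (%k. a k * x^k)" and sy: "summable (%k. a k * y^k)" using s[of x] s[of y] y by auto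
	have "(\<Sum>k. a k * y^k * x^2)<=(\<Sum>k. a k * x^k * y^2)"
	proof (rule suminf_le)
		fix k
		show "a k * y^k * x^2<=a k * x^k * y^2"
		proof (cases "k < 2")
			case True
			hence "k = 0 \<or> k = 1" by linarith
			thus ?thesis using a by auto
		next
			case False
			then obtain j where k: "k = j+2" by (metis add.commute le_add_diff_inverse not_less)
			have "y^j<=x^j" using y by (intro power_mono) auto
			hence "(a k * y^2 * x^2) * y^j<=(a k * y^2 * x^2) * x^j" using an[of k] by (intro mult_left_mono) auto
			thus ?thesis unfolding k power_add by (simp only: mult_ac)
		qed
	qed (intro summable_mult2 sx sy)+
	hence main: "(\<Sum>k. a k * y^k) * x^2<=(\<Sum>k. a k * x^k) * y^2" by (simp only: suminf_mult2[OF sx] suminf_mult2[OF sy])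
	have "gain \<mu> y * x^5*(1+x) = ((1+x)*(1+y) * x^3 * y^3)*((\<Sum>k. a k * y^k) * x^2)"
		unfolding gain_def a_def by (simp add: eval_nat_numeral mult_ac)
	also have "...<=((1+x)*(1+y) * x^3 * y^3)*((\<Sum>k. a k * x^k) * y^2)" using y by (intro mult_left_mono main mult_nonneg_nonneg) auto
	also have "... = gain \<mu> x * y^5*(1+y)" unfolding gain_def a_def by (simp add: eval_nat_numeral mult_ac)
	finally show ?thesis .
qed

text \<open>Negativity means \<open>gain \<mu> y\<close> < y for y = 1/sqrt 2. A sign 1 at index 3
  alone would contribute (1+y) y to the gain, one at index 4 would contribute (1+y)/2, and both
  exceed y.\<close>

lemma neg_factor_two:
	assumes e: "!!k. k>=1 ==> \<mu> k \<in> {-1, 1::int}" and neg: "hreal \<mu> (ypow 2) < 0"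
	shows "\<mu> 3 = -1" "\<mu> 4 = -1"
proof -
	define y where "y = ypow 2"
	have y: "0 < y" "y < 1" "y^2 = 1/2" using ypow_bounds[of 2] by (auto simp: y_def)
	have y3: "y^3 = y/2" using y(3) by (simp add: power3_eq_cube power2_eq_square)
	have g: "gain \<mu> y < y" using neg gain_facts(1)[of \<mu> y] e y B_factor_bounds(3) unfolding y_def[symmetric] by simp
	define a where "a = (%k. real_of_int (1 + \<mu> (k+3)))"
	have an: "a k>=0" for k using e[of "k+3"] by (auto simp: a_def)
	have s: "summable (%k. a k * y^k)" unfolding a_def using gain_facts(3)[of \<mu> y] e y by blast
	have le: "(1+y)*(y^3*(a k * y^k)) < y" for k
	proof -
		have "(\<Sum>k\<in>{k}. a k * y^k)<=(\<Sum>k. a k * y^k)" using an y by (intro sum_le_suminf s) auto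
		hence "(1+y)*(y^3*(a k * y^k))<=(1+y)*(y^3*(\<Sum>k. a k * y^k))" using y by (intro mult_left_mono) auto
		also have "... = gain \<mu> y" by (simp add: gain_def a_def)
		finally show ?thesis using g by simp
	qed
	have yl: "y > 1/2" by (rule power2_less_imp_less) (use y in \<open>simp_all add: power2_eq_square\<close>)
	show "\<mu> 3 = -1"
	proof (rule ccontr)
		assume "\<mu> 3~=-1"
		hence "a 0 = 2" using e[of 3] by (auto simp: a_def)
		hence "(1+y) * y < y" using le[of 0] y3 by simp
		thus False using y by (simp add: distrib_right)
	qed
	show "\<mu> 4 = -1"
	proof (rule ccontr)
		assume "\<mu> 4~=-1"
		hence "a 1 = 2" using e[of 4] by (auto simp: a_def)
		hence "(1+y)*(y * y) < y" using le[of 1] y3 by simp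
		moreover have "y * y = 1/2" using y(3) by (simp add: power2_eq_square)
		ultimately have "(1+y)*(1/2) < y" by (simp only:)
		thus False using y by simp
	qed
qed

text \<open>By the scaling of gains the gain at n is at most that at 2 times y^5 (1+y)/0.3017 with y
  = n^(-1/2), where 0.3017 bounds x^5 (1+x) at x = 1/sqrt 2 from below. As y^5 is y/n^2, the bound
  for n >= 5 is a multiple of 1/n^2, replaced by a telescoping difference.\<close>

lemma odd_gain_bound:
	assumes e: "!!k. k>=1 ==> \<mu> k \<in> {-1, 1::int}" and e34: "\<mu> 3 = -1" "\<mu> 4 = -1" and n: "n>=3" "n~=4"
	shows "gain \<mu> (ypow n)/hreal epsB (ypow n) \<le>
		gain \<mu> (ypow 2)*(if n = 3 then 0.73 else 2.55*(1/(real n-1/2)-1/(real n+1/2)))"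
proof -
	define x where "x = ypow 2"
	define y where "y = ypow n"
	have x: "0 < x" "x < 1" "x^2 = 1/2" using ypow_bounds[of 2] by (auto simp: x_def)
	have y: "0 < y" "y < 1" "y^2 = 1/real n" "y<=x" using ypow_bounds[of n] n ypow_le[of 2 n] by (auto simp: y_def x_def)
	have xl: "0.7071 < x" by (rule power2_less_imp_less) (use x in \<open>simp_all add: power2_eq_square\<close>)
	have x5: "x^5 = x/4"
	proof -
		have "x^5 = x*(x^2)^2" by (simp add: eval_nat_numeral)
		thus ?thesis unfolding x(3) by (simp add: power2_eq_square)
	qed
	have g: "gain \<mu> x>=0" using gain_facts(2)[of \<mu> x] e x by blast
	have sc: "gain \<mu> y*(x^5*(1+x))<=gain \<mu> x*(y^5*(1+y))"
		using gain_scaling[of \<mu> y x] e e34 x y by (simp add: mult.assoc)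
	have low: "0.3017<=x^5*(1+x)"
	proof -
		have "x^5*(1+x) = (x+x^2)/4" unfolding x5 by (simp add: field_simps power2_eq_square)
		thus ?thesis unfolding x(3) using xl by simp
	qed
	have gy: "gain \<mu> y>=0" using gain_facts(2)[of \<mu> y] e y by blast
	have "gain \<mu> y*0.3017<=gain \<mu> y*(x^5*(1+x))" by (rule mult_left_mono[OF low gy])
	hence m: "gain \<mu> y*0.3017<=gain \<mu> x*(y^5*(1+y))" using sc by linarith
	have y5: "y^5 = y*(1/real n)^2"
	proof -
		have "y^5 = y*(y^2)^2" by (simp add: eval_nat_numeral)
		thus ?thesis by (simp only: y(3))
	qed
	show ?thesis
	proof (cases "n = 3")
		case True
		have yb: "y<=0.57736" by (rule power2_le_imp_le) (use y True in \<open>simp_all add: power2_eq_square\<close>)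
		have hB: "hreal epsB y>=0.474"
		proof -
			have y3: "y^2 = 1/3" using y(3) True by simp
			have "y^4 = (y^2)^2" by simp
			hence "y^4 = 1/9" unfolding y3 by (simp add: power2_eq_square)
			hence "2 * y^4/(1-y)<=(2/9)/(1-0.57736)" using yb by (intro frac_le) auto
			thus ?thesis using hreal_extreme(2)[of y] y by simp
		qed
		have "y^5*(1+y)<=0.57736*(1/3)^2*(1+0.57736)" unfolding y5 using yb y True by (intro mult_mono) auto
		also have "...<=(0.1012::real)" by (simp add: power2_eq_square)
		finally have "gain \<mu> x*(y^5*(1+y))<=gain \<mu> x*0.1012" using g by (rule mult_left_mono)
		hence "gain \<mu> y<=gain \<mu> x*0.336" using m g by simp
		also have "...<=gain \<mu> x*0.73*0.474" using g by simp
		also have "...<=gain \<mu> x*0.73 * hreal epsB y" using g hB by (intro mult_left_mono) auto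
		finally have "gain \<mu> y/hreal epsB y<=gain \<mu> x*0.73" using hB by (simp add: divide_le_eq)
		thus ?thesis using True by (simp add: x_def y_def)
	next
		case False
		hence n5: "n>=5" using n by linarith
		have "1/real n<=1/5" using n5 by (intro divide_left_mono) auto
		moreover have "1/5<=(0.44722::real)^2" by (simp add: power2_eq_square)
		ultimately have "y^2<=0.44722^2" unfolding y(3) by linarith
		hence yb: "y<=0.44722" by (rule power2_le_imp_le) simp
		have hB: "hreal epsB y>=0.85" unfolding y_def by (rule B_factor_bounds(2)[OF n5])
		define q where "q = 1/(real n-1/2)-1/(real n+1/2)"
		have q: "(1/real n)^2<=q"
		proof -
			have "q = 1/(real n^2-1/4)" unfolding q_def using n5 by (simp add: field_simps power2_eq_square)
			moreover have "1/real n^2<=1/(real n^2-1/4)"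
			proof (rule divide_left_mono)
				have "5^2<=real n^2" using n5 by (intro power_mono) auto
				thus "0 < real n^2*(real n^2-1/4)" using n5 by (intro mult_pos_pos) auto
			qed auto
			ultimately show ?thesis by (simp add: power_divide)
		qed
		hence q0: "q>=0" using zero_le_power2[of "1/real n"] by linarith
		have "y^5*(1+y)<=0.44722 * q*(1+0.44722)" unfolding y5 using yb y q q0 by (intro mult_mono) auto
		also have "...<=0.6473 * q" using q0 by simp
		finally have "gain \<mu> x*(y^5*(1+y))<=gain \<mu> x*(0.6473 * q)" using g by (intro mult_left_mono) auto
		hence "gain \<mu> y*0.3017<=(gain \<mu> x * q)*0.6473" using m by (simp add: mult_ac)
		moreover have gq: "gain \<mu> x * q>=0" using g q0 by simp
		ultimately have "gain \<mu> y<=(gain \<mu> x * q)*2.55*0.85" by simp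
		also have "...<=(gain \<mu> x * q)*2.55 * hreal epsB y" using gq hB by (intro mult_left_mono) auto
		finally have "gain \<mu> y/hreal epsB y<=(gain \<mu> x * q)*2.55" using hB by (simp add: divide_le_eq)
		thus ?thesis using False by (simp add: x_def y_def q_def mult_ac)
	qed
qed

lemma pprod_split:
	assumes "N>=3"
	shows "pprod \<mu> N = hreal \<mu> (ypow 2)*(\<Prod>n\<in>{3..<N}. if prime n then hreal \<mu> (ypow n) else 1)"
proof -
	have "{..<N} = insert 0 (insert 1 (insert 2 {3..<N}))" using assms by auto
	thus ?thesis unfolding pprod_def by (simp add: two_is_prime_nat)
qed

text \<open>The upper bound compares nonnegative factors. For the lower bound the product of
  \<open>epsB\<close> is at most 0, so only a negative factor at 2 matters. With g the gain there,
  its modulus shrinks by 1 - g/y <= exp(-g/y), y = 1/sqrt 2, while the odd primes grow by at most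
  exp(1.3 g).\<close>

lemma Ureal_extremes:
	assumes e: "!!k. k>=1 ==> \<mu> k \<in> {-1, 1::int}"
	shows "Ureal \<mu><=Ureal epsA" "Ureal epsB<=Ureal \<mu>"
proof -
	have e': "\<bar>\<mu> k\<bar><=1" if "k>=1" for k using e[OF that] by auto
	have lim: "pprod \<mu> \<longlonglongrightarrow> Ureal \<mu>" by (rule Ureal(1)) (rule e')
	have limA: "pprod epsA \<longlonglongrightarrow> Ureal epsA" by (rule Ureal(1)) (rule eps_abs)
	have limB: "pprod epsB \<longlonglongrightarrow> Ureal epsB" by (rule Ureal(1)) (rule eps_abs)
	have y: "0 < ypow n" "ypow n < 1" if "n>=2" for n using ypow_bounds(1,2)[OF that] by auto
	have hB: "hreal epsB (ypow n) > 0" if "n>=3" for n using B_factor_bounds(1)[OF that] by simp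
	have he: "hreal epsB (ypow n)<=hreal \<mu> (ypow n)" "hreal \<mu> (ypow n)<=hreal epsA (ypow n)" if "n>=2" for n
		using gain_facts[of \<mu> "ypow n"] e y[OF that] by auto
	define Q where "Q = (%\<mu> N. \<Prod>n\<in>{3..<N}. if prime n then hreal \<mu> (ypow n) else 1)"
	have Q: "0<=Q epsB N" "Q epsB N<=Q \<mu> N" "Q \<mu> N<=Q epsA N" for N
	proof -
		show "0<=Q epsB N" unfolding Q_def using hB by (intro prod_nonneg) (auto intro: less_imp_le)
		have "0<=hreal epsB (ypow n)" "0<=hreal \<mu> (ypow n)" if "n>=3" for n using hB[OF that] he(1)[of n] that by auto
		thus "Q epsB N<=Q \<mu> N" "Q \<mu> N<=Q epsA N" unfolding Q_def using he by (intro prod_mono; auto)+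
	qed
	have sp: "pprod \<mu> N = hreal \<mu> (ypow 2) * Q \<mu> N" if "N>=3" for N \<mu> using pprod_split[OF that] by (simp add: Q_def)
	have A2: "hreal epsA (ypow 2)>=0"
	proof -
		have "2 * ypow 2^3/(1-ypow 2)>=0" using y[of 2] by simp
		thus ?thesis using hreal_extreme(1)[of "ypow 2"] y[of 2] by simp
	qed
	have "pprod \<mu> N<=pprod epsA N" if N: "N>=3" for N
	proof -
		have "hreal \<mu> (ypow 2) * Q \<mu> N<=hreal epsA (ypow 2) * Q \<mu> N" using he(2)[of 2] Q(1,2)[of N] by (intro mult_right_mono) auto
		also have "...<=hreal epsA (ypow 2) * Q epsA N" using Q[of N] A2 by (intro mult_left_mono) auto
		finally show ?thesis using N by (simp add: sp)
	qed
	thus "Ureal \<mu><=Ureal epsA" by (intro LIMSEQ_le[OF lim limA] exI[of _ 3]) auto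
	have "pprod epsB N<=pprod \<mu> N" if N: "N>=3" for N
	proof (cases "hreal \<mu> (ypow 2)>=0")
		case True
		have "pprod epsB N<=0" using N Q(1)[of N] B_factor_bounds(3) y(1)[of 2] by (simp add: sp mult_nonneg_nonneg)
		moreover have "0<=pprod \<mu> N" using N True Q(1,2)[of N] by (simp add: sp)
		ultimately show ?thesis by linarith
	next
		case False
		hence neg: "hreal \<mu> (ypow 2) < 0" by simp
		have e34: "\<mu> 3 = -1" "\<mu> 4 = -1" using neg_factor_two[of \<mu>] e neg by blast+
		define g where "g = gain \<mu> (ypow 2)"
		have g0: "g>=0" unfolding g_def using gain_facts(2)[of \<mu> "ypow 2"] e y[of 2] by auto
		have h2: "hreal \<mu> (ypow 2) = g-ypow 2" using gain_facts(1)[of \<mu> "ypow 2"] e y[of 2] B_factor_bounds(3) by (auto simp: g_def)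
		\<comment> \<open>The weights sum to at most 0.73 + 2.55/4.5 < 1.3, which is less than sqrt 2, the
		  rate at which the factor at 2 shrinks.\<close>
		define w where "w = (%n::nat. if n = 3 then (0.73::real) else if n = 4 then 0 else 2.55*(1/(real n-1/2)-1/(real n+1/2)))"
		have w0: "w n>=0" if "n>=3" for n using that by (auto simp: w_def intro!: divide_left_mono mult_pos_pos)
		have fac: "(if prime n then hreal \<mu> (ypow n) else 1)<=(if prime n then hreal epsB (ypow n) else 1) * exp (g * w n)" if n: "n>=3" for n
		proof (cases "prime n")
			case True
			have n4: "n~=4" using True by (auto simp: prime_nat_iff dest!: spec[of _ 2])
			have n2: "n>=2" using n by simp
			have "hreal \<mu> (ypow n) = hreal epsB (ypow n)*(1+gain \<mu> (ypow n)/hreal epsB (ypow n))"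
				using gain_facts(1)[of \<mu> "ypow n"] e y[OF n2] hB[OF n] by (simp add: distrib_left)
			also have "...<=hreal epsB (ypow n)*(1+g * w n)"
				using odd_gain_bound[of \<mu> n] e e34 n n4 hB[OF n] by (intro mult_left_mono) (auto simp: g_def w_def)
			also have "...<=hreal epsB (ypow n) * exp (g * w n)" using hB[OF n] exp_ge_add_one_self[of "g * w n"] by (intro mult_left_mono) auto
			finally show ?thesis using True by simp
		qed (use g0 w0[OF n] in simp)
		have "Q \<mu> N<=(\<Prod>n\<in>{3..<N}. (if prime n then hreal epsB (ypow n) else 1) * exp (g * w n))" unfolding Q_def
		proof (rule prod_mono)
			fix n assume "n \<in> {3..<N}"
			hence n: "n>=3" by simp
			have "0<=hreal \<mu> (ypow n)" using hB[OF n] he(1)[of n] n by linarith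
			hence nn: "0<=(if prime n then hreal \<mu> (ypow n) else 1)" by simp
			show "0<=(if prime n then hreal \<mu> (ypow n) else 1) \<and> (if prime n then hreal \<mu> (ypow n) else 1)
					<= (if prime n then hreal epsB (ypow n) else 1) * exp (g * w n)" using nn fac[OF n] by (rule conjI)
		qed
		also have "... = Q epsB N * exp (g*(\<Sum>n\<in>{3..<N}. w n))" unfolding Q_def prod.distrib by (simp add: exp_sum sum_distrib_left)
		finally have Qb: "Q \<mu> N<=Q epsB N * exp (g*(\<Sum>n\<in>{3..<N}. w n))" .
		have W: "(\<Sum>n\<in>{3..<M}. w n)<=1.3-2.55/(real M-1/2)" if "M>=5" for M using that
		proof (induction M rule: dec_induct)
			case base
			have "{3..<5::nat} = {3,4}" by auto
			thus ?case by (simp add: w_def)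
		next
			case (step m)
			have "(\<Sum>n\<in>{3..<Suc m}. w n) = (\<Sum>n\<in>{3..<m}. w n)+w m" using step by simp
			moreover have "w m = 2.55/(real m-1/2)-2.55/(real m+1/2)" using step by (simp add: w_def right_diff_distrib)
			moreover have "real (Suc m)-1/2 = real m+1/2" by simp
			ultimately show ?case using step.IH by (simp only:)
		qed
		have W': "(\<Sum>n\<in>{3..<N}. w n)<=1.3"
		proof (cases "N>=5")
			case True
			have "2.55/(real N-1/2)>=0" using True by simp
			thus ?thesis using W[OF True] by linarith
		next
			case False
			have "(\<Sum>n\<in>{3..<N}. w n)<=(\<Sum>n\<in>{3..<5}. w n)" using False w0 by (intro sum_mono2) auto
			also have "...<=1.3-2.55/(real 5-1/2)" by (rule W) simp
			also have "...<=1.3" by simp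
			finally show ?thesis .
		qed
		have "g*(\<Sum>n\<in>{3..<N}. w n)<=g*1.3" using W' g0 by (rule mult_left_mono)
		hence "exp (g*(\<Sum>n\<in>{3..<N}. w n))<=exp (g*1.3)" by (simp only: exp_le_cancel_iff)
		hence "Q epsB N * exp (g*(\<Sum>n\<in>{3..<N}. w n))<=Q epsB N * exp (g*1.3)" using Q(1)[of N] by (rule mult_left_mono)
		hence Qc: "Q \<mu> N<=Q epsB N * exp (g*1.3)" using Qb by linarith
		define y2 where "y2 = ypow 2"
		have y2: "0 < y2" "y2^2 = 1/2" using ypow_bounds[of 2] by (auto simp: y2_def)
		have y2l: "y2<=0.75" by (rule power2_le_imp_le) (use y2 in \<open>simp_all add: power2_eq_square\<close>)
		have gl: "g < y2" using neg h2 by (simp add: y2_def)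
		have "1.3 * y2<=1" using y2l by simp
		hence "g*(1.3 * y2)<=g*1" using g0 by (rule mult_left_mono)
		hence "g*1.3<=g/y2" using y2(1) by (simp add: pos_le_divide_eq mult_ac)
		hence "exp (g*1.3)<=exp (g/y2)" by simp
		hence "(y2-g) * exp (g*1.3)<=(y2-g) * exp (g/y2)" using gl by (intro mult_left_mono) auto
		also have "...<=y2"
		proof -
			have "1-g/y2<=exp (- (g/y2))" using exp_ge_add_one_self[of "- (g/y2)"] by simp
			hence "(1-g/y2) * exp (g/y2)<=exp (- (g/y2)) * exp (g/y2)" by (intro mult_right_mono) auto
			also have "... = 1" by (simp add: exp_minus)
			finally have "y2*((1-g/y2) * exp (g/y2))<=y2*1" using y2(1) by (intro mult_left_mono) auto
			moreover have "y2*(1-g/y2) = y2-g" using y2(1) by (simp add: right_diff_distrib)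
			ultimately show ?thesis by (simp only: mult.assoc[symmetric] mult_1_right)
		qed
		finally have k: "(y2-g) * exp (g*1.3)<=y2" .
		have "(y2-g) * Q \<mu> N<=(y2-g)*(Q epsB N * exp (g*1.3))" using gl Qc by (intro mult_left_mono) auto
		also have "... = Q epsB N*((y2-g) * exp (g*1.3))" by (simp only: mult_ac)
		also have "...<=Q epsB N * y2" using k Q(1)[of N] by (rule mult_left_mono)
		finally have "(y2-g) * Q \<mu> N<=Q epsB N * y2" .
		moreover have "pprod \<mu> N =-((y2-g) * Q \<mu> N)" unfolding sp[OF N] h2 y2_def by (simp add: left_diff_distrib)
		moreover have "pprod epsB N =-(Q epsB N * y2)" unfolding sp[OF N] B_factor_bounds(3) y2_def by simp
		ultimately show ?thesis by linarith
	qed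
	thus "Ureal epsB<=Ureal \<mu>" by (intro LIMSEQ_le[OF limB lim] exI[of _ 3]) auto
qed

section \<open>Euler-Maclaurin enclosures of zeta on the real axis\<close>

lemma deriv_mono_from_0:
	fixes f g f' g' :: "real => real"
	assumes "f 0 = g 0" and df: "!!u. u>=0 ==> (f has_real_derivative f' u) (at u)"
		and dg: "!!u. u>=0 ==> (g has_real_derivative g' u) (at u)"
		and le: "!!u. u>=0 ==> f' u<=g' u" and a: "a>=0"
	shows "f a<=g a"
proof -
	have "g 0-f 0<=g a-f a"
	proof (rule DERIV_nonneg_imp_nondecreasing[OF a, of "%x. g x-f x"])
		fix x :: real assume "0<=x"
		thus "\<exists>y. ((%x. g x-f x) has_real_derivative y) (at x) \<and> 0<=y"
			using le[of x] by (intro exI[of _ "g' x-f' x"] conjI DERIV_diff df dg) auto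
	qed
	thus ?thesis using assms(1) by simp
qed

text \<open>The error of one step of the trapezoidal rule with first-derivative correction; its third
	derivative is a multiple of \<open>u\<^sup>2\<close>.\<close>
definition trap_err :: "real => real => real" where
	"trap_err s u = (1-(1+u) powr (1-s))/(s-1)-u*(1+(1+u) powr (-s))/2
		 - s * u^2*((1+u) powr (-s-1)-1)/12"

text \<open>\<open>R1\<close> and \<open>R2\<close> are the first two derivatives, and all three
  functions vanish at 0. The third derivative lies between 0 and c u^2/12; integrating three times
  multiplies the denominator by 3, 4 and 5, to 720.\<close>

lemma trap_err_bounds:
	fixes s h :: real
	assumes s: "s > 0" "s~=1" and h: "0<=h"
	shows "0<=trap_err s h" "trap_err s h<=s*(s+1)*(s+2)*(s+3)/720 * h^5"
proof -
	define c where "c = s*(s+1)*(s+2)*(s+3)"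
	have c: "c>=0" using s by (simp add: c_def)
	define p0 where "p0 = (%u::real. (1+u) powr (1-s))"
	define p1 where "p1 = (%u::real. (1+u) powr (-s))"
	define p2 where "p2 = (%u::real. (1+u) powr (-s-1))"
	define p3 where "p3 = (%u::real. (1+u) powr (-s-2))"
	define p4 where "p4 = (%u::real. (1+u) powr (-s-3))"
	define p5 where "p5 = (%u::real. (1+u) powr (-s-4))"
	have Dp: "((%u. (1+u) powr a) has_real_derivative a*(1+u) powr b) (at u)" if "u>=0" "b = a-1" for a b u :: real
		using that by (auto intro!: derivative_eq_intros)
	have D: "(p0 has_real_derivative (1-s) * p1 u) (at u)" "(p1 has_real_derivative (-s) * p2 u) (at u)"
			"(p2 has_real_derivative (-s-1) * p3 u) (at u)" "(p3 has_real_derivative (-s-2) * p4 u) (at u)"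
			"(p4 has_real_derivative (-s-3) * p5 u) (at u)" if "u>=0" for u
		unfolding p0_def p1_def p2_def p3_def p4_def p5_def by (rule Dp[OF that]; simp)+
	define R1 where "R1 = (%u. -1/2+p1 u/2+s * u * p2 u/3+s * u/6+s*(s+1) * u^2 * p3 u/12)"
	define R2 where "R2 = (%u.-s * p2 u/6+s/6-s*(s+1) * u * p3 u/6-s*(s+1)*(s+2) * u^2 * p4 u/12)"
	have te: "trap_err s = (%u. (1-p0 u)/(s-1)-u*(1+p1 u)/2-s * u^2*(p2 u-1)/12)"
		by (simp add: fun_eq_iff trap_err_def p0_def p1_def p2_def)
	have d0: "(trap_err s has_real_derivative R1 u) (at u)" if "u>=0" for u
	proof -
		have "(trap_err s has_real_derivative (0-(1-s) * p1 u)/(s-1)-(1*(1+p1 u)+u*(0+(-s) * p2 u))/2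
				- (s*(2 * u)*(p2 u-1)+s * u^2*((-s-1) * p3 u-0))/12) (at u)"
			unfolding te using D[OF that] s by (auto intro!: derivative_eq_intros) (simp (no_asm) add: field_simps power2_eq_square)
		also have "(0-(1-s) * p1 u)/(s-1) = p1 u" using s by (simp add: field_simps)
		finally show ?thesis by (rule DERIV_cong) (simp add: R1_def field_simps power2_eq_square)
	qed
	have d1: "(R1 has_real_derivative R2 u) (at u)" if "u>=0" for u
	proof -
		have "(R1 has_real_derivative (-s) * p2 u/2+(s * p2 u+s * u*((-s-1) * p3 u))/3+s/6
			 + (s*(s+1)*(2 * u) * p3 u+s*(s+1) * u^2*((-s-2) * p4 u))/12) (at u)"
			unfolding R1_def using D[OF that] by (auto intro!: derivative_eq_intros) (simp (no_asm) add: field_simps power2_eq_square)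
		thus ?thesis by (rule DERIV_cong) (simp add: R2_def field_simps power2_eq_square)
	qed
	have d2: "(R2 has_real_derivative c * u^2 * p5 u/12) (at u)" if "u>=0" for u
	proof -
		have "(R2 has_real_derivative-s*((-s-1) * p3 u)/6-(s*(s+1) * p3 u+s*(s+1) * u*((-s-2) * p4 u))/6
			 - (s*(s+1)*(s+2)*(2 * u) * p4 u+s*(s+1)*(s+2) * u^2*((-s-3) * p5 u))/12) (at u)"
			unfolding R2_def using D[OF that] by (auto intro!: derivative_eq_intros) (simp (no_asm) add: field_simps power2_eq_square)
		thus ?thesis by (rule DERIV_cong) (simp add: c_def field_simps power2_eq_square)
	qed
	have r0: "trap_err s 0 = 0" "R1 0 = 0" "R2 0 = 0" by (simp_all add: te R1_def R2_def p0_def p1_def p2_def)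
	have p: "0<=c * u^2 * p5 u/12" "c * u^2 * p5 u/12<=c * u^2/12" if "u>=0" for u
	proof -
		show "0<=c * u^2 * p5 u/12" using c by (simp add: p5_def)
		have "p5 u<=(1+u) powr 0" unfolding p5_def using that s by (intro powr_mono) auto
		hence "c * u^2 * p5 u<=c * u^2*1" using c that by (intro mult_left_mono) auto
		thus "c * u^2 * p5 u/12<=c * u^2/12" by simp
	qed
	have pw: "((%u. c * u^Suc n/d) has_real_derivative c*(real (Suc n) * u^n)/d) (at u)" for n and d u :: real
		by (rule DERIV_cong, (rule DERIV_cdivide DERIV_cmult DERIV_pow)+) simp
	have R2: "0<=R2 u" "R2 u<=c * u^3/36" if u: "u>=0" for u
	proof -
		show "0<=R2 u"
		proof (rule deriv_mono_from_0[where f = "%_. 0" and f' = "%_. 0", OF _ _ _ _ u])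
			show "(R2 has_real_derivative c * v^2 * p5 v/12) (at v)" if "v>=0" for v by (rule d2[OF that])
			show "0<=c * v^2 * p5 v/12" if "v>=0" for v by (rule p(1)[OF that])
		qed (use r0 in simp_all)
		have "R2 u<=c * u^Suc 2/36"
		proof (rule deriv_mono_from_0[where f = R2, OF _ _ _ _ u])
			show "(R2 has_real_derivative c * v^2 * p5 v/12) (at v)" if "v>=0" for v by (rule d2[OF that])
			show "((%u. c * u^Suc 2/36) has_real_derivative c*(real (Suc 2) * v^2)/36) (at v)" for v by (rule pw)
			show "c * v^2 * p5 v/12<=c*(real (Suc 2) * v^2)/36" if "v>=0" for v using p(2)[OF that] by simp
		qed (use r0 in simp)
		thus "R2 u<=c * u^3/36" by (simp add: eval_nat_numeral)
	qed
	have R1: "0<=R1 u" "R1 u<=c * u^4/144" if u: "u>=0" for u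
	proof -
		show "0<=R1 u"
		proof (rule deriv_mono_from_0[where f = "%_. 0" and f' = "%_. 0", OF _ _ _ _ u])
			show "(R1 has_real_derivative R2 v) (at v)" if "v>=0" for v by (rule d1[OF that])
			show "0<=R2 v" if "v>=0" for v by (rule R2(1)[OF that])
		qed (use r0 in simp_all)
		have "R1 u<=c * u^Suc 3/144"
		proof (rule deriv_mono_from_0[where f = R1, OF _ _ _ _ u])
			show "(R1 has_real_derivative R2 v) (at v)" if "v>=0" for v by (rule d1[OF that])
			show "((%u. c * u^Suc 3/144) has_real_derivative c*(real (Suc 3) * v^3)/144) (at v)" for v by (rule pw)
			show "R2 v<=c*(real (Suc 3) * v^3)/144" if "v>=0" for v using R2(2)[OF that] by simp
		qed (use r0 in simp)
		thus "R1 u<=c * u^4/144" by (simp add: eval_nat_numeral)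
	qed
	show "0<=trap_err s h"
	proof (rule deriv_mono_from_0[where f = "%_. 0" and f' = "%_. 0", OF _ _ _ _ h])
		show "(trap_err s has_real_derivative R1 v) (at v)" if "v>=0" for v by (rule d0[OF that])
		show "0<=R1 v" if "v>=0" for v by (rule R1(1)[OF that])
	qed (use r0 in simp_all)
	have "trap_err s h<=c * h^Suc 4/720"
	proof (rule deriv_mono_from_0[where f = "trap_err s", OF _ _ _ _ h])
		show "(trap_err s has_real_derivative R1 v) (at v)" if "v>=0" for v by (rule d0[OF that])
		show "((%u. c * u^Suc 4/720) has_real_derivative c*(real (Suc 4) * v^4)/720) (at v)" for v by (rule pw)
		show "R1 v<=c*(real (Suc 4) * v^4)/720" if "v>=0" for v using R1(2)[OF that] by simp
	qed (use r0 in simp)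
	thus "trap_err s h<=s*(s+1)*(s+2)*(s+3)/720 * h^5" by (simp add: c_def eval_nat_numeral)
qed

text \<open>Euler-Maclaurin summation up to N with the first Bernoulli correction, whose coefficient
  is 1/12.\<close>

definition zeta_approx :: "nat => real => real" where
	"zeta_approx N s = (\<Sum>n=1..<N. real n powr (-s))+real N powr (1-s)/(s-1)+real N powr (-s)/2
		 + s * real N powr (-s-1)/12"

text \<open>Homogeneity: scaling by N carries the interval [N, N+1] to [1, 1 + 1/N].\<close>

lemma zeta_approx_step:
	assumes N: "N>=1" and s: "s~=1"
	shows "zeta_approx N s-zeta_approx (Suc N) s = real N powr (1-s) * trap_err s (1/real N)"
proof -
	define x where "x = real N"
	have x: "x > 0" using N by (simp add: x_def)
	have e: "real (Suc N) powr a = x powr a*(1+1/x) powr a" for a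
	proof -
		have "real (Suc N) = x*(1+1/x)" using x by (simp add: x_def field_simps)
		thus ?thesis using x by (simp add: powr_mult)
	qed
	define P where "P = (1+1/x) powr (1-s)"
	define Q where "Q = (1+1/x) powr (-s)"
	define S where "S = (1+1/x) powr (-s-1)"
	define X where "X = x powr (1-s)"
	have X: "x powr (-s) = X/x" "x powr (-s-1) = X/x^2"
	proof -
		have "x powr (-s) = x powr ((1-s)-1)" by simp
		also have "... = X/x" unfolding powr_diff X_def using x by simp
		finally show 1: "x powr (-s) = X/x" .
		have "x powr (-s-1) = x powr (-s)/x" unfolding powr_diff using x by simp
		thus "x powr (-s-1) = X/x^2" by (simp add: 1 power2_eq_square)
	qed
	have "zeta_approx N s-zeta_approx (Suc N) s
			=-(X/x)+(X-X * P)/(s-1)+(X/x-X/x * Q)/2+s*(X/x^2-X/x^2 * S)/12" unfolding zeta_approx_def e using N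
		by (simp add: X P_def[symmetric] Q_def[symmetric] S_def[symmetric] X_def[symmetric] x_def[symmetric] algebra_simps diff_divide_distrib)
	also have "... = X*((1-P)/(s-1)-(1/x)*(1+Q)/2-s*(1/x)^2*(S-1)/12)"
		by (simp add: algebra_simps diff_divide_distrib add_divide_distrib power_divide)
	finally show ?thesis by (simp add: trap_err_def P_def Q_def S_def X_def x_def)
qed

lemma zeta_approx_LIMSEQ:
	assumes s: "s > 0" "s~=1"
	shows "(%N. zeta_approx N s) \<longlonglongrightarrow> Re (zeta_reg (of_real s))/(s-1)"
proof -
	have "(%N. ((s-1)*((\<Sum>n=1..N. real n powr (-s))-real N powr (-s)/2)+real N powr (1-s))/(s-1)+s * real N powr (-s-1)/12)
		 \<longlonglongrightarrow> Re (zeta_reg (of_real s))/(s-1)+s*0/12"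
	proof (intro tendsto_intros zeta_reg_real)
		show "(%N. real N powr (-s-1)) \<longlonglongrightarrow> 0" by (rule tendsto_neg_powr[OF _ filterlim_real_sequentially]) (use s in auto)
	qed (use s in auto)
	moreover have "\<forall>\<^sub>F N in sequentially. ((s-1)*((\<Sum>n=1..N. real n powr (-s))-real N powr (-s)/2)+real N powr (1-s))/(s-1)+s * real N powr (-s-1)/12 = zeta_approx N s"
		using eventually_gt_at_top[of 0]
	proof eventually_elim
		case (elim N)
		have "{1..N} = insert N {1..<N}" using elim by auto
		hence "(\<Sum>n=1..N. real n powr (-s)) = (\<Sum>n=1..<N. real n powr (-s))+real N powr (-s)" by simp
		thus ?case using s by (simp add: zeta_approx_def add_divide_distrib)
	qed
	ultimately show ?thesis by (simp add: Lim_transform_eventually)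
qed

text \<open>With a = 1/(n-1) and b = 1/n one has a - b = a b, hence 3 b^4 <= (a - b)(a^2 + a b +
  b^2) = a^3 - b^3, which telescopes.\<close>

lemma sum_cube_tail:
	assumes "N>=2"
	shows "(\<Sum>n=N..<M. 1/real n^4)<=1/(3 * real (N-1)^3)"
proof -
	have bd: "1/real n^4<=1/(3 * real (n-1)^3)-1/(3 * real n^3)" if "n>=2" for n
	proof -
		define x where "x = real n-1"
		have x: "x > 0" "real n = x+1" "real (n-1) = x" using that by (auto simp: x_def of_nat_diff)
		define a b where "a = 1/x" and "b = 1/(x+1)"
		have ab: "0 < b" "b<=a" "a-b = a * b" using x by (auto simp: a_def b_def field_simps)
		have "3 * b^4 = (b * b)*(b^2+b^2+b^2)" by (simp add: eval_nat_numeral)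
		also have "...<=(a * b)*(a^2+a * b+b^2)" using ab by (intro mult_mono add_mono) (auto simp: power2_eq_square intro!: mult_mono)
		also have "... = (a-b)*(a^2+a * b+b^2)" by (simp only: ab(3))
		also have "... = a^3-b^3" by (simp add: algebra_simps power2_eq_square power3_eq_cube)
		finally have "b^4<=a^3/3-b^3/3" by simp
		thus ?thesis unfolding x a_def b_def by (simp add: power_divide)
	qed
	have "(\<Sum>n=N..<M. 1/real n^4)<=1/(3 * real (N-1)^3)-1/(3 * real (M-1)^3)" if "M>=N" using that
	proof (induction M rule: dec_induct)
		case (step m)
		have "(\<Sum>n=N..<Suc m. 1/real n^4) = (\<Sum>n=N..<m. 1/real n^4)+1/real m^4" using step by simp
		thus ?case using step bd[of m] assms by simp
	qed simp
	moreover have "1/(3 * real (M-1)^3)>=0" by simp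
	ultimately show ?thesis by (cases "M>=N") (linarith, simp)
qed

text \<open>The approximations decrease to the value. The n-th step is at most a multiple of N^(-s)
  n^(-4), and 2160 is 720 times the 3 from summing n^(-4).\<close>

lemma zeta_approx_bounds:
	assumes s: "s > 0" "s~=1" and N: "N>=2"
	defines "Z \<equiv> Re (zeta_reg (of_real s))/(s-1)"
	shows "Z<=zeta_approx N s"
		"zeta_approx N s<=Z+s*(s+1)*(s+2)*(s+3)/(2160 * real (N-1)^3) * real N powr (-s)"
proof -
	define c where "c = s*(s+1)*(s+2)*(s+3)/720"
	have c: "c>=0" using s by (simp add: c_def)
	have st: "0<=zeta_approx n s-zeta_approx (Suc n) s"
		"zeta_approx n s-zeta_approx (Suc n) s<=c * real N powr (-s)*(1/real n^4)" if "n>=N" for n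
	proof -
		have n: "real n > 0" using that N by simp
		show "0<=zeta_approx n s-zeta_approx (Suc n) s" using that N s by (subst zeta_approx_step) (auto intro!: mult_nonneg_nonneg trap_err_bounds)
		have "zeta_approx n s-zeta_approx (Suc n) s = real n powr (1-s) * trap_err s (1/real n)" using that N s by (intro zeta_approx_step) auto
		also have "...<=real n powr (1-s)*(c*(1/real n)^5)" unfolding c_def using s by (intro mult_left_mono trap_err_bounds) auto
		also have "... = c * real n powr (-s)*(1/real n^4)"
		proof -
			have "real n powr (1-s) = real n powr (-s) * real n" using n by (simp add: powr_diff powr_minus divide_inverse)
			moreover have "a * x*(c*(1/x)^5) = c * a*(1/x^4)" if "x > 0" for a x :: real using that by (simp add: power_divide eval_nat_numeral)
			ultimately show ?thesis using n by simp
		qed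
		also have "...<=c * real N powr (-s)*(1/real n^4)" using c that N s by (intro mult_right_mono mult_left_mono powr_mono2') auto
		finally show "zeta_approx n s-zeta_approx (Suc n) s<=c * real N powr (-s)*(1/real n^4)" .
	qed
	have lim: "(%N. zeta_approx N s) \<longlonglongrightarrow> Z" unfolding Z_def by (rule zeta_approx_LIMSEQ[OF s])
	have dec: "zeta_approx M s<=zeta_approx N s" if "M>=N" for M using that by (induction M rule: dec_induct) (auto intro: order_trans dest!: st(1))
	show "Z<=zeta_approx N s" by (rule tendsto_upperbound[OF lim]) (use dec in \<open>auto intro: eventually_sequentiallyI[of N]\<close>)
	have inc: "zeta_approx N s-zeta_approx M s<=c * real N powr (-s)*(\<Sum>n=N..<M. 1/real n^4)" if "M>=N" for M using that
	proof (induction M rule: dec_induct)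
		case (step m)
		have e: "(\<Sum>n=N..<Suc m. 1/real n^4) = (\<Sum>n=N..<m. 1/real n^4)+1/real m^4" using step by simp
		have "c * real N powr (-s)*(\<Sum>n=N..<Suc m. 1/real n^4)
				= c * real N powr (-s)*(\<Sum>n=N..<m. 1/real n^4)+c * real N powr (-s)*(1/real m^4)" unfolding e by (rule distrib_left)
		moreover have "zeta_approx m s-zeta_approx (Suc m) s<=c * real N powr (-s)*(1/real m^4)" using step by (intro st(2)) auto
		ultimately show ?case using step.IH by linarith
	qed simp
	have "zeta_approx N s-c * real N powr (-s)*(1/(3 * real (N-1)^3))<=Z"
	proof (rule tendsto_lowerbound[OF lim])
		show "\<forall>\<^sub>F M in sequentially. zeta_approx N s-c * real N powr (-s)*(1/(3 * real (N-1)^3))<=zeta_approx M s"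
			using eventually_ge_at_top[of N]
		proof eventually_elim
			case (elim M)
			have "c * real N powr (-s)*(\<Sum>n=N..<M. 1/real n^4)<=c * real N powr (-s)*(1/(3 * real (N-1)^3))"
				using c by (intro mult_left_mono sum_cube_tail N) auto
			thus ?case using inc[OF elim] by linarith
		qed
	qed auto
	thus "zeta_approx N s<=Z+s*(s+1)*(s+2)*(s+3)/(2160 * real (N-1)^3) * real N powr (-s)" by (simp add: c_def)
qed

section \<open>Fixed-point interval arithmetic on nonnegative numbers\<close>

definition fpS :: int where "fpS = 1000000000000"

text \<open>\<open>(a, b)\<close> encloses \<open>x \<ge> 0\<close> in units of \<open>1 / fpS\<close>.\<close>
definition enc :: "int \<times> int => real => bool" where
	"enc I x \<longleftrightarrow> 0<=fst I \<and> of_int (fst I)<=x * of_int fpS \<and> x * of_int fpS <= of_int (snd I)"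

text \<open>In this and the following operations with a division, lower ends are rounded down and
  upper ends are the floor plus 1; nonnegativity makes the ends multiply monotonically.\<close>

definition imul :: "int \<times> int => int \<times> int => int \<times> int" where
	"imul I J = (fst I * fst J div fpS, snd I * snd J div fpS+1)"
definition idiv :: "int \<times> int => int \<times> int => int \<times> int" where
	"idiv I J = (fst I * fpS div snd J, snd I * fpS div fst J+1)"
definition iadd :: "int \<times> int => int \<times> int => int \<times> int" where
	"iadd I J = (fst I+fst J, snd I+snd J)"
definition isub :: "int \<times> int => int \<times> int => int \<times> int" where
	"isub I J = (max 0 (fst I-snd J), snd I-fst J)"
definition iconst :: "int => int \<times> int" where
	"iconst c = (c * fpS, c * fpS)"
definition ifrac :: "int => int => int \<times> int" where
	"ifrac p q = (p * fpS div q, p * fpS div q+1)"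
primrec ipow :: "int \<times> int => nat => int \<times> int" where
	"ipow I 0 = iconst 1"
| "ipow I (Suc k) = imul I (ipow I k)"

lemma fpS_pos: "fpS > 0" "real_of_int fpS > 0" by (simp_all add: fpS_def)

lemma of_int_div_le: "c > 0 ==> real_of_int (a div c) <= of_int a/of_int c" by (simp add: real_of_int_div4)

lemma of_int_div_ge: "c > 0 ==> of_int a/of_int c<=real_of_int (a div c+1)" using real_of_int_div3[of a c] by simp

lemma enc_imul:
	assumes "enc I x" "enc J y"
	shows "enc (imul I J) (x * y)"
proof -
	define S where "S = real_of_int fpS"
	have S: "S > 0" using fpS_pos by (simp add: S_def)
	have I: "0<=real_of_int (fst I)" "of_int (fst I)<=x * S" "x * S <= of_int (snd I)"
		and J: "0<=real_of_int (fst J)" "of_int (fst J)<=y * S" "y * S <= of_int (snd J)" using assms by (auto simp: enc_def S_def)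
	have "real_of_int (fst I * fst J)<=(x * S)*(y * S)" unfolding of_int_mult using I J by (intro mult_mono) auto
	hence "real_of_int (fst I * fst J)/S<=x * y * S" using S by (simp add: pos_divide_le_eq mult_ac)
	hence 1: "real_of_int (fst I * fst J div fpS)<=x * y * S" using of_int_div_le[OF fpS_pos(1), of "fst I * fst J"] unfolding S_def by linarith
	have "(x * S)*(y * S)<=real_of_int (snd I * snd J)" unfolding of_int_mult using I J by (intro mult_mono) auto
	hence "x * y * S<=real_of_int (snd I * snd J)/S" using S by (simp add: pos_le_divide_eq mult_ac)
	hence 2: "x * y * S<=real_of_int (snd I * snd J div fpS+1)" using of_int_div_ge[OF fpS_pos(1), of "snd I * snd J"] unfolding S_def by linarith
	have "0<=fst I * fst J div fpS" using assms fpS_pos by (intro pos_imp_zdiv_nonneg_iff[THEN iffD2] mult_nonneg_nonneg) (auto simp: enc_def)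
	with 1 2 show ?thesis by (simp add: enc_def imul_def S_def)
qed

lemma enc_idiv:
	assumes "enc I x" "enc J y" and pos: "0 < fst J"
	shows "enc (idiv I J) (x/y)"
proof -
	define S where "S = real_of_int fpS"
	have S: "S > 0" using fpS_pos by (simp add: S_def)
	have I: "0<=real_of_int (fst I)" "of_int (fst I)<=x * S" "x * S <= of_int (snd I)"
		and J: "0 < real_of_int (fst J)" "of_int (fst J)<=y * S" "y * S <= of_int (snd J)" using assms by (auto simp: enc_def S_def)
	have yS: "y * S > 0" using J by linarith
	have sJ: "real_of_int (snd J) > 0" using J by linarith
	have e: "x/y * S = (x * S)/(y * S) * S" using S by simp
	have "of_int (fst I)/of_int (snd J)<=(x * S)/(y * S)" using I J yS by (intro frac_le) auto
	hence "of_int (fst I)/of_int (snd J) * S<=(x * S)/(y * S) * S" using S by (intro mult_right_mono) auto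
	hence "real_of_int (fst I * fpS)/of_int (snd J)<=x/y * S" unfolding e by (simp add: S_def)
	hence 1: "real_of_int (fst I * fpS div snd J)<=x/y * S" using of_int_div_le[of "snd J" "fst I * fpS"] sJ by simp
	have "(x * S)/(y * S) <= of_int (snd I)/of_int (fst J)" using I J yS by (intro frac_le) auto
	hence "(x * S)/(y * S) * S <= of_int (snd I)/of_int (fst J) * S" using S by (intro mult_right_mono) auto
	hence "x/y * S<=real_of_int (snd I * fpS)/of_int (fst J)" unfolding e by (simp add: S_def)
	hence 2: "x/y * S<=real_of_int (snd I * fpS div fst J+1)" using of_int_div_ge[of "fst J" "snd I * fpS"] pos by linarith
	have "0<=fst I * fpS div snd J" using assms fpS_pos sJ by (intro pos_imp_zdiv_nonneg_iff[THEN iffD2] mult_nonneg_nonneg) (auto simp: enc_def)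
	with 1 2 show ?thesis by (simp add: enc_def idiv_def S_def)
qed

lemma enc_iadd: "enc I x ==> enc J y ==> enc (iadd I J) (x+y)" by (auto simp: enc_def iadd_def distrib_right)

lemma enc_isub: "enc I x ==> enc J y ==> y<=x ==> enc (isub I J) (x-y)" using fpS_pos by (auto simp: enc_def isub_def left_diff_distrib max_def)

lemma enc_iconst: "0<=c ==> enc (iconst c) (of_int c)" using fpS_pos by (simp add: enc_def iconst_def)

lemma enc_one: "enc (iconst 1) 1" and enc_two: "enc (iconst 2) 2" using enc_iconst[of 1] enc_iconst[of 2] by simp_all

lemma enc_ipow: "enc I x ==> enc (ipow I k) (x^k)" by (induction k) (auto intro: enc_imul enc_one)

lemma enc_ifrac:
	assumes "0<=p" "0 < q"
	shows "enc (ifrac p q) (of_int p/of_int q)"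
proof -
	have "0<=p * fpS div q" using assms fpS_pos by (intro pos_imp_zdiv_nonneg_iff[THEN iffD2]) auto
	thus ?thesis using of_int_div_le[OF assms(2), of "p * fpS"] of_int_div_ge[OF assms(2), of "p * fpS"] by (simp add: enc_def ifrac_def)
qed

text \<open>10^12/sqrt n rounded down, for n < 25 as used in the zeta sums and for the primes up to
  47. The entries are certified by comparing integer squares.\<close>

definition ytab :: "(nat \<times> int) list" where
	"ytab = [(1, 1000000000000), (2, 707106781186), (3, 577350269189), (4, 500000000000), (5, 447213595499), (6, 408248290463), (7, 377964473009), (8, 353553390593), (9, 333333333333), (10, 316227766016), (11, 301511344577), (12, 288675134594), (13, 277350098112), (14, 267261241912), (15, 258198889747), (16, 250000000000), (17, 242535625036), (18, 235702260395), (19, 229415733870), (20, 223606797749), (21, 218217890235), (22, 213200716355), (23, 208514414057), (24, 204124145231), (29, 185695338177), (31, 179605302026), (37, 164398987305), (41, 156173761888), (43, 152498570332), (47, 145864991497)]"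

definition iy :: "nat => int \<times> int" where
	"iy n = (case map_of ytab n of None => (0, 0) | Some t => (t, t+1))"

lemma ytab_correct: "list_all (%(n, t). 0 < n \<and> 0<=t \<and> t^2 * int n<=fpS^2 \<and> fpS^2<=(t+1)^2 * int n) ytab" by code_simp

lemma enc_iy:
	assumes "map_of ytab n~=None"
	shows "enc (iy n) (ypow n)"
proof -
	obtain t where t: "map_of ytab n = Some t" using assms by auto
	hence "(n, t) \<in> set ytab" by (rule map_of_SomeD)
	hence c: "0 < n" "0<=t" "t^2 * int n<=fpS^2" "fpS^2<=(t+1)^2 * int n" using ytab_correct by (auto simp: list_all_iff)
	define S where "S = real_of_int fpS"
	have S: "S > 0" using fpS_pos by (simp add: S_def)
	have n: "real n > 0" using c by simp
	have y: "(ypow n * S)^2 = S^2/real n" using c by (simp add: power_mult_distrib ypow_bounds)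
	have y0: "0<=ypow n * S" using S by (simp add: ypow_def)
	have "real_of_int (t^2 * int n)<=real_of_int (fpS^2)" using c(3) by (simp only: of_int_le_iff)
	hence "real_of_int t^2<=S^2/real n" using n by (simp add: pos_le_divide_eq S_def)
	hence 1: "of_int t<=ypow n * S" unfolding y[symmetric] using y0 by (rule power2_le_imp_le)
	have "real_of_int (fpS^2)<=real_of_int ((t+1)^2 * int n)" using c(4) by (simp only: of_int_le_iff)
	hence "S^2/real n<=real_of_int (t+1)^2" using n by (simp add: pos_divide_le_eq S_def)
	hence 2: "ypow n * S <= of_int (t+1)" unfolding y[symmetric] by (rule power2_le_imp_le) (use c in simp)
	show ?thesis using 1 2 c(2) t by (simp add: enc_def iy_def S_def)
qed

text \<open>Encloses n^(-k/2) with a single rounding beyond the table: a rational number for even k,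
  and one table entry divided by a power of n for odd k.\<close>

definition ipy :: "nat => nat => int \<times> int" where
	"ipy n k = (if even k then ifrac 1 (int n^(k div 2))
		 else (fst (iy n) div int n^(k div 2), snd (iy n) div int n^(k div 2)+1))"

lemma enc_ipy:
	assumes n: "map_of ytab n~=None" "n>=1"
	shows "enc (ipy n k) (ypow n^k)"
proof -
	define m where "m = int n^(k div 2)"
	have m: "m > 0" using n by (simp add: m_def)
	have y2: "ypow n^2 = 1/real n" by (rule ypow_bounds(3)) (use n in simp)
	have "ypow n^(2*(k div 2)) = (1/real n)^(k div 2)" unfolding power_mult y2 ..
	also have "... = 1/of_int m" by (simp add: m_def power_one_over)
	finally have yk: "ypow n^(2*(k div 2)) = 1/of_int m" .
	have e: "enc (iy n) (ypow n)" by (rule enc_iy) (rule n)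
	show ?thesis
	proof (cases "even k")
		case True
		hence "2*(k div 2) = k" by simp
		hence yk': "ypow n^k = of_int 1/of_int m" using yk by simp
		have eq: "ipy n k = ifrac 1 m" using True by (simp add: ipy_def m_def)
		show ?thesis unfolding eq yk' using m by (intro enc_ifrac) auto
	next
		case False
		define M where "M = real_of_int m"
		have M: "M > 0" using m by (simp add: M_def)
		have k: "2*(k div 2)+1 = k" using False by (rule odd_two_times_div_two_succ)
		have "ypow n^(2*(k div 2)+1) = ypow n^(2*(k div 2)) * ypow n" by simp
		hence "ypow n^(2*(k div 2)+1) = ypow n/M" unfolding yk M_def by simp
		hence yk': "ypow n^k = ypow n/M" unfolding k .
		have eq: "ipy n k = (fst (iy n) div m, snd (iy n) div m+1)" using False by (simp add: ipy_def m_def)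
		have E: "0<=fst (iy n)" "of_int (fst (iy n))<=ypow n * of_int fpS" "ypow n * of_int fpS <= of_int (snd (iy n))"
			using e by (simp_all add: enc_def)
		have "of_int (fst (iy n))/M<=ypow n * of_int fpS/M" using E M by (intro divide_right_mono) auto
		hence 1: "real_of_int (fst (iy n) div m)<=ypow n * of_int fpS/M" using of_int_div_le[OF m, of "fst (iy n)"] unfolding M_def by linarith
		have "ypow n * of_int fpS/M <= of_int (snd (iy n))/M" using E M by (intro divide_right_mono) auto
		hence 2: "ypow n * of_int fpS/M<=real_of_int (snd (iy n) div m+1)" using of_int_div_ge[OF m, of "snd (iy n)"] unfolding M_def by linarith
		have nn: "0<=fst (iy n) div m" using E(1) m by (intro pos_imp_zdiv_nonneg_iff[THEN iffD2])
		have z: "ypow n/M * of_int fpS = ypow n * of_int fpS/M" by simp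
		show ?thesis unfolding enc_def eq yk' z fst_conv snd_conv by (intro conjI nn 1 2)
	qed
qed

section \<open>Enclosures of zeta(k/2)\<close>

definition zval :: "nat => real" where
	"zval k = Re (zeta_reg (of_real (real k/2)))/(real k/2-1)"

definition zsum :: "nat => int \<times> int" where
	"zsum k = foldr (%n. iadd (ipy n k)) [1..<25] (0, 0)"
text \<open>Euler-Maclaurin at N = 25, where 1/sqrt N = 1/5 makes the correction terms rational;
  \<open>E\<close> is the error bound, with 477757440 = 16 times 2160 times 24^3. It is subtracted
  at the lower end only, as the approximation lies above the value.\<close>

definition izeta :: "nat => int \<times> int" where
	"izeta k = (let T = iadd (zsum k) (ifrac (30000+300*(int k-2)+int k*(int k-2)) (600*(int k-2)*5^k));
		 E = ifrac (int (k*(k+2)*(k+4)*(k+6))) (477757440*5^k) in (max 0 (fst T-snd E), snd T))"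
text \<open>Encloses -zeta(1/2), since intervals are nonnegative. The constants are the same ones at
  k = 1: 29699/3000 is minus the correction terms, and 105 is 1 times 3 times 5 times 7.\<close>

definition ihalf :: "int \<times> int" where
	"ihalf = (let T = isub (ifrac 29699 3000) (zsum 1); E = ifrac 105 2388787200 in (fst T, snd T+snd E))"

lemma ypow_powr: "n>=1 ==> real n powr (- (real k/2)) = ypow n^k"
proof -
	assume n: "n>=1"
	have "ypow n = real n powr (-(1/2))" unfolding powr_minus powr_half_sqrt[OF of_nat_0_le_iff] by (simp add: ypow_def divide_inverse)
	hence "ypow n^k = (real n powr (-(1/2)))^k" by (rule arg_cong)
	also have "... = real n powr (real k*(-(1/2)))" by (rule powr_power) (use n in auto)
	finally show ?thesis by simp
qed

lemma ypow_25: "ypow 25 = 1/5" by (simp add: ypow_def)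

lemma zeta_approx_25:
	"zeta_approx 25 (real k/2) = (\<Sum>n=1..<25. ypow n^k)+(1/5)^k*(25/(real k/2-1)+1/2+real k/600)"
proof -
	have a: "real 25 powr (- (real k/2)) = (1/5)^k" using ypow_powr[of 25 k] ypow_25 by simp
	have "real 25 powr (1-real k/2) = real 25 powr (1+- (real k/2))" by simp
	also have "... = real 25 powr 1 * real 25 powr (- (real k/2))" by (rule powr_add)
	finally have b: "real 25 powr (1-real k/2) = 25*(1/5)^k" unfolding a by simp
	have "real 25 powr (- (real k/2)-1) = real 25 powr (- (real k/2))/real 25 powr 1" by (rule powr_diff)
	hence c: "real 25 powr (- (real k/2)-1) = (1/5)^k/25" unfolding a by simp
	have s: "(\<Sum>n=1..<25. real n powr (- (real k/2))) = (\<Sum>n=1..<25. ypow n^k)" by (intro sum.cong ypow_powr) auto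
	show ?thesis unfolding zeta_approx_def s b a c by (simp add: algebra_simps)
qed

lemma enc_zsum: "enc (zsum k) (\<Sum>n=1..<25. ypow n^k)"
proof -
	have "enc (foldr (%n. iadd (ipy n k)) ns (0, 0)) (\<Sum>n\<leftarrow>ns. ypow n^k)"
		if "list_all (%n. map_of ytab n~=None \<and> 1<=n) ns" for ns using that
	proof (induction ns)
		case (Cons n ns)
		have "enc (iadd (ipy n k) (foldr (%n. iadd (ipy n k)) ns (0, 0))) (ypow n^k+(\<Sum>n\<leftarrow>ns. ypow n^k))"
			using Cons by (intro enc_iadd enc_ipy) auto
		thus ?case by simp
	qed (simp add: enc_def)
	moreover have "list_all (%n. map_of ytab n~=None \<and> 1<=n) [1..<25]" by code_simp
	ultimately have "enc (zsum k) (\<Sum>n\<leftarrow>[1..<25]. ypow n^k)" unfolding zsum_def by blast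
	thus ?thesis by (simp only: sum_set_upt_conv_sum_list_nat[symmetric] set_upt)
qed

lemma zval_bounds:
	assumes k: "k>=1" "k~=2"
	shows "zval k<=zeta_approx 25 (real k/2)"
		"zeta_approx 25 (real k/2)<=zval k + of_int (int (k*(k+2)*(k+4)*(k+6)))/of_int (477757440*5^k)"
proof -
	have s: "real k/2 > 0" "real k/2~=1" using k by auto
	show "zval k<=zeta_approx 25 (real k/2)" unfolding zval_def by (rule zeta_approx_bounds(1)[OF s]) simp
	have "zeta_approx 25 (real k/2)<=zval k+real k/2*(real k/2+1)*(real k/2+2)*(real k/2+3)/(2160 * real (25-1)^3) * real 25 powr (-(real k/2))"
		unfolding zval_def by (rule zeta_approx_bounds(2)[OF s]) simp
	also have "real 25 powr (-(real k/2)) = (1/5)^k" using ypow_powr[of 25 k] ypow_25 by simp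
	also have "real k/2*(real k/2+1)*(real k/2+2)*(real k/2+3)/(2160 * real (25-1)^3)*(1/5)^k
			= of_int (int (k*(k+2)*(k+4)*(k+6)))/of_int (477757440*5^k)"
	proof -
		have E: "real k/2*(real k/2+1)*(real k/2+2)*(real k/2+3) = real k*(real k+2)*(real k+4)*(real k+6)/16"
			by (simp add: field_simps)
		have g: "x/16/(2160 * real (25-1)^3)*(1/5)^k = x/(477757440*5^k)" for x :: real by (simp add: power_divide)
		have n1: "of_int (int (k*(k+2)*(k+4)*(k+6))) = real k*(real k+2)*(real k+4)*(real k+6)"
			by (simp only: of_int_of_nat_eq of_nat_mult of_nat_add of_nat_numeral of_int_mult of_int_add of_int_numeral)
		have n2: "real_of_int (477757440*5^k) = 477757440*5^k" by simp
		show ?thesis by (simp only: E g n1 n2)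
	qed
	finally show "zeta_approx 25 (real k/2)<=zval k + of_int (int (k*(k+2)*(k+4)*(k+6)))/of_int (477757440*5^k)" .
qed

lemma enc_izeta:
	assumes k: "k>=3" and z: "zval k>=0"
	shows "enc (izeta k) (zval k)"
proof -
	define T where "T = iadd (zsum k) (ifrac (30000+300*(int k-2)+int k*(int k-2)) (600*(int k-2)*5^k))"
	define E where "E = ifrac (int (k*(k+2)*(k+4)*(k+6))) (477757440*5^k)"
	have r: "(1/5)^k*(25/(real k/2-1)+1/2+real k/600)
			= of_int (30000+300*(int k-2)+int k*(int k-2))/of_int (600*(int k-2)*5^k)"
	proof -
		define m where "m = real k-2"
		have m: "m > 0" using k by (simp add: m_def)
		have q: "real k/2-1 = m/2" "real k = m+2" by (simp_all add: m_def)
		have "25/(real k/2-1)+1/2+real k/600 = (30000+300 * m+real k * m)/(600 * m)" unfolding q using m by (simp add: field_simps)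
		thus ?thesis by (simp add: m_def power_divide)
	qed
	have "enc T (zeta_approx 25 (real k/2))" unfolding T_def zeta_approx_25 r using k by (intro enc_iadd enc_zsum enc_ifrac) auto
	moreover have "enc E (of_int (int (k*(k+2)*(k+4)*(k+6)))/of_int (477757440*5^k))" unfolding E_def by (intro enc_ifrac) auto
	moreover have "zeta_approx 25 (real k/2) * of_int fpS<=(zval k + of_int (int (k*(k+2)*(k+4)*(k+6)))/of_int (477757440*5^k)) * of_int fpS"
		"zval k * of_int fpS<=zeta_approx 25 (real k/2) * of_int fpS" "zval k * of_int fpS>=0"
		using zval_bounds[of k] k fpS_pos z by (intro mult_right_mono mult_nonneg_nonneg; auto)+
	ultimately show ?thesis unfolding izeta_def Let_def T_def[symmetric] E_def[symmetric]
		by (simp add: enc_def max_def distrib_right del: of_int_of_nat_eq of_int_mult of_int_power)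
qed

lemma enc_ihalf: "enc ihalf (- zhalf)"
proof -
	define e where "e = (of_int 105/of_int 2388787200 :: real)"
	have zv: "zval 1 = zhalf" by (simp add: zval_def zhalf_eq)
	have a: "zeta_approx 25 (1/2) = (\<Sum>n=1..<25. ypow n^1)-29699/3000" using zeta_approx_25[of 1] by simp
	have b: "zhalf<=zeta_approx 25 (1/2)" "zeta_approx 25 (1/2)<=zhalf+e" using zval_bounds[of 1] unfolding zv e_def by (simp_all)
	\<comment> \<open>Interval subtraction asks for a nonnegative difference; here the sum is at most
	  9, against 29699/3000.\<close>
	have neg: "zeta_approx 25 (1/2)<=0"
	proof -
		have "real_of_int (fst (zsum 1))>=0" by code_simp
		have "(\<Sum>n=1..<25. ypow n^1) * of_int fpS <= of_int (snd (zsum 1))" using enc_zsum[of 1] by (simp only: enc_def)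
		moreover have "snd (zsum 1)<=9 * fpS" by code_simp
		hence "real_of_int (snd (zsum 1))<=real_of_int (9 * fpS)" by (simp only: of_int_le_iff)
		hence "real_of_int (snd (zsum 1))<=9 * real_of_int fpS" by simp
		ultimately have "(\<Sum>n=1..<25. ypow n^1) * of_int fpS<=9 * of_int fpS" by linarith
		hence "(\<Sum>n=1..<25. ypow n^1)<=9" using fpS_pos by simp
		thus ?thesis unfolding a by simp
	qed
	define T where "T = isub (ifrac 29699 3000) (zsum 1)"
	define E where "E = ifrac 105 2388787200"
	have "enc T (of_int 29699/of_int 3000-(\<Sum>n=1..<25. ypow n^1))" unfolding T_def using neg a by (intro enc_isub enc_zsum enc_ifrac) auto
	hence T: "enc T (- zeta_approx 25 (1/2))" unfolding a by simp
	have E: "enc E e" unfolding E_def e_def by (intro enc_ifrac) auto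
	have "- zhalf * of_int fpS<=(- zeta_approx 25 (1/2)+e) * of_int fpS"
		"- zeta_approx 25 (1/2) * of_int fpS <=-zhalf * of_int fpS" using b fpS_pos by (intro mult_right_mono; simp)+
	thus ?thesis using T E unfolding ihalf_def Let_def T_def[symmetric] E_def[symmetric] by (simp add: enc_def left_diff_distrib)
qed

section \<open>Accelerated Euler products\<close>

definition zprod :: "nat => nat => real" where
	"zprod k N = (\<Prod>n<N. if prime n then 1-ypow n^k else 1)"

lemma zprod_LIMSEQ:
	assumes k: "k>=3"
	shows "zprod k \<longlonglongrightarrow> 1/zval k" "zval k > 0"
proof -
	define s where "s = complex_of_real (real k/2)"
	have s: "Re s > 1" using k by (simp add: s_def)
	have ds: "dseries s = of_real (zval k)"
	proof -
		have z: "zeta_reg (of_real (real k/2)) = of_real (Re (zeta_reg (of_real (real k/2))))" by (rule zeta_reg_real(2)) simp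
		have "dseries s = of_real (Re (zeta_reg (of_real (real k/2))))/of_real (real k/2-1)" unfolding dseries_def s_def z[symmetric] by simp
		thus ?thesis by (simp add: zval_def)
	qed
	have nz: "zval k~=0" using dseries_nonzero[OF s] unfolding ds by simp
	have "(%N. inverse (\<Prod>n<N. if prime n then 1/(1-of_nat n powr (-s)) else 1)) \<longlonglongrightarrow> inverse (dseries s)"
		by (intro tendsto_inverse euler_product_dseries s dseries_nonzero)
	also have "(%N. inverse (\<Prod>n<N. if prime n then 1/(1-of_nat n powr (-s)) else 1)) = (%N. complex_of_real (zprod k N))"
	proof
		fix N
		have h: "inverse (if prime n then 1/(1-of_nat n powr (-s)) else 1) = complex_of_real (if prime n then 1-ypow n^k else 1)" for n
		proof (cases "prime n")
			case True
			have "of_nat n powr (-s) = complex_of_real (real n powr (-(real k/2)))" using powr_of_real[of "real n" "-(real k/2)"] by (simp add: s_def)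
			also have "real n powr (-(real k/2)) = ypow n^k" using prime_gt_0_nat[OF True] by (intro ypow_powr) auto
			finally show ?thesis using True by simp
		qed simp
		have pi: "inverse (prod f {..<N}) = (\<Prod>n<N. inverse (f n))" for f :: "nat => complex" using prod_inversef[of f "{..<N}"] by (simp add: o_def)
		show "inverse (\<Prod>n<N. if prime n then 1/(1-of_nat n powr (-s)) else 1) = complex_of_real (zprod k N)"
			by (simp only: pi h zprod_def of_real_prod)
	qed
	also have "inverse (dseries s) = of_real (1/zval k)" unfolding ds by (simp add: divide_inverse)
	finally have "(%N. complex_of_real (zprod k N)) \<longlonglongrightarrow> of_real (1/zval k)" .
	thus lim: "zprod k \<longlonglongrightarrow> 1/zval k" by (simp only: tendsto_of_real_iff)
	have "zprod k N>=0" for N unfolding zprod_def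
	proof (intro prod_nonneg ballI)
		fix n
		show "0<=(if prime n then 1-ypow n^k else 1)" using ypow_bounds[of n] prime_ge_2_nat[of n] by (auto intro!: power_le_one)
	qed
	hence "1/zval k>=0" using lim by (intro LIMSEQ_le_const[OF lim]) auto
	thus "zval k > 0" using nz by (simp add: zero_le_divide_1_iff)
qed

text \<open>Horner evaluation of integer coefficient lists, lowest degree first. Lists make the
  cancellation of low-order terms a computation.\<close>

primrec hev :: "int list => real => real" where
	"hev [] y = 0"
| "hev (a # as) y = of_int a+y * hev as y"

fun zipadd :: "int list => int list => int list" where
	"zipadd [] bs = bs"
| "zipadd as [] = as"
| "zipadd (a # as) (b # bs) = (a+b) # zipadd as bs"

definition mul1 :: "nat => int list => int list" where
	"mul1 k as = zipadd as (replicate k 0 @ map uminus as)"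

text \<open>A bound for the value at any y in [0, 3/20], in fixed-point units and rounded up; the
  primes beyond 47 have p^(-1/2) in this range.\<close>

primrec hup :: "int list => int" where
	"hup [] = 0"
| "hup (a # as) = \<bar>a\<bar> * fpS+(hup as*3 div 20+1)"

lemma hev_zipadd: "hev (zipadd as bs) y = hev as y+hev bs y" by (induction as bs rule: zipadd.induct) (simp_all add: algebra_simps)

lemma hev_uminus: "hev (map uminus as) y =-hev as y" by (induction as) simp_all

lemma hev_shift: "hev (replicate k 0 @ as) y = y^k * hev as y" by (induction k) simp_all

lemma hev_mul1: "hev (mul1 k as) y = (1-y^k) * hev as y" unfolding mul1_def hev_zipadd hev_shift hev_uminus by (simp add: algebra_simps)

lemma hev_bound:
	assumes y: "0<=y" "y<=3/20"
	shows "\<bar>hev as y\<bar> * of_int fpS <= of_int (hup as)"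
proof (induction as)
	case (Cons a as)
	have "\<bar>hev (a # as) y\<bar> <= \<bar>of_int a\<bar>+y * \<bar>hev as y\<bar>" using y abs_triangle_ineq[of "of_int a" "y * hev as y"] by (simp add: abs_mult)
	hence "\<bar>hev (a # as) y\<bar> * of_int fpS<=(\<bar>of_int a\<bar>+y * \<bar>hev as y\<bar>) * of_int fpS"
		using fpS_pos by (intro mult_right_mono) auto
	also have "... = \<bar>of_int a\<bar> * of_int fpS+y*(\<bar>hev as y\<bar> * of_int fpS)" by (simp add: algebra_simps)
	also have "y*(\<bar>hev as y\<bar> * of_int fpS)<=3/20 * of_int (hup as)" using y fpS_pos Cons by (intro mult_mono) auto
	also have "3/20 * of_int (hup as) = real_of_int (hup as*3)/of_int 20" by simp
	also have "... <= of_int (hup as*3 div 20+1)" by (rule of_int_div_ge) simp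
	finally show ?case by simp
qed simp

text \<open>The factors 1 + 2 y^3/(1-y) and 1 - 2 y^4/(1-y) are multiplied by powers of 1 - y^k, the
  local factors of 1/zeta(k/2), with exponents chosen to remove all terms below y^10 and y^8
  respectively. Numerators and denominators are kept apart to remain polynomials.\<close>

definition polyNA where "polyNA = mul1 3 (mul1 3 (mul1 4 (mul1 4 (mul1 5 (mul1 5 [1, -1, 0, 2])))))"
definition polyDA where "polyDA = mul1 6 (mul1 7 (mul1 7 (mul1 8 (mul1 8 (mul1 8 (mul1 8 (mul1 8 (mul1 9 (mul1 9 (mul1 9 (mul1 9 [1, -1])))))))))))"
definition polyNB :: "int list" where "polyNB = [1, -1, 0, 0, -2]"
definition polyDB where "polyDB = mul1 4 (mul1 4 (mul1 5 (mul1 5 (mul1 6 (mul1 6 (mul1 7 (mul1 7 [1, -1])))))))"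

definition numA :: "real => real" where "numA y = ((1-y)+2 * y^3)*((1-y^3)^2*((1-y^4)^2*(1-y^5)^2))"
definition denA :: "real => real" where "denA y = (1-y)*((1-y^6)*((1-y^7)^2*((1-y^8)^5*(1-y^9)^4)))"
definition numB :: "real => real" where "numB y = (1-y)-2 * y^4"
definition denB :: "real => real" where "denB y = (1-y)*((1-y^4)^2*((1-y^5)^2*((1-y^6)^2*(1-y^7)^2)))"

lemma hev_polys: "hev polyNA y = numA y" "hev polyDA y = denA y" "hev polyNB y = numB y" "hev polyDB y = denB y"
proof -
	have b: "hev [1, -1, 0, 2] y = (1-y)+2 * y^3" "hev [1, -1] y = 1-y" "hev [1, -1, 0, 0, -2] y = (1-y)-2 * y^4"
		by (simp_all add: eval_nat_numeral algebra_simps)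
	show "hev polyNA y = numA y" unfolding polyNA_def hev_mul1 b numA_def by (simp only: power2_eq_square mult_ac)
	have alg: "a*(b*(b*(c*(c*(c*(c*(c*(d*(d*(d*(d * e))))))))))) = e*(a*(b^2*(c^5 * d^4)))" for a b c d e :: real
		by (simp add: eval_nat_numeral mult_ac)
	show "hev polyDA y = denA y" unfolding polyDA_def hev_mul1 b denA_def by (rule alg)
	show "hev polyNB y = numB y" unfolding polyNB_def b numB_def ..
	show "hev polyDB y = denB y" unfolding polyDB_def hev_mul1 b denB_def by (simp only: power2_eq_square mult_ac)
qed

lemma hev_drop:
	assumes "take n as = replicate n 0"
	shows "hev as y = y^n * hev (drop n as) y"
proof -
	have "hev as y = hev (replicate n 0 @ drop n as) y" unfolding assms[symmetric] by simp
	thus ?thesis by (simp only: hev_shift)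
qed

text \<open>N - D is y^m times a polynomial bounded by c, and D = 1 + y D' with |D'| <= 4/3 is at
  least 0.8 for y <= 3/20.\<close>

lemma quotient_near_one:
	assumes y: "0<=y" "y<=3/20"
		and d: "take m (zipadd N (map uminus D)) = replicate m 0"
		and c: "hup (drop m (zipadd N (map uminus D)))<=c * fpS" and c0: "c>=0"
		and D: "take 1 D = [1]" "hup (drop 1 D)*3<=4 * fpS"
	shows "hev D y>=0.8" "\<bar>hev N y/hev D y-1\<bar> <= of_int c/0.8 * y^m"
proof -
	obtain D' where D': "D = 1 # D'" using D(1) by (cases D) auto
	have "\<bar>hev D' y\<bar> * of_int fpS <= of_int (hup D')" by (rule hev_bound[OF y])
	also have "... <= of_int (4 * fpS)/3" using D(2) unfolding D' by (simp flip: of_int_le_iff[where 'a = real])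
	finally have "\<bar>hev D' y\<bar><=4/3" using fpS_pos by simp
	hence "y * \<bar>hev D' y\<bar><=3/20*(4/3)" using y by (intro mult_mono) auto
	hence "\<bar>y * hev D' y\<bar><=0.2" using y by (simp add: abs_mult)
	thus Dl: "hev D y>=0.8" unfolding D' by (simp add: abs_le_iff)
	define r where "r = drop m (zipadd N (map uminus D))"
	have "\<bar>hev r y\<bar> * of_int fpS <= of_int (hup r)" by (rule hev_bound[OF y])
	also have "... <= of_int (c * fpS)" using c unfolding r_def by (simp only: of_int_le_iff)
	finally have rb: "\<bar>hev r y\<bar> <= of_int c" using fpS_pos by simp
	have e: "hev N y-hev D y = y^m * hev r y" using hev_drop[OF d, of y] unfolding hev_zipadd hev_uminus r_def by simp
	have D0: "hev D y > 0" using Dl by simp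
	have "hev N y/hev D y-1 = (hev N y-hev D y)/hev D y" using D0 by (simp add: diff_divide_distrib)
	also have "... = y^m * hev r y/hev D y" by (simp only: e)
	finally have "\<bar>hev N y/hev D y-1\<bar> = y^m * \<bar>hev r y\<bar>/hev D y" using D0 y by (simp add: abs_mult power_abs)
	also have "...<=y^m * of_int c/0.8" using Dl rb y c0 by (intro frac_le mult_left_mono mult_nonneg_nonneg) auto
	finally show "\<bar>hev N y/hev D y-1\<bar> <= of_int c/0.8 * y^m" by (simp add: mult_ac)
qed

lemma ypow_large: "n>=48 ==> 0<=ypow n \<and> ypow n<=3/20"
proof -
	assume n: "n>=48"
	have "1/real n<=1/48" using n by (intro divide_left_mono) auto
	moreover have "1/48<=(3/20::real)^2" by (simp add: power2_eq_square)
	moreover have "ypow n^2 = 1/real n" by (rule ypow_bounds(3)) (use n in simp)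
	ultimately have "ypow n^2<=(3/20)^2" by linarith
	thus ?thesis by (auto intro: power2_le_imp_le simp: ypow_def)
qed

lemma tail_A:
	assumes "n>=48"
	shows "\<bar>numA (ypow n)/denA (ypow n)-1\<bar><=0.08*(1/real n^4)"
proof -
	\<comment> \<open>y^10 is 1/n^5; one factor 1/n <= 1/48 is given up, so that both tails can be
	  summed with n^(-4).\<close>
	have "\<bar>hev polyNA (ypow n)/hev polyDA (ypow n)-1\<bar> <= of_int 3/0.8 * ypow n^10"
	proof (rule quotient_near_one)
		show "take 10 (zipadd polyNA (map uminus polyDA)) = replicate 10 0" by code_simp
		show "hup (drop 10 (zipadd polyNA (map uminus polyDA)))<=3 * fpS" by code_simp
		show "take 1 polyDA = [1]" "hup (drop 1 polyDA)*3<=4 * fpS" by code_simp+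
	qed (use ypow_large[OF assms] in auto)
	also have "ypow n^10 = (ypow n^2)^5" by simp
	also have "ypow n^2 = 1/real n" by (rule ypow_bounds(3)) (use assms in simp)
	also have "(1/real n)^5 = (1/real n)^4*(1/real n)" by (simp add: eval_nat_numeral)
	also have "(1/real n)^4 = 1/real n^4" by (rule power_one_over)
	also have "of_int 3/0.8*(1/real n^4*(1/real n)) <= of_int 3/0.8*(1/real n^4*(1/48))"
		using assms by (intro mult_left_mono divide_left_mono) auto
	also have "...<=0.08*(1/real n^4)"
	proof -
		have "of_int 3/0.8*(c*(1/48))<=0.08 * c" if "0<=c" for c :: real using that by simp
		from this[of "1/real n^4"] show ?thesis by (simp only: zero_le_divide_1_iff zero_le_power of_nat_0_le_iff simp_thms)
	qed
	finally show ?thesis unfolding hev_polys by simp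
qed

lemma tail_B:
	assumes "n>=48"
	shows "\<bar>numB (ypow n)/denB (ypow n)-1\<bar><=5*(1/real n^4)"
proof -
	have "\<bar>hev polyNB (ypow n)/hev polyDB (ypow n)-1\<bar> <= of_int 4/0.8 * ypow n^8"
	proof (rule quotient_near_one)
		show "take 8 (zipadd polyNB (map uminus polyDB)) = replicate 8 0" by code_simp
		show "hup (drop 8 (zipadd polyNB (map uminus polyDB)))<=4 * fpS" by code_simp
		show "take 1 polyDB = [1]" "hup (drop 1 polyDB)*3<=4 * fpS" by code_simp+
	qed (use ypow_large[OF assms] in auto)
	also have "ypow n^8 = (ypow n^2)^4" by simp
	also have "... = 1/real n^4" using assms by (simp add: ypow_bounds power_divide)
	finally show ?thesis unfolding hev_polys by simp
qed

text \<open>Below by the inequality (1 - a)(1 - b) >= 1 - a - b, used inductively, and above by 1 +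
  a <= exp a.\<close>

lemma prod_near_one:
	fixes G :: "nat => real"
	assumes a: "!!n. n>=48 ==> \<bar>G n-1\<bar><=a n" "!!n. n>=48 ==> a n<=1"
	shows "1-(\<Sum>n=48..<M. a n)<=(\<Prod>n=48..<M. G n)" "(\<Prod>n=48..<M. G n)<=exp (\<Sum>n=48..<M. a n)" "0<=(\<Prod>n=48..<M. G n)"
proof -
	have G: "1-a n<=G n" "G n<=exp (a n)" "0<=G n" "0<=a n" if "n>=48" for n using a[OF that] exp_ge_add_one_self[of "a n"] by linarith+
	show P0: "0<=(\<Prod>n=48..<M. G n)" using G by (intro prod_nonneg) auto
	have "(\<Prod>n=48..<M. G n)<=(\<Prod>n=48..<M. exp (a n))" using G by (intro prod_mono) auto
	thus "(\<Prod>n=48..<M. G n)<=exp (\<Sum>n=48..<M. a n)" by (simp add: exp_sum)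
	have "1-(\<Sum>n=48..<M. a n)<=(\<Prod>n=48..<M. 1-a n) \<and> (\<Prod>n=48..<M. 1-a n)<=1 \<and> 0<=(\<Prod>n=48..<M. 1-a n)" if "M>=48"
		using that
	proof (induction M rule: dec_induct)
		case (step m)
		define P where "P = (\<Prod>n=48..<m. 1-a n)"
		have e: "(\<Prod>n=48..<Suc m. 1-a n) = P*(1-a m)" "(\<Sum>n=48..<Suc m. a n) = (\<Sum>n=48..<m. a n)+a m"
			using step by (simp_all add: P_def)
		have am: "0<=a m" "a m<=1" using G(4)[of m] a(2)[of m] step by auto
		have P: "1-(\<Sum>n=48..<m. a n)<=P" "P<=1" "0<=P" using step.IH by (auto simp: P_def)
		have "P * a m<=1 * a m" using P am by (intro mult_right_mono) auto
		moreover have "P*(1-a m) = P-P * a m" by (simp add: right_diff_distrib)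
		moreover have "P*(1-a m)<=1*1" using P am by (intro mult_mono) auto
		moreover have "0<=P*(1-a m)" using P am by simp
		ultimately show ?case unfolding e using P by simp
	qed simp
	moreover have "(\<Prod>n=48..<M. 1-a n)<=(\<Prod>n=48..<M. G n)" using G a by (intro prod_mono) auto
	ultimately show "1-(\<Sum>n=48..<M. a n)<=(\<Prod>n=48..<M. G n)" by (cases "M>=48") auto
qed

definition primes47 :: "nat list" where
	"primes47 = [2, 3, 5, 7, 11, 13, 17, 19, 23, 29, 31, 37, 41, 43, 47]"

lemma primes_below_48: "{n. n < 48 \<and> prime n} = set primes47"
proof -
	have "list_all (%n. prime n \<longleftrightarrow> n \<in> set primes47) [0..<48]" by code_simp
	hence "prime n \<longleftrightarrow> n \<in> set primes47" if "n < 48" for n using that by (auto simp: list_all_iff)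
	moreover have "n < 48" if "n \<in> set primes47" for n using that by (auto simp: primes47_def)
	ultimately show ?thesis by blast
qed

text \<open>All n >= 48 are summed instead of the primes only; the tail of n^(-4) is then at most
  1/(3 times 47^3) = 1/311469.\<close>

lemma limit_near_finite_product:
	fixes G :: "nat => real"
	assumes a: "!!n. n>=48 ==> prime n ==> \<bar>G n-1\<bar> <= \<kappa>*(1/real n^4)" and \<kappa>: "0 <= \<kappa>" "\<kappa><=5"
		and R: "(\<Prod>n\<leftarrow>primes47. G n) > 0"
		and lim: "(%N. \<Prod>n<N. if prime n then G n else 1) \<longlonglongrightarrow> L"
	shows "1 - \<kappa>/311469<=L/(\<Prod>n\<leftarrow>primes47. G n)" "L/(\<Prod>n\<leftarrow>primes47. G n)<=exp (\<kappa>/311469)"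
proof -
	define R where "R = (\<Prod>n\<leftarrow>primes47. G n)"
	define G' where "G' n = (if prime n then G n else 1)" for n
	have R0: "R > 0" using R by (simp add: R_def)
	have "distinct primes47" by (simp add: primes47_def)
	hence "(\<Prod>n\<in>{n. n < 48 \<and> prime n}. G n) = R" unfolding primes_below_48 R_def by (simp add: prod.distinct_set_conv_list)
	moreover have "(\<Prod>n<48. G' n) = (\<Prod>n\<in>{n. n < 48 \<and> prime n}. G n)" unfolding G'_def by (intro prod.mono_neutral_cong_right) auto
	ultimately have fin: "(\<Prod>n<48. G' n) = R" by simp
	have sp: "(\<Prod>n<N. G' n) = R*(\<Prod>n=48..<N. G' n)" if "N>=48" for N
	proof -
		have "{..<N} = {..<48} \<union> {48..<N}" using that by auto
		moreover have "prod G' ({..<48} \<union> {48..<N}) = prod G' {..<48} * prod G' {48..<N}" by (rule prod.union_disjoint) auto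
		ultimately show ?thesis using fin by (simp only:)
	qed
	have b: "1 - \<kappa>/311469<=(\<Prod>n=48..<N. G' n)" "(\<Prod>n=48..<N. G' n)<=exp (\<kappa>/311469)" for N
	proof -
		have s: "(\<Sum>n=48..<N. \<kappa>*(1/real n^4)) <= \<kappa>/311469"
		proof -
			have "(\<Sum>n=48..<N. 1/real n^4)<=1/(3 * real (48-1)^3)" by (rule sum_cube_tail) simp
			hence "\<kappa>*(\<Sum>n=48..<N. 1/real n^4) <= \<kappa>*(1/(3 * real (48-1)^3))" using \<kappa> by (intro mult_left_mono) auto
			thus ?thesis by (simp add: sum_distrib_left)
		qed
		have A: "\<bar>G' n-1\<bar> <= \<kappa>*(1/real n^4)" "\<kappa>*(1/real n^4)<=1" if n: "n>=48" for n
		proof -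
			show "\<bar>G' n-1\<bar> <= \<kappa>*(1/real n^4)" using a[OF n] \<kappa> by (auto simp: G'_def)
			have "real 48^4<=real n^4" using n by (intro power_mono) auto
			hence "1/real n^4<=1/real 48^4" using n by (intro divide_left_mono) auto
			hence "\<kappa>*(1/real n^4)<=5*(1/real 48^4)" using \<kappa> by (intro mult_mono) auto
			also have "5*(1/real 48^4)<=1" by simp
			finally show "\<kappa>*(1/real n^4)<=1" .
		qed
		note P = prod_near_one[of G' "%n. \<kappa>*(1/real n^4)", OF A]
		show "1 - \<kappa>/311469<=(\<Prod>n=48..<N. G' n)" using P(1)[of N] s by linarith
		have "exp (\<Sum>n=48..<N. \<kappa>*(1/real n^4))<=exp (\<kappa>/311469)" using s by simp
		thus "(\<Prod>n=48..<N. G' n)<=exp (\<kappa>/311469)" using P(2)[of N] by linarith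
	qed
	have lim': "(%N. (\<Prod>n<N. G' n)/R) \<longlonglongrightarrow> L/R" using lim R0 unfolding G'_def by (intro tendsto_intros) auto
	have ev: "(\<Prod>n<N. G' n)/R = (\<Prod>n=48..<N. G' n)" if "N>=48" for N using sp[OF that] R0 by simp
	have "\<forall>\<^sub>F N in sequentially. 1 - \<kappa>/311469<=(\<Prod>n<N. G' n)/R"
		using eventually_ge_at_top[of 48] by eventually_elim (simp only: ev b(1))
	from tendsto_lowerbound[OF lim' this] show "1 - \<kappa>/311469<=L/(\<Prod>n\<leftarrow>primes47. G n)" unfolding R_def[symmetric] by simp
	have "\<forall>\<^sub>F N in sequentially. (\<Prod>n<N. G' n)/R<=exp (\<kappa>/311469)"
		using eventually_ge_at_top[of 48] by eventually_elim (simp only: ev b(2))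
	from tendsto_upperbound[OF lim' this] show "L/(\<Prod>n\<leftarrow>primes47. G n)<=exp (\<kappa>/311469)" unfolding R_def[symmetric] by simp
qed

section \<open>Numerical enclosures of A1 and B1\<close>

definition ifac :: "nat => nat => int \<times> int" where
	"ifac k n = isub (iconst 1) (ipy n k)"
definition inumA where "inumA n = imul (iadd (isub (iconst 1) (iy n)) (imul (iconst 2) (ipy n 3)))
	 (imul (ipow (ifac 3 n) 2) (imul (ipow (ifac 4 n) 2) (ipow (ifac 5 n) 2)))"
definition idenA where "idenA n = imul (isub (iconst 1) (iy n)) (imul (ifac 6 n) (imul (ipow (ifac 7 n) 2)
	 (imul (ipow (ifac 8 n) 5) (ipow (ifac 9 n) 4))))"
definition inumB where "inumB n = isub (isub (iconst 1) (iy n)) (imul (iconst 2) (ipy n 4))"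
definition idenB2 where "idenB2 n = imul (ipow (ifac 4 n) 2) (imul (ipow (ifac 5 n) 2) (imul (ipow (ifac 6 n) 2) (ipow (ifac 7 n) 2)))"
definition idenB where "idenB n = imul (isub (iconst 1) (iy n)) (idenB2 n)"

definition denB2 :: "real => real" where "denB2 y = (1-y^4)^2*((1-y^5)^2*((1-y^6)^2*(1-y^7)^2))"

lemma enc_numden:
	assumes n: "map_of ytab n~=None" "n>=2"
	shows "enc (inumA n) (numA (ypow n))" "enc (idenA n) (denA (ypow n))"
		"2 * ypow n^4<=1-ypow n ==> enc (inumB n) (numB (ypow n))"
		"enc (idenB2 n) (denB2 (ypow n))" "enc (idenB n) (denB (ypow n))"
proof -
	have n1: "1<=n" using n by simp
	have y: "0<=ypow n" "ypow n<=1" using ypow_bounds(1,2)[OF n(2)] by auto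
	have f: "enc (ifac k n) (1-ypow n^k)" for k unfolding ifac_def by (intro enc_isub enc_one enc_ipy power_le_one n(1) n1 y)
	have o: "enc (isub (iconst 1) (iy n)) (1-ypow n)" by (intro enc_isub enc_one enc_iy n(1) y(2))
	show "enc (inumA n) (numA (ypow n))" unfolding inumA_def numA_def by (intro enc_imul enc_iadd enc_ipow f o enc_two enc_ipy n(1) n1)
	show "enc (idenA n) (denA (ypow n))" unfolding idenA_def denA_def by (intro enc_imul enc_ipow f o)
	show "enc (inumB n) (numB (ypow n))" if "2 * ypow n^4<=1-ypow n" unfolding inumB_def numB_def
		by (intro enc_isub[OF o] enc_imul enc_two enc_ipy n(1) n1 that)
	show d: "enc (idenB2 n) (denB2 (ypow n))" unfolding idenB2_def denB2_def by (intro enc_imul enc_ipow f)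
	show "enc (idenB n) (denB (ypow n))" unfolding idenB_def denB_def denB2_def[symmetric] by (intro enc_imul o d)
qed

lemma primes47_ok: "list_all (%n. map_of ytab n~=None \<and> 2<=n) primes47" by code_simp

lemma enc_prod_list:
	assumes "!!n. n \<in> set ns ==> enc (I n) (g n)"
	shows "enc (foldr (%n. imul (I n)) ns (iconst 1)) (\<Prod>n\<leftarrow>ns. g n)" using assms by (induction ns) (auto intro!: enc_imul enc_one)

lemma prod_list_divide: "(\<Prod>n\<leftarrow>ns. a n/b n :: real) = (\<Prod>n\<leftarrow>ns. a n)/(\<Prod>n\<leftarrow>ns. b n)"
	by (induction ns) simp_all

definition prodNA where "prodNA = foldr (%n. imul (inumA n)) primes47 (iconst 1)"
definition prodDA where "prodDA = foldr (%n. imul (idenA n)) primes47 (iconst 1)"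
definition prodNB where "prodNB = foldr (%n. imul (if n = 2 then iy 2 else inumB n)) primes47 (iconst 1)"
definition prodDB where "prodDB = foldr (%n. imul (if n = 2 then idenB2 2 else idenB n)) primes47 (iconst 1)"
definition prodA where "prodA = idiv prodNA prodDA"
definition prodB where "prodB = idiv prodNB prodDB"

lemma prodNA_val: "prodNA = (1531243719, 1531243721)" by code_simp

lemma prodDA_val: "prodDA = (1206830518, 1206830520)" by code_simp

lemma prodNB_val: "prodNB = (2879761387, 2879761390)" by code_simp

lemma prodDB_val: "prodDB = (1304879293, 1304879295)" by code_simp

lemma prodA_val: "prodA = (1268814215106, 1268814218867)" unfolding prodA_def prodNA_val prodDA_val by code_simp

lemma prodB_val: "prodB = (2206917833729, 2206917839412)" unfolding prodB_def prodNB_val prodDB_val by code_simp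

lemma izeta_3: "izeta 3 = (2612375342174, 2612375358030)" by code_simp

lemma izeta_4: "izeta 4 = (1644934063820, 1644934070276)" by code_simp

lemma izeta_5: "izeta 5 = (1341487256037, 1341487258386)" by code_simp

lemma izeta_6: "izeta 6 = (1202056902721, 1202056903518)" by code_simp

lemma izeta_7: "izeta 7 = (1126733867162, 1126733867431)" by code_simp

lemma izeta_8: "izeta 8 = (1082323233656, 1082323233754)" by code_simp

lemma izeta_9: "izeta 9 = (1054707510734, 1054707510781)" by code_simp

lemma ihalf_val: "ihalf = (1460354475460, 1460354519465)" by code_simp

definition GA :: "nat => real" where "GA n = numA (ypow n)/denA (ypow n)"
text \<open>At 2 the factor is -1/sqrt 2 exactly. Its sign is dropped, since intervals are
  nonnegative, and the common denominator 1 - y is cancelled; the limit of the product is therefore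
  formed with minus \<open>Ureal epsB\<close>.\<close>

definition GB :: "nat => real" where
	"GB n = (if n = 2 then ypow 2 else numB (ypow n))/(if n = 2 then denB2 (ypow 2) else denB (ypow n))"

lemma enc_prodA: "enc prodA (\<Prod>n\<leftarrow>primes47. GA n)"
proof -
	have n: "map_of ytab n~=None" "2<=n" if "n \<in> set primes47" for n using primes47_ok that by (auto simp: list_all_iff)
	have 1: "enc prodNA (\<Prod>n\<leftarrow>primes47. numA (ypow n))" and 2: "enc prodDA (\<Prod>n\<leftarrow>primes47. denA (ypow n))"
		unfolding prodNA_def prodDA_def by (intro enc_prod_list enc_numden n; assumption)+
	have "0 < fst prodDA" by (simp add: prodDA_val)
	from enc_idiv[OF 1 2 this] show ?thesis unfolding prodA_def GA_def prod_list_divide .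
qed

lemma enc_prodB: "enc prodB (\<Prod>n\<leftarrow>primes47. GB n)"
proof -
	have n: "map_of ytab n~=None" "2<=n" if "n \<in> set primes47" for n using primes47_ok that by (auto simp: list_all_iff)
	have 1: "enc prodNB (\<Prod>n\<leftarrow>primes47. if n = 2 then ypow 2 else numB (ypow n))" unfolding prodNB_def
	proof (rule enc_prod_list)
		fix k assume k: "k \<in> set primes47"
		show "enc (if k = 2 then iy 2 else inumB k) (if k = 2 then ypow 2 else numB (ypow k))"
		proof (cases "k = 2")
			case True
			have "enc (iy 2) (ypow 2)" using enc_iy[OF n(1)[OF k]] True by simp
			thus ?thesis using True by simp
		next
			case False
			have y: "0<=ypow k" "ypow k < 1" using ypow_bounds(1,2)[OF n(2)[OF k]] by auto
			have "0.47<=hreal epsB (ypow k)" using False n(2)[OF k] by (intro B_factor_bounds) auto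
			hence "0<=1-2 * ypow k^4/(1-ypow k)" using hreal_extreme(2)[OF y] by simp
			hence "2 * ypow k^4<=1-ypow k" using y by (simp add: pos_divide_le_eq)
			hence "enc (inumB k) (numB (ypow k))" by (rule enc_numden(3)[OF n[OF k]])
			thus ?thesis using False by simp
		qed
	qed
	have 2: "enc prodDB (\<Prod>n\<leftarrow>primes47. if n = 2 then denB2 (ypow 2) else denB (ypow n))" unfolding prodDB_def
	proof (rule enc_prod_list)
		fix k assume k: "k \<in> set primes47"
		show "enc (if k = 2 then idenB2 2 else idenB k) (if k = 2 then denB2 (ypow 2) else denB (ypow k))"
			using enc_numden(4,5)[OF n[OF k]] by (cases "k = 2") simp_all
	qed
	have "0 < fst prodDB" by (simp add: prodDB_val)
	from enc_idiv[OF 1 2 this] show ?thesis unfolding prodB_def GB_def prod_list_divide .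
qed

lemma enc_pos: "enc I x ==> 0 < fst I ==> 0 < x"
proof -
	assume "enc I x" "0 < fst I"
	hence "0 < x * of_int fpS" by (auto simp: enc_def intro: less_le_trans[of 0 "of_int (fst I)"])
	thus "0 < x" using fpS_pos by (simp add: zero_less_mult_iff)
qed

lemma GA_LIMSEQ:
	"(%N. \<Prod>n<N. if prime n then GA n else 1) \<longlonglongrightarrow>
		 Ureal epsA*((1/zval 3)^2*((1/zval 4)^2*(1/zval 5)^2))/((1/zval 6)*((1/zval 7)^2*((1/zval 8)^5*(1/zval 9)^4)))"
proof -
	have "(if prime n then GA n else 1) = (if prime n then hreal epsA (ypow n) else 1) *
		 ((if prime n then 1-ypow n^3 else 1)^2*((if prime n then 1-ypow n^4 else 1)^2*(if prime n then 1-ypow n^5 else 1)^2)) /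
		 ((if prime n then 1-ypow n^6 else 1)*((if prime n then 1-ypow n^7 else 1)^2*((if prime n then 1-ypow n^8 else 1)^5*(if prime n then 1-ypow n^9 else 1)^4)))" for n
	proof (cases "prime n")
		case True
		have y: "0<=ypow n" "ypow n < 1" using ypow_bounds[of n] prime_ge_2_nat[OF True] by auto
		have "hreal epsA (ypow n) = ((1-ypow n)+2 * ypow n^3)/(1-ypow n)" using hreal_extreme(1)[OF y] y by (simp add: add_divide_distrib)
		thus ?thesis using True by (simp add: GA_def numA_def denA_def)
	qed simp
	hence "(%N. \<Prod>n<N. if prime n then GA n else 1) = (%N. pprod epsA N*(zprod 3 N^2*(zprod 4 N^2 * zprod 5 N^2))/(zprod 6 N*(zprod 7 N^2*(zprod 8 N^5 * zprod 9 N^4))))"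
		by (simp only: prod.distrib prod_dividef prod_power_distrib pprod_def zprod_def)
	moreover have "pprod epsA \<longlonglongrightarrow> Ureal epsA" by (rule Ureal(1)) (rule eps_abs)
	moreover have "1/zval k~=0" if "k>=3" for k using zprod_LIMSEQ(2)[OF that] by simp
	ultimately show ?thesis by (simp only:) (intro tendsto_intros zprod_LIMSEQ | simp)+
qed

lemma GB_LIMSEQ:
	"(%N. \<Prod>n<N. if prime n then GB n else 1) \<longlonglongrightarrow>
		 - Ureal epsB/((1/zval 4)^2*((1/zval 5)^2*((1/zval 6)^2*(1/zval 7)^2)))"
proof -
	have "(if prime n then GB n else 1) = (if n = 2 then -1 else 1)*(if prime n then hreal epsB (ypow n) else 1) /
		 ((if prime n then 1-ypow n^4 else 1)^2*((if prime n then 1-ypow n^5 else 1)^2*((if prime n then 1-ypow n^6 else 1)^2*(if prime n then 1-ypow n^7 else 1)^2)))" for n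
	proof (cases "prime n")
		case True
		have y: "0<=ypow n" "ypow n < 1" using ypow_bounds[of n] prime_ge_2_nat[OF True] by auto
		have "hreal epsB (ypow n) = ((1-ypow n)-2 * ypow n^4)/(1-ypow n)" using hreal_extreme(2)[OF y] y by (simp add: diff_divide_distrib)
		note h = this
		show ?thesis
		proof (cases "n = 2")
			case True
			thus ?thesis using y B_factor_bounds(3) two_is_prime_nat by (simp add: GB_def denB2_def)
		next
			case False
			thus ?thesis using \<open>prime n\<close> by (simp add: GB_def numB_def denB_def h)
		qed
	qed auto
	hence "(%N. \<Prod>n<N. if prime n then GB n else 1) = (%N. (\<Prod>n<N. if n = 2 then -1 else 1) * pprod epsB N/(zprod 4 N^2*(zprod 5 N^2*(zprod 6 N^2 * zprod 7 N^2))))"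
		by (simp only: prod.distrib prod_dividef prod_power_distrib pprod_def zprod_def)
	moreover have "(%N. (\<Prod>n<N. if n = (2::nat) then -1 else (1::real))) \<longlonglongrightarrow> -1"
		by (rule tendsto_eventually) (use eventually_ge_at_top[of 3] in eventually_elim, simp)
	moreover have "pprod epsB \<longlonglongrightarrow> Ureal epsB" by (rule Ureal(1)) (rule eps_abs)
	moreover have "1/zval k~=0" if "k>=3" for k using zprod_LIMSEQ(2)[OF that] by simp
	ultimately have "(%N. \<Prod>n<N. if prime n then GB n else 1) \<longlonglongrightarrow>
		 (-1) * Ureal epsB/((1/zval 4)^2*((1/zval 5)^2*((1/zval 6)^2*(1/zval 7)^2)))"
		by (simp only:) (intro tendsto_intros zprod_LIMSEQ | simp)+
	thus ?thesis by simp
qed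

lemma exp_small: "0<=x ==> x<=1 ==> exp x<=1+x+x^2" for x :: real by (rule exp_bound)

text \<open>An interval around 1 for the tail of the product beyond 47; exp x <= 1 + x + x^2 bounds
  the upper end.\<close>

lemma enc_factor:
	assumes "1 - \<kappa>/311469<=w" "w<=exp (\<kappa>/311469)" "0 <= \<kappa>" "\<kappa><=5"
		and "\<kappa>/311469 * of_int fpS <= of_int t" "(\<kappa>/311469+(\<kappa>/311469)^2) * of_int fpS <= of_int u" "t<=fpS"
	shows "enc (fpS-t, fpS+u) w"
proof -
	have "w<=1 + \<kappa>/311469+(\<kappa>/311469)^2" using assms exp_small[of "\<kappa>/311469"] by simp
	hence "w * of_int fpS<=(1 + \<kappa>/311469+(\<kappa>/311469)^2) * of_int fpS" using fpS_pos by (intro mult_right_mono) auto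
	moreover have "(1 - \<kappa>/311469) * of_int fpS<=w * of_int fpS" using fpS_pos assms by (intro mult_right_mono) auto
	ultimately show ?thesis using assms by (simp add: enc_def algebra_simps)
qed

lemmas interval_vals = izeta_3 izeta_4 izeta_5 izeta_6 izeta_7 izeta_8 izeta_9 ihalf_val prodA_val prodB_val

lemma enc_zval: "k>=3 ==> enc (izeta k) (zval k)" by (intro enc_izeta less_imp_le[OF zprod_LIMSEQ(2)])

text \<open>Splits the product into R over the primes up to 47, the tail L/R close to 1, and the
  zeta values Q that the acceleration divided out.\<close>

lemma A1_enclosure: "enc (10294377307887, 10294383200111) (- A1)"
proof -
	define R where "R = (\<Prod>n\<leftarrow>primes47. GA n)"
	have Rint: "enc prodA R" using enc_prodA unfolding R_def .
	have R0: "R > 0" by (rule enc_pos[OF Rint]) (simp add: interval_vals)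
	have z: "zval k > 0" if "k>=3" for k using zprod_LIMSEQ(2)[OF that] .
	define L where "L = Ureal epsA*((1/zval 3)^2*((1/zval 4)^2*(1/zval 5)^2))/((1/zval 6)*((1/zval 7)^2*((1/zval 8)^5*(1/zval 9)^4)))"
	have b: "1-0.08/311469<=L/R" "L/R<=exp (0.08/311469)"
		using limit_near_finite_product[of GA "0.08" L] tail_A GA_LIMSEQ R0 by (auto simp: GA_def L_def R_def)
	\<comment> \<open>0.08/311469 is about 2.5685e-7, and the square adds nothing visible at this
	  scale.\<close>
	have W: "enc (fpS-257000, fpS+257000) (L/R)" by (rule enc_factor[OF b]) (simp_all add: fpS_def power2_eq_square)
	define Q where "Q = ((zval 3)^2*((zval 4)^2*(zval 5)^2))/(zval 6*((zval 7)^2*((zval 8)^5*(zval 9)^4)))"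
	have z0: "zval 3~=0" "zval 4~=0" "zval 5~=0" "zval 6~=0" "zval 7~=0" "zval 8~=0" "zval 9~=0"
		using z[of 3] z[of 4] z[of 5] z[of 6] z[of 7] z[of 8] z[of 9] by auto
	have Qpos: "L * Q = Ureal epsA" unfolding L_def Q_def using z0 by (simp add: power_divide)
	have f1: "- A1 = ((R*(L/R)) * Q)/(- zhalf)" unfolding A1_B1_eq using Qpos R0 by simp
	have f2: "enc (idiv (imul (imul prodA (fpS-257000, fpS+257000)) (idiv (imul (ipow (izeta 3) 2) (imul (ipow (izeta 4) 2) (ipow (izeta 5) 2)))
			(imul (izeta 6) (imul (ipow (izeta 7) 2) (imul (ipow (izeta 8) 5) (ipow (izeta 9) 4)))))) ihalf) (((R*(L/R)) * Q)/(- zhalf))"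
		unfolding Q_def
	proof (intro enc_idiv enc_imul enc_ipow enc_zval enc_ihalf Rint W)
		show "0 < fst (imul (izeta 6) (imul (ipow (izeta 7) 2) (imul (ipow (izeta 8) 5) (ipow (izeta 9) 4))))" unfolding interval_vals by code_simp
	qed (simp_all add: interval_vals)
	have f3: "idiv (imul (imul prodA (fpS-257000, fpS+257000)) (idiv (imul (ipow (izeta 3) 2) (imul (ipow (izeta 4) 2) (ipow (izeta 5) 2)))
			(imul (izeta 6) (imul (ipow (izeta 7) 2) (imul (ipow (izeta 8) 5) (ipow (izeta 9) 4)))))) ihalf = (10294377307887, 10294383200111)" unfolding interval_vals by code_simp
	show ?thesis using f2 unfolding f3 f1[symmetric] .
qed

lemma B1_enclosure: "enc (169183516006, 169188955746) B1"
proof -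
	define R where "R = (\<Prod>n\<leftarrow>primes47. GB n)"
	have Rint: "enc prodB R" using enc_prodB unfolding R_def .
	have R0: "R > 0" by (rule enc_pos[OF Rint]) (simp add: interval_vals)
	have z: "zval k > 0" if "k>=3" for k using zprod_LIMSEQ(2)[OF that] .
	define L where "L =-Ureal epsB/((1/zval 4)^2*((1/zval 5)^2*((1/zval 6)^2*(1/zval 7)^2)))"
	have b: "1-5/311469<=L/R" "L/R<=exp (5/311469)"
		using limit_near_finite_product[of GB 5 L] tail_B GB_LIMSEQ R0 by (auto simp: GB_def L_def R_def)
	\<comment> \<open>5/311469 is about 1.605296e-5; its square accounts for some 258 units at the
	  upper end.\<close>
	have W: "enc (fpS-16053000, fpS+16053500) (L/R)" by (rule enc_factor[OF b]) (simp_all add: fpS_def power2_eq_square)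
	define Q where "Q = (zval 4)^2*((zval 5)^2*((zval 6)^2*(zval 7)^2))"
	have z0: "zval 4~=0" "zval 5~=0" "zval 6~=0" "zval 7~=0" using z[of 4] z[of 5] z[of 6] z[of 7] by auto
	have Qpos: "L/Q =-Ureal epsB" unfolding L_def Q_def using z0 by (simp add: power_divide)
	have f1: "B1 = ((R*(L/R))/Q)/(- zhalf)" unfolding A1_B1_eq using Qpos R0 by simp
	have f2: "enc (idiv (idiv (imul prodB (fpS-16053000, fpS+16053500)) (imul (ipow (izeta 4) 2) (imul (ipow (izeta 5) 2) (imul (ipow (izeta 6) 2) (ipow (izeta 7) 2))))) ihalf)
			(((R*(L/R))/Q)/(- zhalf))" unfolding Q_def
	proof (intro enc_idiv enc_imul enc_ipow enc_zval enc_ihalf Rint W)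
		show "0 < fst (imul (ipow (izeta 4) 2) (imul (ipow (izeta 5) 2) (imul (ipow (izeta 6) 2) (ipow (izeta 7) 2))))" unfolding interval_vals by code_simp
	qed (simp_all add: interval_vals)
	have f3: "idiv (idiv (imul prodB (fpS-16053000, fpS+16053500)) (imul (ipow (izeta 4) 2) (imul (ipow (izeta 5) 2) (imul (ipow (izeta 6) 2) (ipow (izeta 7) 2))))) ihalf = (169183516006, 169188955746)"
		unfolding interval_vals by code_simp
	show ?thesis using f2 unfolding f3 f1[symmetric] .
qed

lemma A1_B1_numeric: "\<bar>A1-(-10.29438)\<bar> < 0.00001" "0.16918<=B1" "B1 < 0.16919"
proof -
	have a: "10294377307887 <=-A1*1000000000000" "- A1*1000000000000<=10294383200111" using A1_enclosure by (simp_all add: enc_def fpS_def)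
	have "A1-(-10.29438) < 0.00001" using a by simp
	moreover have "- (A1-(-10.29438)) < 0.00001" using a by simp
	ultimately show "\<bar>A1-(-10.29438)\<bar> < 0.00001" by (simp only: abs_less_iff)
	have b: "169183516006<=B1*1000000000000" "B1*1000000000000<=169188955746" using B1_enclosure by (simp_all add: enc_def fpS_def)
	show "0.16918<=B1" "B1 < 0.16919" using b by simp_all
qed

theorem theorem1:
  shows
    "(\<forall>\<epsilon> f. sign_multiplicative \<epsilon> f \<longrightarrow>
        \<epsilon> 1 = 1 \<or> (\<epsilon> 1 = -1 \<and> \<epsilon> 2 = -1) \<longrightarrow> no_bias f)
     \<and>
     (\<forall>\<epsilon> f. sign_multiplicative \<epsilon> f \<longrightarrow> \<epsilon> 1 = -1 \<longrightarrow> \<epsilon> 2 = 1 \<longrightarrow>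
        (\<exists>b. apparent_bias f b \<and> b \<in> {A1..B1}))
     \<and> (\<exists>\<epsilon> f. sign_multiplicative \<epsilon> f \<and> \<epsilon> 1 = -1 \<and> \<epsilon> 2 = 1 \<and> apparent_bias f A1)
     \<and> (\<exists>\<epsilon> f. sign_multiplicative \<epsilon> f \<and> \<epsilon> 1 = -1 \<and> \<epsilon> 2 = 1 \<and> apparent_bias f B1)
     \<and> \<bar>A1 - (-10.29438)\<bar> < 0.00001 \<and> 0.16918 \<le> B1 \<and> B1 < 0.16919
     \<and>
     uncountable {f. \<exists>\<epsilon>. sign_multiplicative \<epsilon> f \<and> \<epsilon> 1 = -1 \<and> \<epsilon> 2 = 1 \<and> no_bias f}
     \<and> (\<forall>\<epsilon> f. sign_multiplicative \<epsilon> f \<longrightarrow> \<epsilon> 1 = -1 \<longrightarrow> \<epsilon> 2 = 1 \<longrightarrow>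
          (no_bias f \<longleftrightarrow> (\<Sum>k. real_of_int (\<epsilon> (Suc k)) / sqrt 2 ^ Suc k) = -1))"
proof -
  have char: "no_bias f \<longleftrightarrow> (\<Sum>k. real_of_int (\<epsilon> (Suc k)) / sqrt 2 ^ Suc k) = -1"
    if sm: "sign_multiplicative \<epsilon> f" and e: "\<epsilon> 1 = -1" "\<epsilon> 2 = 1" for \<epsilon> f
  proof -
    note a = sign_multiplicative_facts(3)[OF sm]
    have "Ureal \<epsilon> = 0 \<longleftrightarrow> hreal \<epsilon> (ypow 2) = 0" by (rule Ureal_eq_0_iff) (rule a)
    moreover have "hreal \<epsilon> (ypow 2) = 0 \<longleftrightarrow> (\<Sum>k. real_of_int (\<epsilon> (Suc k)) / sqrt 2 ^ Suc k) = -1"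
      by (rule hreal_two_eq_0_iff) (use a e in auto)
    ultimately show ?thesis using bias_main(2)[OF sm e] by (simp only:)
  qed
  have range: "\<exists>b. apparent_bias f b \<and> b \<in> {A1..B1}"
    if sm: "sign_multiplicative \<epsilon> f" and e: "\<epsilon> 1 = -1" "\<epsilon> 2 = 1" for \<epsilon> f
  proof (intro exI conjI)
    show "apparent_bias f (Ureal \<epsilon> / zhalf)" by (rule bias_main(1)[OF sm e])
    have s: "\<epsilon> k \<in> {-1, 1}" if "k \<ge> 1" for k using sm that unfolding sign_multiplicative_def by blast
    have "Ureal \<epsilon> \<le> Ureal epsA" "Ureal epsB \<le> Ureal \<epsilon>" using Ureal_extremes[of \<epsilon>] s by blast+
    thus "Ureal \<epsilon> / zhalf \<in> {A1..B1}"
      unfolding A1_B1_eq atLeastAtMost_iff using zhalf_neg by (auto intro: divide_right_mono_neg)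
  qed
  have A: "\<exists>\<epsilon> f. sign_multiplicative \<epsilon> f \<and> \<epsilon> 1 = -1 \<and> \<epsilon> 2 = 1 \<and> apparent_bias f A1"
  proof (intro exI conjI)
    show sm: "sign_multiplicative epsA (fmul epsA)" by (rule sign_multiplicative_fmul) (simp add: epsA_def)
    show e: "epsA 1 = -1" "epsA 2 = 1" by (simp_all add: epsA_def)
    show "apparent_bias (fmul epsA) A1" unfolding A1_B1_eq by (rule bias_main(1)[OF sm e])
  qed
  have B: "\<exists>\<epsilon> f. sign_multiplicative \<epsilon> f \<and> \<epsilon> 1 = -1 \<and> \<epsilon> 2 = 1 \<and> apparent_bias f B1"
  proof (intro exI conjI)
    show sm: "sign_multiplicative epsB (fmul epsB)" by (rule sign_multiplicative_fmul) (simp add: epsB_def)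
    show e: "epsB 1 = -1" "epsB 2 = 1" by (simp_all add: epsB_def)
    show "apparent_bias (fmul epsB) B1" unfolding A1_B1_eq by (rule bias_main(1)[OF sm e])
  qed
  \<comment> \<open>The characterization turns absence of bias into a condition on signs alone, for
    which uncountability has been shown.\<close>
  have seteq: "{f. \<exists>\<epsilon>. sign_multiplicative \<epsilon> f \<and> \<epsilon> 1 = -1 \<and> \<epsilon> 2 = 1 \<and> no_bias f}
      = {f. \<exists>\<epsilon>. sign_multiplicative \<epsilon> f \<and> \<epsilon> 1 = -1 \<and> \<epsilon> 2 = 1 \<and>
         (\<Sum>k. real_of_int (\<epsilon> (Suc k)) / sqrt 2 ^ Suc k) = -1}"
    using char by blast
  have U: "uncountable {f. \<exists>\<epsilon>. sign_multiplicative \<epsilon> f \<and> \<epsilon> 1 = -1 \<and> \<epsilon> 2 = 1 \<and> no_bias f}"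
    unfolding seteq by (rule uncountable_sign_sequences)
  show ?thesis
  proof (intro conjI)
    show "\<forall>\<epsilon> f. sign_multiplicative \<epsilon> f \<longrightarrow>
        \<epsilon> 1 = 1 \<or> (\<epsilon> 1 = -1 \<and> \<epsilon> 2 = -1) \<longrightarrow> no_bias f"
      by (intro allI impI) (rule no_bias_cases)
    show "\<forall>\<epsilon> f. sign_multiplicative \<epsilon> f \<longrightarrow> \<epsilon> 1 = -1 \<longrightarrow> \<epsilon> 2 = 1 \<longrightarrow>
        (\<exists>b. apparent_bias f b \<and> b \<in> {A1..B1})"
      by (intro allI impI) (rule range)
    show "\<forall>\<epsilon> f. sign_multiplicative \<epsilon> f \<longrightarrow> \<epsilon> 1 = -1 \<longrightarrow> \<epsilon> 2 = 1 \<longrightarrow>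
        (no_bias f \<longleftrightarrow> (\<Sum>k. real_of_int (\<epsilon> (Suc k)) / sqrt 2 ^ Suc k) = -1)"
      by (intro allI impI) (rule char)
  qed (rule A B U A1_B1_numeric)+
qed

end
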